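(* Let $\mathfrak g$ be a simple complex Lie algebra, $f\in\mathfrak g$ nilpotent with a good grading $\Gamma$, $\{e,h,f\}$ an $sl_2$-triple compatible with $\Gamma$, $\mathfrak l\subset\mathfrak g_{-1}$ an isotropic subspace, $a\in\mathfrak g$ an element centralizing $\mathfrak n$, and $\{.,.\}_\lambda=\{.,.\}_2+\lambda\{.,.\}_1$. Then the reduced Poisson bracket $\{.,.\}_\lambda^Q$ on $Q=e+\mathfrak L(\mathfrak g_f)$ equals the Dirac reduction of $\{.,.\}_\lambda$ from $\mathfrak L(\mathfrak g)$ to $Q$. It can be calculated by the Dirac formulas: in the coordinates $q^1,\dots,q^n$ of the context, $\{q^i(x),q^j(y)\}^Q_\lambda=\big(\mathbb F^{ij}-\mathbb F^{i\beta}\mathbb S_{\beta\alpha}\mathbb F^{\alpha j}\big)\delta(x-y)$ for $i,j\le m$, where $\mathbb S$ is the inverse of the minor $(\mathbb F^{\alpha\beta})_{\alpha,\beta>m}$ on $Q$. In particular, if the leading terms of the reduced bracket are written $\widetilde F^{ij}\delta(x-y)$ and $\widetilde F_0^{ij}\delta'(x-y)+\widetilde\Gamma^{ij}_kq^k_x\delta(x-y)$, then $$\widetilde F^{ij}=F^{ij}-F^{i\beta}F_{\beta\alpha}F^{\alpha j},$$ $$\widetilde F_0^{ij}=F_0^{ij}-F_0^{i\beta}F_{\beta\alpha}F^{\alpha j}+F^{i\beta}F_{\beta\alpha}F_0^{\alpha\varphi}F_{\varphi\gamma}F^{\gamma j}-F^{i\beta}F_{\beta\alpha}F_0^{\alpha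 j},$$ $$\widetilde\Gamma^{ij}_kq^k_x=\big(\Gamma^{ij}_k-\Gamma^{i\beta}_kF_{\beta\alpha}F^{\alpha j}+F^{i\mu}F_{\mu\alpha}\Gamma^{\alpha\beta}_kF_{\beta\varphi}F^{\varphi j}-F^{i\beta}F_{\beta\alpha}\Gamma^{\alpha j}_k\big)q^k_x-\big(F_0^{i\beta}-F^{i\mu}F_{\mu\alpha}F_0^{\alpha\beta}\big)\partial_x(F_{\beta\varphi}F^{\varphi j}),$$ where Greek indices are summed over $m+1,\dots,n$ and $(F_{\alpha\beta})$ is the inverse of the matrix $(F^{\alpha\beta})$ on $e+\mathfrak g_f$.
   Context: **Algebra.** A good grading for $f$ is a $\mathbb Z$-grading $\mathfrak g=\oplus_{i}\mathfrak g_i$, $[\mathfrak g_i,\mathfrak g_j]\subset\mathfrak g_{i+j}$, with $f\in\mathfrak g_{-2}$ and $\mathrm{ad}\,f:\mathfrak g_j\to\mathfrak g_{j-2}$ injective for $j\ge1$ and surjective for $j\le1$. The $sl_2$-triple satisfies $[h,e]=2e$, $[h,f]=-2f$, $[e,f]=h$; it is compatible with $\Gamma$ if $h\in\mathfrak g_0$, $e\in\mathfrak g_2$. $\langle\cdot|\cdot\rangle$ is the Killing form. On $\mathfrak g_{-1}$ one has the symplectic form $(x,y)=\langle e|[x,y]\rangle$; $\mathfrak l'$ is the symplectic complement of $\mathfrak l$, $\mathfrak m=\mathfrak l\oplus\bigoplus_{i\le-2}\mathfrak g_i$, $\mathfrak n=\mathfrak l'\oplus\bigoplus_{i\le-2}\mathfrak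 g_i$, $\mathfrak b=\mathfrak n^{\perp}$ (Killing orthogonal), $\mathfrak g_f=\ker\mathrm{ad}\,f$. **Brackets and reduction.** $\mathfrak L(V)$ is the space of smooth maps $S^1\to V$; $(u|v)=\int_{S^1}\langle u(x)|v(x)\rangle dx$ identifies $\mathfrak L(\mathfrak g)$ with its (regular) dual. $\{.,.\}_2$, $\{.,.\}_1$ are the Poisson brackets on $\mathfrak L(\mathfrak g)$ with Poisson tensors $P_2(q)(v)=v_x+[q,v]$, $P_1(q)(v)=[a,v]$. Put $S=e+\mathfrak L(\mathfrak b)$, $D_z=P_2(z)(\mathfrak L(\mathfrak n))$, $E_z=D_z\cap\mathfrak L(\mathfrak b)$ for $z\in S$. The leaves of $E$ are the orbits of the adjoint group of $\mathfrak L(\mathfrak m)$ acting on $S$ by $s+e\mapsto\exp(-\mathrm{ad}\,m)[\partial_x+s+e]-\partial_x$, and $Q=e+\mathfrak L(\mathfrak g_f)\subset S$ meets each leaf exactly once, transversally; let $\rho:S\to Q$ be the projection. Then $\{\phi,\psi\}_\lambda^Q=\{F,G\}_\lambda|_Q$, where $F,G$ are functionals on $\mathfrak L(\mathfrak g)$ extending $\phi\circ\rho,\psi\circ\rho$ and constant along $D$. **Coordinates.** $\xi_1,\dots,\xi_n$ is a homogeneous basis of $\mathfrak g$ with $\xi_1,\dots,\xi_m$ a basis of $\mathfrak g_f$, $\xi^1,\dots,\xi^n$ the dual basis ($\langle\xi_i|\xi^j\rangle=\delta_i^j$), and $q^i(z)=\langle z-e|\xi^i\rangle$, so $Q$ is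 given by $q^\alpha=0$, $\alpha=m+1,\dots,n$. Write $\{q^I(x),q^J(y)\}_\lambda=\mathbb F^{IJ}\delta(x-y)$ with $\mathbb F^{IJ}$ a matrix differential operator (depending on $\lambda$). Its terms of degree $-1$ and $0$ (for the grading in which $\partial_x$ adds one degree, so that $\delta$ has degree $-1$ and $\delta'$ and $q^k_x\delta$ have degree $0$) are written $F^{IJ}(q)\delta(x-y)$ and $F_0^{IJ}(q)\delta'(x-y)+\Gamma_k^{IJ}(q)q_x^k\delta(x-y)$. The Dirac reduction to $Q$ is the bracket with operator $\mathbb F^{ij}-\mathbb F^{i\beta}\mathbb S_{\beta\alpha}\mathbb F^{\alpha j}$, $i,j\le m$, where $\mathbb S$ is the inverse, a differential operator of finite order, of the minor $(\mathbb F^{\alpha\beta})_{\alpha,\beta>m}$ restricted to $Q$. *)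

theory Defs
  imports "HOL-Analysis.Analysis"
begin

section \<open>Complex Lie algebras, good gradings, $sl_2$-triples\<close>

text \<open>A complex Lie algebra of finite dimension is carried by the type \<open>complex ^ 'd\<close> (with its
  complex scaling \<open>*s\<close>) and an arbitrary bracket \<open>br\<close>; \<open>'d\<close> is an arbitrary finite index type.\<close>

definition lie_algebra :: "(complex^'d \<Rightarrow> complex^'d \<Rightarrow> complex^'d) \<Rightarrow> bool" where
  "lie_algebra br \<longleftrightarrow>
     (\<forall>x. Vector_Spaces.linear (*s) (*s) (br x)) \<and>
     (\<forall>y. Vector_Spaces.linear (*s) (*s) (\<lambda>x. br x y)) \<and>
     (\<forall>x. br x x = 0) \<and>
     (\<forall>x y z. br x (br y z) + br y (br z x) + br z (br x y) = 0)"

definition lie_ideal :: "(complex^'d \<Rightarrow> complex^'d \<Rightarrow> complex^'d) \<Rightarrow> (complex^'d) set \<Rightarrow> bool" where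
  "lie_ideal br I \<longleftrightarrow> vec.subspace I \<and> (\<forall>x. \<forall>y\<in>I. br x y \<in> I)"

definition simple_lie_algebra :: "(complex^'d \<Rightarrow> complex^'d \<Rightarrow> complex^'d) \<Rightarrow> bool" where
  "simple_lie_algebra br \<longleftrightarrow>
     lie_algebra br \<and> (\<exists>x y. br x y \<noteq> 0) \<and> (\<forall>I. lie_ideal br I \<longrightarrow> I = {0} \<or> I = UNIV)"

definition killing :: "(complex^'d \<Rightarrow> complex^'d \<Rightarrow> complex^'d) \<Rightarrow> complex^'d \<Rightarrow> complex^'d \<Rightarrow> complex" where
  "killing br x y = trace (matrix (\<lambda>z. br x (br y z)))"

definition ad_nilpotent :: "(complex^'d \<Rightarrow> complex^'d \<Rightarrow> complex^'d) \<Rightarrow> complex^'d \<Rightarrow> bool" where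
  "ad_nilpotent br x \<longleftrightarrow> (\<exists>k. \<forall>y. (br x ^^ k) y = 0)"

definition centralizer :: "(complex^'d \<Rightarrow> complex^'d \<Rightarrow> complex^'d) \<Rightarrow> complex^'d \<Rightarrow> (complex^'d) set" where
  "centralizer br f = {x. br f x = 0}"

definition lie_grading ::
  "(complex^'d \<Rightarrow> complex^'d \<Rightarrow> complex^'d) \<Rightarrow> (int \<Rightarrow> (complex^'d) set) \<Rightarrow> bool" where
  "lie_grading br gr \<longleftrightarrow>
     (\<forall>i. vec.subspace (gr i)) \<and>
     (\<forall>v. \<exists>!w. (\<forall>i. w i \<in> gr i) \<and> finite {i. w i \<noteq> 0} \<and> v = (\<Sum>i | w i \<noteq> 0. w i)) \<and>
     (\<forall>i j. \<forall>x\<in>gr i. \<forall>y\<in>gr j. br x y \<in> gr (i + j))"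

definition good_grading ::
  "(complex^'d \<Rightarrow> complex^'d \<Rightarrow> complex^'d) \<Rightarrow> (int \<Rightarrow> (complex^'d) set) \<Rightarrow> complex^'d \<Rightarrow> bool" where
  "good_grading br gr f \<longleftrightarrow>
     lie_grading br gr \<and> f \<in> gr (-2) \<and>
     (\<forall>j\<ge>1. inj_on (br f) (gr j)) \<and> (\<forall>j\<le>1. br f ` gr j = gr (j - 2))"

definition sl2_triple ::
  "(complex^'d \<Rightarrow> complex^'d \<Rightarrow> complex^'d) \<Rightarrow> complex^'d \<Rightarrow> complex^'d \<Rightarrow> complex^'d \<Rightarrow> bool" where
  "sl2_triple br e h f \<longleftrightarrow> br h e = 2 *s e \<and> br h f = (-2) *s f \<and> br e f = h"

text \<open>Subspaces of $\mathfrak g_{-1}$ that are isotropic for $(x,y)=\langle e|[x,y]\rangle$.\<close>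

definition isotropic_subspace ::
  "(complex^'d \<Rightarrow> complex^'d \<Rightarrow> complex^'d) \<Rightarrow> (int \<Rightarrow> (complex^'d) set) \<Rightarrow> complex^'d
    \<Rightarrow> (complex^'d) set \<Rightarrow> bool" where
  "isotropic_subspace br gr e l \<longleftrightarrow>
     vec.subspace l \<and> l \<subseteq> gr (-1) \<and> (\<forall>x\<in>l. \<forall>y\<in>l. killing br e (br x y) = 0)"

definition sympl_compl ::
  "(complex^'d \<Rightarrow> complex^'d \<Rightarrow> complex^'d) \<Rightarrow> (int \<Rightarrow> (complex^'d) set) \<Rightarrow> complex^'d
    \<Rightarrow> (complex^'d) set \<Rightarrow> (complex^'d) set" where
  "sympl_compl br gr e l = {x \<in> gr (-1). \<forall>y\<in>l. killing br e (br x y) = 0}"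

definition m_alg :: "(int \<Rightarrow> (complex^'d) set) \<Rightarrow> (complex^'d) set \<Rightarrow> (complex^'d) set" where
  "m_alg gr l = vec.span (l \<union> (\<Union>i\<in>{..-2}. gr i))"

definition n_alg ::
  "(complex^'d \<Rightarrow> complex^'d \<Rightarrow> complex^'d) \<Rightarrow> (int \<Rightarrow> (complex^'d) set) \<Rightarrow> complex^'d
    \<Rightarrow> (complex^'d) set \<Rightarrow> (complex^'d) set" where
  "n_alg br gr e l = vec.span (sympl_compl br gr e l \<union> (\<Union>i\<in>{..-2}. gr i))"

definition b_space ::
  "(complex^'d \<Rightarrow> complex^'d \<Rightarrow> complex^'d) \<Rightarrow> (int \<Rightarrow> (complex^'d) set) \<Rightarrow> complex^'d
    \<Rightarrow> (complex^'d) set \<Rightarrow> (complex^'d) set" where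
  "b_space br gr e l = {x. \<forall>y\<in>n_alg br gr e l. killing br x y = 0}"

definition is_basis :: "(nat \<Rightarrow> complex^'d) \<Rightarrow> nat \<Rightarrow> (complex^'d) set \<Rightarrow> bool" where
  "is_basis \<xi> k V \<longleftrightarrow>
     inj_on \<xi> {1..k} \<and> vec.independent (\<xi> ` {1..k}) \<and> vec.span (\<xi> ` {1..k}) = V"

section \<open>Loops and functionals\<close>

text \<open>The circle is $\mathbb R/2\pi\mathbb Z$: loops are smooth $2\pi$-periodic functions on the line.\<close>

definition dx :: "(real \<Rightarrow> 'a::real_normed_vector) \<Rightarrow> real \<Rightarrow> 'a" where
  "dx u = (\<lambda>x. vector_derivative u (at x))"

definition loops :: "'a::real_normed_vector set \<Rightarrow> (real \<Rightarrow> 'a) set" where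
  "loops V = {u. (\<forall>x. u x \<in> V) \<and> (\<forall>x. u (x + 2 * pi) = u x) \<and>
                 (\<forall>k x. (dx ^^ k) u differentiable (at x))}"

definition circle_int :: "(real \<Rightarrow> complex) \<Rightarrow> complex" where
  "circle_int u = integral {0..2 * pi} u"

definition loop_form ::
  "(complex^'d \<Rightarrow> complex^'d \<Rightarrow> complex^'d) \<Rightarrow> (real \<Rightarrow> complex^'d) \<Rightarrow> (real \<Rightarrow> complex^'d) \<Rightarrow> complex" where
  "loop_form br u v = circle_int (\<lambda>x. killing br (u x) (v x))"

text \<open>The differential at \<open>q\<close> lies in the regular dual: it is represented by the loop \<open>w\<close>.\<close>

definition has_gradient ::
  "(complex^'d \<Rightarrow> complex^'d \<Rightarrow> complex^'d) \<Rightarrow> ((real \<Rightarrow> complex^'d) \<Rightarrow> complex)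
    \<Rightarrow> (real \<Rightarrow> complex^'d) \<Rightarrow> (real \<Rightarrow> complex^'d) \<Rightarrow> bool" where
  "has_gradient br F q w \<longleftrightarrow> w \<in> loops UNIV \<and>
     (\<forall>s\<in>loops UNIV.
        ((\<lambda>t::real. F (\<lambda>x. q x + t *\<^sub>R s x)) has_vector_derivative loop_form br w s) (at 0))"

definition functional ::
  "(complex^'d \<Rightarrow> complex^'d \<Rightarrow> complex^'d) \<Rightarrow> ((real \<Rightarrow> complex^'d) \<Rightarrow> complex) \<Rightarrow> bool" where
  "functional br F \<longleftrightarrow> (\<forall>q\<in>loops UNIV. \<exists>w. has_gradient br F q w)"

definition grad ::
  "(complex^'d \<Rightarrow> complex^'d \<Rightarrow> complex^'d) \<Rightarrow> ((real \<Rightarrow> complex^'d) \<Rightarrow> complex)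
    \<Rightarrow> (real \<Rightarrow> complex^'d) \<Rightarrow> real \<Rightarrow> complex^'d" where
  "grad br F q = (SOME w. has_gradient br F q w)"

section \<open>The Poisson pencil\<close>

definition P2 ::
  "(complex^'d \<Rightarrow> complex^'d \<Rightarrow> complex^'d) \<Rightarrow> (real \<Rightarrow> complex^'d) \<Rightarrow> (real \<Rightarrow> complex^'d)
    \<Rightarrow> real \<Rightarrow> complex^'d" where
  "P2 br q v = (\<lambda>x. dx v x + br (q x) (v x))"

definition P1 ::
  "(complex^'d \<Rightarrow> complex^'d \<Rightarrow> complex^'d) \<Rightarrow> complex^'d \<Rightarrow> (real \<Rightarrow> complex^'d)
    \<Rightarrow> (real \<Rightarrow> complex^'d) \<Rightarrow> real \<Rightarrow> complex^'d" where
  "P1 br a q v = (\<lambda>x. br a (v x))"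

text \<open>A Poisson tensor \<open>P\<close> gives the bracket $\{F,G\}(q) = (dF \,|\, P(q)\, dG)$.\<close>

definition tensor_bracket ::
  "(complex^'d \<Rightarrow> complex^'d \<Rightarrow> complex^'d)
    \<Rightarrow> ((real \<Rightarrow> complex^'d) \<Rightarrow> (real \<Rightarrow> complex^'d) \<Rightarrow> real \<Rightarrow> complex^'d)
    \<Rightarrow> ((real \<Rightarrow> complex^'d) \<Rightarrow> complex) \<Rightarrow> ((real \<Rightarrow> complex^'d) \<Rightarrow> complex)
    \<Rightarrow> (real \<Rightarrow> complex^'d) \<Rightarrow> complex" where
  "tensor_bracket br P F G q = loop_form br (grad br F q) (P q (grad br G q))"

definition pencil ::
  "(complex^'d \<Rightarrow> complex^'d \<Rightarrow> complex^'d) \<Rightarrow> complex^'d \<Rightarrow> complex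
    \<Rightarrow> ((real \<Rightarrow> complex^'d) \<Rightarrow> complex) \<Rightarrow> ((real \<Rightarrow> complex^'d) \<Rightarrow> complex)
    \<Rightarrow> (real \<Rightarrow> complex^'d) \<Rightarrow> complex" where
  "pencil br a lam F G q =
     tensor_bracket br (P2 br) F G q + lam * tensor_bracket br (P1 br a) F G q"

section \<open>Poisson reduction\<close>

definition S_space ::
  "(complex^'d \<Rightarrow> complex^'d \<Rightarrow> complex^'d) \<Rightarrow> (int \<Rightarrow> (complex^'d) set) \<Rightarrow> complex^'d
    \<Rightarrow> (complex^'d) set \<Rightarrow> (real \<Rightarrow> complex^'d) set" where
  "S_space br gr e l = loops {v. v - e \<in> b_space br gr e l}"

definition slice ::
  "(complex^'d \<Rightarrow> complex^'d \<Rightarrow> complex^'d) \<Rightarrow> complex^'d \<Rightarrow> complex^'d \<Rightarrow> (complex^'d) set" where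
  "slice br e f = {v. v - e \<in> centralizer br f}"

definition Q_space ::
  "(complex^'d \<Rightarrow> complex^'d \<Rightarrow> complex^'d) \<Rightarrow> complex^'d \<Rightarrow> complex^'d
    \<Rightarrow> (real \<Rightarrow> complex^'d) set" where
  "Q_space br e f = loops (slice br e f)"

definition D_dist ::
  "(complex^'d \<Rightarrow> complex^'d \<Rightarrow> complex^'d) \<Rightarrow> (int \<Rightarrow> (complex^'d) set) \<Rightarrow> complex^'d
    \<Rightarrow> (complex^'d) set \<Rightarrow> (real \<Rightarrow> complex^'d) \<Rightarrow> (real \<Rightarrow> complex^'d) set" where
  "D_dist br gr e l z = P2 br z ` loops (n_alg br gr e l)"

text \<open>$\exp(-\mathrm{ad}\,u)[\partial_x+q]-\partial_x$. Since $[u,\partial_x]=-u_x$, one application of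
  $-\mathrm{ad}\,u$ to $\partial_x+q$ gives the loop $u_x+[q,u]=P_2(q)(u)$, so the result is
  $q+\sum_{k\ge0}(-\mathrm{ad}\,u)^k(P_2(q)(u))/(k+1)!$.\<close>

definition gauge ::
  "(complex^'d \<Rightarrow> complex^'d \<Rightarrow> complex^'d) \<Rightarrow> (real \<Rightarrow> complex^'d) \<Rightarrow> (real \<Rightarrow> complex^'d)
    \<Rightarrow> real \<Rightarrow> complex^'d" where
  "gauge br u q = (\<lambda>x. q x +
     (\<Sum>k. (1 / fact (Suc k)) *s ((\<lambda>v. - br (u x) v) ^^ k) (P2 br q u x)))"

definition rho ::
  "(complex^'d \<Rightarrow> complex^'d \<Rightarrow> complex^'d) \<Rightarrow> (int \<Rightarrow> (complex^'d) set) \<Rightarrow> complex^'d \<Rightarrow> complex^'d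
    \<Rightarrow> (complex^'d) set \<Rightarrow> (real \<Rightarrow> complex^'d) \<Rightarrow> real \<Rightarrow> complex^'d" where
  "rho br gr e f l z = (THE p. p \<in> Q_space br e f \<and> (\<exists>u\<in>loops (m_alg gr l). p = gauge br u z))"

text \<open>\<open>F\<close> is a functional on all loops which extends $\phi\circ\rho$ from \<open>S\<close> and whose
  differential at the points of \<open>S\<close> vanishes on the distribution \<open>D\<close>. Of \<open>\<phi>\<close> only the values
  on \<open>Q\<close> matter.\<close>

definition extension ::
  "(complex^'d \<Rightarrow> complex^'d \<Rightarrow> complex^'d) \<Rightarrow> (int \<Rightarrow> (complex^'d) set) \<Rightarrow> complex^'d \<Rightarrow> complex^'d
    \<Rightarrow> (complex^'d) set
    \<Rightarrow> ((real \<Rightarrow> complex^'d) \<Rightarrow> complex) \<Rightarrow> ((real \<Rightarrow> complex^'d) \<Rightarrow> complex) \<Rightarrow> bool" where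
  "extension br gr e f l \<phi> F \<longleftrightarrow>
     functional br F \<and>
     (\<forall>z\<in>S_space br gr e l. F z = \<phi> (rho br gr e f l z)) \<and>
     (\<forall>z\<in>S_space br gr e l. \<forall>d\<in>D_dist br gr e l z.
        ((\<lambda>t::real. F (\<lambda>x. z x + t *\<^sub>R d x)) has_vector_derivative 0) (at 0))"

definition reduced_bracket ::
  "(complex^'d \<Rightarrow> complex^'d \<Rightarrow> complex^'d) \<Rightarrow> (int \<Rightarrow> (complex^'d) set) \<Rightarrow> complex^'d \<Rightarrow> complex^'d
    \<Rightarrow> (complex^'d) set \<Rightarrow> complex^'d \<Rightarrow> complex
    \<Rightarrow> ((real \<Rightarrow> complex^'d) \<Rightarrow> complex) \<Rightarrow> ((real \<Rightarrow> complex^'d) \<Rightarrow> complex)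
    \<Rightarrow> (real \<Rightarrow> complex^'d) \<Rightarrow> complex" where
  "reduced_bracket br gr e f l a lam \<phi> \<psi> z =
     (THE c. \<exists>F G. extension br gr e f l \<phi> F \<and> extension br gr e f l \<psi> G \<and> c = pencil br a lam F G z)"

section \<open>Coordinates, differential polynomials, matrix differential operators\<close>

definition coords ::
  "(complex^'d \<Rightarrow> complex^'d \<Rightarrow> complex^'d) \<Rightarrow> complex^'d \<Rightarrow> (nat \<Rightarrow> complex^'d)
    \<Rightarrow> complex^'d \<Rightarrow> nat \<Rightarrow> complex" where
  "coords br e \<xi>' v i = killing br (v - e) (\<xi>' i)"

text \<open>A jet \<open>u\<close> stores in \<open>u k r\<close> the value of the \<open>r\<close>-th \<open>x\<close>-derivative of the \<open>k\<close>-th coordinate;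
  \<open>c\<close> is the coordinate map.\<close>

type_synonym jet = "nat \<Rightarrow> nat \<Rightarrow> complex"

definition jet_of :: "(complex^'d \<Rightarrow> nat \<Rightarrow> complex) \<Rightarrow> (real \<Rightarrow> complex^'d) \<Rightarrow> real \<Rightarrow> jet" where
  "jet_of c z x = (\<lambda>k r. (dx ^^ r) (\<lambda>y. c (z y) k) x)"

inductive diff_poly :: "nat set \<Rightarrow> (jet \<Rightarrow> complex) \<Rightarrow> bool" for K where
  const: "diff_poly K (\<lambda>u. b)"
| jet_var: "k \<in> K \<Longrightarrow> diff_poly K (\<lambda>u. u k r)"
| add: "diff_poly K p \<Longrightarrow> diff_poly K q \<Longrightarrow> diff_poly K (\<lambda>u. p u + q u)"
| mult: "diff_poly K p \<Longrightarrow> diff_poly K q \<Longrightarrow> diff_poly K (\<lambda>u. p u * q u)"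

text \<open>Densities of local functionals: polynomials in the jet with coefficients that are smooth
  functions on the circle.\<close>

inductive density :: "nat set \<Rightarrow> (real \<Rightarrow> jet \<Rightarrow> complex) \<Rightarrow> bool" for K where
  coefficient: "\<eta> \<in> loops UNIV \<Longrightarrow> density K (\<lambda>x u. \<eta> x)"
| jet_var: "k \<in> K \<Longrightarrow> density K (\<lambda>x u. u k r)"
| add: "density K p \<Longrightarrow> density K q \<Longrightarrow> density K (\<lambda>x u. p x u + q x u)"
| mult: "density K p \<Longrightarrow> density K q \<Longrightarrow> density K (\<lambda>x u. p x u * q x u)"

definition local_functional ::
  "(complex^'d \<Rightarrow> nat \<Rightarrow> complex) \<Rightarrow> nat set \<Rightarrow> (real \<Rightarrow> complex^'d) set
    \<Rightarrow> ((real \<Rightarrow> complex^'d) \<Rightarrow> complex) \<Rightarrow> bool" where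
  "local_functional c K Z \<phi> \<longleftrightarrow>
     (\<exists>p. density K p \<and> (\<forall>z\<in>Z. \<phi> z = circle_int (\<lambda>x. p x (jet_of c z x))))"

text \<open>The list $[A_0,\dots,A_N]$ stands for the differential operator $\sum_r A_r\partial_x^r$.\<close>

type_synonym diff_op = "(jet \<Rightarrow> complex) list"

definition op_coeff :: "diff_op \<Rightarrow> nat \<Rightarrow> jet \<Rightarrow> complex" where
  "op_coeff A r = (if r < length A then A ! r else (\<lambda>u. 0))"

definition op_apply :: "diff_op \<Rightarrow> (real \<Rightarrow> jet) \<Rightarrow> (real \<Rightarrow> complex) \<Rightarrow> real \<Rightarrow> complex" where
  "op_apply A j \<eta> = (\<lambda>x. \<Sum>r<length A. (A ! r) (j x) * (dx ^^ r) \<eta> x)"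

definition matrix_diff_op :: "nat set \<Rightarrow> nat set \<Rightarrow> (nat \<Rightarrow> nat \<Rightarrow> diff_op) \<Rightarrow> bool" where
  "matrix_diff_op I K A \<longleftrightarrow> (\<forall>i\<in>I. \<forall>j\<in>I. \<forall>p\<in>set (A i j). diff_poly K p)"

definition matrix_op ::
  "(complex^'d \<Rightarrow> nat \<Rightarrow> complex) \<Rightarrow> (nat \<Rightarrow> nat \<Rightarrow> diff_op) \<Rightarrow> (real \<Rightarrow> complex^'d)
    \<Rightarrow> nat \<Rightarrow> nat \<Rightarrow> (real \<Rightarrow> complex) \<Rightarrow> real \<Rightarrow> complex" where
  "matrix_op c A z i j \<eta> = op_apply (A i j) (jet_of c z) \<eta>"

text \<open>The coordinate \<open>q\<^sup>i(x)\<close> smeared with a test function.\<close>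

definition smeared ::
  "(complex^'d \<Rightarrow> nat \<Rightarrow> complex) \<Rightarrow> nat \<Rightarrow> (real \<Rightarrow> complex) \<Rightarrow> (real \<Rightarrow> complex^'d) \<Rightarrow> complex" where
  "smeared c i \<eta> z = circle_int (\<lambda>x. \<eta> x * c (z x) i)"

text \<open>At the points of \<open>Z\<close> and for indices in \<open>I\<close>,
  $\{q^i(x),q^j(y)\}=\mathcal A^{ij}\delta(x-y)$, where $\mathcal A^{ij}$ is a (point dependent)
  operator acting in the variable $x$: both sides are integrated against $\eta(x)\zeta(y)$.\<close>

definition coordinate_brackets ::
  "(complex^'d \<Rightarrow> nat \<Rightarrow> complex) \<Rightarrow> nat set \<Rightarrow> (real \<Rightarrow> complex^'d) set
    \<Rightarrow> (((real \<Rightarrow> complex^'d) \<Rightarrow> complex) \<Rightarrow> ((real \<Rightarrow> complex^'d) \<Rightarrow> complex)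
         \<Rightarrow> (real \<Rightarrow> complex^'d) \<Rightarrow> complex)
    \<Rightarrow> ((real \<Rightarrow> complex^'d) \<Rightarrow> nat \<Rightarrow> nat \<Rightarrow> (real \<Rightarrow> complex) \<Rightarrow> real \<Rightarrow> complex) \<Rightarrow> bool" where
  "coordinate_brackets c I Z B \<A> \<longleftrightarrow>
     (\<forall>i\<in>I. \<forall>j\<in>I. \<forall>\<eta>\<in>loops UNIV. \<forall>\<zeta>\<in>loops UNIV. \<forall>z\<in>Z.
        B (smeared c i \<eta>) (smeared c j \<zeta>) z = circle_int (\<lambda>x. \<eta> x * \<A> z i j \<zeta> x))"

section \<open>Leading terms\<close>

text \<open>The part of degree \<open>d\<close> of a differential polynomial, when the \<open>r\<close>-th derivative of a
  coordinate has degree \<open>r\<close>: the coefficient of \<open>t^d\<close> after rescaling \<open>u k r\<close> by \<open>t^r\<close>.\<close>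

definition degree_part :: "nat \<Rightarrow> (jet \<Rightarrow> complex) \<Rightarrow> jet \<Rightarrow> complex" where
  "degree_part d p u = (deriv ^^ d) (\<lambda>t. p (\<lambda>k r. t ^ r * u k r)) 0 / fact d"

definition point_jet :: "(nat \<Rightarrow> complex) \<Rightarrow> jet" where
  "point_jet v = (\<lambda>k r. if r = 0 then v k else 0)"

text \<open>As $\partial_x^r\delta$ has degree \<open>r - 1\<close>, the terms of degree \<open>-1\<close> and \<open>0\<close> of
  $\sum_r A_r\partial_x^r\delta$ are $F\delta$ and $F_0\delta'+\sum_k\Gamma_kq^k_x\delta$, with \<open>F\<close> and
  \<open>F\<^sub>0\<close> the parts of degree \<open>0\<close> of \<open>A\<^sub>0\<close> and \<open>A\<^sub>1\<close>, and $\sum_k\Gamma_kq^k_x$ the part of degree \<open>1\<close> of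
  \<open>A\<^sub>0\<close>, which is linear in the $q^k_x$; $\Gamma_k$ is its value at $q^j_x=\delta_{jk}$.\<close>

definition lead_F :: "diff_op \<Rightarrow> (nat \<Rightarrow> complex) \<Rightarrow> complex" where
  "lead_F A v = degree_part 0 (op_coeff A 0) (point_jet v)"

definition lead_F0 :: "diff_op \<Rightarrow> (nat \<Rightarrow> complex) \<Rightarrow> complex" where
  "lead_F0 A v = degree_part 0 (op_coeff A 1) (point_jet v)"

definition lead_Gamma :: "diff_op \<Rightarrow> nat \<Rightarrow> (nat \<Rightarrow> complex) \<Rightarrow> complex" where
  "lead_Gamma A k v = degree_part 1 (op_coeff A 0)
     (\<lambda>j r. if r = 0 then v j else if r = 1 \<and> j = k then 1 else 0)"

section \<open>Dirac reduction\<close>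

definition inverse_matrix_on ::
  "nat set \<Rightarrow> (nat \<Rightarrow> nat \<Rightarrow> complex) \<Rightarrow> (nat \<Rightarrow> nat \<Rightarrow> complex) \<Rightarrow> bool" where
  "inverse_matrix_on J M N \<longleftrightarrow>
     (\<forall>\<alpha>\<in>J. \<forall>\<gamma>\<in>J. (\<Sum>\<beta>\<in>J. M \<alpha> \<beta> * N \<beta> \<gamma>) = (if \<alpha> = \<gamma> then 1 else 0) \<and>
                   (\<Sum>\<beta>\<in>J. N \<alpha> \<beta> * M \<beta> \<gamma>) = (if \<alpha> = \<gamma> then 1 else 0))"

text \<open>Two-sided inverses, over the index set \<open>J\<close> and at the points of \<open>Z\<close>.\<close>

definition inverse_op_on ::
  "(complex^'d \<Rightarrow> nat \<Rightarrow> complex) \<Rightarrow> nat set \<Rightarrow> (real \<Rightarrow> complex^'d) set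
    \<Rightarrow> (nat \<Rightarrow> nat \<Rightarrow> diff_op) \<Rightarrow> (nat \<Rightarrow> nat \<Rightarrow> diff_op) \<Rightarrow> bool" where
  "inverse_op_on c J Z A B \<longleftrightarrow>
     (\<forall>z\<in>Z. \<forall>\<zeta>. (\<forall>\<gamma>\<in>J. \<zeta> \<gamma> \<in> loops UNIV) \<longrightarrow> (\<forall>\<alpha>\<in>J. \<forall>x.
        (\<Sum>\<beta>\<in>J. matrix_op c A z \<alpha> \<beta> (\<lambda>y. \<Sum>\<gamma>\<in>J. matrix_op c B z \<beta> \<gamma> (\<zeta> \<gamma>) y) x) = \<zeta> \<alpha> x \<and>
        (\<Sum>\<beta>\<in>J. matrix_op c B z \<alpha> \<beta> (\<lambda>y. \<Sum>\<gamma>\<in>J. matrix_op c A z \<beta> \<gamma> (\<zeta> \<gamma>) y) x) = \<zeta> \<alpha> x))"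

text \<open>$\mathbb A^{ij}-\mathbb A^{i\beta}\mathbb S_{\beta\alpha}\mathbb A^{\alpha j}$, summed over
  \<open>\<alpha>, \<beta> \<in> J\<close>, as an operator on test functions.\<close>

definition dirac_op ::
  "(complex^'d \<Rightarrow> nat \<Rightarrow> complex) \<Rightarrow> nat set \<Rightarrow> (nat \<Rightarrow> nat \<Rightarrow> diff_op) \<Rightarrow> (nat \<Rightarrow> nat \<Rightarrow> diff_op)
    \<Rightarrow> (real \<Rightarrow> complex^'d) \<Rightarrow> nat \<Rightarrow> nat \<Rightarrow> (real \<Rightarrow> complex) \<Rightarrow> real \<Rightarrow> complex" where
  "dirac_op c J A S z i j \<zeta> = (\<lambda>x. matrix_op c A z i j \<zeta> x -
     (\<Sum>\<beta>\<in>J. \<Sum>\<alpha>\<in>J. matrix_op c A z i \<beta> (matrix_op c S z \<beta> \<alpha> (matrix_op c A z \<alpha> j \<zeta>)) x))"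

text \<open>Variational derivatives $\zeta_i=\delta\phi/\delta q^i$, \<open>i = 1, \<dots>, m\<close>, of a functional on \<open>Q\<close>.\<close>

definition has_var_deriv ::
  "(nat \<Rightarrow> complex^'d) \<Rightarrow> nat \<Rightarrow> ((real \<Rightarrow> complex^'d) \<Rightarrow> complex) \<Rightarrow> (real \<Rightarrow> complex^'d)
    \<Rightarrow> (nat \<Rightarrow> real \<Rightarrow> complex) \<Rightarrow> bool" where
  "has_var_deriv \<xi> m \<phi> z \<zeta> \<longleftrightarrow> (\<forall>i\<in>{1..m}. \<zeta> i \<in> loops UNIV) \<and>
     (\<forall>s. (\<forall>i\<in>{1..m}. s i \<in> loops UNIV) \<longrightarrow>
        ((\<lambda>t::real. \<phi> (\<lambda>x. z x + (\<Sum>i=1..m. (of_real t * s i x) *s \<xi> i)))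
           has_vector_derivative circle_int (\<lambda>x. \<Sum>i=1..m. \<zeta> i x * s i x)) (at 0))"

definition var_deriv ::
  "(nat \<Rightarrow> complex^'d) \<Rightarrow> nat \<Rightarrow> ((real \<Rightarrow> complex^'d) \<Rightarrow> complex) \<Rightarrow> (real \<Rightarrow> complex^'d)
    \<Rightarrow> nat \<Rightarrow> real \<Rightarrow> complex" where
  "var_deriv \<xi> m \<phi> z = (SOME \<zeta>. has_var_deriv \<xi> m \<phi> z \<zeta>)"

text \<open>The bracket of functionals on \<open>Q\<close> with a given matrix operator.\<close>

definition operator_bracket ::
  "(nat \<Rightarrow> complex^'d) \<Rightarrow> nat
    \<Rightarrow> ((real \<Rightarrow> complex^'d) \<Rightarrow> nat \<Rightarrow> nat \<Rightarrow> (real \<Rightarrow> complex) \<Rightarrow> real \<Rightarrow> complex)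
    \<Rightarrow> ((real \<Rightarrow> complex^'d) \<Rightarrow> complex) \<Rightarrow> ((real \<Rightarrow> complex^'d) \<Rightarrow> complex)
    \<Rightarrow> (real \<Rightarrow> complex^'d) \<Rightarrow> complex" where
  "operator_bracket \<xi> m \<A> \<phi> \<psi> z =
     circle_int (\<lambda>x. \<Sum>i=1..m. \<Sum>j=1..m. var_deriv \<xi> m \<phi> z i x * \<A> z i j (var_deriv \<xi> m \<psi> z j) x)"

end

theory Submission
  imports Defs
begin

text \<open>By $sl_2$-theory $\mathrm{ad}\,e$ induces an isomorphism $[f,\mathfrak g]\to\mathfrak g/\mathfrak g_f$;
  its inverse \<open>\<theta>\<close> decreases the degree by two and maps $\mathfrak b$ to $\mathfrak m$.

  The condition that $u\in\mathfrak L(\mathfrak m)$ moves $z\in S$ into $Q$ is a fixed point equation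
  which determines $u$ degree by degree as a differential polynomial in $z$. Hence $\phi\circ\rho$ is a local
  functional, and it extends to $\mathfrak L(\mathfrak g)$ by composition with a retraction onto $S$ that maps
  $D$ to $E$ infinitesimally.

  The Hamiltonian vector field of an extension is $\mathfrak b$-valued on $Q$, so the bracket does not
  see changes of the gradient by loops in $\mathfrak n$. A change by a loop in $\mathfrak m$ makes the vector
  field tangent to $Q$, and then the gradient solves the linear system of Dirac's formula. The operator of
  this system is $\mathrm{ad}\,e$ up to terms which become nilpotent after applying \<open>\<theta>\<close>; this gives the
  inverse as a finite Neumann series. The formulas for the leading terms follow by comparing the terms of
  degree at most one in the composition of differential operators, whose coefficients are determined by
  their action because waves $e^{ikx}$ separate orders and loops realise all finite jets.\<close>

section \<open>Calculus of loops\<close>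

text \<open>Because the degrees are bounded, every operator that strictly lowers degree is
  nilpotent. Exponentials, the fixed point iteration and the Neumann series are therefore finite
  sums, and no question of convergence arises. The maps built from them are differential
  polynomials, so affine variations of loops give families polynomial in the parameter, and
  derivatives of functionals are read off from coefficients. The obstacle to extending \<phi> o
  \<rho> is that D is generated by n and is in general not tangent to S, whereas \<rho> is known to
  be invariant only along directions generated by m. When l differs from its symplectic complement,
  the part of n outside m has to be removed; the retraction does this by a correction term built
  from P2 itself. The parameter of the pencil enters through two facts. As a centralizes n, P1 kills
  loops in n, so the distribution D serves all values of the parameter. As f lies in n, a lies in
  the centralizer of f, so replacing z - e by z - e + \<open>lam\<close> a keeps it in degrees at
  most 0 over Q.\<close>

primrec times_differentiable :: "nat \<Rightarrow> (real \<Rightarrow> 'a::real_normed_vector) \<Rightarrow> bool" where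
  "times_differentiable 0 u \<longleftrightarrow> (\<forall>x. u differentiable (at x))"
| "times_differentiable (Suc k) u \<longleftrightarrow> (\<forall>x. u differentiable (at x)) \<and> times_differentiable k (dx u)"

text \<open>The recursion takes off the first derivative, while \<open>loops\<close> speaks of
  iterates of \<open>dx\<close>. In the recursive form closure under sums and products is an
  induction in which u is replaced by \<open>dx u\<close>.\<close>

lemma times_differentiable_iff:
  "times_differentiable k u \<longleftrightarrow> (\<forall>j\<le>k. \<forall>x. (dx ^^ j) u differentiable (at x))"
proof (induction k arbitrary: u)
  case (Suc k)
  have "(\<forall>j\<le>Suc k. P j) \<longleftrightarrow> P 0 \<and> (\<forall>j\<le>k. P (Suc j))" for P
    by (metis Suc_le_mono le0 not0_implies_Suc)
  from this[of "\<lambda>j. \<forall>x. (dx ^^ j) u differentiable (at x)"] show ?case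
    by (simp add: Suc funpow_swap1)
qed simp

lemma loops_UNIV_iff:
  "u \<in> loops UNIV \<longleftrightarrow> (\<forall>x. u (x + 2 * pi) = u x) \<and> (\<forall>k. times_differentiable k u)"
  by (auto simp: loops_def times_differentiable_iff)

lemma loops_iff: "u \<in> loops V \<longleftrightarrow> u \<in> loops UNIV \<and> (\<forall>x. u x \<in> V)"
  by (auto simp: loops_def)

lemma loops_UNIV: "u \<in> loops V \<Longrightarrow> u \<in> loops UNIV"
  by (auto simp: loops_def)

lemma loop_differentiable: "u \<in> loops V \<Longrightarrow> u differentiable (at x)"
  unfolding loops_def by (auto dest: spec[of _ 0])

lemma dx_loop: "u \<in> loops V \<Longrightarrow> (u has_vector_derivative dx u x) (at x)"
  by (simp add: dx_def loop_differentiable flip: vector_derivative_works)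

lemma differentiable_dx: "u differentiable (at x) \<Longrightarrow> (u has_vector_derivative dx u x) (at x)"
  by (simp add: dx_def flip: vector_derivative_works)

lemma dx_eqI: "(\<And>x. (u has_vector_derivative v x) (at x)) \<Longrightarrow> dx u = v"
  by (auto simp: dx_def vector_derivative_at)

lemma loop_continuous: "u \<in> loops V \<Longrightarrow> continuous_on A u"
  by (meson continuous_at_imp_continuous_on differentiable_imp_continuous_within loop_differentiable)

lemma dx_in_loops: 
  assumes "u \<in> loops V" shows "dx u \<in> loops UNIV"
proof -
  have u: "u \<in> loops UNIV" using assms by (rule loops_UNIV)
  have "dx u (x + 2 * pi) = dx u x" for x
  proof -
    have "((\<lambda>x. u (x + 2 * pi)) has_vector_derivative dx u (x + 2 * pi)) (at x)"
      using vector_diff_chain_at[of "\<lambda>x. x + 2 * pi" 1 x u "dx u (x + 2 * pi)"] dx_loop[OF u, of "x + 2 * pi"]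
        has_vector_derivative_add_const[of "\<lambda>x. x" "2 * pi" 1 "at x"]
      by (simp add: o_def)
    moreover have "(\<lambda>x. u (x + 2 * pi)) = u" using u by (auto simp: loops_UNIV_iff)
    ultimately show ?thesis using dx_loop[OF u, of x] by (metis vector_derivative_at)
  qed
  moreover have "times_differentiable k (dx u)" for k
    using u times_differentiable.simps(2)[of k u] unfolding loops_UNIV_iff by blast
  ultimately show ?thesis by (simp add: loops_UNIV_iff)
qed

lemma dxs_in_loops: "u \<in> loops UNIV \<Longrightarrow> (dx ^^ k) u \<in> loops UNIV"
  by (induction k) (auto intro: dx_in_loops)

lemma dx_const: "dx (\<lambda>x. b) = (\<lambda>x. 0)"
  by (rule dx_eqI) (auto intro: derivative_eq_intros)

lemma const_in_loops: "(\<lambda>x. b) \<in> loops UNIV"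
proof -
  have "times_differentiable k (\<lambda>x::real. b)" for k and b :: 'a
    by (induction k arbitrary: b) (auto simp: dx_const)
  then show ?thesis by (simp add: loops_UNIV_iff)
qed

lemma dx_bilinear:
  assumes "bounded_bilinear B" "\<And>x. u differentiable (at x)" "\<And>x. v differentiable (at x)"
  shows "dx (\<lambda>x. B (u x) (v x)) = (\<lambda>x. B (u x) (dx v x) + B (dx u x) (v x))"
  by (rule dx_eqI, rule bounded_bilinear.has_vector_derivative[OF assms(1)]) (auto intro!: differentiable_dx assms)

lemma dx_linear:
  assumes "bounded_linear T" "\<And>x. u differentiable (at x)"
  shows "dx (\<lambda>x. T (u x)) = (\<lambda>x. T (dx u x))"
  by (rule dx_eqI, rule bounded_linear.has_vector_derivative[OF assms(1)]) (auto intro!: differentiable_dx assms)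

lemma dx_add':
  assumes "\<And>x. u differentiable (at x)" "\<And>x. v differentiable (at x)"
  shows "dx (\<lambda>x. u x + v x) = (\<lambda>x. dx u x + dx v x)"
  by (rule dx_eqI, rule has_vector_derivative_add) (auto intro!: differentiable_dx assms)

lemma times_differentiable_mono: "times_differentiable (Suc k) u \<Longrightarrow> times_differentiable k u"
  by (auto simp: times_differentiable_iff)

lemma times_differentiable_add:
  "times_differentiable k u \<Longrightarrow> times_differentiable k v \<Longrightarrow> times_differentiable k (\<lambda>x. u x + v x)"
  by (induction k arbitrary: u v) (auto simp: dx_add')

lemma times_differentiable_linear:
  assumes T: "bounded_linear T"
  shows "times_differentiable k u \<Longrightarrow> times_differentiable k (\<lambda>x. T (u x))"
proof (induction k arbitrary: u)
  case 0
  then show ?case using bounded_linear_imp_differentiable[OF T] 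
    by (auto intro: differentiable_compose[of T])
next
  case (Suc k)
  have "(\<lambda>x. T (u x)) differentiable (at x)" for x
    using Suc.prems bounded_linear_imp_differentiable[OF T]
    by (auto intro: differentiable_compose[of T])
  with Suc show ?case by (simp add: dx_linear[OF T])
qed

lemma times_differentiable_bilinear:
  assumes B: "bounded_bilinear B"
  shows "times_differentiable k u \<Longrightarrow> times_differentiable k v
    \<Longrightarrow> times_differentiable k (\<lambda>x. B (u x) (v x))"
proof (induction k arbitrary: u v)
  case 0
  then show ?case
    by (auto intro!: differentiableI_vector[OF bounded_bilinear.has_vector_derivative[OF B differentiable_dx differentiable_dx]])
next
  case (Suc k)
  have d: "(\<lambda>x. B (u x) (v x)) differentiable (at x)" for x
    using Suc.prems
    by (auto intro!: differentiableI_vector[OF bounded_bilinear.has_vector_derivative[OF B differentiable_dx differentiable_dx]])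
  have "times_differentiable k u" "times_differentiable k v"
    using Suc.prems by (auto simp del: times_differentiable.simps intro: times_differentiable_mono)
  with Suc show ?case by (auto simp: dx_bilinear[OF B] d intro!: times_differentiable_add)
qed

lemma loops_add: "u \<in> loops UNIV \<Longrightarrow> v \<in> loops UNIV \<Longrightarrow> (\<lambda>x. u x + v x) \<in> loops UNIV"
  by (auto simp: loops_UNIV_iff times_differentiable_add)

lemma loops_linear: "bounded_linear T \<Longrightarrow> u \<in> loops UNIV \<Longrightarrow> (\<lambda>x. T (u x)) \<in> loops UNIV"
  by (auto simp: loops_UNIV_iff times_differentiable_linear)

lemma loops_bilinear:
  "bounded_bilinear B \<Longrightarrow> u \<in> loops UNIV \<Longrightarrow> v \<in> loops UNIV \<Longrightarrow> (\<lambda>x. B (u x) (v x)) \<in> loops UNIV"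
  by (auto simp: loops_UNIV_iff times_differentiable_bilinear)

lemma loops_uminus: "u \<in> loops UNIV \<Longrightarrow> (\<lambda>x. - u x) \<in> loops UNIV"
  using loops_linear[of uminus u] by (simp add: bounded_linear_minus bounded_linear_ident)

lemma loops_diff: "u \<in> loops UNIV \<Longrightarrow> v \<in> loops UNIV \<Longrightarrow> (\<lambda>x. u x - v x) \<in> loops UNIV"
  using loops_add[of u "\<lambda>x. - v x"] loops_uminus[of v] by simp

lemma loops_scaleR: "u \<in> loops UNIV \<Longrightarrow> (\<lambda>x. t *\<^sub>R u x) \<in> loops UNIV"
  by (rule loops_linear[OF bounded_linear_scaleR_right])

lemma loops_sum: "(\<And>i. i \<in> I \<Longrightarrow> u i \<in> loops UNIV) \<Longrightarrow> (\<lambda>x. \<Sum>i\<in>I. u i x) \<in> loops UNIV"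
  by (induction I rule: infinite_finite_induct) (auto simp: const_in_loops intro!: loops_add)

lemma loops_mult:
  fixes u v :: "real \<Rightarrow> 'a::real_normed_algebra"
  shows "u \<in> loops UNIV \<Longrightarrow> v \<in> loops UNIV \<Longrightarrow> (\<lambda>x. u x * v x) \<in> loops UNIV"
  by (rule loops_bilinear[OF bounded_bilinear_mult])

lemma dx_add: "u \<in> loops UNIV \<Longrightarrow> v \<in> loops UNIV \<Longrightarrow> dx (\<lambda>x. u x + v x) = (\<lambda>x. dx u x + dx v x)"
  by (rule dx_add') (auto intro: loop_differentiable)

lemma dx_bounded_linear: "bounded_linear T \<Longrightarrow> u \<in> loops UNIV \<Longrightarrow> dx (\<lambda>x. T (u x)) = (\<lambda>x. T (dx u x))"
  by (rule dx_linear) (auto intro: loop_differentiable)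

lemma dx_bounded_bilinear:
  "bounded_bilinear B \<Longrightarrow> u \<in> loops UNIV \<Longrightarrow> v \<in> loops UNIV
    \<Longrightarrow> dx (\<lambda>x. B (u x) (v x)) = (\<lambda>x. B (u x) (dx v x) + B (dx u x) (v x))"
  by (rule dx_bilinear) (auto intro: loop_differentiable)

lemma dx_uminus: "u \<in> loops UNIV \<Longrightarrow> dx (\<lambda>x. - u x) = (\<lambda>x. - dx u x)"
  using dx_bounded_linear[of uminus u] by (simp add: bounded_linear_minus bounded_linear_ident)

lemma dx_diff: "u \<in> loops UNIV \<Longrightarrow> v \<in> loops UNIV \<Longrightarrow> dx (\<lambda>x. u x - v x) = (\<lambda>x. dx u x - dx v x)"
  using dx_add[of u "\<lambda>x. - v x"] by (simp add: dx_uminus loops_uminus)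

lemma dx_scaleR: "u \<in> loops UNIV \<Longrightarrow> dx (\<lambda>x. t *\<^sub>R u x) = (\<lambda>x. t *\<^sub>R dx u x)"
  by (rule dx_bounded_linear[OF bounded_linear_scaleR_right])

lemma dx_sum: "(\<And>i. i \<in> I \<Longrightarrow> u i \<in> loops UNIV) \<Longrightarrow> dx (\<lambda>x. \<Sum>i\<in>I. u i x) = (\<lambda>x. \<Sum>i\<in>I. dx (u i) x)"
  by (induction I rule: infinite_finite_induct) (auto simp: dx_const dx_add loops_sum)

lemma dx_mult:
  fixes u v :: "real \<Rightarrow> 'a::real_normed_algebra"
  shows "u \<in> loops UNIV \<Longrightarrow> v \<in> loops UNIV \<Longrightarrow> dx (\<lambda>x. u x * v x) = (\<lambda>x. u x * dx v x + dx u x * v x)"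
  by (rule dx_bounded_bilinear[OF bounded_bilinear_mult])

subsection \<open>Integration over the circle\<close>

lemma loop_integrable: "u \<in> loops UNIV \<Longrightarrow> u integrable_on {0..2 * pi}"
  for u :: "real \<Rightarrow> complex"
  by (intro integrable_continuous_interval loop_continuous)

lemma circle_int_add:
  "u \<in> loops UNIV \<Longrightarrow> v \<in> loops UNIV \<Longrightarrow> circle_int (\<lambda>x. u x + v x) = circle_int u + circle_int v"
  by (auto simp: circle_int_def loop_integrable integral_add)

lemma circle_int_diff:
  "u \<in> loops UNIV \<Longrightarrow> v \<in> loops UNIV \<Longrightarrow> circle_int (\<lambda>x. u x - v x) = circle_int u - circle_int v"
  by (auto simp: circle_int_def loop_integrable integral_diff)

lemma circle_int_uminus: "circle_int (\<lambda>x. - u x) = - circle_int u"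
  by (simp add: circle_int_def)

lemma circle_int_cmult: "circle_int (\<lambda>x. b * u x) = b * circle_int u"
  by (simp add: circle_int_def)

lemma circle_int_zero [simp]: "circle_int (\<lambda>x. 0) = 0"
  by (simp add: circle_int_def)

lemma circle_int_sum:
  "finite I \<Longrightarrow> (\<And>i. i \<in> I \<Longrightarrow> u i \<in> loops UNIV)
    \<Longrightarrow> circle_int (\<lambda>x. \<Sum>i\<in>I. u i x) = (\<Sum>i\<in>I. circle_int (u i))"
  by (auto simp: circle_int_def loop_integrable integral_sum)

lemma circle_int_dx:
  assumes "u \<in> loops UNIV" shows "circle_int (dx u) = 0"
proof -
  have "(dx u has_integral (u (2 * pi) - u 0)) {0..2 * pi}"
    by (intro fundamental_theorem_of_calculus)
      (auto intro: has_vector_derivative_at_within dx_loop[OF assms])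
  moreover have "u (2 * pi) = u 0" using assms unfolding loops_UNIV_iff by (metis add_0)
  ultimately show ?thesis by (simp add: circle_int_def integral_unique)
qed

lemma circle_int_parts:
  assumes "u \<in> loops UNIV" "v \<in> loops UNIV"
  shows "circle_int (\<lambda>x. u x * dx v x) = - circle_int (\<lambda>x. dx u x * v x)"
proof -
  have "circle_int (\<lambda>x. u x * dx v x + dx u x * v x) = 0"
    using circle_int_dx[OF loops_mult[OF assms]] by (simp add: dx_mult assms)
  then show ?thesis
    using assms by (simp add: circle_int_add loops_mult dx_in_loops eq_neg_iff_add_eq_0)
qed

section \<open>Nondegeneracy of the integral pairing on the circle\<close>

lemma cnj_in_loops: "u \<in> loops UNIV \<Longrightarrow> (\<lambda>x. cnj (u x)) \<in> loops UNIV"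
  by (rule loops_linear[OF bounded_linear_cnj])

text \<open>Integrals see one period only; a shift by whole periods, counted by a floor, carries
  vanishing there over to the line.\<close>

lemma periodic_eq_zero:
  assumes per: "\<And>x::real. u (x + 2 * pi) = u x" and z: "\<And>x. 0 \<le> x \<Longrightarrow> x \<le> 2 * pi \<Longrightarrow> u x = 0"
  shows "u x = 0"
proof -
  have pn: "u (y + 2 * pi * real k) = u y" for y k
  proof (induction k)
    case (Suc k)
    have "u (y + 2 * pi * real (Suc k)) = u ((y + 2 * pi * real k) + 2 * pi)"
      by (simp add: algebra_simps)
    then show ?case using per Suc by simp
  qed simp
  have pz: "u (y + 2 * pi * of_int k) = u y" for y k
  proof (cases "k \<ge> 0")
    case True
    then show ?thesis using pn[of y "nat k"] by simp
  next
    case False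
    then show ?thesis using pn[of "y + 2 * pi * of_int k" "nat (- k)"] by simp
  qed
  define y where "y = x + 2 * pi * of_int (- \<lfloor>x / (2 * pi)\<rfloor>)"
  define k where "k = real_of_int \<lfloor>x / (2 * pi)\<rfloor>"
  have p: "0 < 2 * pi" by simp
  have "k \<le> x / (2 * pi)" "x / (2 * pi) \<le> k + 1" unfolding k_def by linarith+
  then have "k * (2 * pi) \<le> x" "x \<le> (k + 1) * (2 * pi)"
    by (simp_all only: pos_le_divide_eq[OF p] pos_divide_le_eq[OF p])
  then have "0 \<le> y" "y \<le> 2 * pi" unfolding y_def k_def by (simp_all add: algebra_simps)
  then show ?thesis using z[of y] pz[of x] unfolding y_def by metis
qed

lemma circle_int_nondegenerate:
  assumes w: "w \<in> loops UNIV" and z: "circle_int (\<lambda>x. w x * cnj (w x)) = 0"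
  shows "w x = 0"
proof (rule periodic_eq_zero)
  show "w (x + 2 * pi) = w x" for x using w by (simp add: loops_UNIV_iff)
  fix x :: real assume x: "0 \<le> x" "x \<le> 2 * pi"
  let ?g = "\<lambda>x. (cmod (w x))\<^sup>2"
  have c: "continuous_on {0..2 * pi} ?g"
    using loop_continuous[OF w] by (intro continuous_intros)
  have "integral {0..2 * pi} (\<lambda>x. of_real (?g x)) = complex_of_real (integral {0..2 * pi} ?g)"
    using integrable_continuous_interval[OF c] by (metis has_integral_of_real integrable_integral integral_unique)
  then have "integral {0..2 * pi} ?g = 0" 
    using z by (simp add: circle_int_def complex_mult_cnj cmod_power2)
  then have "\<forall>x\<in>{0..2 * pi}. ?g x = 0"
    using integral_eq_0_iff[of 0 "2 * pi" ?g] c by simp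
  with x show "w x = 0" by simp
qed

text \<open>As w is itself a smooth loop, its conjugate is an admissible test function, and no
  localisation is required.\<close>

lemma fundamental_lemma:
  assumes "w \<in> loops UNIV" "\<And>\<eta>. \<eta> \<in> loops UNIV \<Longrightarrow> circle_int (\<lambda>x. \<eta> x * w x) = 0"
  shows "w x = 0"
  using assms(2)[OF cnj_in_loops[OF assms(1)]]
  by (intro circle_int_nondegenerate[OF assms(1)]) (simp add: mult.commute)

lemma fundamental_lemma_eq:
  assumes "w \<in> loops UNIV" "w' \<in> loops UNIV"
    "\<And>\<eta>. \<eta> \<in> loops UNIV \<Longrightarrow> circle_int (\<lambda>x. \<eta> x * w x) = circle_int (\<lambda>x. \<eta> x * w' x)"
  shows "w x = w' x"
proof -
  have "circle_int (\<lambda>x. \<eta> x * (w x - w' x)) = 0" if "\<eta> \<in> loops UNIV" for \<eta>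
    using circle_int_diff[OF loops_mult[OF that assms(1)] loops_mult[OF that assms(2)]] assms(3)[OF that]
    by (simp add: right_diff_distrib)
  then show ?thesis using fundamental_lemma[of "\<lambda>x. w x - w' x" x] assms(1,2)
    by (simp add: loops_diff)
qed

section \<open>Linear algebra over the complex numbers\<close>

abbreviation clinear :: "(complex^'d \<Rightarrow> complex^'d) \<Rightarrow> bool" where
  "clinear \<equiv> Vector_Spaces.linear (*s) (*s)"

lemma clinearI:
  "(\<And>x y. T (x + y) = T x + T y) \<Longrightarrow> (\<And>c x. T (c *s x) = c *s T x) \<Longrightarrow> clinear T"
  by (simp add: Vector_Spaces.linear_iff vec.vector_space_axioms)

lemma clinear_add: "clinear T \<Longrightarrow> T (x + y) = T x + T y"
  and clinear_scale: "clinear T \<Longrightarrow> T (c *s x) = c *s T x"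
  by (auto simp: Vector_Spaces.linear_iff)

lemma clinear_0: "clinear T \<Longrightarrow> T 0 = 0"
  using clinear_scale[of T 0 0] by simp

lemma clinear_neg: "clinear T \<Longrightarrow> T (- x) = - T x"
  using clinear_scale[of T "-1" x] by (simp add: vector_sneg_minus1[symmetric])

lemma clinear_diff: "clinear T \<Longrightarrow> T (x - y) = T x - T y"
  using clinear_add[of T x "- y"] by (simp add: clinear_neg)

lemma clinear_sum: "clinear T \<Longrightarrow> T (\<Sum>i\<in>I. f i) = (\<Sum>i\<in>I. T (f i))"
  by (induction I rule: infinite_finite_induct) (auto simp: clinear_0 clinear_add)

lemmas clinear_simps = clinear_add clinear_scale clinear_0 clinear_neg clinear_diff clinear_sum

lemma scaleR_eq_scale: "t *\<^sub>R x = complex_of_real t *s x"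
  by (simp add: vec_eq_iff scaleR_conv_of_real[where 'a = complex])

lemma clinear_bounded: "clinear T \<Longrightarrow> bounded_linear T"
  by (auto simp: linear_conv_bounded_linear[symmetric] scaleR_eq_scale clinear_simps intro!: linearI)

lemma subspace_scaleR: "vec.subspace (U :: (complex^'d) set) \<Longrightarrow> v \<in> U \<Longrightarrow> t *\<^sub>R v \<in> U"
  by (simp add: scaleR_eq_scale vec.subspace_scale)

lemma trace_matrix_comp:
  "clinear T \<Longrightarrow> clinear U \<Longrightarrow> trace (matrix (\<lambda>x. T (U x))) = trace (matrix (\<lambda>x. U (T x)))"
  using matrix_compose_gen[of U T] matrix_compose_gen[of T U] trace_mul_sym[of "matrix T" "matrix U"]
  by (simp add: o_def)

lemma trace_matrix: "trace (matrix T) = (\<Sum>i\<in>UNIV. T (axis i 1) $ i)"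
  by (simp add: trace_def matrix_def)

text \<open>The functional is packaged as an endomorphism, which linear extension from a basis
  supplies directly; a nonzero coordinate of T x later gives the scalar functional.\<close>

lemma separating_functional:
  fixes U :: "(complex^'d) set"
  assumes U: "vec.subspace U" and x: "x \<notin> U"
  obtains T where "clinear T" "\<And>u. u \<in> U \<Longrightarrow> T u = 0" "T x \<noteq> 0"
proof -
  obtain B where B: "B \<subseteq> U" "vec.independent B" "vec.span B = U"
    using vec.basis_exists[of U] U by (metis vec.span_minimal subset_antisym)
  have i: "vec.independent (insert x B)" using B x by (simp add: vec.independent_insertI)
  obtain T where T: "clinear T" "\<And>v. v \<in> insert x B \<Longrightarrow> T v = (if v = x then x else 0)"
    using vec.linear_independent_extend[OF i, of "\<lambda>v. if v = x then x else 0"] by blast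
  have "T u = 0" if "u \<in> U" for u
  proof (rule vec.linear_eq_0_on_span[OF T(1), of B])
    show "T b = 0" if "b \<in> B" for b using T(2)[of b] B(1) x that by auto
  qed (use B that in simp)
  moreover have "x \<noteq> 0" using x vec.subspace_0[OF U] by auto
  ultimately show ?thesis using that T by auto
qed

lemma linear_projection_exists:
  fixes U :: "(complex^'d) set"
  assumes U: "vec.subspace U"
  obtains p where "clinear p" "\<And>v. p v \<in> U" "\<And>u. u \<in> U \<Longrightarrow> p u = u"
proof -
  obtain B where B: "B \<subseteq> U" "vec.independent B" "vec.span B = U"
    using vec.basis_exists[of U] U by (metis vec.span_minimal subset_antisym)
  obtain p where p: "clinear p" "\<And>x. x \<in> B \<Longrightarrow> p x = x" "range p = vec.span B"
    using vec.linear_independent_extend_subspace[OF B(2), of id] by auto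
  have "p u = u" if "u \<in> U" for u
    using vec.linear_eq_on_span[OF p(1) vec.linear_ident, of B u] p(2) B that by simp
  then show ?thesis using that[OF p(1)] p(3) B by blast
qed

section \<open>Representations of $sl_2$\<close>

text \<open>The identity [A^(k+1), F] = (k+1) A^k (H + k) of the enveloping algebra of sl2, for any
  three endomorphisms with the two relations used.\<close>

lemma sl2_commute_power:
  fixes A F H :: "complex^'d \<Rightarrow> complex^'d"
  assumes lin: "clinear A" "clinear F" "clinear H"
    and HA: "\<And>v. H (A v) = A (H v) + 2 *s A v"
    and AF: "\<And>v. A (F v) = F (A v) + H v"
  shows "(A ^^ Suc k) (F v) = F ((A ^^ Suc k) v) + of_nat (Suc k) *s (A ^^ k) (H v + of_nat k *s v)"
proof -
  have An: "clinear (A ^^ k)" for k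
    by (induction k) (auto intro!: clinearI simp: lin clinear_simps)
  have HAn: "H ((A ^^ k) v) = (A ^^ k) (H v) + of_nat (2 * k) *s (A ^^ k) v" for k v
  proof (induction k)
    case (Suc k)
    then show ?case
      by (simp only: funpow.simps o_apply HA clinear_simps[OF lin(1)])
        (simp add: algebra_simps vec_eq_iff)
  qed simp
  show ?thesis
  proof (induction k)
    case 0
    show ?case by (simp add: AF)
  next
    case (Suc k)
    have "(A ^^ Suc (Suc k)) (F v) = A ((A ^^ Suc k) (F v))" by simp
    also have "\<dots> = A (F ((A ^^ Suc k) v)) + of_nat (Suc k) *s A ((A ^^ k) (H v + of_nat k *s v))"
      unfolding Suc by (simp only: clinear_simps[OF lin(1)])
    also have "\<dots> = F ((A ^^ Suc (Suc k)) v) + H ((A ^^ Suc k) v)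
        + of_nat (Suc k) *s (A ^^ Suc k) (H v + of_nat k *s v)"
      by (simp add: AF)
    finally show ?case
      unfolding HAn by (simp add: clinear_simps[OF An] clinear_simps[OF lin(1)] vec_eq_iff algebra_simps)
  qed
qed

text \<open>Induction on the exponent that kills the preimage y: from y one manufactures another
  preimage of x that is killed by a smaller power of A. At exponent 0 the preimage is 0. The vector
  y itself need not be an eigenvector of H.\<close>

lemma sl2_eigenvector_not_in_image:
  fixes A F H :: "complex^'d \<Rightarrow> complex^'d"
  assumes lin: "clinear A" "clinear F" "clinear H"
    and HA: "\<And>v. H (A v) = A (H v) + 2 *s A v"
    and HF: "\<And>v. H (F v) = F (H v) - 2 *s F v"
    and AF: "\<And>v. A (F v) = F (A v) + H v"
    and x: "A x = 0" "H x = of_nat \<mu> *s x"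
  shows "F y = x \<Longrightarrow> (A ^^ k) y = 0 \<Longrightarrow> x = 0"
proof (induction k arbitrary: y)
  case 0
  then show ?case using clinear_0[OF lin(2)] by simp
next
  case (Suc k)
  have An: "clinear (A ^^ k)" for k
    by (induction k) (auto intro!: clinearI simp: lin clinear_simps)
  have FA: "F (A y) = - H y" using AF[of y] Suc.prems x(1) by (simp add: eq_neg_iff_add_eq_0)
  have "(A ^^ k) (F (A y)) = of_nat k *s (A ^^ k) (H y + of_nat (Suc k) *s y)"
  proof (cases k)
    case 0
    then show ?thesis using Suc.prems clinear_0[OF lin(2)] by simp
  next
    case (Suc j)
    have "(A ^^ Suc j) (A y) = 0" using Suc.prems(2) Suc by (simp add: funpow_swap1)
    moreover have "H (A y) + of_nat j *s A y = A (H y + of_nat (Suc k) *s y)"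
      using Suc by (simp add: HA clinear_simps[OF lin(1)] vec_eq_iff algebra_simps)
    ultimately show ?thesis
      using sl2_commute_power[OF lin HA AF, of j "A y"] Suc clinear_0[OF lin(2)]
      by (simp add: funpow_swap1)
  qed
  then have "- (A ^^ k) (H y) = of_nat k *s (A ^^ k) (H y + of_nat (Suc k) *s y)"
    by (simp only: FA clinear_neg[OF An])
  then have "of_nat k *s (A ^^ k) (H y + of_nat (Suc k) *s y) + (A ^^ k) (H y) = 0"
    by (metis add.left_inverse)
  then have z: "of_nat (Suc k) *s (A ^^ k) (H y + of_nat k *s y) = 0"
    by (simp add: clinear_simps[OF An] vec_eq_iff algebra_simps)
  then have z: "(A ^^ k) (H y + of_nat k *s y) = 0"
    by (simp only: vec.scale_eq_0_iff of_nat_eq_0_iff) simp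
  \<comment> \<open>F maps H y + k y to (\<mu> + 2 + k) x. This factor is nonzero because \<mu> is a
    natural number, so division by it gives the new preimage.\<close>
  define b where "b = inverse (of_nat (\<mu> + 2 + k) :: complex)"
  have FH: "F (H y) = of_nat (\<mu> + 2) *s x"
    using HF[of y] Suc.prems(1) x(2) by (simp add: vec_eq_iff algebra_simps)
  have "F (b *s (H y + of_nat k *s y)) = b *s (of_nat (\<mu> + 2 + k) *s x)"
    by (simp add: clinear_simps[OF lin(2)] FH Suc.prems(1) vec_eq_iff algebra_simps)
  also have "\<dots> = x" 
  proof -
    have "b * of_nat (\<mu> + 2 + k) = 1" unfolding b_def by (rule left_inverse) (simp only: of_nat_eq_0_iff)
    then show ?thesis by (simp only: vector_smult_assoc vector_smult_lid)
  qed
  finally show ?case using Suc.IH[of "b *s (H y + of_nat k *s y)"] z 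
    by (simp only: clinear_scale[OF An] vec.scale_zero_right)
qed

text \<open>Otherwise the powers of $F$ would produce a highest weight vector $x=Fy$ of weight $\mu\ge0$,
  and applying powers of $A$ to $y$, of weight $\mu+2$, would never stop.\<close>

lemma sl2_ker_inter_image:
  fixes A F H :: "complex^'d \<Rightarrow> complex^'d"
  assumes lin: "clinear A" "clinear F" "clinear H"
    and HA: "\<And>v. H (A v) = A (H v) + 2 *s A v"
    and HF: "\<And>v. H (F v) = F (H v) - 2 *s F v"
    and AF: "\<And>v. A (F v) = F (A v) + H v"
    and nil: "\<And>v. (A ^^ K) v = 0"
  shows "A x = 0 \<Longrightarrow> x \<in> range F \<Longrightarrow> (F ^^ k) x = 0 \<Longrightarrow> x = 0"
proof (induction k arbitrary: x)
  case (Suc k)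
  \<comment> \<open>The commutation identity is applied with A and F exchanged; the third operator
    of that triple is - H.\<close>
  have H': "clinear (\<lambda>v. - H v)" using lin(3) by (auto intro!: clinearI simp: clinear_simps)
  have "(F ^^ Suc k) (A x) = A ((F ^^ Suc k) x) + of_nat (Suc k) *s (F ^^ k) (- H x + of_nat k *s x)"
    by (rule sl2_commute_power[OF lin(2,1) H']) (use HF AF in \<open>auto simp: clinear_simps[OF lin(2)]\<close>)
  moreover have Fn: "clinear (F ^^ k)" for k
    by (induction k) (auto intro!: clinearI simp: lin clinear_simps)
  ultimately have "of_nat (Suc k) *s (F ^^ k) (- H x + of_nat k *s x) = 0"
    using Suc.prems by (simp only: clinear_0[OF Fn] clinear_0[OF lin(1)]) simp
  then have z: "(F ^^ k) (- H x + of_nat k *s x) = 0"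
    by (simp only: vec.scale_eq_0_iff of_nat_eq_0_iff) simp
  \<comment> \<open>This vector is again in the kernel of A and in the range of F, and a smaller
    power of F kills it. The induction hypothesis makes it 0, so x is an eigenvector with a natural
    eigenvalue, as the previous lemma demands.\<close>
  define x' where "x' = - H x + of_nat k *s x"
  have Ax': "A x' = 0" using HA[of x] Suc.prems(1) clinear_0[OF lin(3)] 
    by (simp add: x'_def clinear_simps[OF lin(1)])
  obtain y where y: "x = F y" using Suc.prems by blast
  have x': "x' = F (- H y + 2 *s y + of_nat k *s y)"
    by (simp add: x'_def y HF clinear_simps[OF lin(2)])
  have "x' = 0"
    by (rule Suc.IH[OF Ax']) (use x' z in \<open>auto simp: x'_def\<close>)
  then have "H x = of_nat k *s x" by (simp add: x'_def)
  from sl2_eigenvector_not_in_image[OF lin HA HF AF Suc.prems(1) this, of y K] show ?case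
    using y nil by simp
qed simp


section \<open>The algebra of the slice\<close>

locale slice_data =
  fixes br :: "complex^'d \<Rightarrow> complex^'d \<Rightarrow> complex^'d"
    and gr :: "int \<Rightarrow> (complex^'d) set"
    and e h f a :: "complex^'d"
    and l :: "(complex^'d) set"
    and \<xi> \<xi>' :: "nat \<Rightarrow> complex^'d"
    and n m :: nat
  assumes lie: "lie_algebra br"
    and good: "good_grading br gr f"
    and triple: "sl2_triple br e h f"
    and e_degree: "e \<in> gr 2"
    and isotropic: "isotropic_subspace br gr e l"
    and centralizes: "\<forall>y\<in>n_alg br gr e l. br a y = 0"
    and basis: "is_basis \<xi> n UNIV"
    and homogeneous: "\<forall>i\<in>{1..n}. \<exists>k. \<xi> i \<in> gr k"
    and m_le_n: "m \<le> n"
    and slice_basis: "is_basis \<xi> m (centralizer br f)"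
    and dual_basis: "\<forall>i\<in>{1..n}. \<forall>j\<in>{1..n}. killing br (\<xi> i) (\<xi>' j) = (if i = j then 1 else 0)"
begin

section \<open>Bracket and Killing form: bilinearity, invariance, nondegeneracy\<close>

lemma br_linear: "clinear (br x)" "clinear (\<lambda>x. br x y)"
  using lie by (auto simp: lie_algebra_def)

lemmas br_simps = clinear_simps[OF br_linear(1)] clinear_simps[OF br_linear(2)]

lemma br_self: "br x x = 0"
  using lie by (auto simp: lie_algebra_def)

lemma br_skew: "br y x = - br x y"
proof -
  have "br (x + y) (x + y) = 0" by (rule br_self)
  then show ?thesis unfolding br_simps by (simp add: br_self eq_neg_iff_add_eq_0)
qed

lemma jacobi: "br x (br y z) = br (br x y) z + br y (br x z)"
proof -
  have "br x (br y z) + br y (br z x) + br z (br x y) = 0"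
    using lie by (auto simp: lie_algebra_def)
  moreover have "br y (br z x) = - br y (br x z)" by (subst br_skew) (simp add: br_simps)
  moreover have "br z (br x y) = - br (br x y) z" by (rule br_skew)
  ultimately show ?thesis by (simp add: algebra_simps)
qed

lemma killing_trace: "killing br x y = (\<Sum>i\<in>UNIV. br x (br y (axis i 1)) $ i)"
  by (simp add: killing_def trace_matrix)

lemma killing_add: "killing br (x + y) z = killing br x z + killing br y z"
  "killing br z (x + y) = killing br z x + killing br z y"
  by (simp_all add: killing_trace br_simps sum.distrib)

lemma killing_scale: "killing br (c *s x) z = c * killing br x z"
  "killing br z (c *s x) = c * killing br z x"
  by (simp_all add: killing_trace br_simps sum_distrib_left)

lemma killing_0: "killing br 0 z = 0" "killing br z 0 = 0"
  using killing_scale[of 0 0 z] killing_scale(2)[of z 0 0] by auto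

lemma killing_neg: "killing br (- x) z = - killing br x z" "killing br z (- x) = - killing br z x"
  by (simp_all add: killing_trace br_simps sum_negf)

lemma killing_diff: "killing br (x - y) z = killing br x z - killing br y z"
  "killing br z (x - y) = killing br z x - killing br z y"
  by (simp_all add: killing_trace br_simps sum_subtractf)

lemma killing_sum: "killing br (\<Sum>i\<in>I. u i) z = (\<Sum>i\<in>I. killing br (u i) z)"
  "killing br z (\<Sum>i\<in>I. u i) = (\<Sum>i\<in>I. killing br z (u i))"
  by (induction I rule: infinite_finite_induct) (auto simp: killing_0 killing_add)

lemmas killing_simps = killing_add killing_scale killing_0 killing_neg killing_diff killing_sum

lemma killing_sym: "killing br x y = killing br y x"
  unfolding killing_def by (rule trace_matrix_comp) (rule br_linear)+

text \<open>Expanding both sides with the Jacobi identity gives the trace of ad x ad y ad z minus a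
  trace of a reordered product; the two reordered products are cyclic rotations of each
  other.\<close>

lemma killing_br: "killing br (br x y) z = killing br x (br y z)"
proof -
  have c: "clinear (\<lambda>v. br x (br z v))" for x z
    by (auto intro!: clinearI simp: br_simps)
  have "killing br (br x y) z + trace (matrix (\<lambda>v. br y (br x (br z v))))
      = trace (matrix (\<lambda>v. br x (br y (br z v))))"
    unfolding killing_def trace_matrix by (simp add: jacobi[of x y] flip: sum.distrib)
  moreover have "killing br x (br y z) + trace (matrix (\<lambda>v. br x (br z (br y v))))
      = trace (matrix (\<lambda>v. br x (br y (br z v))))"
    unfolding killing_def trace_matrix by (simp add: jacobi[of y z] br_simps flip: sum.distrib)
  moreover have "trace (matrix (\<lambda>v. br y (br x (br z v)))) = trace (matrix (\<lambda>v. br x (br z (br y v))))"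
    using trace_matrix_comp[OF br_linear(1) c] by simp
  ultimately show ?thesis by (metis add_right_cancel)
qed

lemma killing_br_right: "killing br x (br y z) = - killing br (br y x) z"
  by (simp add: killing_br[symmetric] br_skew[of y x] killing_neg)

lemma expand_basis: "v = (\<Sum>k=1..n. killing br v (\<xi>' k) *s \<xi> k)"
proof -
  have c: "clinear (\<lambda>v. \<Sum>k=1..n. killing br v (\<xi>' k) *s \<xi> k)"
    by (intro clinearI)
      (auto simp: killing_simps sum.distrib vec.scale_left_distrib vec.scale_sum_right)
  have "(\<Sum>k=1..n. killing br (\<xi> i) (\<xi>' k) *s \<xi> k) = \<xi> i" if "i \<in> {1..n}" for i
  proof -
    have "(\<Sum>k=1..n. killing br (\<xi> i) (\<xi>' k) *s \<xi> k) = (\<Sum>k=1..n. if k = i then \<xi> i else 0)"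
      using dual_basis that by (intro sum.cong) auto
    then show ?thesis using that by simp
  qed
  then have "x = (\<Sum>k=1..n. killing br x (\<xi>' k) *s \<xi> k)" if "x \<in> \<xi> ` {1..n}" for x
    using that by (metis imageE)
  from vec.linear_eq_on_span[OF vec.linear_ident c this, of "\<xi> ` {1..n}" v] show ?thesis
    using basis unfolding is_basis_def by simp
qed

text \<open>The dual basis carries the nondegeneracy: a vector orthogonal to all
  \<open>\<xi> k\<close> is orthogonal to everything, in particular to the \<open>\<xi>' k\<close>,
  which compute its coordinates.\<close>

lemma killing_nondegenerate_basis: "(\<And>k. k \<in> {1..n} \<Longrightarrow> killing br v (\<xi> k) = 0) \<Longrightarrow> v = 0"
proof -
  assume z: "\<And>k. k \<in> {1..n} \<Longrightarrow> killing br v (\<xi> k) = 0"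
  have "killing br v w = 0" for w
    by (subst expand_basis[of w]) (simp add: killing_simps z)
  then show "v = 0" by (subst expand_basis[of v]) simp
qed

lemma killing_nondegenerate: "(\<And>w. killing br v w = 0) \<Longrightarrow> v = 0"
  by (rule killing_nondegenerate_basis)

lemma expand_dual: "v = (\<Sum>k=1..n. killing br v (\<xi> k) *s \<xi>' k)"
proof -
  have "v - (\<Sum>k=1..n. killing br v (\<xi> k) *s \<xi>' k) = 0"
  proof (rule killing_nondegenerate_basis)
    fix j assume j: "j \<in> {1..n}"
    have "(\<Sum>k=1..n. killing br v (\<xi> k) * killing br (\<xi>' k) (\<xi> j))
        = (\<Sum>k=1..n. if k = j then killing br v (\<xi> j) else 0)"
      using dual_basis j by (intro sum.cong) (auto simp: killing_sym[of "\<xi>' _"])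
    then show "killing br (v - (\<Sum>k=1..n. killing br v (\<xi> k) *s \<xi>' k)) (\<xi> j) = 0"
      using j by (simp add: killing_simps)
  qed
  then show ?thesis by simp
qed

lemma killing_separates:
  assumes U: "vec.subspace U" and x: "x \<notin> U"
  obtains y where "\<And>u. u \<in> U \<Longrightarrow> killing br u y = 0" "killing br x y \<noteq> 0"
proof -
  obtain T where T: "clinear T" "\<And>u. u \<in> U \<Longrightarrow> T u = 0" "T x \<noteq> 0"
    using separating_functional[OF U x] by blast
  obtain i where i: "T x $ i \<noteq> 0" using T(3) by (auto simp: vec_eq_iff)
  \<comment> \<open>The representative, with respect to the Killing form, of the functional that
    takes the i-th coordinate of T.\<close>
  define y where "y = (\<Sum>k=1..n. (T (\<xi> k) $ i) *s \<xi>' k)"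
  have y: "killing br v y = T v $ i" for v
  proof -
    have "T v = (\<Sum>k=1..n. killing br v (\<xi>' k) *s T (\<xi> k))"
      by (subst expand_basis[of v]) (simp add: clinear_simps[OF T(1)])
    then show ?thesis by (simp add: y_def killing_simps mult.commute)
  qed
  show ?thesis using that[of y] T(2) i by (simp add: y)
qed

subsection \<open>The grading\<close>

lemma grading: "lie_grading br gr"
  using good by (simp add: good_grading_def)

lemma gr_subspace: "vec.subspace (gr i)"
  using grading by (simp add: lie_grading_def)

lemma gr_br: "x \<in> gr i \<Longrightarrow> y \<in> gr j \<Longrightarrow> br x y \<in> gr (i + j)"
  using grading by (simp add: lie_grading_def)

lemma f_degree: "f \<in> gr (-2)"
  using good by (simp add: good_grading_def)

definition deg :: "nat \<Rightarrow> int" where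
  "deg k = (SOME d. \<xi> k \<in> gr d)"

definition degs :: "int set" where
  "degs = deg ` {1..n}"

text \<open>The homogeneous component is written through the homogeneous basis instead of the unique
  decomposition in \<open>lie_grading\<close>; in this form it is visibly linear and a finite
  sum.\<close>

definition pr :: "int \<Rightarrow> complex^'d \<Rightarrow> complex^'d" where
  "pr j v = (\<Sum>k | k \<in> {1..n} \<and> deg k = j. killing br v (\<xi>' k) *s \<xi> k)"

lemma finite_degs: "finite degs"
  by (simp add: degs_def)

lemma deg: "k \<in> {1..n} \<Longrightarrow> \<xi> k \<in> gr (deg k)"
  unfolding deg_def using homogeneous by (auto intro: someI)

lemma pr_linear: "clinear (pr j)"
  unfolding pr_def by (intro clinearI)
    (auto simp: killing_simps sum.distrib vec.scale_left_distrib vec.scale_sum_right)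

lemmas pr_simps = clinear_simps[OF pr_linear]

lemma pr_in_gr: "pr j v \<in> gr j"
  unfolding pr_def by (intro vec.subspace_sum[OF gr_subspace] vec.subspace_scale[OF gr_subspace])
    (use deg in auto)

lemma sum_pr: "(\<Sum>j\<in>degs. pr j v) = v"
proof -
  have "(\<Sum>j\<in>degs. pr j v) = (\<Sum>k=1..n. killing br v (\<xi>' k) *s \<xi> k)"
    unfolding pr_def degs_def by (subst sum.image_gen[of "{1..n}" _ deg]) auto
  then show ?thesis using expand_basis[of v] by simp
qed

lemma pr_outside: "j \<notin> degs \<Longrightarrow> pr j v = 0"
  unfolding pr_def degs_def by (rule sum.neutral) auto

text \<open>The components \<open>pr i v\<close> and the family concentrated in degree j are both
  finite homogeneous decompositions of v, and the grading admits only one.\<close>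

lemma pr_gr: 
  assumes v: "v \<in> gr j" shows "pr i v = (if i = j then v else 0)"
proof -
  let ?P = "\<lambda>w. (\<forall>i. w i \<in> gr i) \<and> finite {i. w i \<noteq> 0} \<and> v = (\<Sum>i | w i \<noteq> 0. w i)"
  let ?w = "\<lambda>i. if i = j then v else 0"
  have u: "\<exists>!w. ?P w" using grading by (simp add: lie_grading_def)
  have s: "{i. pr i v \<noteq> 0} \<subseteq> degs" using pr_outside by blast
  have "(\<Sum>i | pr i v \<noteq> 0. pr i v) = (\<Sum>i\<in>degs. pr i v)"
    using s by (intro sum.mono_neutral_left) (auto simp: finite_degs)
  then have 1: "?P (\<lambda>i. pr i v)" 
    using s finite_degs by (auto simp: pr_in_gr sum_pr intro: finite_subset)
  have "{i. ?w i \<noteq> 0} = (if v = 0 then {} else {j})" by auto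
  then have 2: "?P ?w"
    using v vec.subspace_0[OF gr_subspace] by (auto split: if_splits)
  from u obtain w0 where w0: "\<forall>w. ?P w \<longrightarrow> w = w0" by (rule ex1E)
  have "(\<lambda>i. pr i v) = ?w"
    using mp[OF spec[OF w0, of "\<lambda>i. pr i v"] 1] mp[OF spec[OF w0, of ?w] 2] by (rule trans[OF _ sym])
  then show ?thesis by (rule fun_cong)
qed

lemma pr_br:
  assumes x: "x \<in> gr d" shows "pr j (br x y) = br x (pr (j - d) y)"
proof -
  have "pr j (br x y) = (\<Sum>i\<in>degs. pr j (br x (pr i y)))"
    by (subst sum_pr[of y, symmetric]) (simp add: br_simps pr_simps)
  also have "\<dots> = (\<Sum>i\<in>degs. if i = j - d then br x (pr (j - d) y) else 0)"
    by (intro sum.cong refl, subst pr_gr[OF gr_br[OF x pr_in_gr]]) auto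
  also have "\<dots> = br x (pr (j - d) y)"
    using finite_degs pr_outside[of "j - d" y] by (simp add: br_simps)
  finally show ?thesis .
qed

text \<open>The trace of a map of nonzero degree $i+j$ vanishes because the map is, up to the factor $i+j$,
  its commutator with the derivation that is $k$ on $\mathfrak g_k$.\<close>

lemma killing_gr:
  assumes x: "x \<in> gr i" and y: "y \<in> gr j" and ij: "i + j \<noteq> 0"
  shows "killing br x y = 0"
proof -
  define D where "D v = (\<Sum>k\<in>degs. of_int k *s pr k v)" for v
  define T where "T z = br x (br y z)" for z
  have D: "clinear D" unfolding D_def
    by (intro clinearI) (auto simp: pr_simps vec.scale_right_distrib sum.distrib vec.scale_sum_right
      vec.scale_scale mult.commute)
  have T: "clinear T" unfolding T_def by (intro clinearI) (auto simp: br_simps)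
  have prT: "pr k (T z) = T (pr (k - (i + j)) z)" for k z
    unfolding T_def pr_br[OF x] pr_br[OF y] by (simp add: algebra_simps)
  have Dgr: "D v = of_int k *s v" if "v \<in> gr k" for v k
  proof -
    have "D v = (\<Sum>j\<in>degs. if j = k then of_int k *s v else 0)"
      unfolding D_def pr_gr[OF that] by (intro sum.cong) auto
    then show ?thesis using finite_degs pr_outside[of k v] pr_gr[OF that, of k] by auto
  qed
  have TD: "T (D z) - D (T z) = - of_int (i + j) *s T z" for z
  proof -
    have "T (D w) - D (T w) = - of_int (i + j) *s T w" if "w \<in> gr k" for w k
    proof -
      have "T w \<in> gr (i + (j + k))" unfolding T_def by (intro gr_br x y that)
      then show ?thesis
        by (simp add: Dgr Dgr[OF that] clinear_simps[OF T] vec.scale_left_distrib algebra_simps)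
    qed
    from this[OF pr_in_gr] have "(\<Sum>k\<in>degs. T (D (pr k z)) - D (T (pr k z))) 
        = (\<Sum>k\<in>degs. - of_int (i + j) *s T (pr k z))" by simp
    then show ?thesis
      unfolding sum_subtractf vec.scale_sum_right[symmetric] clinear_sum[OF T, symmetric]
        clinear_sum[OF D, symmetric] sum_pr .
  qed
  have "trace (matrix (\<lambda>z. T (D z))) - trace (matrix (\<lambda>z. D (T z))) = - of_int (i + j) * trace (matrix T)"
    unfolding trace_matrix sum_distrib_left sum_subtractf[symmetric]
    using TD by (intro sum.cong refl) (simp add: vec_eq_iff flip: vector_smult_component)
  then have "trace (matrix T) = 0" using trace_matrix_comp[OF T D] ij
    by (simp del: of_int_add of_int_minus add: of_int_eq_0_iff[where 'a = complex])
  then show ?thesis by (simp add: killing_def T_def[abs_def])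
qed

text \<open>Only opposite degrees pair nontrivially, so both sides equal the pairing of the
  component of degree i with that of degree - i.\<close>

lemma killing_pr: "killing br (pr i x) y = killing br x (pr (- i) y)"
proof -
  have "killing br (pr i x) y = (\<Sum>j\<in>degs. if j = - i then killing br (pr i x) (pr (- i) y) else 0)"
    by (subst sum_pr[of y, symmetric], unfold killing_simps, intro sum.cong)
      (auto simp: killing_gr[OF pr_in_gr pr_in_gr])
  also have "\<dots> = killing br (pr i x) (pr (- i) y)"
    using finite_degs pr_outside[of "- i" y] by (simp add: killing_0)
  also have "\<dots> = (\<Sum>j\<in>degs. if j = i then killing br (pr i x) (pr (- i) y) else 0)"
    using finite_degs pr_outside[of i x] by (simp add: killing_0)
  also have "\<dots> = killing br x (pr (- i) y)"
    by (subst (2) sum_pr[of x, symmetric], unfold killing_simps, intro sum.cong)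
      (auto simp: killing_gr[OF pr_in_gr pr_in_gr])
  finally show ?thesis .
qed

section \<open>The filtration by degree and its bounds\<close>

definition fil :: "int \<Rightarrow> (complex^'d) set" where
  "fil k = {v. \<forall>i>k. pr i v = 0}"

lemma fil_subspace: "vec.subspace (fil k)"
  by (auto simp: fil_def vec.subspace_def pr_simps)

lemma fil_mono: "i \<le> j \<Longrightarrow> fil i \<subseteq> fil j"
  by (auto simp: fil_def)

lemma gr_fil: "v \<in> gr k \<Longrightarrow> v \<in> fil k"
  by (auto simp: fil_def pr_gr)

lemma fil_br:
  assumes "x \<in> fil i" "y \<in> fil j" shows "br x y \<in> fil (i + j)"
proof -
  have "pr k (br x y) = 0" if "k > i + j" for k
  proof -
    have "pr k (br x y) = (\<Sum>p\<in>degs. br (pr p x) (pr (k - p) y))"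
      by (subst sum_pr[of x, symmetric]) (simp add: br_simps pr_simps pr_br[OF pr_in_gr])
    also have "\<dots> = 0"
    proof (intro sum.neutral ballI)
      fix p
      have "p > i \<or> k - p > j" using that by linarith
      then show "br (pr p x) (pr (k - p) y) = 0"
        using assms by (auto simp: fil_def br_simps)
    qed
    finally show ?thesis .
  qed
  then show ?thesis by (simp add: fil_def)
qed

lemma killing_fil: "x \<in> fil i \<Longrightarrow> y \<in> fil j \<Longrightarrow> i + j < 0 \<Longrightarrow> killing br x y = 0"
proof -
  assume x: "x \<in> fil i" and y: "y \<in> fil j" and "i + j < 0"
  have "killing br (pr k x) y = 0" for k
  proof (cases "k > i")
    case True
    then show ?thesis using x by (simp add: fil_def killing_0)
  next
    case False
    then have "- k > j" using \<open>i + j < 0\<close> by linarith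
    then show ?thesis using y by (simp add: killing_pr fil_def killing_0)
  qed
  then show ?thesis by (subst sum_pr[of x, symmetric]) (simp add: killing_simps)
qed

text \<open>A strict bound for the absolute values of all degrees: \<open>fil bd\<close> is
  everything and \<open>fil (- bd)\<close> is zero. The inserted 0 keeps \<open>Max\<close>
  meaningful for an empty set, and the 1 makes the bound strict and positive.\<close>

definition bd :: nat where
  "bd = nat (Max (insert 0 (abs ` degs))) + 1"

lemma pr_bd: 
  assumes "\<bar>i\<bar> \<ge> int bd" shows "pr i v = 0"
proof (rule pr_outside, rule notI)
  assume "i \<in> degs"
  then have "\<bar>i\<bar> \<le> Max (insert 0 (abs ` degs))" using finite_degs by (intro Max_ge) auto
  then show False using assms unfolding bd_def by linarith
qed

lemma fil_top: "v \<in> fil (int bd)"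
  by (auto simp: fil_def pr_bd)

lemma fil_bot: 
  assumes "v \<in> fil (- int bd)" shows "v = 0"
proof -
  have "pr i v = 0" for i using assms pr_bd[of i v] by (cases "i > - int bd") (auto simp: fil_def)
  then show ?thesis using sum_pr[of v] by simp
qed

text \<open>Each application shifts degrees by 2, so \<open>bd\<close> of them shift by more than
  the distance between any two occurring degrees.\<close>

lemma br_power_zero:
  assumes x: "x \<in> gr d" and d: "\<bar>d\<bar> = 2" shows "(br x ^^ bd) v = 0"
proof -
  have p: "pr j ((br x ^^ k) v) = (br x ^^ k) (pr (j - int k * d) v)" for j k
    by (induction k arbitrary: j) (auto simp: pr_br[OF x] algebra_simps)
  have n: "(br x ^^ k) 0 = 0" for k by (induction k) (auto simp: br_simps)
  have "pr j ((br x ^^ bd) v) = 0" for j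
  proof (cases "\<bar>j\<bar> \<ge> int bd")
    case False
    have "d = 2 \<or> d = -2" using d by linarith
    then have "\<bar>j - int bd * d\<bar> \<ge> int bd" using False by auto
    then show ?thesis by (simp add: p pr_bd n)
  qed (simp add: pr_bd)
  then show ?thesis using sum_pr[of "(br x ^^ bd) v"] by simp
qed

subsection \<open>The splitting $\mathfrak g=\mathfrak g_f\oplus[e,[f,\mathfrak g]]$\<close>

lemma sl2_relations:
  "br h (br e v) = br e (br h v) + 2 *s br e v"
  "br h (br f v) = br f (br h v) - 2 *s br f v"
  "br e (br f v) = br f (br e v) + br h v"
  using triple jacobi[of h e v] jacobi[of h f v] jacobi[of e f v]
  by (simp_all add: sl2_triple_def br_simps)

lemma ker_e_inter_im_f: "br e x = 0 \<Longrightarrow> x \<in> range (br f) \<Longrightarrow> x = 0"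
  using sl2_ker_inter_image[OF br_linear(1)[of e] br_linear(1)[of f] br_linear(1)[of h]
    sl2_relations br_power_zero[OF e_degree], of x bd] br_power_zero[OF f_degree] by simp

text \<open>The triple (f, e, - h) satisfies the same relations as (e, f, h).\<close>

lemma ker_f_inter_im_e: "br f x = 0 \<Longrightarrow> x \<in> range (br e) \<Longrightarrow> x = 0"
proof -
  have "clinear (\<lambda>v. - br h v)" by (auto intro!: clinearI simp: br_simps)
  from sl2_ker_inter_image[OF br_linear(1)[of f] br_linear(1)[of e] this _ _ _ br_power_zero[OF f_degree], of x bd]
  show "br f x = 0 \<Longrightarrow> x \<in> range (br e) \<Longrightarrow> x = 0"
    using br_power_zero[OF e_degree] by (simp add: sl2_relations br_simps)
qed

text \<open>Duality: by invariance the Killing complement of the image of ad p is the kernel of ad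
  p, and that of the kernel of ad q is the image of ad q. A vector orthogonal to the sum therefore
  lies in the intersection that is assumed trivial.\<close>

lemma ker_plus_image:
  assumes "\<And>x. br p x = 0 \<Longrightarrow> x \<in> range (br q) \<Longrightarrow> x = 0"
  shows "\<exists>k w. br q k = 0 \<and> v = k + br p w"
proof -
  let ?K = "{k. br q k = 0}" and ?U = "{x + y |x y. x \<in> {k. br q k = 0} \<and> y \<in> range (br p)}"
  have K: "vec.subspace ?K" by (auto simp: vec.subspace_def br_simps)
  have R: "vec.subspace (range (br p))" for p
    using vec.linear_subspace_image[OF br_linear(1) vec.subspace_UNIV] .
  have "v \<in> ?U"
  proof (rule ccontr)
    assume "v \<notin> ?U"
    then obtain y where y: "\<And>u. u \<in> ?U \<Longrightarrow> killing br u y = 0" "killing br v y \<noteq> 0"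
      using killing_separates[OF vec.subspace_sums[OF K R]] by blast
    have "killing br k y = 0" if "br q k = 0" for k
    proof -
      have "k + br p 0 \<in> ?U" using that by blast
      then show ?thesis using y(1) by (simp add: br_simps)
    qed
    moreover have "br p y = 0"
    proof (rule killing_nondegenerate)
      fix w
      have "0 + br p w \<in> ?U" using br_simps(3)[of q] by blast
      then have "killing br (br p w) y = 0" using y(1) by simp
      then show "killing br (br p y) w = 0"
        by (simp add: killing_sym[of _ w] killing_br_right killing_neg)
    qed
    moreover have "y \<in> range (br q)"
    proof (rule ccontr)
      assume "y \<notin> range (br q)"
      then obtain z where z: "\<And>u. killing br (br q u) z = 0" "killing br y z \<noteq> 0"
        using killing_separates[OF R] by (metis rangeI)
      have "br q z = 0"
      proof (rule killing_nondegenerate)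
        fix w show "killing br (br q z) w = 0"
          using z(1)[of w] by (simp add: killing_sym[of _ w] killing_br_right)
      qed
      with calculation(1)[of z] z(2) show False by (simp add: killing_sym)
    qed
    ultimately have "y = 0" using assms by blast
    then show False using y(2) by (simp add: killing_0)
  qed
  then show ?thesis by blast
qed

abbreviation image_f :: "(complex^'d) set" where
  "image_f \<equiv> range (br f)"

lemma image_f_subspace: "vec.subspace image_f"
  using vec.linear_subspace_image[OF br_linear(1) vec.subspace_UNIV] .

lemma pr_image_f: "v \<in> image_f \<Longrightarrow> pr j v \<in> image_f"
  by (auto simp: pr_br[OF f_degree])

text \<open>The inverse of $\mathrm{ad}\,e:[f,\mathfrak g]\to\mathfrak g/\mathfrak g_f$.\<close>

definition theta :: "complex^'d \<Rightarrow> complex^'d" where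
  "theta y = (THE w. w \<in> image_f \<and> br f (y - br e w) = 0)"

lemma theta_unique:
  assumes "w \<in> image_f" "br f (y - br e w) = 0" "w' \<in> image_f" "br f (y - br e w') = 0"
  shows "w = w'"
proof -
  have "br f (br e (w - w')) = 0" using assms(2,4) by (simp add: br_simps)
  then have "br e (w - w') = 0" using ker_f_inter_im_e by blast
  moreover have "w - w' \<in> image_f" using assms image_f_subspace by (auto intro: vec.subspace_diff)
  ultimately show ?thesis using ker_e_inter_im_f by fastforce
qed

text \<open>Two splittings are combined: y is split along ker f + im e, and the preimage under ad e
  obtained in this way is split along ker e + im f, whose first summand ad e forgets.\<close>

lemma theta_exists: "\<exists>w. w \<in> image_f \<and> br f (y - br e w) = 0"
proof -
  obtain k v where kv: "br f k = 0" "y = k + br e v"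
    using ker_plus_image[of f e y] ker_f_inter_im_e ker_plus_image[of e f y] ker_e_inter_im_f by metis
  obtain k' w where w: "br e k' = 0" "v = k' + br f w"
    using ker_plus_image[of f e v] ker_f_inter_im_e by metis
  have "y - br e (br f w) = k" using kv w by (simp add: br_simps)
  then show ?thesis using kv by (metis rangeI)
qed

lemma theta: "theta y \<in> image_f" "br f (y - br e (theta y)) = 0"
proof -
  have "\<exists>!w. w \<in> image_f \<and> br f (y - br e w) = 0" using theta_exists theta_unique by metis
  from theI'[OF this] show "theta y \<in> image_f" "br f (y - br e (theta y)) = 0"
    by (auto simp: theta_def)
qed

lemma theta_eqI: "w \<in> image_f \<Longrightarrow> br f (y - br e w) = 0 \<Longrightarrow> theta y = w"
  using theta theta_unique by blast

lemma theta_linear: "clinear theta"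
proof (rule clinearI)
  show "theta (x + y) = theta x + theta y" for x y
  proof (rule theta_eqI)
    have "x + y - br e (theta x + theta y) = (x - br e (theta x)) + (y - br e (theta y))"
      by (simp add: br_simps)
    then show "br f (x + y - br e (theta x + theta y)) = 0" by (metis add.right_neutral br_simps(1) theta(2))
  qed (intro vec.subspace_add image_f_subspace theta(1))
  show "theta (c *s x) = c *s theta x" for c x
  proof (rule theta_eqI)
    have "c *s x - br e (c *s theta x) = c *s (x - br e (theta x))"
      by (simp add: br_simps vec.scale_right_diff_distrib)
    then show "br f (c *s x - br e (c *s theta x)) = 0" by (metis br_simps(2) theta(2) vec.scale_zero_right)
  qed (intro vec.subspace_scale image_f_subspace theta(1))
qed

lemmas theta_simps = clinear_simps[OF theta_linear]

lemma theta_eq_0_iff: "theta y = 0 \<longleftrightarrow> br f y = 0"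
  using theta(2)[of y] theta_eqI[of 0 y] vec.subspace_0[OF image_f_subspace] by (auto simp: br_simps)

lemma theta_br_e: "w \<in> image_f \<Longrightarrow> theta (br e w) = w"
  by (rule theta_eqI) (auto simp: br_simps)

lemma pr_theta: "pr j (theta y) = theta (pr (j + 2) y)"
proof (rule sym, rule theta_eqI)
  have "br f (pr (j + 2) (y - br e (theta y))) = 0"
    using pr_br[OF f_degree, of j "y - br e (theta y)"] by (simp add: theta(2) pr_simps)
  then show "br f (pr (j + 2) y - br e (pr j (theta y))) = 0"
    by (simp add: pr_simps pr_br[OF e_degree])
qed (intro pr_image_f theta(1))

lemma theta_fil: "y \<in> fil k \<Longrightarrow> theta y \<in> fil (k - 2)"
  by (auto simp: fil_def pr_theta theta_simps)

subsection \<open>The subspaces $\mathfrak m$, $\mathfrak n$, $\mathfrak b$\<close>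

abbreviation gf :: "(complex^'d) set" where "gf \<equiv> centralizer br f"
abbreviation l' :: "(complex^'d) set" where "l' \<equiv> sympl_compl br gr e l"
abbreviation \<mm> :: "(complex^'d) set" where "\<mm> \<equiv> m_alg gr l"
abbreviation \<nn> :: "(complex^'d) set" where "\<nn> \<equiv> n_alg br gr e l"
abbreviation \<bb> :: "(complex^'d) set" where "\<bb> \<equiv> b_space br gr e l"

lemma gf_subspace: "vec.subspace gf"
  by (auto simp: centralizer_def vec.subspace_def br_simps)

text \<open>A component of positive degree of an element of the centralizer is again killed by ad f,
  which goodness makes injective there.\<close>

lemma gf_fil: "gf \<subseteq> fil 0"
proof
  fix x assume x: "x \<in> gf"
  have "pr i x = 0" if "i > 0" for i
  proof -
    have "br f (pr i x) = 0"
      using x pr_br[OF f_degree, of "i - 2" x] by (simp add: centralizer_def pr_simps)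
    moreover have "inj_on (br f) (gr i)" using good that by (simp add: good_grading_def)
    ultimately show ?thesis
      using pr_in_gr[of i x] vec.subspace_0[OF gr_subspace, of i] br_simps(3)[of f] by (metis inj_onD)
  qed
  then show "x \<in> fil 0" by (simp add: fil_def)
qed

lemma gr_image_f: "i \<le> -1 \<Longrightarrow> gr i \<subseteq> image_f"
proof -
  assume "i \<le> -1"
  then have "br f ` gr (i + 2) = gr (i + 2 - 2)" using good unfolding good_grading_def by smt
  then show ?thesis by auto
qed

lemma fil_image_f: "fil (-1) \<subseteq> image_f"
proof
  fix v assume v: "v \<in> fil (-1)"
  have "pr i v \<in> image_f" for i
    using v gr_image_f[of i] pr_in_gr[of i v] vec.subspace_0[OF image_f_subspace]
    by (cases "i \<le> -1") (auto simp: fil_def)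
  then have "(\<Sum>i\<in>degs. pr i v) \<in> image_f" by (intro vec.subspace_sum image_f_subspace)
  then show "v \<in> image_f" by (simp add: sum_pr)
qed

text \<open>Both m and n have this shape, with U equal to l or to its symplectic complement.
  Membership becomes a condition on the filtration and on one component, which is how it is checked
  everywhere below.\<close>

lemma span_tail_eq:
  assumes U: "vec.subspace U" "U \<subseteq> gr (-1)"
  shows "vec.span (U \<union> (\<Union>i\<in>{..-2}. gr i)) = {v \<in> fil (-1). pr (-1) v \<in> U}" (is "?L = ?R")
proof
  have "vec.subspace ?R" using fil_subspace U by (auto simp: vec.subspace_def pr_simps)
  moreover have "U \<union> (\<Union>i\<in>{..-2}. gr i) \<subseteq> ?R"
  proof
    fix v assume "v \<in> U \<union> (\<Union>i\<in>{..-2}. gr i)"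
    then consider "v \<in> U" "v \<in> gr (-1)" | i where "i \<le> -2" "v \<in> gr i" using U(2) by auto
    then show "v \<in> ?R"
    proof cases
      case 1
      then show ?thesis by (simp add: pr_gr fil_def)
    next
      case 2
      then show ?thesis using vec.subspace_0[OF U(1)] by (simp add: pr_gr fil_def)
    qed
  qed
  ultimately show "?L \<subseteq> ?R" by (rule vec.span_minimal[rotated])
  show "?R \<subseteq> ?L"
  proof
    fix v assume v: "v \<in> ?R"
    have "pr i v \<in> ?L" for i
    proof -
      consider "i > -1" | "i = -1" | "i \<le> -2" by linarith
      then show ?thesis
      proof cases
        case 1 then show ?thesis using v by (simp add: fil_def vec.span_zero)
      next
        case 2 then show ?thesis using v by (auto intro: vec.span_base)
      next
        case 3 then show ?thesis using pr_in_gr[of i v] by (auto intro!: vec.span_base)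
      qed
    qed
    then have "(\<Sum>i\<in>degs. pr i v) \<in> ?L" by (intro vec.subspace_sum vec.subspace_span)
    then show "v \<in> ?L" by (simp add: sum_pr)
  qed
qed

lemma l_subspace: "vec.subspace l" "l \<subseteq> gr (-1)"
  using isotropic by (auto simp: isotropic_subspace_def)

lemma l'_subspace: "vec.subspace l'" "l' \<subseteq> gr (-1)"
  using gr_subspace[of "-1"] by (auto simp: sympl_compl_def vec.subspace_def br_simps killing_simps)

lemma l_le_l': "l \<subseteq> l'"
  using isotropic by (auto simp: isotropic_subspace_def sympl_compl_def)

lemma mm_eq: "\<mm> = {v \<in> fil (-1). pr (-1) v \<in> l}"
  unfolding m_alg_def by (rule span_tail_eq[OF l_subspace])

lemma nn_eq: "\<nn> = {v \<in> fil (-1). pr (-1) v \<in> l'}"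
  unfolding n_alg_def by (rule span_tail_eq[OF l'_subspace])

lemma mm_subspace: "vec.subspace \<mm>" by (simp add: m_alg_def vec.subspace_span)
lemma nn_subspace: "vec.subspace \<nn>" by (simp add: n_alg_def vec.subspace_span)
lemma bb_subspace: "vec.subspace \<bb>" 
  by (auto simp: b_space_def vec.subspace_def killing_simps)

lemma mm_le_nn: "\<mm> \<subseteq> \<nn>"
  using l_le_l' by (auto simp: mm_eq nn_eq)

lemma mm_fil: "\<mm> \<subseteq> fil (-1)" by (auto simp: mm_eq)
lemma nn_fil: "\<nn> \<subseteq> fil (-1)" by (auto simp: nn_eq)

lemma fil_mm: "fil (-2) \<subseteq> \<mm>"
  using vec.subspace_0[OF l_subspace(1)] fil_mono[of "-2" "-1"] by (auto simp: mm_eq fil_def)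

lemma mm_image_f: "\<mm> \<subseteq> image_f" using mm_fil fil_image_f by blast

lemma mm_br: "u \<in> fil (-1) \<Longrightarrow> v \<in> fil (-1) \<Longrightarrow> br u v \<in> \<mm>"
  using fil_br[of u "-1" v "-1"] fil_mm by auto

lemma fil_bb: "fil 0 \<subseteq> \<bb>"
  using nn_fil by (auto simp: b_space_def intro: killing_fil)

lemma gf_bb: "gf \<subseteq> \<bb>" using gf_fil fil_bb by blast

lemma killing_bb_nn: "x \<in> \<bb> \<Longrightarrow> y \<in> \<nn> \<Longrightarrow> killing br x y = 0"
  by (auto simp: b_space_def)

text \<open>As e has degree 2, it sees only the degree -2 part of [v, w], which is the bracket of
  the degree -1 parts. This expresses the pairing through the symplectic form.\<close>

lemma killing_e_br:
  assumes "v \<in> fil (-1)" "w \<in> fil (-1)"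
  shows "killing br (br e v) w = killing br e (br (pr (-1) v) (pr (-1) w))"
proof -
  have 1: "killing br (pr 2 e) u = killing br e (pr (-2) u)" for u by (rule killing_pr)
  have "pr (-2) (br v w) = br (pr (-1) v) (pr (-1) w)"
  proof -
    have v': "v - pr (-1) v \<in> fil (-2)" and w': "w - pr (-1) w \<in> fil (-2)"
      using assms pr_gr[OF pr_in_gr] by (auto simp: fil_def pr_simps) 
    have "br v w = br (pr (-1) v) (pr (-1) w) + br (v - pr (-1) v) w + br (pr (-1) v) (w - pr (-1) w)"
      by (simp add: br_simps)
    moreover have "br (v - pr (-1) v) w \<in> fil (-3)" using fil_br[OF v' assms(2)] by simp
    moreover have "br (pr (-1) v) (w - pr (-1) w) \<in> fil (-3)" using fil_br[OF gr_fil[OF pr_in_gr] w', of "-1" v] by simp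
    moreover have "pr (-2) (br (pr (-1) v) (pr (-1) w)) = br (pr (-1) v) (pr (-1) w)"
      using pr_gr[OF gr_br[OF pr_in_gr pr_in_gr, of "-1" v "-1" w], of "-2"] by simp
    ultimately show ?thesis by (simp add: pr_simps fil_def)
  qed
  moreover have "pr 2 e = e" using pr_gr[OF e_degree] by simp
  ultimately show ?thesis using 1[of "br v w"] by (simp add: killing_br)
qed

text \<open>By \<open>killing_e_br\<close> the pairing with n is the symplectic form between l and
  its complement, hence zero.\<close>

lemma e_mm_bb: "v \<in> \<mm> \<Longrightarrow> br e v \<in> \<bb>"
proof -
  assume v: "v \<in> \<mm>"
  have "killing br (br e v) w = 0" if w: "w \<in> \<nn>" for w
  proof -
    have "killing br e (br (pr (-1) w) (pr (-1) v)) = 0"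
      using v w by (auto simp: mm_eq nn_eq sympl_compl_def)
    then show ?thesis using v w br_skew[of "pr (-1) v" "pr (-1) w"]
      by (auto simp: mm_eq nn_eq killing_e_br killing_neg)
  qed
  then show ?thesis by (simp add: b_space_def)
qed

lemma bb_fil: "\<bb> \<subseteq> fil 1"
proof
  fix x assume x: "x \<in> \<bb>"
  have "pr i x = 0" if "i > 1" for i
  proof (rule killing_nondegenerate)
    fix w
    have "pr (- i) w \<in> fil (- i)" by (intro gr_fil pr_in_gr)
    then have "pr (- i) w \<in> fil (-2)" using fil_mono[of "- i" "-2"] that by auto
    then have "pr (- i) w \<in> \<nn>" using fil_mm mm_le_nn by blast
    then show "killing br (pr i x) w = 0" using x by (simp add: killing_pr b_space_def)
  qed
  then show "x \<in> fil 1" by (simp add: fil_def)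
qed

text \<open>The element f has degree -2 and so belongs to n, which a centralizes.\<close>

lemma a_gf: "a \<in> gf"
proof -
  have "f \<in> fil (-2)" using gr_fil f_degree by blast
  then have "f \<in> \<nn>" using fil_mm mm_le_nn by blast
  then show ?thesis using centralizes br_skew[of f a] by (simp add: centralizer_def)
qed

text \<open>In essence the double symplectic complement of l is l. The degree -1 part p of
  \<open>theta y\<close> satisfies [e, p] = \<open>pr 1 y\<close>. If p were not in l, a vector of
  l' would pair nontrivially with [e, p], contradicting that y is orthogonal to n.\<close>

lemma theta_bb: 
  assumes y: "y \<in> \<bb>" shows "theta y \<in> \<mm>"
proof -
  have t: "theta y \<in> fil (-1)" using theta_fil[of y 1] y bb_fil by auto
  define p where "p = pr (-1) (theta y)"
  have p1: "p \<in> gr (-1)" by (simp add: p_def pr_in_gr)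
  have pf: "p \<in> image_f" using gr_image_f[of "-1"] p1 by auto
  have yp: "pr 1 y = br e p"
  proof -
    have "y - br e (theta y) \<in> gf" using theta(2) by (simp add: centralizer_def)
    then have "pr 1 (y - br e (theta y)) = 0" using gf_fil by (auto simp: fil_def)
    then show ?thesis by (simp add: pr_simps pr_br[OF e_degree] p_def)
  qed
  have "p \<in> l"
  proof (rule ccontr)
    assume "p \<notin> l"
    define U where "U = br e ` l"
    have inj: "x = p" if "x \<in> l" "br e x = br e p" for x
    proof -
      have "br e (x - p) = 0" using that by (simp add: br_simps)
      moreover have "x - p \<in> image_f"
        using that(1) l_subspace(2) gr_image_f[of "-1"] pf image_f_subspace
        by (intro vec.subspace_diff) auto
      ultimately show ?thesis using ker_e_inter_im_f by fastforce
    qed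
    have "br e p \<notin> U" using inj \<open>p \<notin> l\<close> by (auto simp: U_def)
    moreover have "vec.subspace U" unfolding U_def
      using vec.linear_subspace_image[OF br_linear(1) l_subspace(1)] .
    ultimately obtain w where w: "\<And>u. u \<in> U \<Longrightarrow> killing br u w = 0" "killing br (br e p) w \<noteq> 0"
      using killing_separates by blast
    \<comment> \<open>Only the degree -1 part of the separating vector pairs with elements of degree
      1, and this part is the one that lies in l'.\<close>
    define w' where "w' = pr (-1) w"
    have w': "killing br x w = killing br x w'" if "x \<in> gr 1" for x
      using killing_pr[of 1 x w] pr_gr[OF that, of 1] by (simp add: w'_def)
    have "w' \<in> l'"
    proof -
      have "killing br e (br w' z) = 0" if z: "z \<in> l" for z
      proof -
        have "br e z \<in> gr 1" using gr_br[OF e_degree, of z "-1"] z l_subspace(2) by auto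
        then have "killing br (br e z) w' = 0" using w(1)[of "br e z"] z w' by (auto simp: U_def)
        then show ?thesis using br_skew[of z w'] by (simp add: killing_br killing_neg)
      qed
      then show ?thesis by (simp add: sympl_compl_def w'_def pr_in_gr)
    qed
    then have "w' \<in> \<nn>" by (auto simp: n_alg_def intro: vec.span_base)
    then have "killing br y w' = 0" using y by (simp add: b_space_def)
    moreover have "killing br y w' = killing br (pr 1 y) w'"
      using killing_pr[of 1 y w'] pr_gr[OF pr_in_gr, of "-1" "-1" w] by (simp add: w'_def)
    moreover have "killing br (br e p) w = killing br (br e p) w'"
      using w' gr_br[OF e_degree p1] by simp
    ultimately show False using w(2) yp by simp
  qed
  then show ?thesis using t by (simp add: mm_eq p_def)
qed

lemma nn_if_perp_bb: 
  assumes "\<And>b. b \<in> \<bb> \<Longrightarrow> killing br w b = 0" shows "w \<in> \<nn>"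
proof (rule ccontr)
  assume "w \<notin> \<nn>"
  then obtain y where y: "\<And>u. u \<in> \<nn> \<Longrightarrow> killing br u y = 0" "killing br w y \<noteq> 0"
    using killing_separates[OF nn_subspace] by blast
  have "y \<in> \<bb>" using y(1) by (auto simp: b_space_def killing_sym[of y])
  then show False using assms y(2) by blast
qed

lemma s_mm_bb: "s \<in> \<bb> \<Longrightarrow> v \<in> fil (-1) \<Longrightarrow> br s v \<in> \<bb>"
  using fil_br[of s 1 v "-1"] bb_fil fil_bb by auto

lemma xi_gf: "i \<in> {1..m} \<Longrightarrow> \<xi> i \<in> gf"
  using slice_basis vec.span_base[of "\<xi> i" "\<xi> ` {1..m}"] by (auto simp: is_basis_def)

lemma gf_iff: "v \<in> gf \<longleftrightarrow> (\<forall>k\<in>{m+1..n}. killing br v (\<xi>' k) = 0)"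
proof
  assume "v \<in> gf"
  then have "v \<in> vec.span (\<xi> ` {1..m})" using slice_basis by (simp add: is_basis_def)
  moreover have "vec.subspace {v. \<forall>k\<in>{m+1..n}. killing br v (\<xi>' k) = 0}"
    by (auto simp: vec.subspace_def killing_simps)
  moreover have "\<xi> ` {1..m} \<subseteq> {v. \<forall>k\<in>{m+1..n}. killing br v (\<xi>' k) = 0}"
    using dual_basis m_le_n by auto
  ultimately show "\<forall>k\<in>{m+1..n}. killing br v (\<xi>' k) = 0"
    using vec.span_minimal by blast
next
  assume z: "\<forall>k\<in>{m+1..n}. killing br v (\<xi>' k) = 0"
  have "killing br v (\<xi>' k) *s \<xi> k \<in> gf" if "k \<in> {1..n}" for k
    using z xi_gf[of k] that vec.subspace_0[OF gf_subspace]
    by (cases "k \<le> m") (auto intro: vec.subspace_scale gf_subspace)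
  then have "(\<Sum>k=1..n. killing br v (\<xi>' k) *s \<xi> k) \<in> gf"
    by (intro vec.subspace_sum gf_subspace)
  then show "v \<in> gf" using expand_basis[of v] by simp
qed

text \<open>The image of ad f is the Killing complement of its kernel, by invariance; the kernel is
  spanned by the first m basis vectors.\<close>

lemma image_f_iff: "v \<in> image_f \<longleftrightarrow> (\<forall>i\<in>{1..m}. killing br v (\<xi> i) = 0)"
proof
  assume "v \<in> image_f"
  then show "\<forall>i\<in>{1..m}. killing br v (\<xi> i) = 0"
    using xi_gf by (auto simp: centralizer_def killing_br br_skew[of f] killing_simps)
next
  assume z: "\<forall>i\<in>{1..m}. killing br v (\<xi> i) = 0"
  show "v \<in> image_f"
  proof (rule ccontr)
    assume "v \<notin> image_f"
    then obtain y where y: "\<And>u. killing br (br f u) y = 0" "killing br v y \<noteq> 0"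
      using killing_separates[OF image_f_subspace] by (metis rangeI)
    have "br f y = 0"
    proof (rule killing_nondegenerate)
      fix w show "killing br (br f y) w = 0"
        using y(1)[of w] by (simp add: killing_sym[of _ w] killing_br_right)
    qed
    then have "y \<in> gf" by (simp add: centralizer_def)
    then have "y \<in> vec.span (\<xi> ` {1..m})" using slice_basis by (simp add: is_basis_def)
    moreover have "vec.subspace {y. killing br v y = 0}" by (auto simp: vec.subspace_def killing_simps)
    moreover have "\<xi> ` {1..m} \<subseteq> {y. killing br v y = 0}" using z by auto
    ultimately have "killing br v y = 0" using vec.span_minimal by blast
    then show False using y(2) by simp
  qed
qed

end

section \<open>Polynomial families of loops\<close>

text \<open>The triangle i + j \<le> D + E contains the whole support of F, so summing it by
  antidiagonals loses nothing.\<close>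

lemma sum_antidiagonal:
  fixes F :: "nat \<Rightarrow> nat \<Rightarrow> 'a::comm_monoid_add"
  assumes "\<And>i j. i > D \<or> j > E \<Longrightarrow> F i j = 0"
  shows "(\<Sum>k\<le>D + E. \<Sum>i\<le>k. F i (k - i)) = (\<Sum>i\<le>D. \<Sum>j\<le>E. F i j)"
proof -
  have "finite {(i, j). i + j \<le> D + E}"
    by (rule finite_subset[of _ "{..D + E} \<times> {..D + E}"]) auto
  then have "(\<Sum>(i, j)\<in>{..D} \<times> {..E}. F i j) = (\<Sum>(i, j)\<in>{(i, j). i + j \<le> D + E}. F i j)"
    using assms by (intro sum.mono_neutral_left) (auto, (metis not_le)+)
  then show ?thesis
    by (simp only: sum.triangle_reindex_eq sum.cartesian_product)
qed

text \<open>Polynomials in t with loops as coefficients; a and b are the coefficients of degree 0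
  and 1. Derivatives at 0, also of integrals over the circle, are then read off coefficientwise
  without exchanging limits. The vanishing of N beyond D keeps b correct when D = 0.\<close>

definition poly_family ::
  "(real \<Rightarrow> real \<Rightarrow> 'a::real_normed_vector) \<Rightarrow> (real \<Rightarrow> 'a) \<Rightarrow> (real \<Rightarrow> 'a) \<Rightarrow> bool" where
  "poly_family g a b \<longleftrightarrow> (\<exists>D N. (\<forall>d. N d \<in> loops UNIV) \<and> (\<forall>d>D. N d = (\<lambda>x. 0)) \<and>
     (\<forall>t x. g t x = (\<Sum>d\<le>D. t ^ d *\<^sub>R N d x)) \<and> N 0 = a \<and> N 1 = b)"

lemma poly_familyD:
  assumes "poly_family g a b"
  shows "\<exists>N D. (\<forall>d. N d \<in> loops UNIV) \<and> (\<forall>d x. d > D \<longrightarrow> N d x = 0) \<and>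
    g = (\<lambda>t x. \<Sum>d\<le>D. t ^ d *\<^sub>R N d x) \<and> a = N 0 \<and> b = N 1"
proof -
  obtain D N where "\<forall>d. N d \<in> loops UNIV" "\<forall>d>D. N d = (\<lambda>x. 0)"
    "\<forall>t x. g t x = (\<Sum>d\<le>D. t ^ d *\<^sub>R N d x)" "N 0 = a" "N 1 = b"
    using assms unfolding poly_family_def by blast
  then show ?thesis by (intro exI[of _ N] exI[of _ D]) (auto simp: fun_eq_iff)
qed

lemma poly_familyI:
  assumes "\<And>d. N d \<in> loops UNIV" "\<And>d x. d > D \<Longrightarrow> N d x = 0"
    "\<And>t x. g t x = (\<Sum>d\<le>D. t ^ d *\<^sub>R N d x)" "\<And>x. a x = N 0 x" "\<And>x. b x = N 1 x"
  shows "poly_family g a b"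
  using assms unfolding poly_family_def by (intro exI[of _ D] exI[of _ N]) (auto simp: fun_eq_iff)

lemma sum_extend_zero:
  fixes N :: "nat \<Rightarrow> 'a::real_vector"
  assumes "\<And>d. d > D \<Longrightarrow> N d = 0" "D \<le> E"
  shows "(\<Sum>d\<le>D. t ^ d *\<^sub>R N d) = (\<Sum>d\<le>E. t ^ d *\<^sub>R N d)"
  using assms by (intro sum.mono_neutral_left) auto

lemma poly_family_affine:
  "a \<in> loops UNIV \<Longrightarrow> b \<in> loops UNIV \<Longrightarrow> poly_family (\<lambda>t x. a x + t *\<^sub>R b x) a b"
  by (rule poly_familyI[of "\<lambda>d. if d = 0 then a else if d = 1 then b else (\<lambda>x. 0)" 1])
    (auto simp: const_in_loops)

lemma poly_family_const: "a \<in> loops UNIV \<Longrightarrow> poly_family (\<lambda>t. a) a (\<lambda>x. 0)"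
  using poly_family_affine[of a "\<lambda>x. 0"] by (simp add: const_in_loops)

lemma poly_family_linear:
  assumes T: "bounded_linear T" and g: "poly_family g a b"
  shows "poly_family (\<lambda>t x. T (g t x)) (\<lambda>x. T (a x)) (\<lambda>x. T (b x))"
proof -
  interpret T: bounded_linear T by fact
  obtain N D where N: "\<And>d. N d \<in> loops UNIV" "\<And>d x. d > D \<Longrightarrow> N d x = 0"
    "g = (\<lambda>t x. \<Sum>d\<le>D. t ^ d *\<^sub>R N d x)" "a = N 0" "b = N 1" using poly_familyD[OF g] by blast
  show ?thesis
    by (rule poly_familyI[of "\<lambda>d x. T (N d x)" D])
      (auto simp: N(2-) T.zero T.sum T.scaleR intro: loops_linear[OF T] N(1))
qed

lemma poly_family_add:
  assumes "poly_family g a b" "poly_family g' a' b'"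
  shows "poly_family (\<lambda>t x. g t x + g' t x) (\<lambda>x. a x + a' x) (\<lambda>x. b x + b' x)"
proof -
  obtain N D where N: "\<And>d. N d \<in> loops UNIV" "\<And>d x. d > D \<Longrightarrow> N d x = 0"
    "g = (\<lambda>t x. \<Sum>d\<le>D. t ^ d *\<^sub>R N d x)" "a = N 0" "b = N 1" using poly_familyD[OF assms(1)] by blast
  obtain N' D' where N': "\<And>d. N' d \<in> loops UNIV" "\<And>d x. d > D' \<Longrightarrow> N' d x = 0"
    "g' = (\<lambda>t x. \<Sum>d\<le>D'. t ^ d *\<^sub>R N' d x)" "a' = N' 0" "b' = N' 1" using poly_familyD[OF assms(2)] by blast
  have "(\<Sum>d\<le>D. t ^ d *\<^sub>R N d x) = (\<Sum>d\<le>D + D'. t ^ d *\<^sub>R N d x)"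
    "(\<Sum>d\<le>D'. t ^ d *\<^sub>R N' d x) = (\<Sum>d\<le>D + D'. t ^ d *\<^sub>R N' d x)" for t x
    using N(2) N'(2) by (auto intro!: sum_extend_zero)
  then show ?thesis
    by (intro poly_familyI[of "\<lambda>d x. N d x + N' d x" "D + D'"])
      (auto simp: N(2-) N'(2-) scaleR_add_right sum.distrib intro: loops_add N(1) N'(1))
qed

lemma poly_family_sum:
  "(\<And>i. i \<in> I \<Longrightarrow> poly_family (g i) (a i) (b i))
    \<Longrightarrow> poly_family (\<lambda>t x. \<Sum>i\<in>I. g i t x) (\<lambda>x. \<Sum>i\<in>I. a i x) (\<lambda>x. \<Sum>i\<in>I. b i x)"
  by (induction I rule: infinite_finite_induct)
    (auto intro: poly_family_add poly_family_const simp: const_in_loops)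

lemma poly_family_uminus:
  "poly_family g a b \<Longrightarrow> poly_family (\<lambda>t x. - g t x) (\<lambda>x. - a x) (\<lambda>x. - b x)"
  by (rule poly_family_linear[OF bounded_linear_minus[OF bounded_linear_ident]])

lemma poly_family_diff:
  assumes "poly_family g a b" "poly_family g' a' b'"
  shows "poly_family (\<lambda>t x. g t x - g' t x) (\<lambda>x. a x - a' x) (\<lambda>x. b x - b' x)"
  using poly_family_add[OF assms(1) poly_family_uminus[OF assms(2)]] by simp

lemma poly_family_bilinear:
  assumes B: "bounded_bilinear B" and g: "poly_family g a b" and g': "poly_family g' a' b'"
  shows "poly_family (\<lambda>t x. B (g t x) (g' t x)) (\<lambda>x. B (a x) (a' x)) (\<lambda>x. B (a x) (b' x) + B (b x) (a' x))"
proof -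
  interpret B: bounded_bilinear B by fact
  obtain N D where N: "\<And>d. N d \<in> loops UNIV" "\<And>d x. d > D \<Longrightarrow> N d x = 0"
    "g = (\<lambda>t x. \<Sum>d\<le>D. t ^ d *\<^sub>R N d x)" "a = N 0" "b = N 1" using poly_familyD[OF g] by blast
  obtain N' D' where N': "\<And>d. N' d \<in> loops UNIV" "\<And>d x. d > D' \<Longrightarrow> N' d x = 0"
    "g' = (\<lambda>t x. \<Sum>d\<le>D'. t ^ d *\<^sub>R N' d x)" "a' = N' 0" "b' = N' 1" using poly_familyD[OF g'] by blast
  define M where "M k x = (\<Sum>i\<le>k. B (N i x) (N' (k - i) x))" for k x
  have M0: "M k x = 0" if "k > D + D'" for k x
    unfolding M_def
  proof (intro sum.neutral ballI)
    fix i show "B (N i x) (N' (k - i) x) = 0"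
      using that N(2)[of i x] N'(2)[of "k - i" x] by (cases "i > D") (auto simp: B.zero_left B.zero_right)
  qed
  have "B (g t x) (g' t x) = (\<Sum>k\<le>D + D'. t ^ k *\<^sub>R M k x)" for t x
  proof -
    have "B (g t x) (g' t x) = (\<Sum>i\<le>D. \<Sum>j\<le>D'. t ^ (i + j) *\<^sub>R B (N i x) (N' j x))"
      unfolding N(3) N'(3) 
      by (simp add: B.sum_left B.sum_right B.scaleR_left B.scaleR_right power_add sum.swap[of _ "{..D}"])
         (simp add: scaleR_sum_right mult.commute sum.swap[of _ "{..D}"])
    also have "\<dots> = (\<Sum>k\<le>D + D'. \<Sum>i\<le>k. t ^ (i + (k - i)) *\<^sub>R B (N i x) (N' (k - i) x))"
      by (rule sum_antidiagonal[symmetric]) (auto simp: N(2) N'(2) B.zero_left B.zero_right)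
    also have "\<dots> = (\<Sum>k\<le>D + D'. t ^ k *\<^sub>R M k x)"
      by (intro sum.cong refl) (simp add: M_def scaleR_sum_right)
    finally show ?thesis .
  qed
  then show ?thesis
    by (intro poly_familyI[of M "D + D'"] M0)
      (auto simp: M_def[abs_def] N(4,5) N'(4,5) add.commute intro!: loops_sum loops_bilinear[OF B] N(1) N'(1))
qed

lemma poly_family_mult:
  fixes g g' :: "real \<Rightarrow> real \<Rightarrow> complex"
  shows "poly_family g a b \<Longrightarrow> poly_family g' a' b'
    \<Longrightarrow> poly_family (\<lambda>t x. g t x * g' t x) (\<lambda>x. a x * a' x) (\<lambda>x. a x * b' x + b x * a' x)"
  by (rule poly_family_bilinear[OF bounded_bilinear_mult])

lemma poly_family_dx:
  assumes g: "poly_family g a b" shows "poly_family (\<lambda>t. dx (g t)) (dx a) (dx b)"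
proof -
  obtain N D where N: "\<And>d. N d \<in> loops UNIV" "\<And>d x. d > D \<Longrightarrow> N d x = 0"
    "g = (\<lambda>t x. \<Sum>d\<le>D. t ^ d *\<^sub>R N d x)" "a = N 0" "b = N 1" using poly_familyD[OF g] by blast
  have "dx (N d) x = 0" if "d > D" for d x
  proof -
    have "N d = (\<lambda>x. 0)" using N(2)[OF that] by auto
    then show ?thesis by (simp add: dx_const)
  qed
  then show ?thesis
    by (intro poly_familyI[of "\<lambda>d. dx (N d)" D])
      (auto simp: N(3-) dx_sum loops_scaleR N(1) dx_scaleR intro: dx_in_loops[OF N(1)])
qed

lemma poly_family_dxs: "poly_family g a b \<Longrightarrow> poly_family (\<lambda>t. (dx ^^ r) (g t)) ((dx ^^ r) a) ((dx ^^ r) b)"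
  by (induction r) (auto intro: poly_family_dx)

lemma poly_family_in_loops:
  assumes "poly_family g a b"
  shows "g t \<in> loops UNIV" "a \<in> loops UNIV" "b \<in> loops UNIV"
proof -
  obtain N D where N: "\<And>d. N d \<in> loops UNIV" "\<And>d x. d > D \<Longrightarrow> N d x = 0"
    "g = (\<lambda>t x. \<Sum>d\<le>D. t ^ d *\<^sub>R N d x)" "a = N 0" "b = N 1" using poly_familyD[OF assms] by blast
  then show "g t \<in> loops UNIV" "a \<in> loops UNIV" "b \<in> loops UNIV"
    by (auto intro!: loops_sum loops_scaleR)
qed

lemma poly_family_at_0:
  assumes "poly_family g a b" shows "g 0 = a"
proof -
  obtain N D where N: "\<And>d. N d \<in> loops UNIV" "\<And>d x. d > D \<Longrightarrow> N d x = 0"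
    "g = (\<lambda>t x. \<Sum>d\<le>D. t ^ d *\<^sub>R N d x)" "a = N 0" "b = N 1" using poly_familyD[OF assms] by blast
  then show ?thesis by (auto simp: power_0_left if_distrib[of "\<lambda>c. c *\<^sub>R _"] cong: if_cong)
qed

lemma polynomial_has_vector_derivative_0:
  fixes c :: "nat \<Rightarrow> 'a::real_normed_vector"
  assumes "\<And>d. d > D \<Longrightarrow> c d = 0"
  shows "((\<lambda>t::real. \<Sum>d\<le>D. t ^ d *\<^sub>R c d) has_vector_derivative c 1) (at 0)"
proof -
  have "((\<lambda>t::real. t ^ d *\<^sub>R c d) has_vector_derivative (if d = 1 then c 1 else 0)) (at 0)" for d
  proof -
    have "((\<lambda>t::real. t ^ d) has_field_derivative (real d * 0 ^ (d - 1))) (at 0)"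
      by (auto intro!: derivative_eq_intros)
    then have "((\<lambda>t::real. t ^ d *\<^sub>R c d) has_vector_derivative (real d * 0 ^ (d - 1)) *\<^sub>R c d) (at 0)"
      by (auto intro!: derivative_eq_intros)
    moreover have "(real d * 0 ^ (d - 1)) *\<^sub>R c d = (if d = 1 then c 1 else 0)"
      by (cases d) (auto simp: power_0_left)
    ultimately show ?thesis by simp
  qed
  then have "((\<lambda>t::real. \<Sum>d\<le>D. t ^ d *\<^sub>R c d) has_vector_derivative (\<Sum>d\<le>D. if d = 1 then c 1 else 0)) (at 0)"
    by (intro has_vector_derivative_sum) auto
  moreover have "(\<Sum>d\<le>D. if d = 1 then c 1 else 0) = c 1" using assms[of 1] by auto
  ultimately show ?thesis by simp
qed

lemma poly_family_has_derivative:
  assumes "poly_family g a b" shows "((\<lambda>t. g t x) has_vector_derivative b x) (at 0)"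
proof -
  obtain N D where N: "\<And>d. N d \<in> loops UNIV" "\<And>d x. d > D \<Longrightarrow> N d x = 0"
    "g = (\<lambda>t x. \<Sum>d\<le>D. t ^ d *\<^sub>R N d x)" "a = N 0" "b = N 1" using poly_familyD[OF assms] by blast
  then show ?thesis using polynomial_has_vector_derivative_0[of D "\<lambda>d. N d x"] by simp
qed

lemma poly_family_circle_int:
  assumes "poly_family g a b"
  shows "((\<lambda>t. circle_int (g t)) has_vector_derivative circle_int b) (at 0)"
proof -
  obtain N D where N: "\<And>d. N d \<in> loops UNIV" "\<And>d x. d > D \<Longrightarrow> N d x = 0"
    "g = (\<lambda>t x. \<Sum>d\<le>D. t ^ d *\<^sub>R N d x)" "a = N 0" "b = N 1" using poly_familyD[OF assms] by blast
  have "circle_int (N d) = 0" if "d > D" for d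
  proof -
    have "N d = (\<lambda>x. 0)" using N(2)[OF that] by auto
    then show ?thesis by simp
  qed
  moreover have "circle_int (g t) = (\<Sum>d\<le>D. t ^ d *\<^sub>R circle_int (N d))" for t
    unfolding N(3) using N(1) 
    by (simp add: circle_int_sum loops_scaleR) (simp add: circle_int_def)
  ultimately show ?thesis
    using polynomial_has_vector_derivative_0[of D "\<lambda>d. circle_int (N d)"] by (simp add: N(5))
qed

lemma poly_family_derivative_linear_constraint:
  assumes g: "poly_family g a b" and T: "bounded_linear T" and z: "\<And>t x. T (g t x) = T' (g t x)"
    and T': "bounded_linear T'"
  shows "T (b x) = T' (b x)"
  using poly_family_has_derivative[OF poly_family_linear[OF T g], of x]
    poly_family_has_derivative[OF poly_family_linear[OF T' g], of x]
  unfolding z by (rule vector_derivative_unique_at)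

section \<open>Differential polynomial maps on loops\<close>

text \<open>Differential polynomials in the components of q, with loops as coefficients, as a class
  of maps and not as a syntax. The rule \<open>congr\<close> is needed because identities involving
  \<open>dx\<close> hold only at smooth q.\<close>

inductive diff_map :: "((real \<Rightarrow> complex^'d) \<Rightarrow> real \<Rightarrow> complex) \<Rightarrow> bool" where
  coefficient: "\<eta> \<in> loops UNIV \<Longrightarrow> diff_map (\<lambda>q. \<eta>)"
| coordinate: "diff_map (\<lambda>q x. q x $ i)"
| add: "diff_map N \<Longrightarrow> diff_map M \<Longrightarrow> diff_map (\<lambda>q x. N q x + M q x)"
| mult: "diff_map N \<Longrightarrow> diff_map M \<Longrightarrow> diff_map (\<lambda>q x. N q x * M q x)"
| dx: "diff_map N \<Longrightarrow> diff_map (\<lambda>q. dx (N q))"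
| congr: "diff_map N \<Longrightarrow> (\<And>q. q \<in> loops UNIV \<Longrightarrow> M q = N q) \<Longrightarrow> diff_map M"

definition diff_map_vec :: "((real \<Rightarrow> complex^'d) \<Rightarrow> real \<Rightarrow> complex^'d) \<Rightarrow> bool" where
  "diff_map_vec N \<longleftrightarrow> (\<forall>i. diff_map (\<lambda>q x. N q x $ i))"

lemma diff_map_sum: "(\<And>i. i \<in> I \<Longrightarrow> diff_map (N i)) \<Longrightarrow> diff_map (\<lambda>q x. \<Sum>i\<in>I. N i q x)"
proof (induction I rule: infinite_finite_induct)
  case (insert i I)
  then show ?case by (simp add: diff_map.add)
qed (use diff_map.coefficient[OF const_in_loops[of 0]] in simp_all)

lemma diff_map_cmult: "diff_map N \<Longrightarrow> diff_map (\<lambda>q x. N q x * b)"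
  by (rule diff_map.mult[OF _ diff_map.coefficient[OF const_in_loops]])

lemma diff_map_dxs: "diff_map N \<Longrightarrow> diff_map (\<lambda>q. (dx ^^ r) (N q))"
  by (induction r) (auto intro: diff_map.dx)

lemma linear_functional_components:
  assumes "\<And>x y. \<Phi> (x + y) = \<Phi> x + \<Phi> y" "\<And>c x. \<Phi> (c *s x) = c * \<Phi> (x :: complex^'d)"
  shows "\<Phi> v = (\<Sum>j\<in>UNIV. v $ j * \<Phi> (axis j 1))"
proof -
  have "\<Phi> 0 = 0" using assms(2)[of 0 0] by simp
  then have "\<Phi> (\<Sum>j\<in>J. u j) = (\<Sum>j\<in>J. \<Phi> (u j))" for J and u :: "'d \<Rightarrow> complex^'d"
    by (induction J rule: infinite_finite_induct) (auto simp: assms)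
  then have "\<Phi> (\<Sum>j\<in>UNIV. v $ j *s axis j 1) = (\<Sum>j\<in>UNIV. v $ j * \<Phi> (axis j 1))" 
    by (simp add: assms)
  then show ?thesis by (simp add: basis_expansion)
qed

lemma diff_map_functional:
  assumes "diff_map_vec N" "\<And>x y. \<Phi> (x + y) = \<Phi> x + \<Phi> y" "\<And>c x. \<Phi> (c *s x) = c * \<Phi> x"
  shows "diff_map (\<lambda>q x. \<Phi> (N q x))"
proof -
  have "(\<lambda>q x. \<Phi> (N q x)) = (\<lambda>q x. \<Sum>j\<in>UNIV. N q x $ j * \<Phi> (axis j 1))"
    by (intro ext linear_functional_components assms)
  moreover have "diff_map (\<lambda>q x. \<Sum>j\<in>UNIV. N q x $ j * \<Phi> (axis j 1))"
    using assms(1) by (intro diff_map_sum diff_map_cmult) (auto simp: diff_map_vec_def)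
  ultimately show ?thesis by simp
qed

lemma diff_map_vec_linear: "clinear T \<Longrightarrow> diff_map_vec N \<Longrightarrow> diff_map_vec (\<lambda>q x. T (N q x))"
  unfolding diff_map_vec_def[of "\<lambda>q x. T (N q x)"]
  by (intro allI diff_map_functional[where \<Phi> = "\<lambda>v. T v $ _"]) (auto simp: clinear_simps)

lemma diff_map_vec_add: "diff_map_vec N \<Longrightarrow> diff_map_vec M \<Longrightarrow> diff_map_vec (\<lambda>q x. N q x + M q x)"
  unfolding diff_map_vec_def by (auto intro: diff_map.add)

lemma diff_map_vec_const: "u \<in> loops UNIV \<Longrightarrow> diff_map_vec (\<lambda>q. u)"
  unfolding diff_map_vec_def
  by (auto intro!: diff_map.coefficient loops_linear[OF bounded_linear_vec_nth])

lemma diff_map_vec_id: "diff_map_vec (\<lambda>q. q)"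
  unfolding diff_map_vec_def by (auto intro: diff_map.coordinate)

lemma diff_map_vec_diff: "diff_map_vec N \<Longrightarrow> diff_map_vec M \<Longrightarrow> diff_map_vec (\<lambda>q x. N q x - M q x)"
  using diff_map_vec_add[of N "\<lambda>q x. - M q x"] diff_map_vec_linear[of uminus M]
  by (simp add: clinearI)

lemma diff_map_vec_sum: "(\<And>i. i \<in> I \<Longrightarrow> diff_map_vec (N i)) \<Longrightarrow> diff_map_vec (\<lambda>q x. \<Sum>i\<in>I. N i q x)"
  unfolding diff_map_vec_def by (auto intro: diff_map_sum)

lemma diff_map_vec_bilinear:
  assumes B: "\<And>y. clinear (\<lambda>x. B x y)" "\<And>x. clinear (B x)"
    and N: "diff_map_vec N" and M: "diff_map_vec M"
  shows "diff_map_vec (\<lambda>q x. B (N q x) (M q x))"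
proof -
  have B': "B u v = (\<Sum>j\<in>UNIV. \<Sum>k\<in>UNIV. (u $ j * v $ k) *s B (axis j 1) (axis k 1))" for u v
  proof -
    have "B (\<Sum>j\<in>UNIV. u $ j *s axis j 1) (\<Sum>k\<in>UNIV. v $ k *s axis k 1)
        = (\<Sum>k\<in>UNIV. \<Sum>j\<in>UNIV. (v $ k * u $ j) *s B (axis j 1) (axis k 1))"
      by (simp add: clinear_simps[OF B(1)] clinear_simps[OF B(2)] vec.scale_sum_right)
    also have "\<dots> = (\<Sum>j\<in>UNIV. \<Sum>k\<in>UNIV. (u $ j * v $ k) *s B (axis j 1) (axis k 1))"
      by (subst sum.swap) (simp only: mult.commute)
    finally have "B (\<Sum>j\<in>UNIV. u $ j *s axis j 1) (\<Sum>k\<in>UNIV. v $ k *s axis k 1)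
        = (\<Sum>j\<in>UNIV. \<Sum>k\<in>UNIV. (u $ j * v $ k) *s B (axis j 1) (axis k 1))" .
    then show ?thesis by (simp only: basis_expansion)
  qed
  show ?thesis unfolding diff_map_vec_def
  proof
    fix i
    have "(\<lambda>q x. B (N q x) (M q x) $ i)
        = (\<lambda>q x. \<Sum>j\<in>UNIV. \<Sum>k\<in>UNIV. (N q x $ j * M q x $ k) * B (axis j 1) (axis k 1) $ i)"
      by (intro ext, subst B') simp
    moreover have "diff_map (\<lambda>q x. \<Sum>j\<in>UNIV. \<Sum>k\<in>UNIV. (N q x $ j * M q x $ k) * B (axis j 1) (axis k 1) $ i)"
      using N M by (intro diff_map_sum diff_map_cmult diff_map.mult) (auto simp: diff_map_vec_def)
    ultimately show "diff_map (\<lambda>q x. B (N q x) (M q x) $ i)" by simp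
  qed
qed

lemma diff_map_in_loops: "diff_map N \<Longrightarrow> q \<in> loops UNIV \<Longrightarrow> N q \<in> loops UNIV"
  by (induction rule: diff_map.induct)
    (auto intro: loops_add loops_mult dx_in_loops loops_linear[OF bounded_linear_vec_nth])

lemma loops_vec_iff: "u \<in> loops UNIV \<longleftrightarrow> (\<forall>i. (\<lambda>x. u x $ i) \<in> loops UNIV)"
  for u :: "real \<Rightarrow> complex^'d"
proof
  assume i: "\<forall>i. (\<lambda>x. u x $ i) \<in> loops UNIV"
  have "bounded_linear (\<lambda>b::complex. b *s axis i (1::complex) :: complex^'d)" for i
    by (simp add: linear_conv_bounded_linear[symmetric])
      (auto intro!: linearI simp: vec.scale_left_distrib scaleR_eq_scale scaleR_conv_of_real[where 'a = complex])
  from loops_linear[OF this] have "(\<lambda>x. \<Sum>i\<in>UNIV. u x $ i *s axis i (1::complex) :: complex^'d) \<in> loops UNIV"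
    using i by (intro loops_sum) auto
  then show "u \<in> loops UNIV" by (simp add: basis_expansion)
qed (auto intro: loops_linear[OF bounded_linear_vec_nth])

lemma diff_map_vec_in_loops: "diff_map_vec N \<Longrightarrow> q \<in> loops UNIV \<Longrightarrow> N q \<in> loops UNIV"
  by (auto simp: diff_map_vec_def loops_vec_iff[of "N q"] intro: diff_map_in_loops)

lemma dx_vec_nth: "u \<in> loops UNIV \<Longrightarrow> dx u x $ i = dx (\<lambda>x. u x $ i) x"
  by (simp add: dx_bounded_linear[OF bounded_linear_vec_nth])

lemma diff_map_vec_dx: 
  assumes N: "diff_map_vec N" shows "diff_map_vec (\<lambda>q. dx (N q))"
  unfolding diff_map_vec_def
proof
  fix i
  have "diff_map (\<lambda>q. dx (\<lambda>x. N q x $ i))" using N by (auto simp: diff_map_vec_def intro: diff_map.dx)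
  then show "diff_map (\<lambda>q x. dx (N q) x $ i)"
    by (rule diff_map.congr) (simp add: dx_vec_nth diff_map_vec_in_loops[OF N])
qed

lemma loops_scale: "\<eta> \<in> loops UNIV \<Longrightarrow> (\<lambda>x. \<eta> x *s y) \<in> loops UNIV" for y :: "complex^'d"
  unfolding loops_vec_iff[of "\<lambda>x. \<eta> x *s y"] by (auto intro!: loops_mult const_in_loops)

text \<open>The value at \<open>\<eta> = 1\<close> of the formal adjoint \<open>Ta\<close> is the gradient of \<open>q \<mapsto> \<integral> N(q)\<close>.\<close>

lemma diff_map_derivative:
  fixes q :: "real \<Rightarrow> complex^'d"
  assumes "diff_map N" and q: "q \<in> loops UNIV"
  shows "\<exists>T Ta. (\<forall>s\<in>loops UNIV. poly_family (\<lambda>t. N (\<lambda>x. q x + t *\<^sub>R s x)) (N q) (T s)) \<and>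
    (\<forall>\<eta>\<in>loops UNIV. Ta \<eta> \<in> loops UNIV \<and> (\<forall>s\<in>loops UNIV.
       circle_int (\<lambda>x. \<eta> x * T s x) = circle_int (\<lambda>x. \<Sum>i\<in>UNIV. Ta \<eta> x $ i * s x $ i)))"
  using assms(1)
proof induction
  case (coefficient \<eta>)
  show ?case
    by (rule exI[of _ "\<lambda>s x. 0"], rule exI[of _ "\<lambda>\<eta> x. 0"])
      (auto intro: poly_family_const coefficient const_in_loops)
next
  case (coordinate i)
  show ?case
  proof (rule exI[of _ "\<lambda>s x. s x $ i"], rule exI[of _ "\<lambda>\<eta> x. \<eta> x *s axis i 1"], intro conjI ballI)
    fix s :: "real \<Rightarrow> complex^'d" assume "s \<in> loops UNIV"
    then show "poly_family (\<lambda>t x. (q x + t *\<^sub>R s x) $ i) (\<lambda>x. q x $ i) (\<lambda>x. s x $ i)"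
      using q by (intro poly_family_linear[OF bounded_linear_vec_nth] poly_family_affine)
  next
    fix \<eta> :: "real \<Rightarrow> complex" and s :: "real \<Rightarrow> complex^'d"
    show "circle_int (\<lambda>x. \<eta> x * s x $ i) = circle_int (\<lambda>x. \<Sum>j\<in>UNIV. (\<eta> x *s axis i 1) $ j * s x $ j)"
      by (simp add: axis_def if_distrib[of "\<lambda>c. _ * c * _"] if_distrib[of "\<lambda>c. c * _"] cong: if_cong)
  qed (rule loops_scale)
next
  case (add N M)
  obtain T Ta where T: "\<And>s. s \<in> loops UNIV \<Longrightarrow> poly_family (\<lambda>t. N (\<lambda>x. q x + t *\<^sub>R s x)) (N q) (T s)"
    "\<And>\<eta>. \<eta> \<in> loops UNIV \<Longrightarrow> Ta \<eta> \<in> loops UNIV"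
    "\<And>\<eta> s. \<eta> \<in> loops UNIV \<Longrightarrow> s \<in> loops UNIV \<Longrightarrow>
      circle_int (\<lambda>x. \<eta> x * T s x) = circle_int (\<lambda>x. \<Sum>i\<in>UNIV. Ta \<eta> x $ i * s x $ i)"
    using add.IH(1) by blast
  obtain U Ua where U: "\<And>s. s \<in> loops UNIV \<Longrightarrow> poly_family (\<lambda>t. M (\<lambda>x. q x + t *\<^sub>R s x)) (M q) (U s)"
    "\<And>\<eta>. \<eta> \<in> loops UNIV \<Longrightarrow> Ua \<eta> \<in> loops UNIV"
    "\<And>\<eta> s. \<eta> \<in> loops UNIV \<Longrightarrow> s \<in> loops UNIV \<Longrightarrow>
      circle_int (\<lambda>x. \<eta> x * U s x) = circle_int (\<lambda>x. \<Sum>i\<in>UNIV. Ua \<eta> x $ i * s x $ i)"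
    using add.IH(2) by blast
  have pair: "(\<lambda>x. \<Sum>i\<in>UNIV. u x $ i * s x $ i) \<in> loops UNIV"
    if "u \<in> loops UNIV" "s \<in> loops UNIV" for u s :: "real \<Rightarrow> complex^'d"
    using that by (intro loops_sum loops_mult) (auto simp: loops_vec_iff)
  show ?case
  proof (rule exI[of _ "\<lambda>s x. T s x + U s x"], rule exI[of _ "\<lambda>\<eta> x. Ta \<eta> x + Ua \<eta> x"], intro conjI ballI)
    fix \<eta> :: "real \<Rightarrow> complex" and s :: "real \<Rightarrow> complex^'d" assume h: "\<eta> \<in> loops UNIV" "s \<in> loops UNIV"
    note l = poly_family_in_loops(3)[OF T(1)[OF h(2)]] poly_family_in_loops(3)[OF U(1)[OF h(2)]]
    have "circle_int (\<lambda>x. \<eta> x * T s x) + circle_int (\<lambda>x. \<eta> x * U s x) 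
        = circle_int (\<lambda>x. \<Sum>i\<in>UNIV. Ta \<eta> x $ i * s x $ i) + circle_int (\<lambda>x. \<Sum>i\<in>UNIV. Ua \<eta> x $ i * s x $ i)"
      using T(3) U(3) h by simp
    then show "circle_int (\<lambda>x. \<eta> x * (T s x + U s x)) = circle_int (\<lambda>x. \<Sum>i\<in>UNIV. (Ta \<eta> x + Ua \<eta> x) $ i * s x $ i)"
      using h l T(2)[OF h(1)] U(2)[OF h(1)]
      by (simp add: distrib_left distrib_right sum.distrib circle_int_add loops_mult pair)
  qed (auto intro: poly_family_add T U loops_add)
next
  case (mult N M)
  obtain T Ta where T: "\<And>s. s \<in> loops UNIV \<Longrightarrow> poly_family (\<lambda>t. N (\<lambda>x. q x + t *\<^sub>R s x)) (N q) (T s)"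
    "\<And>\<eta>. \<eta> \<in> loops UNIV \<Longrightarrow> Ta \<eta> \<in> loops UNIV"
    "\<And>\<eta> s. \<eta> \<in> loops UNIV \<Longrightarrow> s \<in> loops UNIV \<Longrightarrow>
      circle_int (\<lambda>x. \<eta> x * T s x) = circle_int (\<lambda>x. \<Sum>i\<in>UNIV. Ta \<eta> x $ i * s x $ i)"
    using mult.IH(1) by blast
  obtain U Ua where U: "\<And>s. s \<in> loops UNIV \<Longrightarrow> poly_family (\<lambda>t. M (\<lambda>x. q x + t *\<^sub>R s x)) (M q) (U s)"
    "\<And>\<eta>. \<eta> \<in> loops UNIV \<Longrightarrow> Ua \<eta> \<in> loops UNIV"
    "\<And>\<eta> s. \<eta> \<in> loops UNIV \<Longrightarrow> s \<in> loops UNIV \<Longrightarrow>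
      circle_int (\<lambda>x. \<eta> x * U s x) = circle_int (\<lambda>x. \<Sum>i\<in>UNIV. Ua \<eta> x $ i * s x $ i)"
    using mult.IH(2) by blast
  have pair: "(\<lambda>x. \<Sum>i\<in>UNIV. u x $ i * s x $ i) \<in> loops UNIV"
    if "u \<in> loops UNIV" "s \<in> loops UNIV" for u s :: "real \<Rightarrow> complex^'d"
    using that by (intro loops_sum loops_mult) (auto simp: loops_vec_iff)
  have NM: "N q \<in> loops UNIV" "M q \<in> loops UNIV"
    using mult.hyps q by (auto intro: diff_map_in_loops)
  show ?case
  proof (rule exI[of _ "\<lambda>s x. N q x * U s x + T s x * M q x"], 
      rule exI[of _ "\<lambda>\<eta> x. Ua (\<lambda>x. \<eta> x * N q x) x + Ta (\<lambda>x. \<eta> x * M q x) x"], intro conjI ballI)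
    fix \<eta> :: "real \<Rightarrow> complex" and s :: "real \<Rightarrow> complex^'d" assume h: "\<eta> \<in> loops UNIV" "s \<in> loops UNIV"
    note l = poly_family_in_loops(3)[OF T(1)[OF h(2)]] poly_family_in_loops(3)[OF U(1)[OF h(2)]]
    note hN = loops_mult[OF h(1) NM(1)] loops_mult[OF h(1) NM(2)]
    have "circle_int (\<lambda>x. \<eta> x * N q x * U s x) + circle_int (\<lambda>x. \<eta> x * M q x * T s x) 
        = circle_int (\<lambda>x. \<Sum>i\<in>UNIV. Ua (\<lambda>x. \<eta> x * N q x) x $ i * s x $ i)
         + circle_int (\<lambda>x. \<Sum>i\<in>UNIV. Ta (\<lambda>x. \<eta> x * M q x) x $ i * s x $ i)"
      using T(3) U(3) h hN by simp
    then have "circle_int (\<lambda>x. \<eta> x * N q x * U s x + \<eta> x * M q x * T s x) 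
        = circle_int (\<lambda>x. (\<Sum>i\<in>UNIV. Ua (\<lambda>x. \<eta> x * N q x) x $ i * s x $ i)
         + (\<Sum>i\<in>UNIV. Ta (\<lambda>x. \<eta> x * M q x) x $ i * s x $ i))"
      using h l hN T(2)[OF hN(2)] U(2)[OF hN(1)] by (simp add: circle_int_add loops_mult pair)
    then show "circle_int (\<lambda>x. \<eta> x * (N q x * U s x + T s x * M q x)) = 
      circle_int (\<lambda>x. \<Sum>i\<in>UNIV. (Ua (\<lambda>x. \<eta> x * N q x) x + Ta (\<lambda>x. \<eta> x * M q x) x) $ i * s x $ i)"
      by (simp add: distrib_left distrib_right sum.distrib mult_ac)
  qed (auto intro!: poly_family_mult T U loops_add loops_mult NM)
next
  case (dx N)
  obtain T Ta where T: "\<And>s. s \<in> loops UNIV \<Longrightarrow> poly_family (\<lambda>t. N (\<lambda>x. q x + t *\<^sub>R s x)) (N q) (T s)"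
    "\<And>\<eta>. \<eta> \<in> loops UNIV \<Longrightarrow> Ta \<eta> \<in> loops UNIV"
    "\<And>\<eta> s. \<eta> \<in> loops UNIV \<Longrightarrow> s \<in> loops UNIV \<Longrightarrow>
      circle_int (\<lambda>x. \<eta> x * T s x) = circle_int (\<lambda>x. \<Sum>i\<in>UNIV. Ta \<eta> x $ i * s x $ i)"
    using dx.IH by blast
  show ?case
  proof (rule exI[of _ "\<lambda>s. dx (T s)"], rule exI[of _ "\<lambda>\<eta>. Ta (\<lambda>x. - dx \<eta> x)"], intro conjI ballI)
    fix \<eta> :: "real \<Rightarrow> complex" and s :: "real \<Rightarrow> complex^'d" assume h: "\<eta> \<in> loops UNIV" "s \<in> loops UNIV"
    have "circle_int (\<lambda>x. \<eta> x * dx (T s) x) = circle_int (\<lambda>x. - dx \<eta> x * T s x)"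
      using circle_int_parts[OF h(1) poly_family_in_loops(3)[OF T(1)[OF h(2)]]]
      by (simp add: circle_int_uminus)
    also have "\<dots> = circle_int (\<lambda>x. \<Sum>i\<in>UNIV. Ta (\<lambda>x. - dx \<eta> x) x $ i * s x $ i)"
      using h by (intro T(3)) (auto intro: dx_in_loops loops_uminus)
    finally show "circle_int (\<lambda>x. \<eta> x * dx (T s) x) = \<dots>" .
  qed (auto intro!: poly_family_dx T loops_uminus dx_in_loops)
next
  case (congr N M)
  have "M (\<lambda>x. q x + t *\<^sub>R s x) = N (\<lambda>x. q x + t *\<^sub>R s x)" if "s \<in> loops UNIV" for s t
    using that q by (intro congr.hyps loops_add loops_scaleR)
  moreover have "M q = N q" using q by (rule congr.hyps)
  ultimately show ?case using congr.IH by simp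
qed

text \<open>A linear projection onto V commutes with \<open>dx\<close> and fixes u.\<close>

lemma subspace_dx:
  assumes V: "vec.subspace (V :: (complex^'d) set)" and u: "u \<in> loops V"
  shows "dx u \<in> loops V"
proof -
  obtain p where p: "clinear p" "\<And>v. p v \<in> V" "\<And>v. v \<in> V \<Longrightarrow> p v = v"
    using linear_projection_exists[OF V] by blast
  have "dx (\<lambda>x. p (u x)) = (\<lambda>x. p (dx u x))"
    by (rule dx_bounded_linear[OF clinear_bounded[OF p(1)] loops_UNIV[OF u]])
  moreover have "(\<lambda>x. p (u x)) = u" using u p(3) by (auto simp: loops_def)
  ultimately have "dx u x \<in> V" for x using p(2) by metis
  then show ?thesis using dx_in_loops[OF u] by (auto simp: loops_iff[of _ V])
qed

context slice_data
begin

section \<open>Loops in the Lie algebra\<close>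

lemma bounded_bilinear_br: "bounded_bilinear br"
  unfolding bilinear_conv_bounded_bilinear[symmetric] bilinear_def
  by (auto intro!: linearI simp: br_simps scaleR_eq_scale)

lemma bounded_bilinear_killing: "bounded_bilinear (killing br)"
  unfolding bilinear_conv_bounded_bilinear[symmetric] bilinear_def
  by (auto intro!: linearI simp: killing_simps scaleR_eq_scale scaleR_conv_of_real[where 'a = complex])

lemmas loops_br = loops_bilinear[OF bounded_bilinear_br]
lemmas loops_killing = loops_bilinear[OF bounded_bilinear_killing]
lemmas dx_br = dx_bounded_bilinear[OF bounded_bilinear_br]
lemmas dx_killing = dx_bounded_bilinear[OF bounded_bilinear_killing]
lemmas bounded_linear_killing = bounded_bilinear.bounded_linear_left[OF bounded_bilinear_killing]

lemma loop_form_add: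
  "u \<in> loops UNIV \<Longrightarrow> v \<in> loops UNIV \<Longrightarrow> w \<in> loops UNIV \<Longrightarrow>
    loop_form br (\<lambda>x. u x + v x) w = loop_form br u w + loop_form br v w"
  "u \<in> loops UNIV \<Longrightarrow> v \<in> loops UNIV \<Longrightarrow> w \<in> loops UNIV \<Longrightarrow>
    loop_form br w (\<lambda>x. u x + v x) = loop_form br w u + loop_form br w v"
  by (simp_all add: loop_form_def killing_simps circle_int_add loops_killing)

lemma loop_form_diff:
  "u \<in> loops UNIV \<Longrightarrow> v \<in> loops UNIV \<Longrightarrow> w \<in> loops UNIV \<Longrightarrow>
    loop_form br (\<lambda>x. u x - v x) w = loop_form br u w - loop_form br v w"
  "u \<in> loops UNIV \<Longrightarrow> v \<in> loops UNIV \<Longrightarrow> w \<in> loops UNIV \<Longrightarrow>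
    loop_form br w (\<lambda>x. u x - v x) = loop_form br w u - loop_form br w v"
  by (simp_all add: loop_form_def killing_simps circle_int_diff loops_killing)

lemma loop_form_0: "(\<And>x. killing br (u x) (v x) = 0) \<Longrightarrow> loop_form br u v = 0"
  by (simp add: loop_form_def)

text \<open>Test loops of the form \<eta> y localise an orthogonality under the integral to a
  pointwise one.\<close>

lemma loop_form_perp:
  assumes u: "u \<in> loops UNIV" and V: "vec.subspace V"
    and z: "\<And>v. v \<in> loops V \<Longrightarrow> loop_form br u v = 0" and y: "y \<in> V"
  shows "killing br (u x) y = 0"
proof (rule fundamental_lemma[of "\<lambda>x. killing br (u x) y"])
  show "(\<lambda>x. killing br (u x) y) \<in> loops UNIV" using u by (intro loops_killing const_in_loops)
  fix \<eta> :: "real \<Rightarrow> complex" assume \<eta>: "\<eta> \<in> loops UNIV"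
  have "(\<lambda>x. \<eta> x *s y) \<in> loops V"
    using loops_scale[OF \<eta>] vec.subspace_scale[OF V y] by (auto simp: loops_iff[of _ V])
  from z[OF this] show "circle_int (\<lambda>x. \<eta> x * killing br (u x) y) = 0"
    by (simp add: loop_form_def killing_simps)
qed

lemma has_gradient_unique:
  assumes "has_gradient br F q w" "has_gradient br F q w'" shows "w = w'"
proof
  fix x
  have w: "w \<in> loops UNIV" "w' \<in> loops UNIV" using assms by (auto simp: has_gradient_def)
  have "loop_form br (\<lambda>x. w x - w' x) s = 0" if "s \<in> loops UNIV" for s
    using assms w that vector_derivative_unique_at unfolding has_gradient_def
    by (simp add: loop_form_diff) blast
  then have "killing br (w x - w' x) y = 0" for y
    using loop_form_perp[of "\<lambda>x. w x - w' x" UNIV y x] w by (auto intro: loops_diff)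
  then show "w x = w' x" using killing_nondegenerate[of "w x - w' x"] by simp
qed

lemma grad: "functional br F \<Longrightarrow> q \<in> loops UNIV \<Longrightarrow> has_gradient br F q (grad br F q)"
  unfolding grad_def functional_def by (metis someI_ex)

lemma grad_in_loops: "functional br F \<Longrightarrow> q \<in> loops UNIV \<Longrightarrow> grad br F q \<in> loops UNIV"
  using grad by (auto simp: has_gradient_def)

lemma grad_eq: "has_gradient br F q w \<Longrightarrow> grad br F q = w"
  unfolding grad_def using has_gradient_unique by (metis someI_ex)

lemma functional_diff_map:
  assumes N: "diff_map N" shows "functional br (\<lambda>q. circle_int (N q))"
  unfolding functional_def
proof
  fix q :: "real \<Rightarrow> complex^'d" assume q: "q \<in> loops UNIV"
  obtain T Ta where T: "\<And>s. s \<in> loops UNIV \<Longrightarrow> poly_family (\<lambda>t. N (\<lambda>x. q x + t *\<^sub>R s x)) (N q) (T s)"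
    "\<And>\<eta>. \<eta> \<in> loops UNIV \<Longrightarrow> Ta \<eta> \<in> loops UNIV"
    "\<And>\<eta> s. \<eta> \<in> loops UNIV \<Longrightarrow> s \<in> loops UNIV \<Longrightarrow>
      circle_int (\<lambda>x. \<eta> x * T s x) = circle_int (\<lambda>x. \<Sum>i\<in>UNIV. Ta \<eta> x $ i * s x $ i)"
    using diff_map_derivative[OF N q] by blast
  define u where "u = Ta (\<lambda>x. 1)"
  have u: "u \<in> loops UNIV" using T(2)[OF const_in_loops] by (simp add: u_def)
  \<comment> \<open>The loop u represents the differential for the coordinatewise pairing. The inner
    sum is the vector whose Killing pairing with v is the i-th coordinate of v, so w represents the
    same differential for the Killing form.\<close>
  define w where "w x = (\<Sum>i\<in>UNIV. u x $ i *s (\<Sum>k=1..n. (\<xi> k $ i) *s \<xi>' k))" for x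
  have w: "w \<in> loops UNIV" unfolding w_def[abs_def]
    using u by (intro loops_sum loops_scale) (auto simp: loops_vec_iff)
  have "killing br (w x) v = (\<Sum>i\<in>UNIV. u x $ i * v $ i)" for x v
  proof -
    have "killing br (\<Sum>k=1..n. (\<xi> k $ i) *s \<xi>' k) v = v $ i" for i
      by (subst (2) expand_basis[of v]) (simp add: killing_simps mult.commute killing_sym[of v])
    then show ?thesis by (simp add: w_def killing_simps)
  qed
  then have "has_gradient br (\<lambda>q. circle_int (N q)) q w"
    unfolding has_gradient_def loop_form_def
    using w poly_family_circle_int[OF T(1)] T(3)[OF const_in_loops[of 1]] by (auto simp: u_def)
  then show "\<exists>w. has_gradient br (\<lambda>q. circle_int (N q)) q w" by blast
qed

lemma diff_map_vec_br: "diff_map_vec N \<Longrightarrow> diff_map_vec M \<Longrightarrow> diff_map_vec (\<lambda>q x. br (N q x) (M q x))"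
  by (rule diff_map_vec_bilinear[OF br_linear(2) br_linear(1)])

section \<open>The gauge action\<close>

text \<open>The part of degree k in u of exp(-ad u) applied to \<partial> + z, with \<partial> taken
  away. The extra \<open>dx u\<close> in the first step is - ad u applied to \<partial>. Starting
  from z instead of P2 makes the recursion uniform, as the derivative lemma below requires.\<close>

fun gauge_term :: "(real \<Rightarrow> complex^'d) \<Rightarrow> (real \<Rightarrow> complex^'d) \<Rightarrow> nat \<Rightarrow> real \<Rightarrow> complex^'d" where
  "gauge_term u z 0 = z"
| "gauge_term u z (Suc k) = (\<lambda>x. (1 / of_nat (Suc k)) *s ((if k = 0 then dx u x else 0) - br (u x) (gauge_term u z k x)))"

lemma gauge_term_eq:
  "gauge_term u z (Suc k) x = (1 / fact (Suc k)) *s ((\<lambda>v. - br (u x) v) ^^ k) (P2 br z u x)"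
proof (induction k)
  case 0
  show ?case using br_skew[of "u x" "z x"] by (simp add: P2_def)
next
  case (Suc k)
  show ?case
    by (subst gauge_term.simps, subst Suc) (simp add: br_simps vec.scale_right_distrib)
qed

lemma minus_br_power_fil:
  "u \<in> fil (-1) \<Longrightarrow> v \<in> fil j \<Longrightarrow> ((\<lambda>v. - br u v) ^^ k) v \<in> fil (j - int k)"
proof (induction k)
  case (Suc k)
  then have "br u (((\<lambda>v. - br u v) ^^ k) v) \<in> fil (-1 + (j - int k))" by (intro fil_br) auto
  then show ?case using vec.subspace_neg[OF fil_subspace] by (simp add: algebra_simps)
qed simp

text \<open>Each bracket with u lowers the filtration by one, so \<open>2 * bd\<close> of them lead
  from the top \<open>bd\<close> to the bottom \<open>- bd\<close>.\<close>

lemma gauge_term_0: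
  assumes "u x \<in> fil (-1)" "k > 2 * bd" shows "gauge_term u z k x = 0"
proof -
  obtain j where k: "k = Suc j" using assms(2) by (cases k) auto
  have "((\<lambda>v. - br (u x) v) ^^ j) (P2 br z u x) \<in> fil (int bd - int j)"
    by (rule minus_br_power_fil[OF assms(1) fil_top])
  then have "((\<lambda>v. - br (u x) v) ^^ j) (P2 br z u x) \<in> fil (- int bd)"
    using fil_mono[of "int bd - int j" "- int bd"] assms(2) k by auto
  then show ?thesis unfolding k gauge_term_eq by (simp add: fil_bot)
qed

text \<open>The gauge action as a finite sum, which agrees with \<open>gauge\<close> for u of
  negative degree; unlike the series it is evidently a differential polynomial in u and z.\<close>

definition gau :: "(real \<Rightarrow> complex^'d) \<Rightarrow> (real \<Rightarrow> complex^'d) \<Rightarrow> real \<Rightarrow> complex^'d" where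
  "gau u z = (\<lambda>x. \<Sum>k\<le>2 * bd. gauge_term u z k x)"

lemma gauge_eq:
  assumes "\<And>x. u x \<in> fil (-1)" shows "gauge br u z = gau u z"
proof
  fix x
  have z: "(1 / fact (Suc k)) *s ((\<lambda>v. - br (u x) v) ^^ k) (P2 br z u x) = 0" if "k \<notin> {..<2 * bd}" for k
    unfolding gauge_term_eq[symmetric] using that assms by (intro gauge_term_0) auto
  have "gauge br u z x = z x + (\<Sum>k<2 * bd. gauge_term u z (Suc k) x)"
    unfolding gauge_def gauge_term_eq using suminf_finite[OF finite_lessThan z] by simp
  also have "\<dots> = gau u z x"
    unfolding gau_def lessThan_Suc_atMost[symmetric] sum.lessThan_Suc_shift by simp
  finally show "gauge br u z x = gau u z x" .
qed

lemma loops_clinear: "clinear T \<Longrightarrow> u \<in> loops UNIV \<Longrightarrow> (\<lambda>x. T (u x)) \<in> loops UNIV"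
  by (rule loops_linear[OF clinear_bounded])

lemma clinear_scale_const: "clinear (\<lambda>x. b *s x)"
  by (intro clinearI) (auto simp: vec.scale_right_distrib mult.commute)

lemma gauge_term_in_loops: "u \<in> loops UNIV \<Longrightarrow> z \<in> loops UNIV \<Longrightarrow> gauge_term u z k \<in> loops UNIV"
proof (induction k)
  case (Suc k)
  have "(\<lambda>x. (if k = 0 then dx u x else 0)) \<in> loops UNIV" 
    using dx_in_loops[OF Suc.prems(1)] const_in_loops by (cases "k = 0") auto
  then show ?case using Suc
    by (auto simp only: gauge_term.simps intro!: loops_clinear[OF clinear_scale_const] loops_diff loops_br)
qed auto

lemma gau_in_loops: "u \<in> loops UNIV \<Longrightarrow> z \<in> loops UNIV \<Longrightarrow> gau u z \<in> loops UNIV"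
  unfolding gau_def by (intro loops_sum gauge_term_in_loops)

lemma diff_map_gauge_term:
  assumes "diff_map_vec M" "diff_map_vec N" shows "diff_map_vec (\<lambda>q. gauge_term (M q) (N q) k)"
proof (induction k)
  case (Suc k)
  have "diff_map_vec (\<lambda>q x. (if k = 0 then dx (M q) x else 0))" 
    using diff_map_vec_dx[OF assms(1)] diff_map_vec_const[OF const_in_loops[of 0]] by (cases "k = 0") auto
  then show ?case using Suc assms
    by (auto simp only: gauge_term.simps 
      intro!: diff_map_vec_linear[OF clinear_scale_const] diff_map_vec_diff diff_map_vec_br)
qed (simp add: assms)

lemma diff_map_gau: "diff_map_vec M \<Longrightarrow> diff_map_vec N \<Longrightarrow> diff_map_vec (\<lambda>q. gau (M q) (N q))"
  unfolding gau_def by (intro diff_map_vec_sum diff_map_gauge_term)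

section \<open>The affine space S, the slice Q and the gauge action of loops in m\<close>

abbreviation SS :: "(real \<Rightarrow> complex^'d) set" where "SS \<equiv> S_space br gr e l"
abbreviation QQ :: "(real \<Rightarrow> complex^'d) set" where "QQ \<equiv> Q_space br e f"

lemma SS_iff: "z \<in> SS \<longleftrightarrow> z \<in> loops UNIV \<and> (\<forall>x. z x - e \<in> \<bb>)"
  by (auto simp: S_space_def loops_iff[of _ "{v. v - e \<in> \<bb>}"])

lemma QQ_iff: "z \<in> QQ \<longleftrightarrow> z \<in> loops UNIV \<and> (\<forall>x. z x - e \<in> gf)"
  by (auto simp: Q_space_def slice_def loops_iff[of _ "{v. v - e \<in> gf}"])

lemma QQ_SS: "z \<in> QQ \<Longrightarrow> z \<in> SS"
  using gf_bb by (auto simp: QQ_iff SS_iff)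

lemma br_split_e: "br (z x) v = br e v + br (z x - e) v"
  by (simp add: br_simps)

lemma P2_bb:
  assumes z: "z \<in> SS" and u: "u \<in> loops \<mm>" shows "P2 br z u x \<in> \<bb>"
proof -
  have ux: "u x \<in> \<mm>" using u by (simp add: loops_def)
  have "dx u x \<in> \<mm>" using subspace_dx[OF mm_subspace u] by (simp add: loops_def)
  then have "dx u x \<in> fil 0" using mm_fil fil_mono[of "-1" 0] by auto
  then have "dx u x \<in> \<bb>" using fil_bb by auto
  moreover have "br e (u x) \<in> \<bb>" using e_mm_bb ux by auto
  moreover have "br (z x - e) (u x) \<in> \<bb>" using z ux mm_fil by (auto simp: SS_iff intro: s_mm_bb)
  ultimately show ?thesis unfolding P2_def br_split_e[of z x]
    by (intro vec.subspace_add bb_subspace)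
qed

text \<open>The first term is P2, where m being mapped into b by ad e is used. A further bracket of
  u, of degree at most -1, with b, of degree at most 1, lands in degree at most 0, and that is part
  of b.\<close>

lemma gauge_term_bb:
  assumes z: "z \<in> SS" and u: "u \<in> loops \<mm>" shows "gauge_term u z (Suc k) x \<in> \<bb>"
proof (induction k)
  case 0
  have "gauge_term u z (Suc 0) x = P2 br z u x"
    using br_skew[of "u x" "z x"] by (simp add: P2_def)
  then show ?case using P2_bb[OF z u] by simp
next
  case (Suc k)
  have "br (u x) (gauge_term u z (Suc k) x) \<in> fil (-1 + 1)"
    using Suc bb_fil u mm_fil by (intro fil_br) (auto simp: loops_def)
  then have "br (u x) (gauge_term u z (Suc k) x) \<in> \<bb>" using fil_bb by auto
  then show ?case by (subst gauge_term.simps) 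
    (auto intro!: vec.subspace_scale vec.subspace_neg bb_subspace simp del: gauge_term.simps)
qed

lemma gau_bb:
  assumes z: "z \<in> SS" and u: "u \<in> loops \<mm>" shows "gau u z x - e \<in> \<bb>"
proof -
  have "gau u z x - e = (z x - e) + (\<Sum>k<2 * bd. gauge_term u z (Suc k) x)"
    unfolding gau_def lessThan_Suc_atMost[symmetric] sum.lessThan_Suc_shift by simp
  also have "\<dots> \<in> \<bb>"
    using z gauge_term_bb[OF z u]
    by (intro vec.subspace_add vec.subspace_sum bb_subspace) (auto simp: SS_iff)
  finally show ?thesis .
qed

text \<open>The equation $\theta(\mathrm{gau}\,u\,z-e)=0$ for $u$ is solved by the iteration below, each
  step of which corrects one more degree of $u$.\<close>

definition step :: "(real \<Rightarrow> complex^'d) \<Rightarrow> (real \<Rightarrow> complex^'d) \<Rightarrow> real \<Rightarrow> complex^'d" where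
  "step z u = (\<lambda>x. u x - theta (gau u z x - e))"

lemma fil_dx: "u \<in> loops UNIV \<Longrightarrow> (\<And>x. u x \<in> fil k) \<Longrightarrow> dx u x \<in> fil k"
  using subspace_dx[OF fil_subspace, of u k] by (simp add: loops_def)

text \<open>The linearisation of the gauge action is ad e up to terms of lower degree:
  \<open>dx\<close> keeps the degree, z - e raises it by at most one instead of two, and every later
  term of the series carries an additional bracket with a loop of negative degree.\<close>

lemma gau_contraction:
  assumes z: "z \<in> SS" and u: "u \<in> loops \<mm>" and u': "u' \<in> loops \<mm>" and k: "k \<ge> 1"
    and d: "\<And>x. u x - u' x \<in> fil (- k)"
  shows "gau u z x - gau u' z x - br e (u x - u' x) \<in> fil (1 - k)"
proof -
  let ?d = "\<lambda>j. gauge_term u z j x - gauge_term u' z j x"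
  define \<delta> where "\<delta> = (\<lambda>x. u x - u' x)"
  have L: "u \<in> loops UNIV" "u' \<in> loops UNIV" using u u' by (auto intro: loops_UNIV)
  have \<delta>: "\<And>x. \<delta> x \<in> fil (- k)" "\<delta> \<in> loops UNIV" using d L by (auto simp: \<delta>_def intro: loops_diff)
  have "dx \<delta> x \<in> fil (- k)" by (rule fil_dx[OF \<delta>(2,1)])
  then have dd: "dx \<delta> x \<in> fil (1 - k)" using fil_mono[of "- k" "1 - k"] by auto
  have s: "br (z x - e) (\<delta> x) \<in> fil (1 - k)"
    using fil_br[of "z x - e" 1 "\<delta> x" "- k"] z bb_fil \<delta> by (auto simp: SS_iff)
  have d1: "?d (Suc 0) - br e (\<delta> x) = dx \<delta> x + br (z x - e) (\<delta> x)"
    using br_skew[of "u x" "z x"] br_skew[of "u' x" "z x"] 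
    by (simp add: \<delta>_def dx_diff L br_simps)
  have e: "br e (\<delta> x) \<in> fil (2 - k)"
    using fil_br[OF gr_fil[OF e_degree] \<delta>(1)[of x]] by simp
  have d1': "?d (Suc 0) - br e (\<delta> x) \<in> fil (1 - k)"
    unfolding d1 using dd s by (intro vec.subspace_add fil_subspace)
  have stp: "?d (Suc (Suc j)) \<in> fil (1 - k)" if "?d (Suc j) \<in> fil (2 - k)" for j
  proof -
    have "br (\<delta> x) (gauge_term u z (Suc j) x) \<in> fil (- k + 1)"
      using gauge_term_bb[OF z u, of j x] bb_fil \<delta> by (intro fil_br) auto
    moreover have "br (u' x) (?d (Suc j)) \<in> fil (-1 + (2 - k))"
      using that u' mm_fil by (intro fil_br) (auto simp: loops_def)
    ultimately have "br (\<delta> x) (gauge_term u z (Suc j) x) + br (u' x) (?d (Suc j)) \<in> fil (1 - k)"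
      by (intro vec.subspace_add fil_subspace) simp_all
    moreover have "?d (Suc (Suc j)) = (- (1 / of_nat (Suc (Suc j)))) *s
        (br (\<delta> x) (gauge_term u z (Suc j) x) + br (u' x) (?d (Suc j)))"
    proof -
      have "br (\<delta> x) (gauge_term u z (Suc j) x) + br (u' x) (?d (Suc j))
          = br (u x) (gauge_term u z (Suc j) x) - br (u' x) (gauge_term u' z (Suc j) x)"
        unfolding \<delta>_def by (simp only: br_simps) simp
      then show ?thesis
        unfolding gauge_term.simps(2)[of u z "Suc j"] gauge_term.simps(2)[of u' z "Suc j"]
        by (simp only: vec.scale_minus_left vec.scale_right_diff_distrib nat.simps if_False vec.scale_zero_right)
          (simp add: vec.scale_right_diff_distrib)
    qed
    ultimately show ?thesis by (metis fil_subspace vec.subspace_scale)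
  qed
  have up: "v \<in> fil (2 - k)" if "v \<in> fil (1 - k)" for v
    using that fil_mono[of "1 - k" "2 - k"] by auto
  have all: "?d (Suc j) \<in> fil (2 - k)" for j
  proof (induction j)
    case 0
    then show ?case using vec.subspace_add[OF fil_subspace up[OF d1'] e] by simp
  next
    case (Suc j)
    show ?case by (rule up[OF stp[OF Suc]])
  qed
  have b: "bd \<ge> 1" by (simp add: bd_def)
  have "gau u z x - gau u' z x = (\<Sum>j\<le>2 * bd. ?d j)"
    by (simp add: gau_def sum_subtractf)
  also have "\<dots> = ?d 0 + (?d (Suc 0) + (\<Sum>j<2 * bd - 1. ?d (Suc (Suc j))))"
  proof -
    obtain c where c: "2 * bd = Suc c" using b by (cases "2 * bd") auto
    show ?thesis unfolding c lessThan_Suc_atMost[symmetric] sum.lessThan_Suc_shift by simp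
  qed
  finally have "gau u z x - gau u' z x - br e (\<delta> x)
      = (?d (Suc 0) - br e (\<delta> x)) + (\<Sum>j<2 * bd - 1. ?d (Suc (Suc j)))" by (simp del: gauge_term.simps(2))
  also have "\<dots> \<in> fil (1 - k)"
    using d1' stp[OF all] by (intro vec.subspace_add vec.subspace_sum fil_subspace)
  finally show ?thesis by (simp add: \<delta>_def)
qed

text \<open>On m the map \<open>theta\<close> inverts ad e, so the leading part of the difference
  cancels; the remainder is lowered by two by \<open>theta\<close>, a net gain of one
  degree.\<close>

lemma step_contraction:
  assumes z: "z \<in> SS" and u: "u \<in> loops \<mm>" and u': "u' \<in> loops \<mm>" and k: "k \<ge> 1"
    and d: "\<And>x. u x - u' x \<in> fil (- k)"
  shows "step z u x - step z u' x \<in> fil (- k - 1)"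
proof -
  have "u x - u' x \<in> fil (-1)" using d[of x] fil_mono[of "- k" "-1"] k by auto
  then have "theta (br e (u x - u' x)) = u x - u' x" using fil_image_f by (intro theta_br_e) auto
  then have "step z u x - step z u' x = - theta (gau u z x - gau u' z x - br e (u x - u' x))"
    by (simp add: step_def theta_simps)
  moreover have "theta (gau u z x - gau u' z x - br e (u x - u' x)) \<in> fil (1 - k - 2)"
    by (rule theta_fil[OF gau_contraction[OF assms]])
  moreover have "1 - k - 2 = - k - 1" by simp
  ultimately show ?thesis using vec.subspace_neg[OF fil_subspace] by metis
qed

lemma step_mm: 
  assumes z: "z \<in> SS" and u: "u \<in> loops \<mm>" shows "step z u \<in> loops \<mm>"
proof -
  have "step z u \<in> loops UNIV" unfolding step_def
    using u z by (intro loops_diff loops_clinear[OF theta_linear] gau_in_loops const_in_loops)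
      (auto simp: SS_iff intro: loops_UNIV)
  moreover have "step z u x \<in> \<mm>" for x unfolding step_def
    using u theta_bb[OF gau_bb[OF z u]] by (intro vec.subspace_diff mm_subspace) (auto simp: loops_def)
  ultimately show ?thesis by (auto simp: loops_iff[of _ \<mm>])
qed

fun iter :: "(real \<Rightarrow> complex^'d) \<Rightarrow> nat \<Rightarrow> real \<Rightarrow> complex^'d" where
  "iter z 0 = (\<lambda>x. 0)"
| "iter z (Suc k) = step z (iter z k)"

lemma zero_mm: "(\<lambda>x. 0) \<in> loops \<mm>"
  using const_in_loops[of 0] vec.subspace_0[OF mm_subspace] by (auto simp: loops_iff[of _ \<mm>])

lemma iter_mm: "z \<in> SS \<Longrightarrow> iter z k \<in> loops \<mm>"
  by (induction k) (auto intro: step_mm zero_mm)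

lemma iter_converges: "z \<in> SS \<Longrightarrow> iter z (Suc k) x - iter z k x \<in> fil (- int k - 1)"
proof (induction k arbitrary: x)
  case 0
  then show ?case using iter_mm[of z 1] mm_fil by (auto simp: loops_def)
next
  case (Suc k)
  have "iter z (Suc k) y - iter z k y \<in> fil (- (int k + 1))" for y
    using Suc.IH[OF Suc.prems, of y] by (metis add_uminus_conv_diff minus_add_distrib)
  from step_contraction[OF Suc.prems iter_mm[OF Suc.prems] iter_mm[OF Suc.prems] _ this]
  show ?case by (simp add: algebra_simps)
qed

text \<open>Each iteration settles one further degree, and after \<open>bd\<close> of them the error
  lies in the zero part of the filtration.\<close>

definition sol :: "(real \<Rightarrow> complex^'d) \<Rightarrow> real \<Rightarrow> complex^'d" where
  "sol z = iter z bd"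

lemma sol_mm: "z \<in> SS \<Longrightarrow> sol z \<in> loops \<mm>"
  by (simp add: sol_def iter_mm)

lemma sol_fixed: "z \<in> SS \<Longrightarrow> step z (sol z) = sol z"
proof
  fix x assume z: "z \<in> SS"
  have "step z (sol z) x - sol z x \<in> fil (- int bd)"
    using iter_converges[OF z, of bd x] fil_mono[of "- int bd - 1" "- int bd"] by (auto simp: sol_def)
  then show "step z (sol z) x = sol z x" using fil_bot by fastforce
qed

lemma in_QQ_iff_step_fixed:
  assumes z: "z \<in> SS" and u: "u \<in> loops \<mm>"
  shows "gau u z \<in> QQ \<longleftrightarrow> step z u = u"
proof -
  have "gau u z \<in> loops UNIV" using z u by (intro gau_in_loops) (auto simp: SS_iff intro: loops_UNIV)
  then show ?thesis by (auto simp: QQ_iff step_def fun_eq_iff theta_eq_0_iff centralizer_def)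
qed

lemma step_fixed_unique:
  assumes z: "z \<in> SS" and u: "u \<in> loops \<mm>" "step z u = u" and u': "u' \<in> loops \<mm>" "step z u' = u'"
  shows "u = u'"
proof
  fix x
  have "u x - u' x \<in> fil (- int k - 1)" for k x
  proof (induction k arbitrary: x)
    case 0
    have "u x \<in> fil (-1)" "u' x \<in> fil (-1)" using u u' mm_fil by (auto simp: loops_def)
    then show ?case by (simp add: vec.subspace_diff fil_subspace)
  next
    case (Suc k)
    have "u y - u' y \<in> fil (- (int k + 1))" for y
      using Suc[of y] by (metis add_uminus_conv_diff minus_add_distrib)
    from step_contraction[OF z u(1) u'(1) _ this] show ?case
      by (simp add: u(2) u'(2) algebra_simps)
  qed
  from this[of x bd] show "u x = u' x" 
    using fil_mono[of "- int bd - 1" "- int bd"] fil_bot[of "u x - u' x"] by auto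
qed

text \<open>Loops in m that move z into Q are fixed points of \<open>step\<close>, of which there is
  only one; this also gives the uniqueness demanded by the description operator in
  \<open>rho\<close>.\<close>

lemma rho_eqI:
  assumes z: "z \<in> SS" and u: "u \<in> loops \<mm>" and q: "gau u z \<in> QQ"
  shows "rho br gr e f l z = gau u z"
  unfolding rho_def
proof (rule the_equality)
  have g: "gauge br u z = gau u z" if "u \<in> loops \<mm>" for u
    using that mm_fil by (intro gauge_eq) (auto simp: loops_def)
  show "gau u z \<in> QQ \<and> (\<exists>u'\<in>loops \<mm>. gau u z = gauge br u' z)"
    using q u g[OF u] by metis
  fix p assume "p \<in> QQ \<and> (\<exists>u'\<in>loops \<mm>. p = gauge br u' z)"
  then obtain u' where u': "u' \<in> loops \<mm>" "p = gau u' z" "p \<in> QQ" using g by auto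
  have "u' = u"
    by (rule step_fixed_unique[OF z]) (use u u' q z in \<open>auto simp: in_QQ_iff_step_fixed\<close>)
  then show "p = gau u z" using u' by simp
qed

lemma rho_eq: "z \<in> SS \<Longrightarrow> rho br gr e f l z = gau (sol z) z" "z \<in> SS \<Longrightarrow> gau (sol z) z \<in> QQ"
  using rho_eqI[of z "sol z"] by (simp_all add: sol_mm in_QQ_iff_step_fixed sol_fixed)

lemma gau_0: "gau (\<lambda>x. 0) z = z"
proof -
  have "gauge_term (\<lambda>x. 0) z (Suc k) x = 0" for k x
    by (simp add: dx_const br_simps)
  then show ?thesis
    unfolding gau_def lessThan_Suc_atMost[symmetric] sum.lessThan_Suc_shift
    by (simp del: gauge_term.simps(2))
qed

lemma rho_QQ: "z \<in> QQ \<Longrightarrow> rho br gr e f l z = z"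
  using rho_eqI[OF QQ_SS zero_mm, of z] by (simp add: gau_0)

lemma diff_map_iter: "diff_map_vec N \<Longrightarrow> diff_map_vec (\<lambda>q. iter (N q) k)"
proof (induction k)
  case 0
  then show ?case using diff_map_vec_const[OF const_in_loops[of 0]] by simp
next
  case (Suc k)
  then show ?case unfolding iter.simps step_def
    by (intro diff_map_vec_diff diff_map_vec_linear[OF theta_linear] diff_map_gau diff_map_vec_const
        const_in_loops) auto
qed

end

text \<open>The product rule for generating series in an auxiliary parameter: the factor k + 1 is
  distributed as i + (k + 1 - i) over the two factors.\<close>

lemma convolution_Leibniz:
  fixes g w :: "nat \<Rightarrow> complex^'d"
  assumes B: "\<And>y. clinear (\<lambda>x. B x y)" "\<And>x. clinear (B x)"
  shows "of_nat (Suc k) *s (\<Sum>i\<le>Suc k. B (g i) (w (Suc k - i)))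
    = (\<Sum>i\<le>k. B (of_nat (Suc i) *s g (Suc i)) (w (k - i)))
      + (\<Sum>i\<le>k. B (g i) (of_nat (Suc (k - i)) *s w (Suc (k - i))))"
proof -
  have "of_nat (Suc k) *s (\<Sum>i\<le>Suc k. B (g i) (w (Suc k - i)))
     = (\<Sum>i\<le>Suc k. of_nat i *s B (g i) (w (Suc k - i)) + of_nat (Suc k - i) *s B (g i) (w (Suc k - i)))"
    unfolding vec.scale_sum_right
    by (intro sum.cong refl, subst vec.scale_left_distrib[symmetric]) (simp flip: of_nat_add)
  also have "\<dots> = (\<Sum>i\<le>Suc k. of_nat i *s B (g i) (w (Suc k - i)))
      + (\<Sum>i\<le>Suc k. of_nat (Suc k - i) *s B (g i) (w (Suc k - i)))"
    by (rule sum.distrib)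
  also have "(\<Sum>i\<le>Suc k. of_nat i *s B (g i) (w (Suc k - i)))
      = (\<Sum>i\<le>k. B (of_nat (Suc i) *s g (Suc i)) (w (k - i)))"
    by (subst sum.atMost_Suc_shift) (simp add: clinear_simps[OF B(1)])
  also have "(\<Sum>i\<le>Suc k. of_nat (Suc k - i) *s B (g i) (w (Suc k - i)))
      = (\<Sum>i\<le>k. B (g i) (of_nat (Suc (k - i)) *s w (Suc (k - i))))"
  proof -
    have "(\<Sum>i\<le>k. of_nat (Suc k - i) *s B (g i) (w (Suc k - i)))
       = (\<Sum>i\<le>k. B (g i) (of_nat (Suc (k - i)) *s w (Suc (k - i))))"
      by (intro sum.cong refl) (simp add: Suc_diff_le clinear_simps[OF B(2)])
    then show ?thesis by simp
  qed
  finally show ?thesis .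
qed

context slice_data
begin

lemmas poly_family_br = poly_family_bilinear[OF bounded_bilinear_br]

lemma poly_family_clinear:
  "clinear T \<Longrightarrow> poly_family g u v \<Longrightarrow> poly_family (\<lambda>t x. T (g t x)) (\<lambda>x. T (u x)) (\<lambda>x. T (v x))"
  by (rule poly_family_linear[OF clinear_bounded])

section \<open>The projection $\rho$ is constant along $E$\<close>

text \<open>The terms $w_k$ of a loop $w=\sum_kw_k$ such that $P_2(p)(w)$ is the derivative of
  $p=\mathrm{gau}\,u\,z$ when $\dot z=P_2(z)(v)$ and $\dot u$ is given.\<close>

fun flow_term ::
  "(real \<Rightarrow> complex^'d) \<Rightarrow> (real \<Rightarrow> complex^'d) \<Rightarrow> (real \<Rightarrow> complex^'d) \<Rightarrow> nat \<Rightarrow> real \<Rightarrow> complex^'d" where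
  "flow_term u u' v 0 = v"
| "flow_term u u' v (Suc k) =
     (\<lambda>x. (1 / of_nat (Suc k)) *s ((if k = 0 then u' x else 0) - br (u x) (flow_term u u' v k x)))"

lemma flow_term_loops:
  "u \<in> loops UNIV \<Longrightarrow> u' \<in> loops UNIV \<Longrightarrow> v \<in> loops UNIV \<Longrightarrow> flow_term u u' v k \<in> loops UNIV"
proof (induction k)
  case (Suc k)
  have "(\<lambda>x. (if k = 0 then u' x else 0)) \<in> loops UNIV" 
    using Suc.prems const_in_loops by (cases "k = 0") auto
  then show ?case using Suc
    by (auto simp only: flow_term.simps intro!: loops_clinear[OF clinear_scale_const] loops_diff loops_br)
qed auto

text \<open>The infinitesimal equivariance of the gauge action, separated by degree. After
  multiplication by k + 1 the recursions of \<open>gauge_term\<close> and \<open>flow_term\<close>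
  can be inserted, and the Jacobi identity collects the iterated brackets with u into a bracket of u
  with the previous derivative.\<close>

lemma poly_family_gauge_term:
  assumes u: "poly_family U u u'" and z: "poly_family Z z (P2 br z v)" and v: "v \<in> loops UNIV"
  shows "poly_family (\<lambda>t. gauge_term (U t) (Z t) k) (gauge_term u z k)
    (\<lambda>x. dx (flow_term u u' v k) x + (\<Sum>i\<le>k. br (gauge_term u z i x) (flow_term u u' v (k - i) x)))"
proof (induction k)
  case 0
  show ?case using z by (simp add: P2_def)
next
  case (Suc k)
  let ?g = "gauge_term u z" and ?w = "flow_term u u' v"
  define y where "y k x = dx (?w k) x + (\<Sum>i\<le>k. br (?g i x) (?w (k - i) x))" for k x
  have L: "u \<in> loops UNIV" "u' \<in> loops UNIV" "z \<in> loops UNIV"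
    using poly_family_in_loops[OF u] poly_family_in_loops[OF z] by auto
  note wl = flow_term_loops[OF L(1,2) v]
  have 1: "poly_family (\<lambda>t x. if k = 0 then dx (U t) x else 0) (\<lambda>x. if k = 0 then dx u x else 0)
     (\<lambda>x. if k = 0 then dx u' x else 0)"
    using poly_family_dx[OF u] poly_family_const[OF const_in_loops[of "0::complex^'d"]] by (cases "k = 0") simp_all
  have "poly_family (\<lambda>t. gauge_term (U t) (Z t) (Suc k)) (?g (Suc k))
     (\<lambda>x. (1 / of_nat (Suc k)) *s ((if k = 0 then dx u' x else 0) - (br (u x) (y k x) + br (u' x) (?g k x))))"
    unfolding gauge_term.simps y_def
    by (intro poly_family_clinear[OF clinear_scale_const] poly_family_diff 1 poly_family_br u Suc.IH)
  moreover have "(1 / of_nat (Suc k)) *s ((if k = 0 then dx u' x else 0) - (br (u x) (y k x) + br (u' x) (?g k x)))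
      = y (Suc k) x" for x
  proof -
    have g: "of_nat (Suc i) *s ?g (Suc i) x = (if i = 0 then dx u x else 0) - br (u x) (?g i x)" for i
      by (simp del: of_nat_Suc)
    have w: "of_nat (Suc i) *s ?w (Suc i) x = (if i = 0 then u' x else 0) - br (u x) (?w i x)" for i
      by (simp del: of_nat_Suc)
    have dw: "of_nat (Suc k) *s dx (?w (Suc k)) x
        = (if k = 0 then dx u' x else 0) - (br (u x) (dx (?w k) x) + br (dx u x) (?w k x))"
    proof -
      have "dx (\<lambda>x. of_nat (Suc k) *s ?w (Suc k) x) x = of_nat (Suc k) *s dx (?w (Suc k)) x"
        by (simp only: dx_bounded_linear[OF clinear_bounded[OF clinear_scale_const] wl])
      moreover have "(\<lambda>x. of_nat (Suc k) *s ?w (Suc k) x) = (\<lambda>x. (if k = 0 then u' x else 0) - br (u x) (?w k x))"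
        by (rule ext) (simp del: of_nat_Suc)
      moreover have "dx (\<lambda>x. (if k = 0 then u' x else 0) - br (u x) (?w k x)) x
        = (if k = 0 then dx u' x else 0) - (br (u x) (dx (?w k) x) + br (dx u x) (?w k x))"
        using L v wl const_in_loops[of "0::complex^'d"]
        by (cases "k = 0") (simp_all add: dx_diff dx_br loops_br dx_uminus)
      ultimately show ?thesis by simp
    qed
    have "of_nat (Suc k) *s y (Suc k) x
      = of_nat (Suc k) *s dx (?w (Suc k)) x
        + (\<Sum>i\<le>k. br (of_nat (Suc i) *s ?g (Suc i) x) (?w (k - i) x))
        + (\<Sum>i\<le>k. br (?g i x) (of_nat (Suc (k - i)) *s ?w (Suc (k - i)) x))"
      unfolding y_def vec.scale_right_distrib
      using convolution_Leibniz[OF br_linear(2) br_linear(1), of k "\<lambda>i. ?g i x" "\<lambda>i. ?w i x"] by (simp only: add.assoc)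
    also have "(\<Sum>i\<le>k. br (of_nat (Suc i) *s ?g (Suc i) x) (?w (k - i) x))
       = br (dx u x) (?w k x) - (\<Sum>i\<le>k. br (br (u x) (?g i x)) (?w (k - i) x))"
    proof -
      have "(\<Sum>i\<le>k. br (if i = 0 then dx u x else 0) (?w (k - i) x)) 
         = (\<Sum>i\<le>k. if i = 0 then br (dx u x) (?w k x) else 0)"
        by (intro sum.cong) (auto simp: br_simps)
      then show ?thesis unfolding g by (simp add: br_simps sum_subtractf)
    qed
    also have "(\<Sum>i\<le>k. br (?g i x) (of_nat (Suc (k - i)) *s ?w (Suc (k - i)) x))
       = br (?g k x) (u' x) - (\<Sum>i\<le>k. br (?g i x) (br (u x) (?w (k - i) x)))"
    proof -
      have "(\<Sum>i\<le>k. br (?g i x) (if k - i = 0 then u' x else 0)) 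
         = (\<Sum>i\<le>k. if i = k then br (?g k x) (u' x) else 0)"
        by (intro sum.cong) (auto simp: br_simps)
      then show ?thesis unfolding w by (simp add: br_simps sum_subtractf)
    qed
    also have "of_nat (Suc k) *s dx (?w (Suc k)) x
        + (br (dx u x) (?w k x) - (\<Sum>i\<le>k. br (br (u x) (?g i x)) (?w (k - i) x)))
        + (br (?g k x) (u' x) - (\<Sum>i\<le>k. br (?g i x) (br (u x) (?w (k - i) x))))
      = (if k = 0 then dx u' x else 0) - (br (u x) (y k x) + br (u' x) (?g k x))"
    proof -
      have "br (u x) (\<Sum>i\<le>k. br (?g i x) (?w (k - i) x))
        = (\<Sum>i\<le>k. br (br (u x) (?g i x)) (?w (k - i) x)) + (\<Sum>i\<le>k. br (?g i x) (br (u x) (?w (k - i) x)))"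
        unfolding br_simps(6) by (simp only: jacobi[of "u x"] sum.distrib)
      then show ?thesis
        unfolding dw y_def using br_skew[of "u' x" "?g k x"] by (simp add: br_simps(1))
    qed
    finally show ?thesis by (metis (no_types, lifting) divide_inverse mult_1 vec.scale_one vec.scale_scale 
          left_inverse of_nat_eq_0_iff nat.distinct(1))
  qed
  ultimately show ?case by (simp only: y_def)
qed

lemma flow_term_mm:
  assumes "u \<in> loops \<mm>" "u' \<in> loops \<mm>" "v \<in> loops \<mm>"
  shows "flow_term u u' v k x \<in> \<mm>"
proof -
  have m: "u x \<in> \<mm>" "u' x \<in> \<mm>" "v x \<in> \<mm>" using assms by (auto simp: loops_def)
  show ?thesis
  proof (induction k)
    case (Suc k)
    have "br (u x) (flow_term u u' v k x) \<in> \<mm>" using m Suc mm_fil by (intro mm_br) auto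
    then have "(if k = 0 then u' x else 0) - br (u x) (flow_term u u' v k x) \<in> \<mm>"
      using m vec.subspace_0[OF mm_subspace] by (intro vec.subspace_diff mm_subspace) simp_all
    then show ?case by (simp only: flow_term.simps) (intro vec.subspace_scale mm_subspace)
  qed (use m in simp)
qed

lemma flow_term_fil:
  assumes "u \<in> loops \<mm>" "u' \<in> loops \<mm>" "v \<in> loops \<mm>"
  shows "flow_term u u' v (Suc k) x \<in> fil (- 1 - int k)"
proof (induction k)
  case 0
  then show ?case using flow_term_mm[OF assms, of "Suc 0" x] mm_fil by auto
next
  case (Suc k)
  have "br (u x) (flow_term u u' v (Suc k) x) \<in> fil (-1 + (-1 - int k))"
    using assms mm_fil Suc by (intro fil_br) (auto simp: loops_def)
  moreover have "-1 + (-1 - int k) = - 1 - int (Suc k)" by simp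
  ultimately have "br (u x) (flow_term u u' v (Suc k) x) \<in> fil (- 1 - int (Suc k))" by metis
  then have "(1 / of_nat (Suc (Suc k))) *s (0 - br (u x) (flow_term u u' v (Suc k) x)) \<in> fil (- 1 - int (Suc k))"
    by (intro vec.subspace_scale vec.subspace_diff vec.subspace_0 fil_subspace)
  then show ?case by (simp only: flow_term.simps(2)[of _ _ _ "Suc k"] nat.simps if_False)
qed

lemma flow_term_0:
  assumes "u \<in> loops \<mm>" "u' \<in> loops \<mm>" "v \<in> loops \<mm>" "k > bd"
  shows "flow_term u u' v k x = 0"
proof -
  obtain j where k: "k = Suc j" using assms(4) by (cases k) auto
  have "flow_term u u' v k x \<in> fil (- int bd)"
    using flow_term_fil[OF assms(1-3), of j x] fil_mono[of "- 1 - int j" "- int bd"] assms(4) k by auto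
  then show ?thesis by (rule fil_bot)
qed

text \<open>Summation of the graded identities: the antidiagonal sums recombine into the bracket of
  the full gauge transform with w. That w takes values in m is what transversality later
  needs.\<close>

lemma poly_family_gau:
  assumes U: "poly_family U u u'" "\<And>t. U t \<in> loops \<mm>" and u: "u \<in> loops \<mm>" "u' \<in> loops \<mm>"
    and z: "poly_family Z z (P2 br z v)" and v: "v \<in> loops \<mm>"
  obtains w where "w \<in> loops \<mm>" "poly_family (\<lambda>t. gau (U t) (Z t)) (gau u z) (P2 br (gau u z) w)"
proof -
  let ?g = "gauge_term u z" and ?w = "flow_term u u' v"
  define y where "y k x = dx (?w k) x + (\<Sum>i\<le>k. br (?g i x) (?w (k - i) x))" for k x
  define w where "w x = (\<Sum>k\<le>bd. ?w k x)" for x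
  have vl: "v \<in> loops UNIV" using v by (rule loops_UNIV)
  have wl: "?w k \<in> loops UNIV" for k using u v by (intro flow_term_loops) (auto intro: loops_UNIV)
  have y: "poly_family (\<lambda>t. gauge_term (U t) (Z t) k) (?g k) (y k)" for k
    using poly_family_gauge_term[OF U(1) z vl, of k] by (simp add: y_def[abs_def])
  have g0: "?g k x = 0" if "k > 2 * bd" for k x
  proof (rule gauge_term_0[OF _ that])
    show "u x \<in> fil (-1)" using u mm_fil by (auto simp: loops_def)
  qed
  \<comment> \<open>Beyond \<open>2 * bd\<close> the whole family vanishes, so its derivative does
    too; no direct estimate of the convolution is made.\<close>
  have y0: "y k x = 0" if k: "k > 2 * bd" for k x
  proof -
    have "gauge_term (U t) (Z t) k x = 0" for t
      using gauge_term_0[OF _ k, of "U t"] U(2)[of t] mm_fil by (auto simp: loops_def)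
    then have "((\<lambda>t::real. 0::complex^'d) has_vector_derivative y k x) (at 0)"
      using poly_family_has_derivative[OF y[of k], of x] by simp
    then show ?thesis using vector_derivative_unique_at has_vector_derivative_const by blast
  qed
  have dw0: "dx (?w k) x = 0" if "k > bd" for k x
  proof -
    have "?w k = (\<lambda>x. 0)" using flow_term_0[OF u v that] by auto
    then show ?thesis by (simp add: dx_const)
  qed
  have w: "w \<in> loops \<mm>"
    using flow_term_mm[OF u v] wl
    by (auto simp: w_def[abs_def] loops_iff[of _ \<mm>] intro!: loops_sum vec.subspace_sum mm_subspace)
  have "(\<Sum>k\<le>2 * bd. y k x) = P2 br (gau u z) w x" for x
  proof -
    \<comment> \<open>The range is enlarged to \<open>2 * bd + bd\<close> so that every product of a
      nonzero gauge term with a nonzero flow term lies on one of the antidiagonals.\<close>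
    have "(\<Sum>k\<le>2 * bd. y k x) = (\<Sum>k\<le>2 * bd + bd. y k x)"
      using y0 by (intro sum.mono_neutral_left) auto
    also have "\<dots> = (\<Sum>k\<le>2 * bd + bd. dx (?w k) x) + (\<Sum>k\<le>2 * bd + bd. \<Sum>i\<le>k. br (?g i x) (?w (k - i) x))"
      unfolding y_def by (rule sum.distrib)
    also have "(\<Sum>k\<le>2 * bd + bd. dx (?w k) x) = (\<Sum>k\<le>bd. dx (?w k) x)"
      using dw0 by (intro sum.mono_neutral_right) auto
    also have "\<dots> = dx w x" unfolding w_def[abs_def] using wl by (simp add: dx_sum)
    also have "(\<Sum>k\<le>2 * bd + bd. \<Sum>i\<le>k. br (?g i x) (?w (k - i) x))
       = (\<Sum>i\<le>2 * bd. \<Sum>j\<le>bd. br (?g i x) (?w j x))"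
      by (rule sum_antidiagonal) (use g0 flow_term_0[OF u v] in \<open>auto simp: br_simps\<close>)
    also have "\<dots> = br (gau u z x) (w x)" unfolding gau_def w_def 
      by (simp only: clinear_sum[OF br_linear(1)] clinear_sum[OF br_linear(2)]) (rule sum.swap)
    finally show ?thesis by (simp add: P2_def)
  qed
  then have eq: "(\<lambda>x. \<Sum>k\<le>2 * bd. y k x) = P2 br (gau u z) w" by auto
  have "poly_family (\<lambda>t. gau (U t) (Z t)) (gau u z) (P2 br (gau u z) w)"
    unfolding eq[symmetric] unfolding gau_def by (intro poly_family_sum y)
  with w show ?thesis using that by blast
qed

text \<open>Applying \<open>theta\<close> turns tangency into the equation w = - theta(w_x +
  [p - e, w]). The right side has lower degree than w because p - e has degree at most 0 on Q, so w
  descends through the filtration to 0.\<close>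

lemma transversal:
  assumes p: "p \<in> QQ" and w: "w \<in> loops \<mm>" and d: "\<And>x. P2 br p w x \<in> gf"
  shows "w x = 0"
proof -
  have wl: "w \<in> loops UNIV" using w by (rule loops_UNIV)
  have wm: "w x \<in> \<mm>" for x using w by (simp add: loops_def)
  have eq: "w x = - theta (dx w x + br (p x - e) (w x))" for x
  proof -
    have "theta (P2 br p w x) = 0" using d by (simp add: theta_eq_0_iff centralizer_def)
    moreover have "theta (br e (w x)) = w x" using wm mm_image_f by (intro theta_br_e) auto
    ultimately have "w x + theta (dx w x + br (p x - e) (w x)) = 0"
      unfolding P2_def br_split_e[of p x] by (simp add: theta_simps add.left_commute)
    then show ?thesis by (simp add: eq_neg_iff_add_eq_0)
  qed
  have "w x \<in> fil (- int k)" for k x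
  proof (induction k arbitrary: x)
    case 0
    then show ?case using wm mm_fil fil_mono[of "-1" 0] by auto
  next
    case (Suc k)
    have "br (p x - e) (w x) \<in> fil (0 + - int k)"
      using p gf_fil Suc by (intro fil_br) (auto simp: QQ_iff)
    then have "dx w x + br (p x - e) (w x) \<in> fil (- int k)"
      using fil_dx[OF wl Suc] by (intro vec.subspace_add fil_subspace) auto
    then have "theta (dx w x + br (p x - e) (w x)) \<in> fil (- int (Suc k))"
      using theta_fil fil_mono[of "- int k - 2" "- int (Suc k)"] by fastforce
    then show ?case by (subst eq) (intro vec.subspace_neg fil_subspace)
  qed
  then show ?thesis using fil_bot by blast
qed

lemma poly_family_subspace:
  assumes g: "poly_family g u v" and V: "vec.subspace (V :: (complex^'d) set)" and m: "\<And>t x. g t x \<in> V"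
  shows "u x \<in> V" "v x \<in> V"
proof -
  show "u x \<in> V" using m[of 0 x] poly_family_at_0[OF g] by simp
  obtain p where p: "clinear p" "\<And>v. p v \<in> V" "\<And>v. v \<in> V \<Longrightarrow> p v = v"
    using linear_projection_exists[OF V] by blast
  have "p (v x) = v x"
    by (rule poly_family_derivative_linear_constraint[OF g clinear_bounded[OF p(1)] _ bounded_linear_ident])
      (simp add: p m)
  then show "v x \<in> V" using p(2) by metis
qed

text \<open>Only the existence of a first-order coefficient matters; its value never has to be
  computed, since transversality decides the derivative of \<rho>.\<close>

lemma poly_family_iter:
  assumes Z: "poly_family Z z z'" shows "\<exists>u'. poly_family (\<lambda>t. iter (Z t) k) (iter z k) u'"
proof (induction k)
  case 0
  then show ?case using poly_family_const[OF const_in_loops[of 0]] by auto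
next
  case (Suc k)
  then obtain u' where u': "poly_family (\<lambda>t. iter (Z t) k) (iter z k) u'" by blast
  have "\<exists>y. poly_family (\<lambda>t. gauge_term (iter (Z t) k) (Z t) j) (gauge_term (iter z k) z j) y" for j
  proof (induction j)
    case 0
    then show ?case using Z by auto
  next
    case (Suc j)
    then obtain y where y: "poly_family (\<lambda>t. gauge_term (iter (Z t) k) (Z t) j) (gauge_term (iter z k) z j) y"
      by blast
    have 1: "\<exists>b. poly_family (\<lambda>t x. if j = 0 then dx (iter (Z t) k) x else 0)
       (\<lambda>x. if j = 0 then dx (iter z k) x else 0) b"
      using poly_family_dx[OF u'] poly_family_const[OF const_in_loops[of "0::complex^'d"]] by (cases "j = 0") auto
    then obtain b where b: "poly_family (\<lambda>t x. if j = 0 then dx (iter (Z t) k) x else 0)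
       (\<lambda>x. if j = 0 then dx (iter z k) x else 0) b" by blast
    show ?case unfolding gauge_term.simps
      by (rule exI, rule poly_family_clinear[OF clinear_scale_const], rule poly_family_diff[OF b], 
          rule poly_family_br[OF u' y])
  qed
  then have "\<forall>j. \<exists>y. poly_family (\<lambda>t. gauge_term (iter (Z t) k) (Z t) j) (gauge_term (iter z k) z j) y"
    by blast
  from choice[OF this] obtain y where
    y: "\<And>j. poly_family (\<lambda>t. gauge_term (iter (Z t) k) (Z t) j) (gauge_term (iter z k) z j) (y j)"
    by blast
  have e: "poly_family (\<lambda>t x. e) (\<lambda>x. e) (\<lambda>x. 0)" by (rule poly_family_const[OF const_in_loops])
  show ?case unfolding iter.simps step_def gau_def
    by (rule exI, rule poly_family_diff[OF u'], rule poly_family_clinear[OF theta_linear], 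
        rule poly_family_diff[OF _ e], rule poly_family_sum[OF y])
qed

text \<open>Along a direction P2(z)(v) with v in m the projected point p moves by P2(p)(w) with w in
  m, and it stays in Q. Transversality forces w = 0.\<close>

lemma rho_flat:
  assumes Z: "poly_family Z z (P2 br z v)" "\<And>t. Z t \<in> SS" and v: "v \<in> loops \<mm>"
  shows "poly_family (\<lambda>t. gau (sol (Z t)) (Z t)) (gau (sol z) z) (\<lambda>x. 0)"
proof -
  have z: "z \<in> SS" using Z(2)[of 0] poly_family_at_0[OF Z(1)] by simp
  obtain u' where u': "poly_family (\<lambda>t. sol (Z t)) (sol z) u'"
    using poly_family_iter[OF Z(1)] unfolding sol_def by blast
  have m: "sol (Z t) x \<in> \<mm>" for t x using sol_mm[OF Z(2)] by (auto simp: loops_def)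
  have um: "sol z \<in> loops \<mm>" "u' \<in> loops \<mm>"
    using poly_family_subspace[OF u' mm_subspace m] poly_family_in_loops[OF u'] by (auto simp: loops_iff[of _ \<mm>])
  obtain w where w: "w \<in> loops \<mm>"
    "poly_family (\<lambda>t. gau (sol (Z t)) (Z t)) (gau (sol z) z) (P2 br (gau (sol z) z) w)"
    using poly_family_gau[OF u' sol_mm[OF Z(2)] um Z(1) v] by blast
  have "gau (sol (Z t)) (Z t) x - e \<in> gf" for t x using rho_eq(2)[OF Z(2)] by (auto simp: QQ_iff)
  from poly_family_subspace(2)[OF poly_family_diff[OF w(2) poly_family_const[OF const_in_loops]] gf_subspace this]
  have "P2 br (gau (sol z) z) w x \<in> gf" for x by simp
  then have "w = (\<lambda>x. 0)" using transversal[OF rho_eq(2)[OF z] w(1)] by auto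
  then have "P2 br (gau (sol z) z) w = (\<lambda>x. 0)" by (simp add: P2_def dx_const br_simps)
  with w(2) show ?thesis by simp
qed

section \<open>Existence of extensions\<close>

definition proj_b :: "complex^'d \<Rightarrow> complex^'d" where
  "proj_b = (SOME p. clinear p \<and> (\<forall>v. p v \<in> \<bb>) \<and> (\<forall>u\<in>\<bb>. p u = u))"

lemma proj_b: "clinear proj_b" "proj_b v \<in> \<bb>" "u \<in> \<bb> \<Longrightarrow> proj_b u = u"
proof -
  have "\<exists>p. clinear p \<and> (\<forall>v. p v \<in> \<bb>) \<and> (\<forall>u\<in>\<bb>. p u = u)"
    using linear_projection_exists[OF bb_subspace] by metis
  from someI_ex[OF this] show "clinear proj_b" "proj_b v \<in> \<bb>" "u \<in> \<bb> \<Longrightarrow> proj_b u = u"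
    by (auto simp: proj_b_def)
qed

definition proj_l :: "complex^'d \<Rightarrow> complex^'d" where
  "proj_l = (SOME p. clinear p \<and> (\<forall>v. p v \<in> l) \<and> (\<forall>u\<in>l. p u = u))"

lemma proj_l: "clinear proj_l" "proj_l v \<in> l" "u \<in> l \<Longrightarrow> proj_l u = u"
proof -
  have "\<exists>p. clinear p \<and> (\<forall>v. p v \<in> l) \<and> (\<forall>u\<in>l. p u = u)"
    using linear_projection_exists[OF l_subspace(1)] by metis
  from someI_ex[OF this] show "clinear proj_l" "proj_l v \<in> l" "u \<in> l \<Longrightarrow> proj_l u = u"
    by (auto simp: proj_l_def)
qed

text \<open>Reads off from \<open>[e, v] + \<dots>\<close> the class of the degree \<open>-1\<close> part of \<open>v \<in> \<nn>\<close> modulo \<open>l\<close>.\<close>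

definition kap :: "complex^'d \<Rightarrow> complex^'d" where
  "kap y = pr (-1) (theta y) - proj_l (pr (-1) (theta y))"

lemma kap_linear: "clinear kap"
  unfolding kap_def
  by (intro clinearI) (auto simp: theta_simps pr_simps clinear_simps[OF proj_l(1)] vec.scale_right_diff_distrib)

lemma kap_bb: "y \<in> \<bb> \<Longrightarrow> kap y = 0"
  using theta_bb[of y] by (simp add: kap_def mm_eq proj_l(3))

lemma kap_gr: "kap y \<in> gr (-1)"
  unfolding kap_def using proj_l(2) l_subspace(2) pr_in_gr
  by (intro vec.subspace_diff gr_subspace) auto

lemma kap_fil: "kap y \<in> fil (-1)" using gr_fil[OF kap_gr] .

text \<open>The terms v_x and [z - e, v] have degree at most 0, and \<open>theta\<close> sends them
  below degree -1. Hence \<open>theta\<close> recovers the degree -1 part of v exactly, and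
  \<open>kap\<close> its component complementary to l.\<close>

lemma kap_P2:
  assumes z: "z \<in> SS" and v: "v \<in> loops \<nn>"
  shows "v x - kap (P2 br z v x) \<in> \<mm>"
proof -
  have vl: "v \<in> loops UNIV" and vn: "\<And>x. v x \<in> \<nn>" using v by (auto simp: loops_def)
  have vf: "v x \<in> fil (-1)" for x using vn nn_fil by auto
  have "dx v x \<in> fil 0" using fil_dx[OF vl vf, of x] fil_mono[of "-1" 0] by auto
  moreover have "br (z x - e) (v x) \<in> fil 0"
    using fil_br[of "z x - e" 1 "v x" "-1"] z bb_fil vf by (auto simp: SS_iff)
  ultimately have "dx v x + br (z x - e) (v x) \<in> fil 0" by (intro vec.subspace_add fil_subspace)
  from theta_fil[OF this] have "pr (-1) (theta (dx v x + br (z x - e) (v x))) = 0" by (simp add: fil_def)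
  moreover have "theta (br e (v x)) = v x" using vf fil_image_f by (intro theta_br_e) auto
  ultimately have "pr (-1) (theta (P2 br z v x)) = pr (-1) (v x)"
    unfolding P2_def br_split_e[of z x] by (simp add: theta_simps pr_simps)
  then have k: "kap (P2 br z v x) = pr (-1) (v x) - proj_l (pr (-1) (v x))" by (simp add: kap_def)
  have "pr (-1) (v x - kap (P2 br z v x)) = proj_l (pr (-1) (v x))"
    unfolding k using pr_gr[OF pr_in_gr[of "-1"]] pr_gr[of "proj_l (pr (-1) (v x))" "-1" "-1"] proj_l(2) l_subspace(2)
    by (auto simp: pr_simps)
  then show ?thesis
    using proj_l(2) vf[of x] kap_fil vec.subspace_diff[OF fil_subspace] by (auto simp: mm_eq)
qed

text \<open>A linear projection alone need not carry D into E. Subtracting P2 of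
  \<open>kap (q - e)\<close> changes a direction P2(z)(v) with v in n into P2(z)(v - kap ...) with
  argument in m. On S the correction vanishes, since \<open>kap\<close> kills b.\<close>

definition retract :: "(real \<Rightarrow> complex^'d) \<Rightarrow> real \<Rightarrow> complex^'d" where
  "retract q = (\<lambda>x. e + proj_b (q x - e - P2 br q (\<lambda>x. kap (q x - e)) x))"

lemma retract_diff_map: "diff_map_vec retract"
  unfolding retract_def P2_def
  by (intro diff_map_vec_add diff_map_vec_diff diff_map_vec_linear[OF proj_b(1)] diff_map_vec_br diff_map_vec_dx
    diff_map_vec_linear[OF kap_linear] diff_map_vec_const[OF const_in_loops] diff_map_vec_id)

lemma retract_SS: "q \<in> loops UNIV \<Longrightarrow> retract q \<in> SS"
  using diff_map_vec_in_loops[OF retract_diff_map] proj_b(2) by (auto simp: SS_iff retract_def)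

lemma retract_id: 
  assumes "z \<in> SS" shows "retract z = z"
proof -
  have "(\<lambda>x. kap (z x - e)) = (\<lambda>x. 0)" using assms by (auto simp: SS_iff kap_bb)
  then show ?thesis using assms by (auto simp: SS_iff retract_def P2_def dx_const br_simps proj_b(3))
qed

lemma retract_derivative:
  assumes z: "z \<in> SS" and v: "v \<in> loops \<nn>"
  obtains v' where "v' \<in> loops \<mm>"
    "poly_family (\<lambda>t. retract (\<lambda>x. z x + t *\<^sub>R P2 br z v x)) z (P2 br z v')"
proof -
  define d where "d = P2 br z v"
  \<comment> \<open>The first-order effect of the correction term: the part of v outside m is
    removed from the argument of P2.\<close>
  define v' where "v' = (\<lambda>x. v x - kap (d x))"
  have zl: "z \<in> loops UNIV" and vl: "v \<in> loops UNIV" using z v by (auto simp: SS_iff intro: loops_UNIV)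
  have dl: "d \<in> loops UNIV" unfolding d_def P2_def using zl vl by (intro loops_add dx_in_loops loops_br)
  have kl: "(\<lambda>x. kap (d x)) \<in> loops UNIV" using dl by (rule loops_clinear[OF kap_linear])
  have v': "v' \<in> loops \<mm>" unfolding v'_def loops_iff[of _ \<mm>]
    using kap_P2[OF z v] loops_diff[OF vl kl] by (auto simp: d_def)
  have q: "poly_family (\<lambda>t x. z x + t *\<^sub>R d x) z d" by (rule poly_family_affine[OF zl dl])
  have c: "poly_family (\<lambda>t x. e) (\<lambda>x. e) (\<lambda>x. 0)" by (rule poly_family_const[OF const_in_loops])
  have y: "poly_family (\<lambda>t x. z x + t *\<^sub>R d x - e) (\<lambda>x. z x - e) d"
    using poly_family_diff[OF q c] by simp
  have k0: "(\<lambda>x. kap (z x - e)) = (\<lambda>x. 0)" using z by (auto simp: SS_iff kap_bb)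
  have k: "poly_family (\<lambda>t x. kap (z x + t *\<^sub>R d x - e)) (\<lambda>x. 0) (\<lambda>x. kap (d x))"
    using poly_family_clinear[OF kap_linear y] by (simp add: k0)
  have "poly_family (\<lambda>t. retract (\<lambda>x. z x + t *\<^sub>R d x)) 
     (\<lambda>x. e + proj_b (z x - e - (dx (\<lambda>x. 0) x + br (z x) 0)))
     (\<lambda>x. 0 + proj_b (d x - (dx (\<lambda>x. kap (d x)) x + (br (z x) (kap (d x)) + br (d x) 0))))"
    unfolding retract_def P2_def
    by (intro poly_family_add c poly_family_clinear[OF proj_b(1)] poly_family_diff[OF y] poly_family_dx[OF k]
      poly_family_br[OF q k])
  moreover have "(\<lambda>x. e + proj_b (z x - e - (dx (\<lambda>x. 0) x + br (z x) 0))) = z"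
    using z by (auto simp: SS_iff dx_const br_simps proj_b(3))
  moreover have "0 + proj_b (d x - (dx (\<lambda>x. kap (d x)) x + (br (z x) (kap (d x)) + br (d x) 0))) = P2 br z v' x" for x
  proof -
    have "d x - (dx (\<lambda>x. kap (d x)) x + (br (z x) (kap (d x)) + br (d x) 0)) = P2 br z v' x"
      unfolding v'_def P2_def dx_diff[OF vl kl] by (simp add: br_simps) (simp add: d_def P2_def)
    then show ?thesis using P2_bb[OF z v', of x] by (simp add: proj_b(3))
  qed
  ultimately show ?thesis using that[OF v'] by (simp add: d_def)
qed

section \<open>Coordinates and local functionals\<close>

definition cc :: "complex^'d \<Rightarrow> nat \<Rightarrow> complex" where "cc = coords br e \<xi>'"

lemma cc: "cc v i = killing br (v - e) (\<xi>' i)"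
  by (simp add: cc_def coords_def)

lemma jet_of_cc: "jet_of cc z x = (\<lambda>k r. (dx ^^ r) (\<lambda>y. killing br (z y - e) (\<xi>' k)) x)"
  by (simp add: jet_of_def cc)

lemma density_diff_map:
  assumes "density K p" and N: "diff_map_vec N"
  shows "diff_map (\<lambda>q x. p x (jet_of cc (N q) x))"
  using assms(1)
proof induction
  case (jet_var k r)
  have "diff_map (\<lambda>q y. killing br (N q y - e) (\<xi>' k))"
    by (rule diff_map_functional[where \<Phi> = "\<lambda>v. killing br v (\<xi>' k)"])
      (auto simp: killing_simps intro!: diff_map_vec_diff N diff_map_vec_const const_in_loops)
  then show ?case unfolding jet_of_cc by (rule diff_map_dxs)
qed (auto intro: diff_map.intros)

lemma density_flat:
  assumes "density K p" and R: "poly_family R r (\<lambda>x. 0)"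
  shows "poly_family (\<lambda>t x. p x (jet_of cc (R t) x)) (\<lambda>x. p x (jet_of cc r x)) (\<lambda>x. 0)"
  using assms(1)
proof induction
  case (coefficient \<eta>)
  then show ?case by (rule poly_family_const)
next
  case (jet_var k j)
  have "poly_family (\<lambda>t x. R t x - e) (\<lambda>x. r x - e) (\<lambda>x. 0)"
    using poly_family_diff[OF R poly_family_const[OF const_in_loops]] by simp
  from poly_family_linear[OF bounded_linear_killing this]
  have "poly_family (\<lambda>t x. killing br (R t x - e) (\<xi>' k)) (\<lambda>x. killing br (r x - e) (\<xi>' k)) (\<lambda>x. 0)"
    by (simp add: killing_simps)
  moreover have "(dx ^^ j) (\<lambda>x. 0::complex) = (\<lambda>x. 0)" by (induction j) (auto simp: dx_const)
  ultimately show ?case using poly_family_dxs[of _ _ _ j] unfolding jet_of_cc by metis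
next
  case (add p q)
  then show ?case using poly_family_add[OF add.IH] by simp
next
  case (mult p q)
  then show ?case using poly_family_mult[OF mult.IH] by simp
qed

text \<open>On S the retraction is the identity, which gives the values. Along D it moves in a
  direction of E, where \<rho> is flat to first order, which gives the constancy.\<close>

lemma extension_exists:
  assumes "local_functional cc K QQ \<phi>"
  shows "\<exists>F. extension br gr e f l \<phi> F"
proof -
  obtain p where p: "density K p" "\<And>z. z \<in> QQ \<Longrightarrow> \<phi> z = circle_int (\<lambda>x. p x (jet_of cc z x))"
    using assms by (auto simp: local_functional_def)
  define R where "R q = gau (sol (retract q)) (retract q)" for q
  define F where "F q = circle_int (\<lambda>x. p x (jet_of cc (R q) x))" for q
  have "diff_map_vec R" unfolding R_def[abs_def] sol_def
    by (intro diff_map_gau diff_map_iter retract_diff_map)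
  then have "functional br F" unfolding F_def[abs_def]
    by (intro functional_diff_map density_diff_map[OF p(1)])
  moreover have "F z = \<phi> (rho br gr e f l z)" if "z \<in> SS" for z
    using that p(2)[OF rho_eq(2)[OF that]] by (simp add: F_def R_def retract_id rho_eq(1))
  moreover have "((\<lambda>t::real. F (\<lambda>x. z x + t *\<^sub>R d x)) has_vector_derivative 0) (at 0)"
    if z: "z \<in> SS" and d: "d \<in> D_dist br gr e l z" for z d
  proof -
    obtain v where v: "v \<in> loops \<nn>" "d = P2 br z v" using d by (auto simp: D_dist_def)
    obtain v' where v': "v' \<in> loops \<mm>" 
      "poly_family (\<lambda>t. retract (\<lambda>x. z x + t *\<^sub>R P2 br z v x)) z (P2 br z v')"
      using retract_derivative[OF z v(1)] by blast
    have zl: "z \<in> loops UNIV" using z by (simp add: SS_iff)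
    have dl: "P2 br z v \<in> loops UNIV" unfolding P2_def using zl loops_UNIV[OF v(1)] 
      by (intro loops_add dx_in_loops loops_br)
    have "poly_family (\<lambda>t. R (\<lambda>x. z x + t *\<^sub>R d x)) (gau (sol z) z) (\<lambda>x. 0)"
      unfolding R_def v(2)
      by (rule rho_flat[OF v'(2) _ v'(1)]) (intro retract_SS loops_add zl loops_scaleR dl)
    from poly_family_circle_int[OF density_flat[OF p(1) this]]
    show ?thesis unfolding F_def by simp
  qed
  ultimately show ?thesis unfolding extension_def by blast
qed


section \<open>The reduced bracket\<close>

text \<open>P2 + \<open>lam\<close> P1 is P2 with the constant \<open>lam\<close> a added to q, so
  the whole pencil is handled as one operator.\<close>

definition pen :: "complex \<Rightarrow> (real \<Rightarrow> complex^'d) \<Rightarrow> (real \<Rightarrow> complex^'d) \<Rightarrow> real \<Rightarrow> complex^'d" where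
  "pen lam q v = (\<lambda>x. dx v x + br (q x + lam *s a) (v x))"

lemma pen_P2: "pen lam q v x = P2 br q v x + lam *s br a (v x)"
  by (simp add: pen_def P2_def br_simps)

lemma pen_in_loops: "q \<in> loops UNIV \<Longrightarrow> v \<in> loops UNIV \<Longrightarrow> pen lam q v \<in> loops UNIV"
  unfolding pen_def by (intro loops_add dx_in_loops loops_br const_in_loops)

lemma pen_diff: "u \<in> loops UNIV \<Longrightarrow> v \<in> loops UNIV \<Longrightarrow> pen lam q (\<lambda>x. u x - v x) x = pen lam q u x - pen lam q v x"
  by (simp add: pen_def dx_diff br_simps(5))

lemma pen_sum: 
  "(\<And>i. i \<in> I \<Longrightarrow> u i \<in> loops UNIV) \<Longrightarrow> pen lam q (\<lambda>x. \<Sum>i\<in>I. u i x) x = (\<Sum>i\<in>I. pen lam q (u i) x)"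
  by (simp add: pen_def dx_sum br_simps(6) sum.distrib)

lemma pencil_eq:
  assumes "functional br F" "functional br G" "q \<in> loops UNIV"
  shows "pencil br a lam F G q = loop_form br (grad br F q) (pen lam q (grad br G q))"
proof -
  let ?u = "grad br F q" and ?v = "grad br G q"
  have l: "?u \<in> loops UNIV" "?v \<in> loops UNIV" using grad_in_loops assms by auto
  have P: "P2 br q ?v \<in> loops UNIV" "P1 br a q ?v \<in> loops UNIV"
    unfolding P2_def P1_def using l assms by (auto intro!: loops_add dx_in_loops loops_br const_in_loops)
  have "lam * loop_form br ?u (P1 br a q ?v) = loop_form br ?u (\<lambda>x. lam *s P1 br a q ?v x)"
    by (simp add: loop_form_def killing_simps circle_int_cmult)
  moreover have "pen lam q ?v = (\<lambda>x. P2 br q ?v x + lam *s P1 br a q ?v x)"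
    by (auto simp: pen_P2 P1_def)
  ultimately show ?thesis
    using loop_form_add(2)[OF P(1) loops_clinear[OF clinear_scale_const[of lam] P(2)] l(1)]
    by (simp add: pencil_def tensor_bracket_def)
qed

text \<open>Integration by parts for the derivative, invariance of the Killing form for the
  bracket.\<close>

lemma pen_skew:
  assumes "q \<in> loops UNIV" "u \<in> loops UNIV" "v \<in> loops UNIV"
  shows "loop_form br u (pen lam q v) = - loop_form br (pen lam q u) v"
proof -
  have "circle_int (\<lambda>x. killing br (u x) (dx v x) + killing br (dx u x) (v x)) = 0"
    using circle_int_dx[OF loops_killing[OF assms(2,3)]] by (simp add: dx_killing assms)
  moreover have "killing br (u x) (pen lam q v x) + killing br (pen lam q u x) (v x)
    = killing br (u x) (dx v x) + killing br (dx u x) (v x)" for x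
    using killing_br_right[of "u x" "q x + lam *s a" "v x"] by (simp add: pen_def killing_add)
  ultimately have "circle_int (\<lambda>x. killing br (u x) (pen lam q v x) + killing br (pen lam q u x) (v x)) = 0"
    by simp
  then show ?thesis
    using assms by (simp add: loop_form_def circle_int_add loops_killing pen_in_loops eq_neg_iff_add_eq_0)
qed

text \<open>The point at which the centralizing property of a acts: the distribution D does not
  depend on \<open>lam\<close>.\<close>

lemma pen_nn: "v \<in> loops \<nn> \<Longrightarrow> pen lam z v = P2 br z v"
  using centralizes by (auto simp: pen_P2 loops_def)

lemma extension_functional: "extension br gr e f l \<phi> F \<Longrightarrow> functional br F"
  by (simp add: extension_def)

lemma functional_derivative:
  assumes "functional br F" "q \<in> loops UNIV" "s \<in> loops UNIV"
  shows "((\<lambda>t::real. F (\<lambda>x. q x + t *\<^sub>R s x)) has_vector_derivative loop_form br (grad br F q) s) (at 0)"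
  using grad[OF assms(1,2)] assms(3) by (auto simp: has_gradient_def)

lemma P2_in_loops: "z \<in> loops UNIV \<Longrightarrow> v \<in> loops UNIV \<Longrightarrow> P2 br z v \<in> loops UNIV"
  unfolding P2_def by (intro loops_add dx_in_loops loops_br)

text \<open>Constancy along D says that the gradient is orthogonal to P2 of loops in n. Skewness
  moves the operator to the gradient, whose image is then orthogonal to n.\<close>

lemma extension_pen_bb:
  assumes F: "extension br gr e f l \<phi> F" and z: "z \<in> SS"
  shows "pen lam z (grad br F z) x \<in> \<bb>"
proof -
  let ?u = "grad br F z"
  have zl: "z \<in> loops UNIV" using z by (simp add: SS_iff)
  have ul: "?u \<in> loops UNIV" by (rule grad_in_loops[OF extension_functional[OF F] zl])
  have "loop_form br (pen lam z ?u) v = 0" if v: "v \<in> loops \<nn>" for v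
  proof -
    have vl: "v \<in> loops UNIV" using v by (rule loops_UNIV)
    have "loop_form br ?u (P2 br z v) = 0"
    proof (rule vector_derivative_unique_at)
      show "((\<lambda>t::real. F (\<lambda>x. z x + t *\<^sub>R P2 br z v x)) has_vector_derivative loop_form br ?u (P2 br z v)) (at 0)"
        by (rule functional_derivative[OF extension_functional[OF F] zl P2_in_loops[OF zl vl]])
      show "((\<lambda>t::real. F (\<lambda>x. z x + t *\<^sub>R P2 br z v x)) has_vector_derivative 0) (at 0)"
        using F z v by (auto simp: extension_def D_dist_def)
    qed
    then show ?thesis using pen_skew[OF zl ul vl, of lam] by (simp add: pen_nn[OF v])
  qed
  from loop_form_perp[OF pen_in_loops[OF zl ul] nn_subspace this]
  show ?thesis by (auto simp: b_space_def)
qed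

lemma SS_affine: "z \<in> SS \<Longrightarrow> b \<in> loops \<bb> \<Longrightarrow> (\<lambda>x. z x + t *\<^sub>R b x) \<in> SS"
proof -
  assume z: "z \<in> SS" and b: "b \<in> loops \<bb>"
  have "z x + t *\<^sub>R b x - e \<in> \<bb>" for x
  proof -
    have "(z x - e) + t *\<^sub>R b x \<in> \<bb>" using z b
      by (intro vec.subspace_add bb_subspace subspace_scaleR) (auto simp: SS_iff loops_def)
    then show ?thesis by (simp add: algebra_simps)
  qed
  then show ?thesis using z b by (auto simp: SS_iff intro!: loops_add loops_scaleR intro: loops_UNIV)
qed

text \<open>Two extensions agree on S, hence in the directions b, and the Killing complement of b is
  n.\<close>

lemma extension_difference_nn:
  assumes F: "extension br gr e f l \<phi> F" "extension br gr e f l \<phi> F'" and z: "z \<in> SS"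
  shows "grad br F z x - grad br F' z x \<in> \<nn>"
proof -
  have zl: "z \<in> loops UNIV" using z by (simp add: SS_iff)
  note fu = extension_functional[OF F(1)] extension_functional[OF F(2)]
  note gl = grad_in_loops[OF fu(1) zl] grad_in_loops[OF fu(2) zl]
  have "loop_form br (\<lambda>x. grad br F z x - grad br F' z x) b = 0" if b: "b \<in> loops \<bb>" for b
  proof -
    have bl: "b \<in> loops UNIV" using b by (rule loops_UNIV)
    have "F (\<lambda>x. z x + t *\<^sub>R b x) = F' (\<lambda>x. z x + t *\<^sub>R b x)" for t
      using F SS_affine[OF z b] by (simp add: extension_def)
    then have "loop_form br (grad br F z) b = loop_form br (grad br F' z) b"
      using vector_derivative_unique_at[OF functional_derivative[OF fu(1) zl bl]]
        functional_derivative[OF fu(2) zl bl] by simp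
    then show ?thesis using gl bl by (simp add: loop_form_diff)
  qed
  from loop_form_perp[OF loops_diff[OF gl] bb_subspace this]
  show ?thesis by (rule nn_if_perp_bb)
qed

text \<open>The arguments are exchanged one at a time; each time a difference with values in n is
  paired with a Hamiltonian field with values in b. This makes the description in
  \<open>reduced_bracket\<close> well defined.\<close>

lemma pencil_extension_cong:
  assumes F: "extension br gr e f l \<phi> F" "extension br gr e f l \<phi> F'"
    and G: "extension br gr e f l \<psi> G" "extension br gr e f l \<psi> G'" and z: "z \<in> SS"
  shows "pencil br a lam F G z = pencil br a lam F' G' z"
proof -
  have zl: "z \<in> loops UNIV" using z by (simp add: SS_iff)
  note fu = F[THEN extension_functional] G[THEN extension_functional]
  note gl = fu[THEN grad_in_loops, OF zl]
  note pl = gl[THEN pen_in_loops[OF zl]]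
  have "loop_form br (\<lambda>x. grad br F z x - grad br F' z x) (pen lam z (grad br G z)) = 0"
    using killing_bb_nn[OF extension_pen_bb[OF G(1) z] extension_difference_nn[OF F z]]
    by (intro loop_form_0) (simp add: killing_sym)
  then have 1: "loop_form br (grad br F z) (pen lam z (grad br G z)) = loop_form br (grad br F' z) (pen lam z (grad br G z))"
    by (simp add: loop_form_diff gl pl)
  have "loop_form br (grad br F' z) (pen lam z (\<lambda>x. grad br G z x - grad br G' z x)) = 0"
    using killing_bb_nn[OF extension_pen_bb[OF F(2) z] extension_difference_nn[OF G z]]
    by (subst pen_skew[OF zl gl(2) loops_diff[OF gl(3,4)]]) (simp add: loop_form_0)
  then have 2: "loop_form br (grad br F' z) (pen lam z (grad br G z)) = loop_form br (grad br F' z) (pen lam z (grad br G' z))"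
    unfolding pen_diff[OF gl(3,4), abs_def] by (simp add: loop_form_diff gl pl)
  show ?thesis using 1 2 fu zl by (simp add: pencil_eq)
qed

lemma reduced_bracket_eq:
  assumes "extension br gr e f l \<phi> F" "extension br gr e f l \<psi> G" "z \<in> SS"
  shows "reduced_bracket br gr e f l a lam \<phi> \<psi> z = pencil br a lam F G z"
  unfolding reduced_bracket_def
  by (rule the_equality) (use assms pencil_extension_cong in blast)+

subsection \<open>Brackets of coordinates\<close>

definition coord_op :: "complex \<Rightarrow> (real \<Rightarrow> complex^'d) \<Rightarrow> nat \<Rightarrow> nat \<Rightarrow> (real \<Rightarrow> complex) \<Rightarrow> real \<Rightarrow> complex" where
  "coord_op lam z i j \<zeta> x = killing br (\<xi>' i) (pen lam z (\<lambda>x. \<zeta> x *s \<xi>' j) x)"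

lemma coord_op_loops: "z \<in> loops UNIV \<Longrightarrow> \<zeta> \<in> loops UNIV \<Longrightarrow> coord_op lam z i j \<zeta> \<in> loops UNIV"
  unfolding coord_op_def[abs_def] by (intro loops_killing const_in_loops pen_in_loops loops_scale)

lemma has_gradient_smeared:
  assumes "\<eta> \<in> loops UNIV" "q \<in> loops UNIV"
  shows "has_gradient br (smeared cc i \<eta>) q (\<lambda>x. \<eta> x *s \<xi>' i)"
  unfolding has_gradient_def
proof (intro conjI ballI)
  fix s :: "real \<Rightarrow> complex^'d" assume s: "s \<in> loops UNIV"
  have q: "(\<lambda>x. \<eta> x * killing br (q x - e) (\<xi>' i)) \<in> loops UNIV" "(\<lambda>x. \<eta> x * killing br (s x) (\<xi>' i)) \<in> loops UNIV"
    using assms s by (auto intro!: loops_mult loops_killing loops_diff const_in_loops)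
  have "\<eta> x * cc (q x + t *\<^sub>R s x) i = \<eta> x * killing br (q x - e) (\<xi>' i) + t *\<^sub>R (\<eta> x * killing br (s x) (\<xi>' i))" for t x
    by (simp add: cc killing_simps scaleR_eq_scale algebra_simps scaleR_conv_of_real[where 'a = complex])
  then show "((\<lambda>t. smeared cc i \<eta> (\<lambda>x. q x + t *\<^sub>R s x)) has_vector_derivative
      loop_form br (\<lambda>x. \<eta> x *s \<xi>' i) s) (at 0)"
    using poly_family_circle_int[OF poly_family_affine[OF q]]
    by (simp add: smeared_def loop_form_def killing_simps killing_sym[of "s _"])
qed (intro loops_scale assms)

lemma pencil_smeared:
  assumes "\<eta> \<in> loops UNIV" "\<zeta> \<in> loops UNIV" "z \<in> loops UNIV"
  shows "pencil br a lam (smeared cc i \<eta>) (smeared cc j \<zeta>) z = circle_int (\<lambda>x. \<eta> x * coord_op lam z i j \<zeta> x)"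
proof -
  have "functional br (smeared cc i \<eta>)" if "\<eta> \<in> loops UNIV" for \<eta> i
    using has_gradient_smeared[OF that] by (auto simp: functional_def)
  then show ?thesis
    using assms by (simp add: pencil_eq grad_eq[OF has_gradient_smeared] loop_form_def coord_op_def killing_simps)
qed

lemma pen_expand:
  assumes z: "z \<in> loops UNIV" and \<omega>: "\<And>j. j \<in> I \<Longrightarrow> \<omega> j \<in> loops UNIV"
  shows "killing br (\<xi>' i) (pen lam z (\<lambda>x. \<Sum>j\<in>I. \<omega> j x *s \<xi>' j) x) = (\<Sum>j\<in>I. coord_op lam z i j (\<omega> j) x)"
  using \<omega> by (subst pen_sum) (auto simp: coord_op_def killing_simps intro: loops_scale)

subsection \<open>Inversion of the constraint operator\<close>

text \<open>On loops in $[f,\mathfrak g]$ one has \<open>\<theta> \<circ> P = 1 - low\<close>. Over $Q$ the operator \<open>low\<close> decreases the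
  degree by two, hence it is nilpotent and the Neumann series is finite.\<close>

definition low :: "complex \<Rightarrow> (real \<Rightarrow> complex^'d) \<Rightarrow> (real \<Rightarrow> complex^'d) \<Rightarrow> real \<Rightarrow> complex^'d" where
  "low lam z v = (\<lambda>x. - theta (dx v x + br (z x - e + lam *s a) (v x)))"

definition neumann :: "complex \<Rightarrow> (real \<Rightarrow> complex^'d) \<Rightarrow> (real \<Rightarrow> complex^'d) \<Rightarrow> real \<Rightarrow> complex^'d" where
  "neumann lam z v = (\<lambda>x. \<Sum>k<bd. (low lam z ^^ k) v x)"

lemma low_loops: "z \<in> loops UNIV \<Longrightarrow> v \<in> loops UNIV \<Longrightarrow> low lam z v \<in> loops UNIV"
  unfolding low_def
  by (intro loops_uminus loops_clinear[OF theta_linear] loops_add loops_diff dx_in_loops loops_br const_in_loops)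

lemma lows_loops: "z \<in> loops UNIV \<Longrightarrow> v \<in> loops UNIV \<Longrightarrow> (low lam z ^^ k) v \<in> loops UNIV"
  by (induction k) (auto intro: low_loops)

lemma neumann_loops: "z \<in> loops UNIV \<Longrightarrow> v \<in> loops UNIV \<Longrightarrow> neumann lam z v \<in> loops UNIV"
  unfolding neumann_def by (intro loops_sum lows_loops)

lemma low_sum:
  "(\<And>i. i \<in> I \<Longrightarrow> u i \<in> loops UNIV) \<Longrightarrow> low lam z (\<lambda>x. \<Sum>i\<in>I. u i x) = (\<lambda>x. \<Sum>i\<in>I. low lam z (u i) x)"
  by (simp add: low_def dx_sum br_simps(6) theta_simps sum.distrib sum_negf sum_subtractf)

lemma lows_sum:
  "z \<in> loops UNIV \<Longrightarrow> (\<And>i. i \<in> I \<Longrightarrow> u i \<in> loops UNIV)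
    \<Longrightarrow> (low lam z ^^ k) (\<lambda>x. \<Sum>i\<in>I. u i x) = (\<lambda>x. \<Sum>i\<in>I. (low lam z ^^ k) (u i) x)"
  by (induction k) (auto simp: low_sum lows_loops)

lemma low_diff:
  "u \<in> loops UNIV \<Longrightarrow> v \<in> loops UNIV \<Longrightarrow> low lam z (\<lambda>x. u x - v x) = (\<lambda>x. low lam z u x - low lam z v x)"
  by (auto simp: low_def dx_diff br_simps(5) theta_simps)

lemma lows_diff:
  "z \<in> loops UNIV \<Longrightarrow> u \<in> loops UNIV \<Longrightarrow> v \<in> loops UNIV
    \<Longrightarrow> (low lam z ^^ k) (\<lambda>x. u x - v x) = (\<lambda>x. (low lam z ^^ k) u x - (low lam z ^^ k) v x)"
  by (induction k) (auto simp: low_diff lows_loops)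

lemma neumann_sum:
  "z \<in> loops UNIV \<Longrightarrow> (\<And>i. i \<in> I \<Longrightarrow> u i \<in> loops UNIV)
    \<Longrightarrow> neumann lam z (\<lambda>x. \<Sum>i\<in>I. u i x) x = (\<Sum>i\<in>I. neumann lam z (u i) x)"
  by (simp add: neumann_def lows_sum sum.swap[of _ I])

text \<open>That z lies in Q is essential: then z - e + \<open>lam\<close> a is in the centralizer
  of f, of degree at most 0, so the bracket cannot raise the degree that \<open>theta\<close> lowers
  by two.\<close>

lemma lows_fil:
  assumes z: "z \<in> QQ" and v: "v \<in> loops UNIV" "\<And>x. v x \<in> fil j"
  shows "(low lam z ^^ k) v x \<in> fil (j - 2 * int k)"
proof (induction k arbitrary: x)
  case (Suc k)
  let ?w = "(low lam z ^^ k) v"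
  have zl: "z \<in> loops UNIV" using z by (simp add: QQ_iff)
  have "z x - e + lam *s a \<in> gf"
    using z a_gf by (intro vec.subspace_add vec.subspace_scale gf_subspace) (auto simp: QQ_iff)
  then have "br (z x - e + lam *s a) (?w x) \<in> fil (0 + (j - 2 * int k))"
    using gf_fil Suc by (intro fil_br) auto
  then have "dx ?w x + br (z x - e + lam *s a) (?w x) \<in> fil (j - 2 * int k)"
    using fil_dx[OF lows_loops[OF zl v(1)] Suc] by (intro vec.subspace_add fil_subspace) simp_all
  from theta_fil[OF this] have "theta (dx ?w x + br (z x - e + lam *s a) (?w x)) \<in> fil (j - 2 * int (Suc k))"
    by (simp add: algebra_simps)
  then show ?case by (simp add: low_def[of _ _ ?w] vec.subspace_neg fil_subspace)
qed (use v in simp)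

lemma lows_bd: "z \<in> QQ \<Longrightarrow> v \<in> loops UNIV \<Longrightarrow> (low lam z ^^ bd) v x = 0"
  using lows_fil[of z v "int bd" bd lam x] fil_top fil_bot by simp

lemma telescope: "(\<Sum>k<N. g k) - (\<Sum>k<N. g (Suc k)) = g 0 - g N" for g :: "nat \<Rightarrow> 'a::ab_group_add"
  by (induction N) (auto simp: algebra_simps)

lemma neumann_right:
  assumes z: "z \<in> QQ" and v: "v \<in> loops UNIV"
  shows "neumann lam z v x - low lam z (neumann lam z v) x = v x"
proof -
  have zl: "z \<in> loops UNIV" using z by (simp add: QQ_iff)
  have "low lam z (neumann lam z v) x = (\<Sum>k<bd. (low lam z ^^ Suc k) v x)"
    unfolding neumann_def by (subst low_sum) (auto intro: lows_loops zl v)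
  then show ?thesis
    using telescope[of "\<lambda>k. (low lam z ^^ k) v x" bd] lows_bd[OF z v] by (simp add: neumann_def)
qed

lemma neumann_left:
  assumes z: "z \<in> QQ" and v: "v \<in> loops UNIV"
  shows "neumann lam z (\<lambda>x. v x - low lam z v x) x = v x"
proof -
  have zl: "z \<in> loops UNIV" using z by (simp add: QQ_iff)
  have "neumann lam z (\<lambda>x. v x - low lam z v x) x = (\<Sum>k<bd. (low lam z ^^ k) v x) - (\<Sum>k<bd. (low lam z ^^ Suc k) v x)"
    unfolding neumann_def using zl v by (simp add: lows_diff low_loops sum_subtractf funpow_swap1)
  then show ?thesis
    using telescope[of "\<lambda>k. (low lam z ^^ k) v x" bd] lows_bd[OF z v] by simp
qed

lemma theta_pen:
  assumes "v x \<in> image_f" shows "theta (pen lam z v x) = v x - low lam z v x"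
proof -
  have "pen lam z v x = br e (v x) + (dx v x + br (z x - e + lam *s a) (v x))"
    by (simp add: pen_def br_simps)
  then show ?thesis using theta_br_e[OF assms] by (simp add: theta_simps low_def)
qed

lemma low_image_f: "low lam z v x \<in> image_f"
  unfolding low_def by (intro vec.subspace_neg image_f_subspace theta(1))

lemma neumann_image_f:
  assumes "\<And>x. v x \<in> image_f" shows "neumann lam z v x \<in> image_f"
proof -
  have "(low lam z ^^ k) v x \<in> image_f" for k using assms low_image_f by (cases k) auto
  then show ?thesis unfolding neumann_def by (intro vec.subspace_sum image_f_subspace)
qed

lemma neumann_mm:
  assumes z: "z \<in> QQ" and v: "v \<in> loops \<mm>" shows "neumann lam z v \<in> loops \<mm>"
proof -
  have zl: "z \<in> loops UNIV" using z by (simp add: QQ_iff)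
  have "(low lam z ^^ k) v \<in> loops \<mm>" for k
  proof (induction k)
    case (Suc k)
    let ?w = "(low lam z ^^ k) v"
    have wf: "?w x \<in> fil (-1)" for x using Suc mm_fil by (auto simp: loops_def)
    have "z x - e + lam *s a \<in> fil 0" for x
      using z a_gf gf_fil vec.subspace_add[OF gf_subspace] vec.subspace_scale[OF gf_subspace] by (auto simp: QQ_iff)
    from fil_br[OF this wf] have "br (z x - e + lam *s a) (?w x) \<in> fil (-1)" for x by simp
    then have "dx ?w x + br (z x - e + lam *s a) (?w x) \<in> fil (-1)" for x
      using fil_dx[OF loops_UNIV[OF Suc] wf] by (intro vec.subspace_add fil_subspace)
    then have "dx ?w x + br (z x - e + lam *s a) (?w x) \<in> \<bb>" for x
      using fil_bb fil_mono[of "-1" 0] by auto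
    then have "low lam z ?w x \<in> \<mm>" for x unfolding low_def by (intro vec.subspace_neg mm_subspace theta_bb)
    then show ?case using low_loops[OF zl loops_UNIV[OF Suc]] by (auto simp: loops_iff[of _ \<mm>])
  qed (use v in simp)
  then show ?thesis unfolding neumann_def loops_iff[of _ \<mm>]
    by (auto intro!: loops_sum vec.subspace_sum mm_subspace)
qed

lemma gf_if_theta_eq: "theta x = theta y \<Longrightarrow> x - y \<in> gf"
  using theta_eq_0_iff[of "x - y"] by (simp add: theta_simps centralizer_def)

text \<open>Up to a loop in \<open>\<mm>\<close>, which does not affect the bracket, the gradient of an extension has
  Hamiltonian vector field tangent to \<open>Q\<close>.\<close>

lemma dirac_gradient:
  assumes F: "extension br gr e f l \<phi> F" and z: "z \<in> QQ"
  obtains v where "v \<in> loops \<mm>" "\<And>x. pen lam z (\<lambda>x. grad br F z x - v x) x \<in> gf"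
proof -
  let ?p = "pen lam z (grad br F z)"
  \<comment> \<open>Solves theta(pen v) = theta(pen (grad F)), so that the two Hamiltonian fields
    differ by an element of the kernel of \<open>theta\<close>, the centralizer of f.\<close>
  define v where "v = neumann lam z (\<lambda>x. theta (?p x))"
  have zl: "z \<in> loops UNIV" using z by (simp add: QQ_iff)
  have gl: "grad br F z \<in> loops UNIV" by (rule grad_in_loops[OF extension_functional[OF F] zl])
  have pl: "?p \<in> loops UNIV" by (rule pen_in_loops[OF zl gl])
  have tl: "(\<lambda>x. theta (?p x)) \<in> loops UNIV" by (rule loops_clinear[OF theta_linear pl])
  have "(\<lambda>x. theta (?p x)) \<in> loops \<mm>"
    using tl theta_bb[OF extension_pen_bb[OF F QQ_SS[OF z]]] by (auto simp: loops_iff[of _ \<mm>])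
  from neumann_mm[OF z this] have vm: "v \<in> loops \<mm>" by (simp add: v_def)
  have vl: "v \<in> loops UNIV" using vm by (rule loops_UNIV)
  have "pen lam z (\<lambda>x. grad br F z x - v x) x \<in> gf" for x
  proof -
    have "theta (pen lam z v x) = theta (?p x)"
      using theta_pen[of v x lam z] neumann_right[OF z tl, of lam x] vm mm_image_f by (auto simp: v_def loops_def)
    then show ?thesis using gf_if_theta_eq[of "?p x" "pen lam z v x"] by (simp add: pen_diff gl vl)
  qed
  with vm show ?thesis by (rule that)
qed

text \<open>Entry of the inverse: a loop v in the image of ad f is sought with pen v equal to
  \<zeta> times \<open>\<xi> \<alpha>\<close> modulo the centralizer of f. The Neumann series
  applied to \<open>theta\<close> of that right side gives it, and pairing with
  \<open>\<xi> \<beta>\<close> reads off its coefficient at \<open>\<xi>' \<beta>\<close>.\<close>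

definition inv_op :: "complex \<Rightarrow> (real \<Rightarrow> complex^'d) \<Rightarrow> nat \<Rightarrow> nat \<Rightarrow> (real \<Rightarrow> complex) \<Rightarrow> real \<Rightarrow> complex" where
  "inv_op lam z \<beta> \<alpha> \<zeta> x = killing br (neumann lam z (\<lambda>x. \<zeta> x *s theta (\<xi> \<alpha>)) x) (\<xi> \<beta>)"

abbreviation J :: "nat set" where "J \<equiv> {m + 1..n}"

lemma image_f_expand: 
  assumes "v \<in> image_f" shows "(\<Sum>\<beta>\<in>J. killing br v (\<xi> \<beta>) *s \<xi>' \<beta>) = v"
proof -
  have "(\<Sum>\<beta>\<in>J. killing br v (\<xi> \<beta>) *s \<xi>' \<beta>) = (\<Sum>\<beta>=1..n. killing br v (\<xi> \<beta>) *s \<xi>' \<beta>)"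
    using assms unfolding image_f_iff by (intro sum.mono_neutral_left) (auto simp: not_le)
  then show ?thesis using expand_dual[of v] by simp
qed

lemma xi'_image_f: "\<beta> \<in> J \<Longrightarrow> \<xi>' \<beta> \<in> image_f"
  unfolding image_f_iff using dual_basis m_le_n by (auto simp: killing_sym[of "\<xi>' \<beta>"])

text \<open>The vector V solves theta(pen V) = theta(Y) for the prescribed right side Y. So pen V
  and Y differ by an element of the centralizer, which has no coordinates with index above
  m.\<close>

lemma coord_op_inv_op:
  assumes z: "z \<in> QQ" and \<zeta>: "\<And>\<gamma>. \<gamma> \<in> J \<Longrightarrow> \<zeta> \<gamma> \<in> loops UNIV" and \<alpha>: "\<alpha> \<in> J"
  shows "(\<Sum>\<beta>\<in>J. coord_op lam z \<alpha> \<beta> (\<lambda>y. \<Sum>\<gamma>\<in>J. inv_op lam z \<beta> \<gamma> (\<zeta> \<gamma>) y) x) = \<zeta> \<alpha> x"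
proof -
  have zl: "z \<in> loops UNIV" using z by (simp add: QQ_iff)
  define Y where "Y x = (\<Sum>\<gamma>\<in>J. \<zeta> \<gamma> x *s \<xi> \<gamma>)" for x
  have Yl: "Y \<in> loops UNIV" unfolding Y_def[abs_def] using \<zeta> by (intro loops_sum loops_scale)
  define V where "V = neumann lam z (\<lambda>x. theta (Y x))"
  have tl: "(\<lambda>x. theta (Y x)) \<in> loops UNIV" by (rule loops_clinear[OF theta_linear Yl])
  have Vl: "V \<in> loops UNIV" unfolding V_def by (rule neumann_loops[OF zl tl])
  have Vf: "V x \<in> image_f" for x unfolding V_def by (rule neumann_image_f[OF theta(1)])
  have V: "V x = (\<Sum>\<gamma>\<in>J. neumann lam z (\<lambda>x. \<zeta> \<gamma> x *s theta (\<xi> \<gamma>)) x)" for x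
    unfolding V_def Y_def theta_simps using zl \<zeta> by (intro neumann_sum) (auto intro: loops_scale)
  have c: "(\<Sum>\<gamma>\<in>J. inv_op lam z \<beta> \<gamma> (\<zeta> \<gamma>) x) = killing br (V x) (\<xi> \<beta>)" for \<beta> x
    unfolding V inv_op_def killing_simps ..
  have "(\<Sum>\<beta>\<in>J. coord_op lam z \<alpha> \<beta> (\<lambda>x. killing br (V x) (\<xi> \<beta>)) x)
     = killing br (\<xi>' \<alpha>) (pen lam z (\<lambda>x. \<Sum>\<beta>\<in>J. killing br (V x) (\<xi> \<beta>) *s \<xi>' \<beta>) x)"
    by (rule pen_expand[symmetric, OF zl]) (intro loops_killing Vl const_in_loops)
  also have "\<dots> = killing br (pen lam z V x) (\<xi>' \<alpha>)" unfolding image_f_expand[OF Vf] by (rule killing_sym)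
  also have "\<dots> = killing br (Y x) (\<xi>' \<alpha>)"
  proof -
    have "theta (pen lam z V x) = theta (Y x)"
      using theta_pen[OF Vf] neumann_right[OF z tl, of lam x] by (simp add: V_def)
    from gf_if_theta_eq[OF this] show ?thesis using \<alpha> unfolding gf_iff killing_simps by auto
  qed
  also have "\<dots> = (\<Sum>\<gamma>\<in>J. if \<gamma> = \<alpha> then \<zeta> \<alpha> x else 0)"
    unfolding Y_def killing_simps using dual_basis \<alpha> m_le_n by (intro sum.cong) auto
  also have "\<dots> = \<zeta> \<alpha> x" using \<alpha> by simp
  finally show ?thesis unfolding c .
qed

text \<open>Keeping only the coordinates of pen u with index above m changes it by an element of the
  centralizer, invisible to \<open>theta\<close>. What remains is (1 - low) u, which the Neumann
  series inverts.\<close>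

lemma inv_op_coord_op:
  assumes z: "z \<in> QQ" and \<zeta>: "\<And>\<gamma>. \<gamma> \<in> J \<Longrightarrow> \<zeta> \<gamma> \<in> loops UNIV" and \<alpha>: "\<alpha> \<in> J"
  shows "(\<Sum>\<beta>\<in>J. inv_op lam z \<alpha> \<beta> (\<lambda>y. \<Sum>\<gamma>\<in>J. coord_op lam z \<beta> \<gamma> (\<zeta> \<gamma>) y) x) = \<zeta> \<alpha> x"
proof -
  have zl: "z \<in> loops UNIV" using z by (simp add: QQ_iff)
  define u where "u x = (\<Sum>\<gamma>\<in>J. \<zeta> \<gamma> x *s \<xi>' \<gamma>)" for x
  have ul: "u \<in> loops UNIV" unfolding u_def[abs_def] using \<zeta> by (intro loops_sum loops_scale)
  have uf: "u x \<in> image_f" for x unfolding u_def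
    by (intro vec.subspace_sum vec.subspace_scale image_f_subspace xi'_image_f)
  define Y where "Y x = (\<Sum>\<beta>\<in>J. killing br (\<xi>' \<beta>) (pen lam z u x) *s \<xi> \<beta>)" for x
  have c: "(\<Sum>\<gamma>\<in>J. coord_op lam z \<beta> \<gamma> (\<zeta> \<gamma>) x) = killing br (\<xi>' \<beta>) (pen lam z u x)" for \<beta> x
    unfolding u_def[abs_def] by (rule pen_expand[symmetric, OF zl \<zeta>])
  have kl: "(\<lambda>x. killing br (\<xi>' \<beta>) (pen lam z u x)) \<in> loops UNIV" for \<beta>
    by (intro loops_killing const_in_loops pen_in_loops zl ul)
  have "(\<Sum>\<beta>\<in>J. inv_op lam z \<alpha> \<beta> (\<lambda>x. killing br (\<xi>' \<beta>) (pen lam z u x)) x)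
     = killing br (neumann lam z (\<lambda>x. theta (Y x)) x) (\<xi> \<alpha>)"
    unfolding inv_op_def Y_def theta_simps killing_sum[symmetric]
    by (subst neumann_sum[OF zl]) (auto intro: loops_scale kl)
  also have "(\<lambda>x. theta (Y x)) = (\<lambda>x. u x - low lam z u x)"
  proof
    fix x
    have "killing br (pen lam z u x - Y x) (\<xi>' k) = 0" if k: "k \<in> J" for k
    proof -
      have "killing br (Y x) (\<xi>' k) = (\<Sum>\<beta>\<in>J. if \<beta> = k then killing br (\<xi>' k) (pen lam z u x) else 0)"
        unfolding Y_def killing_simps using dual_basis k m_le_n by (intro sum.cong) auto
      then show ?thesis using k by (simp add: killing_simps killing_sym[of "\<xi>' k"])
    qed
    then have "pen lam z u x - Y x \<in> gf" by (simp add: gf_iff)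
    then have "theta (pen lam z u x) = theta (Y x)"
      using theta_eq_0_iff[of "pen lam z u x - Y x"] by (simp add: theta_simps centralizer_def)
    then show "theta (Y x) = u x - low lam z u x" using theta_pen[OF uf] by simp
  qed
  also have "neumann lam z (\<lambda>x. u x - low lam z u x) x = u x" by (rule neumann_left[OF z ul])
  also have "killing br (u x) (\<xi> \<alpha>) = (\<Sum>\<gamma>\<in>J. if \<gamma> = \<alpha> then \<zeta> \<alpha> x else 0)"
    unfolding u_def killing_simps using dual_basis \<alpha> m_le_n
    by (intro sum.cong) (auto simp: killing_sym[of "\<xi>' _"])
  also have "\<dots> = \<zeta> \<alpha> x" using \<alpha> by simp
  finally show ?thesis unfolding c .
qed

end

section \<open>Differential polynomials\<close>

text \<open>The derivative in the direction that moves each jet variable by the next one. As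
  \<open>diff_poly\<close> is a predicate on functions and not a syntax, this derivation is defined
  analytically.\<close>

definition total_derivative :: "(jet \<Rightarrow> complex) \<Rightarrow> jet \<Rightarrow> complex" where
  "total_derivative p u = deriv (\<lambda>t. p (\<lambda>k r. u k r + t * u k (Suc r))) 0"

lemma diff_poly_field_differentiable:
  "diff_poly K p \<Longrightarrow> (\<And>k r. (\<lambda>t. \<gamma> t k r) field_differentiable at t0)
    \<Longrightarrow> (\<lambda>t. p (\<gamma> t)) field_differentiable at t0"
  by (induction rule: diff_poly.induct) (auto intro: field_differentiable_add field_differentiable_mult)

lemma total_derivative_curve:
  "diff_poly K p \<Longrightarrow> (\<lambda>t. p (\<lambda>k r. u k r + t * u k (Suc r))) field_differentiable at 0"
  by (erule diff_poly_field_differentiable)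
    (intro field_differentiable_add field_differentiable_mult field_differentiable_ident field_differentiable_const)

lemma rescaled_curve:
  "diff_poly K p \<Longrightarrow> (\<lambda>t. p (\<lambda>k r. t ^ r * u k r)) field_differentiable at 0"
proof (erule diff_poly_field_differentiable)
  fix k r
  have "(\<lambda>t. t ^ r * u k r) field_differentiable at 0" for r
    by (intro field_differentiable_mult field_differentiable_power field_differentiable_ident field_differentiable_const)
  then show "(\<lambda>t. t ^ r * u k r) field_differentiable at 0" .
qed

lemma total_derivative_const: "total_derivative (\<lambda>u. b) u = 0"
  by (simp add: total_derivative_def)

lemma total_derivative_var: "total_derivative (\<lambda>u. u k r) u = u k (Suc r)"
proof -
  have "((\<lambda>t. u k r + t * u k (Suc r)) has_field_derivative u k (Suc r)) (at 0)"
    by (auto intro!: derivative_eq_intros)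
  then show ?thesis by (simp add: total_derivative_def DERIV_imp_deriv)
qed

lemma total_derivative_add:
  "diff_poly K p \<Longrightarrow> diff_poly K' q \<Longrightarrow>
    total_derivative (\<lambda>u. p u + q u) u = total_derivative p u + total_derivative q u"
  unfolding total_derivative_def by (intro deriv_add total_derivative_curve)

lemma total_derivative_mult:
  "diff_poly K p \<Longrightarrow> diff_poly K' q \<Longrightarrow>
    total_derivative (\<lambda>u. p u * q u) u = p u * total_derivative q u + total_derivative p u * q u"
  unfolding total_derivative_def
  by (subst deriv_mult) (auto intro: total_derivative_curve)

lemma diff_poly_sum: "(\<And>i. i \<in> I \<Longrightarrow> diff_poly K (p i)) \<Longrightarrow> diff_poly K (\<lambda>u. \<Sum>i\<in>I. p i u)"
  by (induction I rule: infinite_finite_induct) (auto intro: diff_poly.intros)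

lemma total_derivative_sum:
  "(\<And>i. i \<in> I \<Longrightarrow> diff_poly K (p i)) \<Longrightarrow>
    total_derivative (\<lambda>u. \<Sum>i\<in>I. p i u) u = (\<Sum>i\<in>I. total_derivative (p i) u)"
proof (induction I rule: infinite_finite_induct)
  case (insert i I)
  then show ?case by (simp add: total_derivative_add[of K _ K] diff_poly_sum)
qed (auto simp: total_derivative_const)

lemma diff_poly_total_derivative: "diff_poly K p \<Longrightarrow> diff_poly K (total_derivative p)"
proof (induction rule: diff_poly.induct)
  case (const b)
  show ?case unfolding total_derivative_const[abs_def] by (rule diff_poly.const)
next
  case (jet_var k r)
  then show ?case unfolding total_derivative_var[abs_def] by (rule diff_poly.jet_var)
next
  case (add p q)
  then show ?case unfolding total_derivative_add[OF add.hyps, abs_def] by (intro diff_poly.intros)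
next
  case (mult p q)
  then show ?case unfolding total_derivative_mult[OF mult.hyps, abs_def] by (intro diff_poly.intros)
qed

definition jets :: "(nat \<Rightarrow> real \<Rightarrow> complex) \<Rightarrow> real \<Rightarrow> jet" where
  "jets g x = (\<lambda>k r. (dx ^^ r) (g k) x)"

lemma diff_poly_jets_loops:
  assumes "diff_poly K p" "\<And>k. g k \<in> loops UNIV" shows "(\<lambda>x. p (jets g x)) \<in> loops UNIV"
  using assms(1)
  by (induction rule: diff_poly.induct)
    (auto simp: jets_def const_in_loops assms(2) intro: loops_add loops_mult dxs_in_loops)

lemma dx_diff_poly:
  assumes "diff_poly K p" "\<And>k. g k \<in> loops UNIV"
  shows "dx (\<lambda>x. p (jets g x)) = (\<lambda>x. total_derivative p (jets g x))"
  using assms(1)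
proof (induction rule: diff_poly.induct)
  case (const b)
  then show ?case by (simp add: total_derivative_const dx_const)
next
  case (jet_var k r)
  then show ?case by (simp add: total_derivative_var jets_def)
next
  case (add p q)
  then show ?case
    by (simp add: total_derivative_add[OF add.hyps] dx_add add.hyps[THEN diff_poly_jets_loops, OF assms(2)])
next
  case (mult p q)
  then show ?case
    by (simp add: total_derivative_mult[OF mult.hyps] dx_mult mult.hyps[THEN diff_poly_jets_loops, OF assms(2)])
qed

lemma diff_poly_finite_order:
  "diff_poly K p \<Longrightarrow> \<exists>R. \<forall>u u'. (\<forall>k\<in>K. \<forall>r<R. u k r = u' k r) \<longrightarrow> p u = p u'"
proof (induction rule: diff_poly.induct)
  case (jet_var k r)
  then show ?case by (intro exI[of _ "Suc r"]) auto
next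
  case (add p q)
  then obtain R R' where "\<forall>u u'. (\<forall>k\<in>K. \<forall>r<R. u k r = u' k r) \<longrightarrow> p u = p u'"
    "\<forall>u u'. (\<forall>k\<in>K. \<forall>r<R'. u k r = u' k r) \<longrightarrow> q u = q u'" by blast
  then show ?case by (intro exI[of _ "max R R'"]) (metis less_max_iff_disj)
next
  case (mult p q)
  then obtain R R' where "\<forall>u u'. (\<forall>k\<in>K. \<forall>r<R. u k r = u' k r) \<longrightarrow> p u = p u'"
    "\<forall>u u'. (\<forall>k\<in>K. \<forall>r<R'. u k r = u' k r) \<longrightarrow> q u = q u'" by blast
  then show ?case by (intro exI[of _ "max R R'"]) (metis less_max_iff_disj)
qed auto

subsection \<open>Parts of degree 0 and 1\<close>

abbreviation part0 :: "(jet \<Rightarrow> complex) \<Rightarrow> jet \<Rightarrow> complex" where "part0 \<equiv> degree_part 0"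
abbreviation part1 :: "(jet \<Rightarrow> complex) \<Rightarrow> jet \<Rightarrow> complex" where "part1 \<equiv> degree_part (Suc 0)"

lemma part0: "part0 p u = p (\<lambda>k r. 0 ^ r * u k r)"
  by (simp add: degree_part_def)

lemma part1: "part1 p u = deriv (\<lambda>t. p (\<lambda>k r. t ^ r * u k r)) 0"
  by (simp add: degree_part_def)

lemma part1_const: "part1 (\<lambda>u. b) u = 0"
  by (simp add: part1)

lemma part1_var: "part1 (\<lambda>u. u k r) u = (if r = 1 then u k 1 else 0)"
proof -
  have "((\<lambda>t. t ^ r * u k r) has_field_derivative (of_nat r * 0 ^ (r - 1) * u k r)) (at 0)"
    by (auto intro!: derivative_eq_intros)
  then have "part1 (\<lambda>u. u k r) u = of_nat r * 0 ^ (r - 1) * u k r"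
    unfolding part1 by (rule DERIV_imp_deriv)
  then show ?thesis by (cases r) (auto simp: power_0_left)
qed

lemma part1_add:
  "diff_poly K p \<Longrightarrow> diff_poly K' q \<Longrightarrow> part1 (\<lambda>u. p u + q u) u = part1 p u + part1 q u"
  unfolding part1 by (intro deriv_add rescaled_curve)

lemma part1_mult:
  "diff_poly K p \<Longrightarrow> diff_poly K' q \<Longrightarrow>
    part1 (\<lambda>u. p u * q u) u = part0 p u * part1 q u + part1 p u * part0 q u"
  unfolding part1 part0 by (subst deriv_mult) (auto intro: rescaled_curve)

lemma part1_sum:
  "(\<And>i. i \<in> I \<Longrightarrow> diff_poly K (p i)) \<Longrightarrow> part1 (\<lambda>u. \<Sum>i\<in>I. p i u) u = (\<Sum>i\<in>I. part1 (p i) u)"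
proof (induction I rule: infinite_finite_induct)
  case (insert i I)
  then show ?case by (simp add: part1_add[of K _ K] diff_poly_sum)
qed (auto simp: part1_const)

lemma diff_poly_part0: "diff_poly K p \<Longrightarrow> diff_poly K (part0 p)"
  unfolding part0[abs_def]
proof (induction rule: diff_poly.induct)
  case (jet_var k r)
  then have "diff_poly K (\<lambda>u. 0 ^ r * u k r)" by (intro diff_poly.intros)
  then show ?case .
qed (auto intro: diff_poly.intros)

lemma part0_total_derivative: "diff_poly K p \<Longrightarrow> part0 (total_derivative p) u = 0"
proof (induction rule: diff_poly.induct)
  case (add p q)
  then show ?case by (simp add: part0 total_derivative_add[OF add.hyps])
next
  case (mult p q)
  then show ?case by (simp add: part0 total_derivative_mult[OF mult.hyps])
qed (auto simp: part0 total_derivative_const total_derivative_var)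

text \<open>Differentiation in x raises the degree by exactly one, so only the part of degree 0
  contributes.\<close>

lemma part1_total_derivative: "diff_poly K p \<Longrightarrow> part1 (total_derivative p) u = total_derivative (part0 p) u"
proof (induction rule: diff_poly.induct)
  case (const b)
  then show ?case by (simp add: total_derivative_const[abs_def] part1_const part0)
next
  case (jet_var k r)
  have "part0 (\<lambda>u. u k r) = (\<lambda>u. 0 ^ r * u k r)" by (simp add: part0[abs_def])
  moreover have "total_derivative (\<lambda>u. 0 ^ r * u k r) u = 0 ^ r * u k (Suc r)"
    using jet_var by (subst total_derivative_mult[of UNIV _ UNIV])
      (auto simp: total_derivative_const total_derivative_var intro: diff_poly.intros)
  ultimately show ?case by (simp add: total_derivative_var[abs_def] part1_var)
next
  case (add p q)
  have "part0 (\<lambda>u. p u + q u) = (\<lambda>u. part0 p u + part0 q u)" by (simp add: part0[abs_def])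
  with add show ?case
    by (simp add: total_derivative_add[OF add.hyps, abs_def] part1_add[of K _ K] diff_poly_total_derivative
      total_derivative_add[of K _ K] diff_poly_part0)
next
  case (mult p q)
  have "part0 (\<lambda>u. p u * q u) = (\<lambda>u. part0 p u * part0 q u)" by (simp add: part0[abs_def])
  moreover have "part1 (\<lambda>u. p u * total_derivative q u + total_derivative p u * q u) u
     = (part0 p u * part1 (total_derivative q) u + part1 p u * part0 (total_derivative q) u)
     + (part0 (total_derivative p) u * part1 q u + part1 (total_derivative p) u * part0 q u)"
    using mult.hyps by (subst part1_add[of K _ K])
      (auto simp: part1_mult[of K _ K] diff_poly_total_derivative intro!: diff_poly.mult)
  ultimately show ?case using mult
    by (simp add: total_derivative_mult[OF mult.hyps, abs_def] total_derivative_mult[of K _ K] diff_poly_part0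
      part0_total_derivative[of K])
qed

text \<open>A monomial of degree one contains exactly one first derivative and no higher one. This
  recombines the coefficients \<Gamma> with the derivatives of the coordinates.\<close>

lemma part1_linear:
  assumes "diff_poly K p" "finite K"
  shows "part1 p u = (\<Sum>k\<in>K. part1 p (\<lambda>j r. if r = 0 then u j 0 else if r = 1 \<and> j = k then 1 else 0) * u k 1)"
  using assms(1)
proof (induction rule: diff_poly.induct)
  case (const b)
  then show ?case by (simp add: part1_const)
next
  case (jet_var k r)
  then show ?case using assms(2)
    by (cases "r = 1") (auto simp: part1_var if_distrib[of "\<lambda>c. c * _"] cong: if_cong)
next
  case (add p q)
  then show ?case by (simp add: part1_add[OF add.hyps] sum.distrib distrib_right)
next
  case (mult p q)
  have e: "(\<lambda>i r. 0 ^ r * (if r = 0 then u i 0 else if r = 1 \<and> i = k then 1 else 0)) = (\<lambda>i r. 0 ^ r * u i r)" for k :: nat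
    by (auto simp: fun_eq_iff power_0_left)
  have p0: "part0 q (\<lambda>i r. if r = 0 then u i 0 else if r = 1 \<and> i = k then 1 else 0) = part0 q u" for q k
    unfolding part0 e ..
  show ?case
    unfolding part1_mult[OF mult.hyps] p0 
    by (subst mult.IH(1), subst mult.IH(2))
      (simp add: sum_distrib_left sum_distrib_right sum.distrib distrib_left distrib_right mult_ac)
qed

section \<open>Differential operators\<close>

lemma op_apply_coeff:
  "length L \<le> N \<Longrightarrow> op_apply L j \<eta> x = (\<Sum>r<N. op_coeff L r (j x) * (dx ^^ r) \<eta> x)"
  unfolding op_apply_def op_coeff_def
  by (rule sum.mono_neutral_cong_left) auto

definition op_of :: "nat \<Rightarrow> (nat \<Rightarrow> jet \<Rightarrow> complex) \<Rightarrow> diff_op" where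
  "op_of N g = map g [0..<N]"

lemma op_coeff_op_of: "op_coeff (op_of N g) r = (if r < N then g r else (\<lambda>u. 0))"
  by (simp add: op_coeff_def op_of_def)

lemma length_op_of: "length (op_of N g) = N"
  by (simp add: op_of_def)

definition op_sum :: "'i set \<Rightarrow> ('i \<Rightarrow> diff_op) \<Rightarrow> diff_op" where
  "op_sum I L = op_of (\<Sum>i\<in>I. length (L i)) (\<lambda>r u. \<Sum>i\<in>I. op_coeff (L i) r u)"

definition op_add :: "diff_op \<Rightarrow> diff_op \<Rightarrow> diff_op" where
  "op_add L M = op_of (length L + length M) (\<lambda>r u. op_coeff L r u + op_coeff M r u)"

definition op_mult :: "(jet \<Rightarrow> complex) \<Rightarrow> diff_op \<Rightarrow> diff_op" where
  "op_mult p L = op_of (length L) (\<lambda>r u. p u * op_coeff L r u)"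

definition op_dx :: "diff_op \<Rightarrow> diff_op" where
  "op_dx L = op_of (Suc (length L)) (\<lambda>r u. total_derivative (op_coeff L r) u +
     (case r of 0 \<Rightarrow> 0 | Suc s \<Rightarrow> op_coeff L s u))"

text \<open>A list p # L stands for p + L o \<partial>. Recursion therefore passes the derivative on
  to the right factor, where \<open>op_dx\<close> applies the product rule once.\<close>

fun op_comp :: "diff_op \<Rightarrow> diff_op \<Rightarrow> diff_op" where
  "op_comp [] M = []"
| "op_comp (p # L) M = op_add (op_mult p M) (op_comp L (op_dx M))"

lemma op_coeff_outside: "length L \<le> r \<Longrightarrow> op_coeff L r = (\<lambda>u. 0)"
  by (simp add: op_coeff_def)

lemma op_coeff_sum: 
  assumes "finite I" shows "op_coeff (op_sum I L) r u = (\<Sum>i\<in>I. op_coeff (L i) r u)"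
proof (cases "r < (\<Sum>i\<in>I. length (L i))")
  case False
  then have "length (L i) \<le> r" if "i \<in> I" for i
    using member_le_sum[OF that, of "\<lambda>i. length (L i)"] assms by simp
  then show ?thesis using False by (simp add: op_sum_def op_coeff_op_of op_coeff_outside)
qed (simp add: op_sum_def op_coeff_op_of)

lemma op_coeff_add: "op_coeff (op_add L M) r u = op_coeff L r u + op_coeff M r u"
  by (auto simp: op_add_def op_coeff_op_of op_coeff_outside)

lemma op_coeff_mult: "op_coeff (op_mult p L) r u = p u * op_coeff L r u"
  by (auto simp: op_mult_def op_coeff_op_of op_coeff_outside)

lemma op_coeff_dx:
  "op_coeff (op_dx L) r u = total_derivative (op_coeff L r) u + (case r of 0 \<Rightarrow> 0 | Suc s \<Rightarrow> op_coeff L s u)"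
  by (auto simp: op_dx_def op_coeff_op_of op_coeff_outside total_derivative_const split: nat.split)

lemma op_coeff_Cons: "op_coeff (p # L) 0 = p" "op_coeff (p # L) (Suc r) = op_coeff L r"
  by (auto simp: op_coeff_def)

definition poly_op :: "nat set \<Rightarrow> diff_op \<Rightarrow> bool" where
  "poly_op K L \<longleftrightarrow> (\<forall>p\<in>set L. diff_poly K p)"

lemma poly_op_coeff: "poly_op K L \<Longrightarrow> diff_poly K (op_coeff L r)"
  by (auto simp: poly_op_def op_coeff_def intro: diff_poly.const)

lemma poly_op_op_of: "(\<And>r. diff_poly K (g r)) \<Longrightarrow> poly_op K (op_of N g)"
  by (auto simp: poly_op_def op_of_def)

lemma poly_op_sum: "(\<And>i. i \<in> I \<Longrightarrow> poly_op K (L i)) \<Longrightarrow> poly_op K (op_sum I L)"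
  unfolding op_sum_def by (intro poly_op_op_of diff_poly_sum poly_op_coeff)

lemma poly_op_add: "poly_op K L \<Longrightarrow> poly_op K M \<Longrightarrow> poly_op K (op_add L M)"
  unfolding op_add_def by (intro poly_op_op_of diff_poly.add poly_op_coeff)

lemma poly_op_mult: "diff_poly K p \<Longrightarrow> poly_op K L \<Longrightarrow> poly_op K (op_mult p L)"
  unfolding op_mult_def by (intro poly_op_op_of diff_poly.mult poly_op_coeff)

lemma poly_op_dx: "poly_op K L \<Longrightarrow> poly_op K (op_dx L)"
  unfolding op_dx_def
proof (intro poly_op_op_of)
  fix r assume L: "poly_op K L"
  have "diff_poly K (\<lambda>u. case r of 0 \<Rightarrow> 0 | Suc s \<Rightarrow> op_coeff L s u)"
    using poly_op_coeff[OF L] by (cases r) (auto intro: diff_poly.const)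
  then show "diff_poly K (\<lambda>u. total_derivative (op_coeff L r) u + (case r of 0 \<Rightarrow> 0 | Suc s \<Rightarrow> op_coeff L s u))"
    by (intro diff_poly.add diff_poly_total_derivative poly_op_coeff L)
qed

lemma poly_op_comp: "poly_op K L \<Longrightarrow> poly_op K M \<Longrightarrow> poly_op K (op_comp L M)"
  by (induction L arbitrary: M) (auto simp: poly_op_def[of K "_ # _"] poly_op_def[of K "[]"] 
    intro!: poly_op_add poly_op_mult poly_op_dx simp flip: poly_op_def)

lemma op_apply_loops:
  assumes "poly_op K L" "\<And>k. g k \<in> loops UNIV" "\<eta> \<in> loops UNIV"
  shows "op_apply L (jets g) \<eta> \<in> loops UNIV"
  unfolding op_apply_def using assms
  by (intro loops_sum loops_mult diff_poly_jets_loops[of K] dxs_in_loops) (auto simp: poly_op_def)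

lemma op_apply_sum:
  assumes "finite I" 
  shows "op_apply (op_sum I L) j \<eta> x = (\<Sum>i\<in>I. op_apply (L i) j \<eta> x)"
proof -
  have "length (L i) \<le> (\<Sum>i\<in>I. length (L i))" if "i \<in> I" for i
    using member_le_sum[OF that, of "\<lambda>i. length (L i)"] assms by simp
  then have "(\<Sum>i\<in>I. op_apply (L i) j \<eta> x) 
     = (\<Sum>i\<in>I. \<Sum>r<(\<Sum>i\<in>I. length (L i)). op_coeff (L i) r (j x) * (dx ^^ r) \<eta> x)"
    by (intro sum.cong refl op_apply_coeff)
  also have "\<dots> = op_apply (op_sum I L) j \<eta> x"
    by (subst op_apply_coeff[of _ "\<Sum>i\<in>I. length (L i)"])
      (auto simp: op_sum_def length_op_of op_coeff_op_of sum_distrib_right intro: sum.swap)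
  finally show ?thesis ..
qed

lemma op_apply_add: "op_apply (op_add L M) j \<eta> x = op_apply L j \<eta> x + op_apply M j \<eta> x"
  by (simp add: op_apply_coeff[of _ "length L + length M"] op_coeff_add distrib_right sum.distrib
    op_add_def[THEN arg_cong, of length] length_op_of)

lemma op_apply_mult: "op_apply (op_mult p L) j \<eta> x = p (j x) * op_apply L j \<eta> x"
  by (simp add: op_apply_coeff[of _ "length L"] op_coeff_mult sum_distrib_left mult.assoc
    op_mult_def[THEN arg_cong, of length] length_op_of)

lemma op_apply_dx:
  assumes L: "poly_op K L" and g: "\<And>k. g k \<in> loops UNIV" and \<eta>: "\<eta> \<in> loops UNIV"
  shows "op_apply (op_dx L) (jets g) \<eta> = dx (op_apply L (jets g) \<eta>)"
proof
  fix x
  have l: "(\<lambda>x. op_coeff L r (jets g x)) \<in> loops UNIV" for r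
    by (rule diff_poly_jets_loops[OF poly_op_coeff[OF L] g])
  have "op_apply L (jets g) \<eta> = (\<lambda>x. \<Sum>r<length L. op_coeff L r (jets g x) * (dx ^^ r) \<eta> x)"
    by (rule ext) (simp add: op_apply_coeff[of L "length L"])
  then have "dx (op_apply L (jets g) \<eta>) x = dx (\<lambda>x. \<Sum>r<length L. op_coeff L r (jets g x) * (dx ^^ r) \<eta> x) x"
    by simp
  also have "\<dots> = (\<Sum>r<length L. op_coeff L r (jets g x) * (dx ^^ Suc r) \<eta> x 
      + total_derivative (op_coeff L r) (jets g x) * (dx ^^ r) \<eta> x)"
    by (simp add: dx_sum loops_mult l dxs_in_loops \<eta> dx_mult dx_diff_poly[OF poly_op_coeff[OF L] g])
  also have "\<dots> = (\<Sum>r<length L. op_coeff L r (jets g x) * (dx ^^ Suc r) \<eta> x)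
      + (\<Sum>r<Suc (length L). total_derivative (op_coeff L r) (jets g x) * (dx ^^ r) \<eta> x)"
    by (simp add: sum.distrib op_coeff_outside total_derivative_const)
  also have "(\<Sum>r<length L. op_coeff L r (jets g x) * (dx ^^ Suc r) \<eta> x)
     = (\<Sum>r<Suc (length L). (case r of 0 \<Rightarrow> 0 | Suc s \<Rightarrow> op_coeff L s (jets g x)) * (dx ^^ r) \<eta> x)"
    by (subst sum.lessThan_Suc_shift) simp
  finally show "op_apply (op_dx L) (jets g) \<eta> x = dx (op_apply L (jets g) \<eta>) x"
    by (simp add: op_apply_coeff[of "op_dx L" "Suc (length L)"] op_dx_def[THEN arg_cong, of length] length_op_of
      op_coeff_dx distrib_right sum.distrib del: sum.lessThan_Suc)
qed

lemma op_apply_Cons: "op_apply (p # L) j \<eta> x = p (j x) * \<eta> x + op_apply L j (dx \<eta>) x"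
  unfolding op_apply_def by (simp add: sum.lessThan_Suc_shift funpow_swap1 del: sum.lessThan_Suc)

lemma op_apply_Cons': "op_apply (p # L) j \<eta> = (\<lambda>x. p (j x) * \<eta> x + op_apply L j (dx \<eta>) x)"
  by (rule ext) (rule op_apply_Cons)

lemma op_apply_comp:
  assumes g: "\<And>k. g k \<in> loops UNIV" and \<eta>: "\<eta> \<in> loops UNIV"
  shows "poly_op K L \<Longrightarrow> poly_op K M \<Longrightarrow>
    op_apply (op_comp L M) (jets g) \<eta> = op_apply L (jets g) (op_apply M (jets g) \<eta>)"
proof (induction L arbitrary: M)
  case Nil
  then show ?case by (simp add: op_apply_def)
next
  case (Cons p L)
  have "poly_op K L" using Cons.prems by (simp add: poly_op_def)
  then have "op_apply (op_comp L (op_dx M)) (jets g) \<eta> = op_apply L (jets g) (dx (op_apply M (jets g) \<eta>))"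
    using Cons.IH[of "op_dx M"] Cons.prems poly_op_dx op_apply_dx[OF Cons.prems(2) g \<eta>] by simp
  then show ?case by (intro ext) (simp add: op_apply_add op_apply_mult op_apply_Cons')
qed

subsection \<open>Leading terms of a composition\<close>

text \<open>The first digit is the order of the coefficient in $\partial_x$, the second its degree.\<close>

definition s00 :: "diff_op \<Rightarrow> jet \<Rightarrow> complex" where "s00 L = part0 (op_coeff L 0)"
definition s10 :: "diff_op \<Rightarrow> jet \<Rightarrow> complex" where "s10 L = part0 (op_coeff L (Suc 0))"
definition s01 :: "diff_op \<Rightarrow> jet \<Rightarrow> complex" where "s01 L = part1 (op_coeff L 0)"

lemma diff_poly_s00: "poly_op K L \<Longrightarrow> diff_poly K (s00 L)"
  unfolding s00_def by (intro diff_poly_part0 poly_op_coeff)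

lemma s_add:
  assumes "poly_op K L" "poly_op K M"
  shows "s00 (op_add L M) u = s00 L u + s00 M u" "s10 (op_add L M) u = s10 L u + s10 M u"
    "s01 (op_add L M) u = s01 L u + s01 M u"
  using part1_add[OF poly_op_coeff[OF assms(1)] poly_op_coeff[OF assms(2)]]
  unfolding s00_def s10_def s01_def op_coeff_add[abs_def] part0 by auto

lemma s_sum:
  assumes "finite I" "\<And>i. i \<in> I \<Longrightarrow> poly_op K (L i)"
  shows "s00 (op_sum I L) u = (\<Sum>i\<in>I. s00 (L i) u)" "s10 (op_sum I L) u = (\<Sum>i\<in>I. s10 (L i) u)"
    "s01 (op_sum I L) u = (\<Sum>i\<in>I. s01 (L i) u)"
  using part1_sum[OF poly_op_coeff[OF assms(2)]]
  unfolding s00_def s10_def s01_def op_coeff_sum[OF assms(1), abs_def] part0 by auto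

lemma s_mult:
  assumes "diff_poly K p" "poly_op K M"
  shows "s00 (op_mult p M) u = part0 p u * s00 M u" "s10 (op_mult p M) u = part0 p u * s10 M u"
    "s01 (op_mult p M) u = part0 p u * s01 M u + part1 p u * s00 M u"
  using part1_mult[OF assms(1) poly_op_coeff[OF assms(2)]]
  unfolding s00_def s10_def s01_def op_coeff_mult[abs_def] part0 by auto

lemma s_dx:
  assumes "poly_op K M"
  shows "s00 (op_dx M) u = 0" "s10 (op_dx M) u = s00 M u" "s01 (op_dx M) u = total_derivative (s00 M) u"
proof -
  note c = poly_op_coeff[OF assms]
  show "s00 (op_dx M) u = 0" 
    using part0_total_derivative[OF c[of 0], of u]
    unfolding s00_def part0 by (simp add: op_coeff_dx)
  show "s10 (op_dx M) u = s00 M u"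
    using part0_total_derivative[OF c[of "Suc 0"], of u]
    unfolding s00_def s10_def part0 by (simp add: op_coeff_dx)
  have "op_coeff (op_dx M) 0 = total_derivative (op_coeff M 0)" by (auto simp: op_coeff_dx)
  then show "s01 (op_dx M) u = total_derivative (s00 M) u"
    using part1_total_derivative[OF c[of 0], of u] by (simp add: s01_def s00_def)
qed

text \<open>A derivative that hits a coefficient of M costs one degree. Only the first-order
  coefficient of L can contribute such a term in degree one, and higher-order coefficients do not
  reach these leading terms.\<close>

lemma s_comp:
  "poly_op K L \<Longrightarrow> poly_op K M \<Longrightarrow> s00 (op_comp L M) u = s00 L u * s00 M u"
  "poly_op K L \<Longrightarrow> poly_op K M \<Longrightarrow> s10 (op_comp L M) u = s00 L u * s10 M u + s10 L u * s00 M u"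
  "poly_op K L \<Longrightarrow> poly_op K M \<Longrightarrow>
    s01 (op_comp L M) u = s00 L u * s01 M u + s01 L u * s00 M u + s10 L u * total_derivative (s00 M) u"
proof (induction L arbitrary: M)
  case Nil
  {
    case 1 show ?case by (simp add: s00_def part0 op_coeff_def)
  next
    case 2 show ?case by (simp add: s00_def s10_def part0 op_coeff_def)
  next
    case 3 show ?case by (simp add: s00_def s10_def s01_def part0 part1_const op_coeff_def)
  }
next
  case (Cons p L)
  have a: "s00 (p # L) u = part0 p u" "s10 (p # L) u = s00 L u" "s01 (p # L) u = part1 p u"
    by (simp_all add: s00_def s10_def s01_def op_coeff_Cons)
  have b: "diff_poly K p" "poly_op K L" if "poly_op K (p # L)" using that by (auto simp: poly_op_def)
  {
    case 1
    then show ?case using Cons.IH(1)[of "op_dx M"] b poly_op_dx[of K M]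
      by (simp add: s_add[of K] poly_op_mult poly_op_comp s_mult[of K] s_dx[of K] a)
  next
    case 2
    then show ?case using Cons.IH(2)[of "op_dx M"] b poly_op_dx[of K M]
      by (simp add: s_add[of K] poly_op_mult poly_op_comp s_mult[of K] s_dx[of K] a)
  next
    case 3
    \<comment> \<open>The induction replaces M by \<open>op_dx M\<close>, whose part of order 0 and
      degree 0 vanishes identically; no second derivative of a coefficient survives.\<close>
    have "total_derivative (s00 (op_dx M)) u = 0"
      using 3 s_dx(1)[of K M] by (simp add: total_derivative_def)
    then show ?case using 3 Cons.IH(3)[of "op_dx M"] b poly_op_dx[of K M]
      by (simp add: total_derivative_const s_add[of K] poly_op_mult poly_op_comp s_mult[of K] s_dx[of K] a)
  }
qed

subsection \<open>Operators are determined by their action\<close>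

definition wave :: "nat \<Rightarrow> real \<Rightarrow> complex" where "wave k = (\<lambda>x. exp (\<i> * of_nat k * of_real x))"

lemma dx_wave: "dx (wave k) = (\<lambda>x. \<i> * of_nat k * wave k x)"
proof (rule dx_eqI)
  fix x
  have "((\<lambda>z. exp (\<i> * of_nat k * z)) has_field_derivative (\<i> * of_nat k * exp (\<i> * of_nat k * of_real x))) (at (of_real x))"
    by (auto intro!: derivative_eq_intros)
  then show "(wave k has_vector_derivative \<i> * of_nat k * wave k x) (at x)"
    unfolding wave_def by (rule has_vector_derivative_real_field)
qed

lemma wave_loops: "wave k \<in> loops UNIV"
proof -
  have d: "(\<lambda>x. b * wave k x) differentiable (at x)" for b x
  proof -
    have "((\<lambda>z. b * exp (\<i> * of_nat k * z)) has_field_derivative (b * (\<i> * of_nat k * exp (\<i> * of_nat k * of_real x)))) (at (of_real x))"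
      by (auto intro!: derivative_eq_intros)
    from has_vector_derivative_real_field[OF this]
    show ?thesis unfolding wave_def by (rule differentiableI_vector)
  qed
  have w: "wave k differentiable (at x)" for x using d[of 1 x] by simp
  have "dx (\<lambda>x. b * wave k x) = (\<lambda>x. (b * (\<i> * of_nat k)) * wave k x)" for b
    using dx_linear[OF bounded_linear_mult_right[of b] w] by (simp add: dx_wave mult.assoc)
  then have "times_differentiable j (\<lambda>x. b * wave k x)" for j b
    by (induction j arbitrary: b) (auto simp: w)
  from this[of _ 1] have "times_differentiable j (wave k)" for j by simp
  moreover have "wave k (x + 2 * pi) = wave k x" for x
  proof -
    have "\<i> * of_nat k * of_real (x + 2 * pi) = \<i> * of_nat k * of_real x + of_int (int k) * (of_real (2 * pi) * \<i>)"
      by (simp add: algebra_simps)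
    then show ?thesis unfolding wave_def using exp_plus_2pin[of "\<i> * of_nat k * of_real x" "int k"] 
      by (simp add: algebra_simps)
  qed
  ultimately show ?thesis by (simp add: loops_UNIV_iff)
qed

lemma dxs_wave: "(dx ^^ r) (wave k) = (\<lambda>x. (\<i> * of_nat k) ^ r * wave k x)"
proof (induction r)
  case (Suc r)
  have "dx (\<lambda>x. (\<i> * of_nat k) ^ r * wave k x) = (\<lambda>x. (\<i> * of_nat k) ^ r * dx (wave k) x)"
    by (rule dx_bounded_linear[OF bounded_linear_mult_right wave_loops])
  then show ?case by (simp add: Suc dx_wave mult.assoc mult.left_commute)
qed simp

text \<open>The points i k are infinitely many roots of one polynomial.\<close>

lemma wave_polynomial_zero:
  fixes b :: "nat \<Rightarrow> complex"
  assumes "\<And>k. (\<Sum>r<N. b r * (\<i> * of_nat k) ^ r) = 0" and "r < N"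
  shows "b r = 0"
proof (rule ccontr)
  assume "b r \<noteq> 0"
  then have "finite {z. (\<Sum>i\<le>N - 1. b i * z ^ i) = 0}"
    using assms(2) by (intro polyfun_roots_finite[of b r]) auto
  moreover have "range (\<lambda>k. \<i> * of_nat k) \<subseteq> {z. (\<Sum>i\<le>N - 1. b i * z ^ i) = 0}"
  proof -
    have "{..N - 1} = {..<N}" using assms(2) by auto
    then show ?thesis using assms(1) by auto
  qed
  moreover have "inj (\<lambda>k. \<i> * complex_of_nat k)" by (auto simp: inj_def)
  ultimately show False using finite_subset range_inj_infinite by blast
qed

text \<open>$(e^{ix}-1)^N$ vanishes to the exact order $N$ at $0$, so combinations of these loops have
  prescribed jets.\<close>

definition bump :: "nat \<Rightarrow> real \<Rightarrow> complex" where "bump N = (\<lambda>x. (wave 1 x - 1) ^ N)"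

lemma bump_loops: "bump N \<in> loops UNIV"
proof (induction N)
  case (Suc N)
  then show ?case unfolding bump_def power_Suc
    by (intro loops_mult loops_diff wave_loops const_in_loops)
qed (simp add: bump_def const_in_loops)

text \<open>The derivative of e^(ix) - 1 is i times (e^(ix) - 1) + 1, so differentiation mixes only
  two neighbouring powers.\<close>

lemma dx_bump: "dx (bump (Suc N)) = (\<lambda>x. \<i> * of_nat (Suc N) * (bump (Suc N) x + bump N x))"
proof (induction N)
  case 0
  have "dx (\<lambda>x. wave 1 x - 1) = (\<lambda>x. \<i> * wave 1 x)"
    by (simp add: dx_diff wave_loops const_in_loops dx_wave dx_const)
  then show ?case by (simp add: bump_def)
next
  case (Suc N)
  have w: "dx (\<lambda>x. wave 1 x - 1) = (\<lambda>x. \<i> * wave 1 x)"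
    by (simp add: dx_diff wave_loops const_in_loops dx_wave dx_const)
  have "dx (bump (Suc (Suc N))) = dx (\<lambda>x. (wave 1 x - 1) * bump (Suc N) x)" by (simp add: bump_def)
  also have "\<dots> = (\<lambda>x. (wave 1 x - 1) * dx (bump (Suc N)) x + dx (\<lambda>x. wave 1 x - 1) x * bump (Suc N) x)"
    by (intro dx_mult loops_diff wave_loops const_in_loops bump_loops)
  also have "\<dots> = (\<lambda>x. \<i> * of_nat (Suc (Suc N)) * (bump (Suc (Suc N)) x + bump (Suc N) x))"
    unfolding Suc w by (auto simp: bump_def algebra_simps)
  finally show ?case .
qed

lemma dxs_bump_0: "j < N \<Longrightarrow> (dx ^^ j) (bump N) 0 = 0" "(dx ^^ N) (bump N) 0 \<noteq> 0"
proof -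
  have s: "(dx ^^ Suc j) (bump (Suc N)) x = \<i> * of_nat (Suc N) * ((dx ^^ j) (bump (Suc N)) x + (dx ^^ j) (bump N) x)" for j N x
  proof (induction j arbitrary: x)
    case 0
    show ?case by (simp add: dx_bump)
  next
    case (Suc j)
    have "(dx ^^ Suc j) (bump (Suc N)) = (\<lambda>x. \<i> * of_nat (Suc N) * ((dx ^^ j) (bump (Suc N)) x + (dx ^^ j) (bump N) x))"
      using Suc by blast
    then have "(dx ^^ Suc (Suc j)) (bump (Suc N)) x 
      = dx (\<lambda>x. \<i> * of_nat (Suc N) * ((dx ^^ j) (bump (Suc N)) x + (dx ^^ j) (bump N) x)) x" by simp
    also have "\<dots> = \<i> * of_nat (Suc N) * dx (\<lambda>x. (dx ^^ j) (bump (Suc N)) x + (dx ^^ j) (bump N) x) x"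
      by (simp only: dx_bounded_linear[OF bounded_linear_mult_right loops_add[OF dxs_in_loops[OF bump_loops] dxs_in_loops[OF bump_loops]]])
    also have "\<dots> = \<i> * of_nat (Suc N) * ((dx ^^ Suc j) (bump (Suc N)) x + (dx ^^ Suc j) (bump N) x)"
      by (simp add: dx_add dxs_in_loops bump_loops)
    finally show ?case .
  qed
  have z: "(dx ^^ j) (bump N) 0 = 0" if "j < N" for j N using that
  proof (induction j arbitrary: N)
    case 0
    then show ?case by (cases N) (auto simp: bump_def wave_def)
  next
    case (Suc j)
    then obtain N' where N': "N = Suc N'" by (cases N) auto
    then show ?case using Suc.IH[of N] Suc.IH[of N'] Suc.prems by (simp only: N' s) simp
  qed
  then show "j < N \<Longrightarrow> (dx ^^ j) (bump N) 0 = 0" .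
  show "(dx ^^ N) (bump N) 0 \<noteq> 0"
  proof (induction N)
    case (Suc N)
    then show ?case using z[of N "Suc N"] by (simp only: s) (simp del: of_nat_Suc)
  qed (simp add: bump_def)
qed

text \<open>The next derivative is adjusted by a multiple of \<open>bump R\<close>, whose
  derivatives of order below R vanish at 0, so the values already prescribed are not
  disturbed.\<close>

lemma loop_with_jet:
  fixes b :: "nat \<Rightarrow> complex"
  shows "\<exists>g\<in>loops UNIV. \<forall>r<R. (dx ^^ r) g 0 = b r"
proof (induction R)
  case 0
  show ?case using const_in_loops[of 0] by blast
next
  case (Suc R)
  then obtain g where g: "g \<in> loops UNIV" "\<forall>r<R. (dx ^^ r) g 0 = b r" by blast
  define t where "t = (b R - (dx ^^ R) g 0) / (dx ^^ R) (bump R) 0"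
  have "(dx ^^ r) (\<lambda>x. g x + t * bump R x) = (\<lambda>x. (dx ^^ r) g x + t * (dx ^^ r) (bump R) x)" for r
  proof (induction r)
    case (Suc r)
    then show ?case 
      by (simp add: dx_add dxs_in_loops g bump_loops loops_mult const_in_loops
        dx_bounded_linear[OF bounded_linear_mult_right dxs_in_loops[OF bump_loops]])
  qed simp
  then have "\<forall>r<Suc R. (dx ^^ r) (\<lambda>x. g x + t * bump R x) 0 = b r"
    using g(2) dxs_bump_0(1)[of _ R] dxs_bump_0(2)[of R] by (auto simp: t_def less_Suc_eq)
  moreover have "(\<lambda>x. g x + t * bump R x) \<in> loops UNIV"
    by (intro loops_add g loops_mult const_in_loops bump_loops)
  ultimately show ?case by blast
qed

text \<open>A coefficient depends on finitely many jet variables, which some loops realise at x = 0.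
  Evaluated on waves at 0, the difference of the operators is a polynomial in i k with the
  differences of coefficients as its coefficients.\<close>

lemma op_coeff_unique:
  assumes L: "poly_op K L" and M: "poly_op K M"
    and eq: "\<And>g k. (\<And>k. g k \<in> loops UNIV) \<Longrightarrow> (\<And>k. k \<notin> K \<Longrightarrow> g k = (\<lambda>x. 0)) \<Longrightarrow>
      op_apply L (jets g) (wave k) 0 = op_apply M (jets g) (wave k) 0"
  shows "op_coeff L r = op_coeff M r"
proof
  fix u
  show "op_coeff L r u = op_coeff M r u"
  proof (cases "r < length L + length M")
    case True
    obtain R R' where R: "\<forall>u u'. (\<forall>k\<in>K. \<forall>r<R. u k r = u' k r) \<longrightarrow> op_coeff L r u = op_coeff L r u'"
      "\<forall>u u'. (\<forall>k\<in>K. \<forall>r<R'. u k r = u' k r) \<longrightarrow> op_coeff M r u = op_coeff M r u'"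
      using diff_poly_finite_order[OF poly_op_coeff[OF L]] diff_poly_finite_order[OF poly_op_coeff[OF M]] by blast
    have "\<forall>k. \<exists>g. g \<in> loops UNIV \<and> (\<forall>r<max R R'. (dx ^^ r) g 0 = u k r)"
      using loop_with_jet by blast
    from choice[OF this] obtain g0 where g0: "\<And>k. g0 k \<in> loops UNIV" "\<And>k r. r < max R R' \<Longrightarrow> (dx ^^ r) (g0 k) 0 = u k r"
      by blast
    \<comment> \<open>Setting the other loops to zero meets the hypothesis on indices outside K and
      does not affect the coefficients.\<close>
    define g where "g k = (if k \<in> K then g0 k else (\<lambda>x. 0))" for k
    have g: "g k \<in> loops UNIV" for k by (simp add: g_def g0 const_in_loops)
    have "(\<Sum>r<length L + length M. (op_coeff L r (jets g 0) - op_coeff M r (jets g 0)) * (\<i> * of_nat k) ^ r) = 0" for k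
    proof -
      have "op_apply L (jets g) (wave k) 0 = op_apply M (jets g) (wave k) 0"
        by (rule eq[OF g]) (simp add: g_def)
      then show ?thesis
        by (simp add: op_apply_coeff[of _ "length L + length M"] dxs_wave left_diff_distrib sum_subtractf) (simp add: wave_def)
    qed
    from wave_polynomial_zero[OF this True]
    have "op_coeff L r (jets g 0) = op_coeff M r (jets g 0)" by simp
    moreover have "op_coeff L r (jets g 0) = op_coeff L r u"
      by (rule R(1)[rule_format]) (auto simp: jets_def g_def g0)
    moreover have "op_coeff M r (jets g 0) = op_coeff M r u"
      by (rule R(2)[rule_format]) (auto simp: jets_def g_def g0)
    ultimately show ?thesis by simp
  qed (simp add: op_coeff_outside)
qed

section \<open>Dirac's formula in low degrees\<close>

lemma solve_linear:
  fixes F H :: "nat \<Rightarrow> nat \<Rightarrow> complex"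
  assumes J: "finite J"
    and HF: "\<And>\<alpha> \<gamma>. \<alpha> \<in> J \<Longrightarrow> \<gamma> \<in> J \<Longrightarrow> (\<Sum>\<beta>\<in>J. H \<alpha> \<beta> * F \<beta> \<gamma>) = (if \<alpha> = \<gamma> then 1 else 0)"
    and y: "\<And>\<alpha>. \<alpha> \<in> J \<Longrightarrow> (\<Sum>\<phi>\<in>J. F \<alpha> \<phi> * y \<phi>) + w \<alpha> = 0" and \<beta>: "\<beta> \<in> J"
  shows "y \<beta> = - (\<Sum>\<alpha>\<in>J. H \<beta> \<alpha> * w \<alpha>)"
proof -
  have "(\<Sum>\<alpha>\<in>J. H \<beta> \<alpha> * (\<Sum>\<phi>\<in>J. F \<alpha> \<phi> * y \<phi>)) = (\<Sum>\<alpha>\<in>J. H \<beta> \<alpha> * - w \<alpha>)"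
    using y by (intro sum.cong) (auto simp: add_eq_0_iff2)
  moreover have "(\<Sum>\<alpha>\<in>J. H \<beta> \<alpha> * (\<Sum>\<phi>\<in>J. F \<alpha> \<phi> * y \<phi>)) = y \<beta>"
  proof -
    have "(\<Sum>\<alpha>\<in>J. H \<beta> \<alpha> * (\<Sum>\<phi>\<in>J. F \<alpha> \<phi> * y \<phi>)) = (\<Sum>\<phi>\<in>J. (\<Sum>\<alpha>\<in>J. H \<beta> \<alpha> * F \<alpha> \<phi>) * y \<phi>)"
      unfolding sum_distrib_left sum_distrib_right by (subst sum.swap) (simp add: mult.assoc)
    also have "\<dots> = (\<Sum>\<phi>\<in>J. if \<beta> = \<phi> then y \<phi> else 0)"
      using HF[OF \<beta>] by (intro sum.cong) auto
    finally show ?thesis using J \<beta> by simp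
  qed
  ultimately show ?thesis by (simp add: sum_negf)
qed

lemma sum_row:
  fixes p X :: "nat \<Rightarrow> complex"
  shows "(\<Sum>\<beta>\<in>J. \<Sum>\<alpha>\<in>J. p \<beta> * H \<beta> \<alpha> * X \<alpha>) = (\<Sum>\<alpha>\<in>J. (\<Sum>\<beta>\<in>J. p \<beta> * H \<beta> \<alpha>) * X \<alpha>)"
  by (subst sum.swap) (simp add: sum_distrib_right)

lemma sum_column:
  fixes p X :: "nat \<Rightarrow> complex"
  shows "(\<Sum>\<beta>\<in>J. \<Sum>\<alpha>\<in>J. p \<beta> * H \<beta> \<alpha> * X \<alpha>) = (\<Sum>\<beta>\<in>J. p \<beta> * (\<Sum>\<alpha>\<in>J. H \<beta> \<alpha> * X \<alpha>))"
  by (simp add: sum_distrib_left mult.assoc)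

lemma sum_four:
  fixes p X :: "nat \<Rightarrow> complex"
  shows "(\<Sum>\<beta>\<in>J. \<Sum>\<alpha>\<in>J. \<Sum>\<phi>\<in>J. \<Sum>\<gamma>\<in>J. p \<beta> * H \<beta> \<alpha> * M \<alpha> \<phi> * H \<phi> \<gamma> * X \<gamma>)
    = (\<Sum>\<alpha>\<in>J. (\<Sum>\<beta>\<in>J. p \<beta> * H \<beta> \<alpha>) * (\<Sum>\<phi>\<in>J. M \<alpha> \<phi> * (\<Sum>\<gamma>\<in>J. H \<phi> \<gamma> * X \<gamma>)))"
proof -
  have "(\<Sum>\<phi>\<in>J. \<Sum>\<gamma>\<in>J. p \<beta> * H \<beta> \<alpha> * M \<alpha> \<phi> * H \<phi> \<gamma> * X \<gamma>)
     = p \<beta> * H \<beta> \<alpha> * (\<Sum>\<phi>\<in>J. M \<alpha> \<phi> * (\<Sum>\<gamma>\<in>J. H \<phi> \<gamma> * X \<gamma>))" for \<alpha> \<beta>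
    by (simp add: sum_distrib_left mult.assoc)
  then show ?thesis using sum_row[of p H "\<lambda>\<alpha>. \<Sum>\<phi>\<in>J. M \<alpha> \<phi> * (\<Sum>\<gamma>\<in>J. H \<phi> \<gamma> * X \<gamma>)" J] by simp
qed

text \<open>Here H, S0 and S1 play the leading parts of an operator S inverse to F. The relation F S
  = 1 in the next degree is a linear system with the solutions S0 = - H F0 H and S1 = - H (G H + F0
  dH), which are inserted into the product F S F. The numbers dF and dH play the x-derivatives, so
  the last factor is the derivative of H F.\<close>

lemma dirac_low_degree:
  fixes F F0 G H S0 S1 dH :: "nat \<Rightarrow> nat \<Rightarrow> complex" and dF :: "nat \<Rightarrow> complex"
  assumes J: "finite J"
    and HF: "\<And>\<alpha> \<gamma>. \<alpha> \<in> J \<Longrightarrow> \<gamma> \<in> J \<Longrightarrow> (\<Sum>\<beta>\<in>J. H \<alpha> \<beta> * F \<beta> \<gamma>) = (if \<alpha> = \<gamma> then 1 else 0)"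
    and S0: "\<And>\<alpha> \<gamma>. \<alpha> \<in> J \<Longrightarrow> \<gamma> \<in> J \<Longrightarrow> (\<Sum>\<beta>\<in>J. F \<alpha> \<beta> * S0 \<beta> \<gamma> + F0 \<alpha> \<beta> * H \<beta> \<gamma>) = 0"
    and S1: "\<And>\<alpha> \<gamma>. \<alpha> \<in> J \<Longrightarrow> \<gamma> \<in> J \<Longrightarrow>
      (\<Sum>\<beta>\<in>J. F \<alpha> \<beta> * S1 \<beta> \<gamma> + G \<alpha> \<beta> * H \<beta> \<gamma> + F0 \<alpha> \<beta> * dH \<beta> \<gamma>) = 0"
  shows "(\<Sum>\<beta>\<in>J. \<Sum>\<alpha>\<in>J. F i \<beta> * (H \<beta> \<alpha> * F0 \<alpha> j + S0 \<beta> \<alpha> * F \<alpha> j) + F0 i \<beta> * (H \<beta> \<alpha> * F \<alpha> j))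
      = (\<Sum>\<beta>\<in>J. \<Sum>\<alpha>\<in>J. F0 i \<beta> * H \<beta> \<alpha> * F \<alpha> j)
        - (\<Sum>\<beta>\<in>J. \<Sum>\<alpha>\<in>J. \<Sum>\<phi>\<in>J. \<Sum>\<gamma>\<in>J. F i \<beta> * H \<beta> \<alpha> * F0 \<alpha> \<phi> * H \<phi> \<gamma> * F \<gamma> j)
        + (\<Sum>\<beta>\<in>J. \<Sum>\<alpha>\<in>J. F i \<beta> * H \<beta> \<alpha> * F0 \<alpha> j)" (is ?A)
    and "(\<Sum>\<beta>\<in>J. \<Sum>\<alpha>\<in>J. F i \<beta> * (H \<beta> \<alpha> * G \<alpha> j + S1 \<beta> \<alpha> * F \<alpha> j + S0 \<beta> \<alpha> * dF \<alpha>)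
          + G i \<beta> * (H \<beta> \<alpha> * F \<alpha> j) + F0 i \<beta> * (H \<beta> \<alpha> * dF \<alpha> + dH \<beta> \<alpha> * F \<alpha> j))
      = (\<Sum>\<beta>\<in>J. \<Sum>\<alpha>\<in>J. G i \<beta> * H \<beta> \<alpha> * F \<alpha> j)
        - (\<Sum>\<beta>\<in>J. \<Sum>\<alpha>\<in>J. \<Sum>\<phi>\<in>J. \<Sum>\<gamma>\<in>J. F i \<beta> * H \<beta> \<alpha> * G \<alpha> \<phi> * H \<phi> \<gamma> * F \<gamma> j)
        + (\<Sum>\<beta>\<in>J. \<Sum>\<alpha>\<in>J. F i \<beta> * H \<beta> \<alpha> * G \<alpha> j)
        + (\<Sum>\<beta>\<in>J. (F0 i \<beta> - (\<Sum>\<mu>\<in>J. \<Sum>\<alpha>\<in>J. F i \<mu> * H \<mu> \<alpha> * F0 \<alpha> \<beta>))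
            * (\<Sum>\<phi>\<in>J. H \<beta> \<phi> * dF \<phi> + dH \<beta> \<phi> * F \<phi> j))" (is ?B)
proof -
  \<comment> \<open>The row vector F H and, next, the column vectors H X; with them every fourfold
    sum becomes a row times a matrix times a column.\<close>
  define r where "r \<alpha> = (\<Sum>\<beta>\<in>J. F i \<beta> * H \<beta> \<alpha>)" for \<alpha>
  define c where "c X \<phi> = (\<Sum>\<gamma>\<in>J. H \<phi> \<gamma> * X \<gamma>)" for X :: "nat \<Rightarrow> complex" and \<phi>
  define Fj where "Fj \<alpha> = F \<alpha> j" for \<alpha>
  define d where "d \<beta> = (\<Sum>\<phi>\<in>J. dH \<beta> \<phi> * F \<phi> j)" for \<beta>
  have s0: "S0 \<beta> \<gamma> = - (\<Sum>\<alpha>\<in>J. H \<beta> \<alpha> * (\<Sum>\<phi>\<in>J. F0 \<alpha> \<phi> * H \<phi> \<gamma>))" if "\<beta> \<in> J" "\<gamma> \<in> J" for \<beta> \<gamma>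
    by (rule solve_linear[OF J HF _ that(1)]) (use S0 that in \<open>auto simp: sum.distrib\<close>)
  have s1: "S1 \<beta> \<gamma> = - (\<Sum>\<alpha>\<in>J. H \<beta> \<alpha> * (\<Sum>\<phi>\<in>J. G \<alpha> \<phi> * H \<phi> \<gamma> + F0 \<alpha> \<phi> * dH \<phi> \<gamma>))"
    if "\<beta> \<in> J" "\<gamma> \<in> J" for \<beta> \<gamma>
    by (rule solve_linear[OF J HF _ that(1)]) (use S1 that in \<open>auto simp: sum.distrib add.assoc\<close>)
  have FS: "(\<Sum>\<beta>\<in>J. F i \<beta> * (\<Sum>\<alpha>\<in>J. H \<beta> \<alpha> * w \<alpha>)) = (\<Sum>\<alpha>\<in>J. r \<alpha> * w \<alpha>)" for w
    unfolding r_def using sum_row[of "F i" H w J] sum_column[of "F i" H w J] by simp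
  have FS0: "(\<Sum>\<beta>\<in>J. \<Sum>\<gamma>\<in>J. F i \<beta> * (S0 \<beta> \<gamma> * X \<gamma>)) = - (\<Sum>\<alpha>\<in>J. r \<alpha> * (\<Sum>\<phi>\<in>J. F0 \<alpha> \<phi> * c X \<phi>))" for X
  proof -
    have "(\<Sum>\<beta>\<in>J. \<Sum>\<gamma>\<in>J. F i \<beta> * (S0 \<beta> \<gamma> * X \<gamma>)) = (\<Sum>\<gamma>\<in>J. (\<Sum>\<beta>\<in>J. F i \<beta> * S0 \<beta> \<gamma>) * X \<gamma>)"
      by (subst sum.swap) (simp add: sum_distrib_right mult.assoc)
    also have "\<dots> = (\<Sum>\<gamma>\<in>J. - (\<Sum>\<alpha>\<in>J. r \<alpha> * (\<Sum>\<phi>\<in>J. F0 \<alpha> \<phi> * H \<phi> \<gamma>)) * X \<gamma>)"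
      using s0 by (intro sum.cong refl) (simp add: FS sum_negf cong: sum.cong)
    also have "\<dots> = - (\<Sum>\<alpha>\<in>J. r \<alpha> * (\<Sum>\<phi>\<in>J. F0 \<alpha> \<phi> * c X \<phi>))"
    proof -
      have "(\<Sum>\<gamma>\<in>J. (\<Sum>\<alpha>\<in>J. r \<alpha> * (\<Sum>\<phi>\<in>J. F0 \<alpha> \<phi> * H \<phi> \<gamma>)) * X \<gamma>)
        = (\<Sum>\<alpha>\<in>J. r \<alpha> * (\<Sum>\<gamma>\<in>J. (\<Sum>\<phi>\<in>J. F0 \<alpha> \<phi> * H \<phi> \<gamma>) * X \<gamma>))"
        unfolding sum_distrib_right[of _ J] by (subst sum.swap) (simp add: sum_distrib_left sum_distrib_right mult.assoc)
      then show ?thesis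
        using sum_row[of "F0 _" H X J] sum_column[of "F0 _" H X J] by (simp add: sum_negf c_def)
    qed
    finally show ?thesis .
  qed
  have FS1: "(\<Sum>\<beta>\<in>J. \<Sum>\<gamma>\<in>J. F i \<beta> * (S1 \<beta> \<gamma> * F \<gamma> j))
     = - (\<Sum>\<alpha>\<in>J. r \<alpha> * (\<Sum>\<phi>\<in>J. G \<alpha> \<phi> * c Fj \<phi>)) - (\<Sum>\<alpha>\<in>J. r \<alpha> * (\<Sum>\<phi>\<in>J. F0 \<alpha> \<phi> * d \<phi>))"
  proof -
    have inner: "(\<Sum>\<gamma>\<in>J. (\<Sum>\<phi>\<in>J. G \<alpha> \<phi> * H \<phi> \<gamma> + F0 \<alpha> \<phi> * dH \<phi> \<gamma>) * F \<gamma> j)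
       = (\<Sum>\<phi>\<in>J. G \<alpha> \<phi> * c Fj \<phi>) + (\<Sum>\<phi>\<in>J. F0 \<alpha> \<phi> * d \<phi>)" for \<alpha>
      using sum_row[of "G \<alpha>" H Fj J] sum_column[of "G \<alpha>" H Fj J]
        sum_row[of "F0 \<alpha>" dH Fj J] sum_column[of "F0 \<alpha>" dH Fj J]
      by (simp add: sum.distrib distrib_right c_def d_def Fj_def)
    have "(\<Sum>\<beta>\<in>J. \<Sum>\<gamma>\<in>J. F i \<beta> * (S1 \<beta> \<gamma> * F \<gamma> j)) = (\<Sum>\<gamma>\<in>J. (\<Sum>\<beta>\<in>J. F i \<beta> * S1 \<beta> \<gamma>) * F \<gamma> j)"
      by (subst sum.swap) (simp add: sum_distrib_right mult.assoc)
    also have "\<dots> = (\<Sum>\<gamma>\<in>J. - (\<Sum>\<alpha>\<in>J. r \<alpha> * (\<Sum>\<phi>\<in>J. G \<alpha> \<phi> * H \<phi> \<gamma> + F0 \<alpha> \<phi> * dH \<phi> \<gamma>)) * F \<gamma> j)"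
      using s1 by (intro sum.cong refl) (simp add: FS sum_negf cong: sum.cong)
    also have "\<dots> = - (\<Sum>\<alpha>\<in>J. r \<alpha> * (\<Sum>\<gamma>\<in>J. (\<Sum>\<phi>\<in>J. G \<alpha> \<phi> * H \<phi> \<gamma> + F0 \<alpha> \<phi> * dH \<phi> \<gamma>) * F \<gamma> j))"
    proof -
      have "(\<Sum>\<gamma>\<in>J. (\<Sum>\<alpha>\<in>J. r \<alpha> * (\<Sum>\<phi>\<in>J. G \<alpha> \<phi> * H \<phi> \<gamma> + F0 \<alpha> \<phi> * dH \<phi> \<gamma>)) * F \<gamma> j)
        = (\<Sum>\<alpha>\<in>J. r \<alpha> * (\<Sum>\<gamma>\<in>J. (\<Sum>\<phi>\<in>J. G \<alpha> \<phi> * H \<phi> \<gamma> + F0 \<alpha> \<phi> * dH \<phi> \<gamma>) * F \<gamma> j))"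
        unfolding sum_distrib_right[of _ J "F _ j"] by (subst sum.swap) (simp add: sum_distrib_left sum_distrib_right mult.assoc)
      then show ?thesis by (simp add: sum_negf)
    qed
    finally show ?thesis unfolding inner by (simp add: distrib_left sum.distrib)
  qed
  have row: "(\<Sum>\<beta>\<in>J. \<Sum>\<alpha>\<in>J. F i \<beta> * (H \<beta> \<alpha> * X \<alpha>)) = (\<Sum>\<alpha>\<in>J. r \<alpha> * X \<alpha>)" for X
    using sum_row[of "F i" H X J] by (simp add: r_def mult.assoc)
  have col: "(\<Sum>\<beta>\<in>J. \<Sum>\<alpha>\<in>J. P i \<beta> * (H \<beta> \<alpha> * X \<alpha>)) = (\<Sum>\<beta>\<in>J. P i \<beta> * c X \<beta>)" for X P
    by (simp add: c_def sum_distrib_left)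
  have four: "(\<Sum>\<beta>\<in>J. \<Sum>\<alpha>\<in>J. \<Sum>\<phi>\<in>J. \<Sum>\<gamma>\<in>J. F i \<beta> * H \<beta> \<alpha> * M \<alpha> \<phi> * H \<phi> \<gamma> * F \<gamma> j)
    = (\<Sum>\<alpha>\<in>J. r \<alpha> * (\<Sum>\<phi>\<in>J. M \<alpha> \<phi> * c Fj \<phi>))" for M
    unfolding sum_four r_def c_def Fj_def ..
  show ?A
    unfolding four using FS0[of Fj] col[of F0 Fj] row[of "\<lambda>\<alpha>. F0 \<alpha> j"]
    by (simp add: distrib_left sum.distrib Fj_def mult.assoc)
  have X: "(\<Sum>\<beta>\<in>J. (F0 i \<beta> - (\<Sum>\<mu>\<in>J. \<Sum>\<alpha>\<in>J. F i \<mu> * H \<mu> \<alpha> * F0 \<alpha> \<beta>)) * D \<beta>)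
    = (\<Sum>\<beta>\<in>J. F0 i \<beta> * D \<beta>) - (\<Sum>\<alpha>\<in>J. r \<alpha> * (\<Sum>\<phi>\<in>J. F0 \<alpha> \<phi> * D \<phi>))" for D
  proof -
    have "(\<Sum>\<beta>\<in>J. (\<Sum>\<mu>\<in>J. \<Sum>\<alpha>\<in>J. F i \<mu> * H \<mu> \<alpha> * F0 \<alpha> \<beta>) * D \<beta>) = (\<Sum>\<beta>\<in>J. (\<Sum>\<alpha>\<in>J. r \<alpha> * F0 \<alpha> \<beta>) * D \<beta>)"
      unfolding sum_row r_def ..
    also have "\<dots> = (\<Sum>\<alpha>\<in>J. r \<alpha> * (\<Sum>\<phi>\<in>J. F0 \<alpha> \<phi> * D \<phi>))"
      unfolding sum_distrib_right[of _ J "D _"] by (subst sum.swap) (simp add: sum_distrib_left mult.assoc)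
    finally show ?thesis by (simp add: left_diff_distrib sum_subtractf)
  qed
  have D: "(\<Sum>\<phi>\<in>J. H \<beta> \<phi> * dF \<phi> + dH \<beta> \<phi> * F \<phi> j) = c dF \<beta> + d \<beta>" for \<beta>
    by (simp add: sum.distrib c_def d_def)
  have dd: "(\<Sum>\<beta>\<in>J. \<Sum>\<alpha>\<in>J. F0 i \<beta> * (dH \<beta> \<alpha> * F \<alpha> j)) = (\<Sum>\<beta>\<in>J. F0 i \<beta> * d \<beta>)"
    by (simp add: d_def sum_distrib_left)
  show ?B
    unfolding four X D
    using FS0[of dF] FS1 col[of G Fj] col[of F0 dF] row[of "\<lambda>\<alpha>. G \<alpha> j"] dd
    by (simp add: distrib_left sum.distrib Fj_def mult.assoc)
qed

section \<open>Dependence of operators on their jets and on their arguments\<close>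

lemma diff_poly_cong: "diff_poly K p \<Longrightarrow> (\<And>k r. k \<in> K \<Longrightarrow> u k r = u' k r) \<Longrightarrow> p u = p u'"
  by (induction rule: diff_poly.induct) auto

lemma op_apply_cong:
  assumes "poly_op K L" "\<And>k r x. k \<in> K \<Longrightarrow> j x k r = j' x k r"
  shows "op_apply L j \<eta> x = op_apply L j' \<eta> x"
proof -
  have "(L ! r) (j x) = (L ! r) (j' x)" if "r < length L" for r
    by (rule diff_poly_cong[of K]) (use assms that in \<open>auto simp: poly_op_def\<close>)
  then show ?thesis unfolding op_apply_def by simp
qed

lemma op_apply_arg_sum:
  assumes "\<And>i. i \<in> I \<Longrightarrow> \<zeta> i \<in> loops UNIV"
  shows "op_apply L j (\<lambda>x. \<Sum>i\<in>I. \<zeta> i x) x = (\<Sum>i\<in>I. op_apply L j (\<zeta> i) x)"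
proof -
  have "(dx ^^ r) (\<lambda>x. \<Sum>i\<in>I. \<zeta> i x) = (\<lambda>x. \<Sum>i\<in>I. (dx ^^ r) (\<zeta> i) x)" for r
    by (induction r) (auto simp: dx_sum dxs_in_loops assms)
  then show ?thesis
    unfolding op_apply_def by (simp add: sum_distrib_left sum.swap[of _ I])
qed

lemma op_apply_arg_neg:
  assumes "\<zeta> \<in> loops UNIV" shows "op_apply L j (\<lambda>x. - \<zeta> x) x = - op_apply L j \<zeta> x"
proof -
  have "(dx ^^ r) (\<lambda>x. - \<zeta> x) = (\<lambda>x. - (dx ^^ r) \<zeta> x)" for r
    by (induction r) (auto simp: dx_uminus dxs_in_loops assms)
  then show ?thesis unfolding op_apply_def by (simp add: sum_negf)
qed

lemma op_apply_arg_0: "op_apply L j (\<lambda>x. 0) x = 0"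
proof -
  have "(dx ^^ r) (\<lambda>x. 0::complex) = (\<lambda>x. 0)" for r by (induction r) (auto simp: dx_const)
  then show ?thesis unfolding op_apply_def by simp
qed

text \<open>Restriction of a coefficient to Q, where the coordinates with index above m and all
  their derivatives vanish.\<close>

definition set_zero :: "nat set \<Rightarrow> (jet \<Rightarrow> complex) \<Rightarrow> jet \<Rightarrow> complex" where
  "set_zero J p = (\<lambda>u. p (\<lambda>k r. if k \<in> J then 0 else u k r))"

lemma diff_poly_set_zero: "diff_poly K p \<Longrightarrow> K - J \<subseteq> K' \<Longrightarrow> diff_poly K' (set_zero J p)"
  unfolding set_zero_def
proof (induction rule: diff_poly.induct)
  case (jet_var k r)
  then show ?case by (cases "k \<in> J") (auto intro: diff_poly.intros)
qed (auto intro: diff_poly.intros)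

context slice_data
begin

section \<open>Operators on $Q$\<close>

lemma coord_loops: "z \<in> loops UNIV \<Longrightarrow> (\<lambda>y. cc (z y) k) \<in> loops UNIV"
  unfolding cc by (intro loops_killing loops_diff const_in_loops)

lemma jet_of_jets: "jet_of cc z = jets (\<lambda>k y. cc (z y) k)"
  by (simp add: jet_of_def[abs_def] jets_def[abs_def])

lemma QQ_loops: "z \<in> QQ \<Longrightarrow> z \<in> loops UNIV"
  by (simp add: QQ_iff)

lemma cc_J: "z \<in> QQ \<Longrightarrow> k \<in> J \<Longrightarrow> cc (z x) k = 0"
  by (auto simp: QQ_iff gf_iff cc)

lemma jet_J: 
  assumes "z \<in> QQ" "k \<in> J" shows "jet_of cc z x k r = 0"
proof -
  have "(dx ^^ r) (\<lambda>y. 0::complex) = (\<lambda>x. 0)" by (induction r) (auto simp: dx_const)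
  moreover have "(\<lambda>y. cc (z y) k) = (\<lambda>y. 0)" using assms by (auto simp: cc_J)
  ultimately show ?thesis by (simp add: jet_of_def)
qed

lemma QQ_expand: 
  assumes "z \<in> QQ" shows "z x - e = (\<Sum>k=1..m. cc (z x) k *s \<xi> k)"
proof -
  have "(\<Sum>k=1..m. cc (z x) k *s \<xi> k) = (\<Sum>k=1..n. cc (z x) k *s \<xi> k)"
    using m_le_n cc_J[OF assms] by (intro sum.mono_neutral_left) auto
  then show ?thesis using expand_basis[of "z x - e"] by (simp add: cc)
qed

text \<open>One list of coefficients has to serve all z in Q and all \<zeta>. Closure properties of
  this class show that the inverse, built as a Neumann series, is a differential operator in the m
  coordinates of Q.\<close>

definition dop :: "((real \<Rightarrow> complex^'d) \<Rightarrow> (real \<Rightarrow> complex) \<Rightarrow> real \<Rightarrow> complex) \<Rightarrow> bool" where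
  "dop T \<longleftrightarrow> (\<exists>L. poly_op {1..m} L \<and> (\<forall>z\<in>QQ. \<forall>\<zeta>\<in>loops UNIV. T z \<zeta> = op_apply L (jet_of cc z) \<zeta>))"

definition dop_vec :: "((real \<Rightarrow> complex^'d) \<Rightarrow> (real \<Rightarrow> complex) \<Rightarrow> real \<Rightarrow> complex^'d) \<Rightarrow> bool" where
  "dop_vec T \<longleftrightarrow> (\<forall>i. dop (\<lambda>z \<zeta> x. T z \<zeta> x $ i))"

lemma dop_loops: "dop T \<Longrightarrow> z \<in> QQ \<Longrightarrow> \<zeta> \<in> loops UNIV \<Longrightarrow> T z \<zeta> \<in> loops UNIV"
  unfolding dop_def jet_of_jets using op_apply_loops coord_loops QQ_loops by (metis (no_types, lifting))

lemma dop_id: "dop (\<lambda>z \<zeta>. \<zeta>)"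
  unfolding dop_def
  by (rule exI[of _ "[\<lambda>u. 1]"]) (auto simp: poly_op_def op_apply_def intro: diff_poly.const)

lemma dop_congr: "dop T \<Longrightarrow> (\<And>z \<zeta> x. z \<in> QQ \<Longrightarrow> \<zeta> \<in> loops UNIV \<Longrightarrow> T' z \<zeta> x = T z \<zeta> x) \<Longrightarrow> dop T'"
  unfolding dop_def by (metis (no_types, lifting) ext)

lemma dop_sum:
  assumes "finite I" "\<And>i. i \<in> I \<Longrightarrow> dop (T i)" shows "dop (\<lambda>z \<zeta> x. \<Sum>i\<in>I. T i z \<zeta> x)"
proof -
  have "\<forall>i\<in>I. \<exists>L. poly_op {1..m} L \<and> (\<forall>z\<in>QQ. \<forall>\<zeta>\<in>loops UNIV. T i z \<zeta> = op_apply L (jet_of cc z) \<zeta>)"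
    using assms(2) by (auto simp: dop_def)
  from bchoice[OF this] obtain L where L: "\<And>i. i \<in> I \<Longrightarrow> poly_op {1..m} (L i)"
    "\<And>i z \<zeta>. i \<in> I \<Longrightarrow> z \<in> QQ \<Longrightarrow> \<zeta> \<in> loops UNIV \<Longrightarrow> T i z \<zeta> = op_apply (L i) (jet_of cc z) \<zeta>" by blast
  show ?thesis unfolding dop_def
    by (rule exI[of _ "op_sum I L"]) (auto simp: op_apply_sum assms(1) L simp del: One_nat_def intro!: poly_op_sum)
qed

lemma dop_add: "dop T \<Longrightarrow> dop U \<Longrightarrow> dop (\<lambda>z \<zeta> x. T z \<zeta> x + U z \<zeta> x)"
  using dop_sum[of "UNIV :: bool set" "\<lambda>b. if b then T else U"] by (simp add: UNIV_bool add.commute)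

lemma dop_mult:
  assumes "diff_poly {1..m} p" "dop T" shows "dop (\<lambda>z \<zeta> x. p (jet_of cc z x) * T z \<zeta> x)"
proof -
  obtain L where L: "poly_op {1..m} L" "\<And>z \<zeta>. z \<in> QQ \<Longrightarrow> \<zeta> \<in> loops UNIV \<Longrightarrow> T z \<zeta> = op_apply L (jet_of cc z) \<zeta>"
    using assms(2) by (auto simp: dop_def)
  show ?thesis unfolding dop_def
    by (rule exI[of _ "op_mult p L"]) (auto simp: op_apply_mult L simp del: One_nat_def intro!: poly_op_mult assms)
qed

lemma dop_dx:
  assumes "dop T" shows "dop (\<lambda>z \<zeta>. dx (T z \<zeta>))"
proof -
  obtain L where L: "poly_op {1..m} L" "\<And>z \<zeta>. z \<in> QQ \<Longrightarrow> \<zeta> \<in> loops UNIV \<Longrightarrow> T z \<zeta> = op_apply L (jet_of cc z) \<zeta>"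
    using assms by (auto simp: dop_def)
  show ?thesis unfolding dop_def
    by (rule exI[of _ "op_dx L"])
      (auto simp: jet_of_jets op_apply_dx[OF L(1)] coord_loops QQ_loops L(2) simp del: One_nat_def
        intro!: poly_op_dx L(1))
qed

lemma dop_functional:
  assumes "dop_vec N" "\<And>x y. \<Phi> (x + y) = \<Phi> x + \<Phi> y" "\<And>c x. \<Phi> (c *s x) = c * \<Phi> x"
  shows "dop (\<lambda>z \<zeta> x. \<Phi> (N z \<zeta> x))"
proof -
  have "dop (\<lambda>z \<zeta> x. \<Sum>j\<in>UNIV. (\<lambda>u. \<Phi> (axis j 1)) (jet_of cc z x) * N z \<zeta> x $ j)"
    using assms(1) by (intro dop_sum dop_mult diff_poly.const) (auto simp: dop_vec_def)
  then show ?thesis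
    by (rule dop_congr) (subst linear_functional_components[of \<Phi>, OF assms(2,3)], simp add: mult.commute)
qed

lemma dop_vec_linear: "clinear T \<Longrightarrow> dop_vec N \<Longrightarrow> dop_vec (\<lambda>z \<zeta> x. T (N z \<zeta> x))"
  unfolding dop_vec_def[of "\<lambda>z \<zeta> x. T (N z \<zeta> x)"]
  by (intro allI dop_functional[where \<Phi> = "\<lambda>v. T v $ _"]) (auto simp: clinear_simps)

lemma dop_vec_sum: "finite I \<Longrightarrow> (\<And>i. i \<in> I \<Longrightarrow> dop_vec (N i)) \<Longrightarrow> dop_vec (\<lambda>z \<zeta> x. \<Sum>i\<in>I. N i z \<zeta> x)"
  unfolding dop_vec_def by (auto intro: dop_sum)

lemma dop_vec_add: "dop_vec N \<Longrightarrow> dop_vec M \<Longrightarrow> dop_vec (\<lambda>z \<zeta> x. N z \<zeta> x + M z \<zeta> x)"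
  unfolding dop_vec_def by (auto intro: dop_add)

lemma dop_vec_mult: "diff_poly {1..m} p \<Longrightarrow> dop_vec N \<Longrightarrow> dop_vec (\<lambda>z \<zeta> x. p (jet_of cc z x) *s N z \<zeta> x)"
  unfolding dop_vec_def by (auto intro: dop_mult)

lemma dop_vec_loops: "dop_vec N \<Longrightarrow> z \<in> QQ \<Longrightarrow> \<zeta> \<in> loops UNIV \<Longrightarrow> N z \<zeta> \<in> loops UNIV"
  by (auto simp: dop_vec_def loops_vec_iff[of "N z \<zeta>"] intro: dop_loops)

lemma dop_vec_dx: 
  assumes N: "dop_vec N" shows "dop_vec (\<lambda>z \<zeta>. dx (N z \<zeta>))"
  unfolding dop_vec_def
proof
  fix i
  have "dop (\<lambda>z \<zeta>. dx (\<lambda>x. N z \<zeta> x $ i))" using N by (auto simp: dop_vec_def intro: dop_dx)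
  then show "dop (\<lambda>z \<zeta> x. dx (N z \<zeta>) x $ i)"
    by (rule dop_congr) (simp add: dx_vec_nth dop_vec_loops[OF N])
qed

lemma dop_vec_congr:
  "dop_vec N \<Longrightarrow> (\<And>z \<zeta> x. z \<in> QQ \<Longrightarrow> \<zeta> \<in> loops UNIV \<Longrightarrow> M z \<zeta> x = N z \<zeta> x) \<Longrightarrow> dop_vec M"
  unfolding dop_vec_def
proof
  fix i
  assume "\<forall>i. dop (\<lambda>z \<zeta> x. N z \<zeta> x $ i)" and eq: "\<And>z \<zeta> x. z \<in> QQ \<Longrightarrow> \<zeta> \<in> loops UNIV \<Longrightarrow> M z \<zeta> x = N z \<zeta> x"
  then have "dop (\<lambda>z \<zeta> x. N z \<zeta> x $ i)" by blast
  then show "dop (\<lambda>z \<zeta> x. M z \<zeta> x $ i)" by (rule dop_congr) (simp add: eq)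
qed

text \<open>On Q the loop z - e is a combination of the first m basis vectors with the coordinates
  as coefficients, so the bracket with it has differential polynomial coefficients.\<close>

lemma dop_vec_low:
  assumes N: "dop_vec N" shows "dop_vec (\<lambda>z \<zeta>. low lam z (N z \<zeta>))"
proof -
  have 1: "clinear (\<lambda>v. - theta (br x v))" for x
    by (intro clinearI) (auto simp: br_simps theta_simps)
  have 2: "clinear (\<lambda>v. - theta v)" "clinear (\<lambda>v. - theta (lam *s br a v))"
    by (intro clinearI; auto simp: br_simps theta_simps vec.scale_right_distrib mult.commute)+
  have "dop_vec (\<lambda>z \<zeta> x. - theta (dx (N z \<zeta>) x) + ((\<Sum>k\<in>{1..m}. (\<lambda>u. u k 0) (jet_of cc z x) *s - theta (br (\<xi> k) (N z \<zeta> x)))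
     + - theta (lam *s br a (N z \<zeta> x))))"
    by (intro dop_vec_add dop_vec_sum dop_vec_mult dop_vec_linear[OF 1] dop_vec_linear[OF 2(1)] dop_vec_linear[OF 2(2)]
      dop_vec_dx N diff_poly.jet_var) auto
  then show ?thesis
  proof (rule dop_vec_congr)
    fix z \<zeta> x assume z: "z \<in> QQ"
    show "low lam z (N z \<zeta>) x = - theta (dx (N z \<zeta>) x) + ((\<Sum>k\<in>{1..m}. jet_of cc z x k 0 *s - theta (br (\<xi> k) (N z \<zeta> x)))
     + - theta (lam *s br a (N z \<zeta> x)))"
      unfolding low_def QQ_expand[OF z]
      by (simp add: jet_of_def br_simps theta_simps sum_negf)
  qed
qed

lemma dop_vec_scale: "dop_vec (\<lambda>z \<zeta> x. \<zeta> x *s y)"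
  unfolding dop_vec_def
proof
  fix i
  have "dop (\<lambda>z \<zeta> x. (\<lambda>u. y $ i) (jet_of cc z x) * \<zeta> x)" by (intro dop_mult diff_poly.const dop_id)
  then show "dop (\<lambda>z \<zeta> x. (\<zeta> x *s y) $ i)" by (simp add: mult.commute)
qed

lemma dop_inverse: "dop (\<lambda>z. inv_op lam z \<beta> \<alpha>)"
proof -
  have l: "dop_vec (\<lambda>z \<zeta>. (low lam z ^^ k) (\<lambda>x. \<zeta> x *s theta (\<xi> \<alpha>)))" for k
    by (induction k) (auto intro: dop_vec_scale dop_vec_low)
  have "dop (\<lambda>z \<zeta> x. killing br (neumann lam z (\<lambda>x. \<zeta> x *s theta (\<xi> \<alpha>)) x) (\<xi> \<beta>))"
    unfolding neumann_def
    by (rule dop_functional[where \<Phi> = "\<lambda>v. killing br v (\<xi> \<beta>)"]) (auto simp: killing_simps intro!: dop_vec_sum l)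
  then show ?thesis by (simp add: inv_op_def[abs_def])
qed

text \<open>Any m loops are the coordinates of a point of Q, so identities valid on Q suffice for
  the general uniqueness.\<close>

lemma op_unique_QQ:
  assumes L: "poly_op {1..m} L" and M: "poly_op {1..m} M"
    and eq: "\<And>z \<zeta> x. z \<in> QQ \<Longrightarrow> \<zeta> \<in> loops UNIV \<Longrightarrow> op_apply L (jet_of cc z) \<zeta> x = op_apply M (jet_of cc z) \<zeta> x"
  shows "op_coeff L r = op_coeff M r"
proof (rule op_coeff_unique[OF L M])
  fix g :: "nat \<Rightarrow> real \<Rightarrow> complex" and k
  assume g: "\<And>k. g k \<in> loops UNIV"
  define z where "z x = e + (\<Sum>k=1..m. g k x *s \<xi> k)" for x
  have z: "z \<in> QQ"
    unfolding QQ_iff using xi_gf 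
    by (auto simp: z_def[abs_def] intro!: loops_add loops_sum const_in_loops loops_scale g 
      vec.subspace_sum vec.subspace_scale gf_subspace)
  have "cc (z x) k = g k x" if "k \<in> {1..m}" for k x
  proof -
    have "cc (z x) k = (\<Sum>i=1..m. if i = k then g k x else 0)"
      unfolding cc z_def using dual_basis that m_le_n 
      by (simp add: killing_simps del: sum.delta sum.delta') (intro sum.cong, auto)
    then show ?thesis using that by simp
  qed
  then have "(\<lambda>y. cc (z y) k) = g k" if "k \<in> {1..m}" for k using that by auto
  then have j: "jet_of cc z x k r = jets g x k r" if "k \<in> {1..m}" for k r x
    using that by (simp add: jet_of_def jets_def)
  show "op_apply L (jets g) (wave k) 0 = op_apply M (jets g) (wave k) 0"
  proof -
    have "op_apply L (jet_of cc z) (wave k) 0 = op_apply L (jets g) (wave k) 0" by (rule op_apply_cong[OF L j])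
    moreover have "op_apply M (jet_of cc z) (wave k) 0 = op_apply M (jets g) (wave k) 0" by (rule op_apply_cong[OF M j])
    ultimately show ?thesis using eq[OF z wave_loops, of k 0] by simp
  qed
qed

section \<open>The reduced bracket as a Dirac bracket\<close>

definition is_F :: "complex \<Rightarrow> (nat \<Rightarrow> nat \<Rightarrow> diff_op) \<Rightarrow> bool" where
  "is_F lam A \<longleftrightarrow> matrix_diff_op {1..n} {1..n} A \<and>
     coordinate_brackets cc {1..n} (loops UNIV) (pencil br a lam) (matrix_op cc A)"

lemma matrix_op_loops:
  assumes "matrix_diff_op I K A" "i \<in> I" "j \<in> I" "z \<in> loops UNIV" "\<zeta> \<in> loops UNIV"
  shows "matrix_op cc A z i j \<zeta> \<in> loops UNIV"
  unfolding matrix_op_def jet_of_jets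
  by (rule op_apply_loops[of K]) (use assms in \<open>auto simp: matrix_diff_op_def poly_op_def coord_loops\<close>)

text \<open>The bracket is given only in integrated form; the fundamental lemma recovers the
  operator pointwise, so every admissible A acts as \<open>coord_op\<close>.\<close>

lemma is_F_coord_op:
  assumes A: "is_F lam A" and ij: "i \<in> {1..n}" "j \<in> {1..n}" and z: "z \<in> loops UNIV" and \<zeta>: "\<zeta> \<in> loops UNIV"
  shows "matrix_op cc A z i j \<zeta> = coord_op lam z i j \<zeta>"
proof
  fix x
  have "matrix_op cc A z i j \<zeta> \<in> loops UNIV" using A ij z \<zeta> by (auto simp: is_F_def intro: matrix_op_loops)
  moreover have "circle_int (\<lambda>x. \<eta> x * matrix_op cc A z i j \<zeta> x) = circle_int (\<lambda>x. \<eta> x * coord_op lam z i j \<zeta> x)"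
    if "\<eta> \<in> loops UNIV" for \<eta>
    using A ij z \<zeta> that pencil_smeared[OF that \<zeta> z, of lam i j] by (auto simp: is_F_def coordinate_brackets_def)
  ultimately show "matrix_op cc A z i j \<zeta> x = coord_op lam z i j \<zeta> x"
    using fundamental_lemma_eq[OF _ coord_op_loops[OF z \<zeta>]] by blast
qed

lemma is_F_exists: "\<exists>A. is_F lam A"
proof -
  \<comment> \<open>The pencil is affine in q: order zero carries the bracket with e +
    \<open>lam\<close> a and with the basis vectors, order one the constant Killing matrix of the
    dual basis.\<close>
  define A :: "nat \<Rightarrow> nat \<Rightarrow> diff_op" where "A i j = [\<lambda>u. killing br (\<xi>' i) (br (e + lam *s a) (\<xi>' j))
    + (\<Sum>k=1..n. killing br (\<xi>' i) (br (\<xi> k) (\<xi>' j)) * u k 0), \<lambda>u. killing br (\<xi>' i) (\<xi>' j)]" for i j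
  have p: "matrix_diff_op {1..n} {1..n} A"
    unfolding matrix_diff_op_def A_def by (auto intro!: diff_poly.intros diff_poly_sum)
  have c: "matrix_op cc A z i j \<zeta> x = coord_op lam z i j \<zeta> x" if "z \<in> loops UNIV" "\<zeta> \<in> loops UNIV" for z i j \<zeta> x
  proof -
    have "dx (\<lambda>x. \<zeta> x *s \<xi>' j) = (\<lambda>x. dx \<zeta> x *s \<xi>' j)"
    proof
      fix x show "dx (\<lambda>x. \<zeta> x *s \<xi>' j) x = dx \<zeta> x *s \<xi>' j"
        using that(2) by (simp add: vec_eq_iff dx_vec_nth loops_scale dx_bounded_linear[OF bounded_linear_mult_left])
    qed
    moreover have "z x + lam *s a = (e + lam *s a) + (\<Sum>k=1..n. cc (z x) k *s \<xi> k)"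
      using expand_basis[of "z x - e"] by (simp add: cc algebra_simps)
    ultimately show ?thesis
      unfolding coord_op_def pen_def
      by (simp only: br_simps killing_simps matrix_op_def op_apply_def A_def)
        (simp add: jet_of_def killing_simps distrib_left distrib_right sum_distrib_left sum_distrib_right mult_ac)
  qed
  have "coordinate_brackets cc {1..n} (loops UNIV) (pencil br a lam) (matrix_op cc A)"
    unfolding coordinate_brackets_def by (auto simp: pencil_smeared c)
  with p show ?thesis by (auto simp: is_F_def)
qed

definition is_S :: "(nat \<Rightarrow> nat \<Rightarrow> diff_op) \<Rightarrow> (nat \<Rightarrow> nat \<Rightarrow> diff_op) \<Rightarrow> bool" where
  "is_S A S \<longleftrightarrow> matrix_diff_op J {1..m} S \<and> inverse_op_on cc J QQ A S"

lemma J_sub: "i \<in> J \<Longrightarrow> i \<in> {1..n}" by auto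

lemma is_S_exists:
  assumes A: "is_F lam A" shows "\<exists>S. is_S A S"
proof -
  have "\<forall>\<beta>. \<forall>\<alpha>. \<exists>L. poly_op {1..m} L \<and> (\<forall>z\<in>QQ. \<forall>\<zeta>\<in>loops UNIV. inv_op lam z \<beta> \<alpha> \<zeta> = op_apply L (jet_of cc z) \<zeta>)"
    using dop_inverse by (auto simp: dop_def)
  then obtain S where S: "\<And>\<beta> \<alpha>. poly_op {1..m} (S \<beta> \<alpha>)"
    "\<And>\<beta> \<alpha> z \<zeta>. z \<in> QQ \<Longrightarrow> \<zeta> \<in> loops UNIV \<Longrightarrow> inv_op lam z \<beta> \<alpha> \<zeta> = op_apply (S \<beta> \<alpha>) (jet_of cc z) \<zeta>"
    by metis
  have p: "matrix_diff_op J {1..m} S" using S(1) by (auto simp: matrix_diff_op_def poly_op_def)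
  have mS: "matrix_op cc S z \<beta> \<alpha> \<zeta> = inv_op lam z \<beta> \<alpha> \<zeta>" if "z \<in> QQ" "\<zeta> \<in> loops UNIV" for z \<beta> \<alpha> \<zeta>
    using S(2)[OF that] by (simp add: matrix_op_def)
  have mA: "matrix_op cc A z \<beta> \<alpha> \<zeta> = coord_op lam z \<beta> \<alpha> \<zeta>" if "z \<in> QQ" "\<zeta> \<in> loops UNIV" "\<beta> \<in> J" "\<alpha> \<in> J" for z \<beta> \<alpha> \<zeta>
    using is_F_coord_op[OF A J_sub J_sub] that QQ_loops by auto
  have "inverse_op_on cc J QQ A S"
    unfolding inverse_op_on_def
  proof (intro ballI allI impI conjI)
    fix z \<alpha> x and \<zeta> :: "nat \<Rightarrow> real \<Rightarrow> complex" assume z: "z \<in> QQ" and \<zeta>: "\<forall>\<gamma>\<in>J. \<zeta> \<gamma> \<in> loops UNIV" and \<alpha>: "\<alpha> \<in> J"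
    have iS: "inv_op lam z \<beta> \<gamma> (\<zeta> \<gamma>) \<in> loops UNIV" if "\<gamma> \<in> J" for \<beta> \<gamma>
      using dop_loops[OF dop_inverse z] \<zeta> that by auto
    have "(\<lambda>y. \<Sum>\<gamma>\<in>J. matrix_op cc S z \<beta> \<gamma> (\<zeta> \<gamma>) y) = (\<lambda>y. \<Sum>\<gamma>\<in>J. inv_op lam z \<beta> \<gamma> (\<zeta> \<gamma>) y)" for \<beta>
      using \<zeta> by (intro ext sum.cong refl) (simp add: mS[OF z])
    then have "(\<Sum>\<beta>\<in>J. matrix_op cc A z \<alpha> \<beta> (\<lambda>y. \<Sum>\<gamma>\<in>J. matrix_op cc S z \<beta> \<gamma> (\<zeta> \<gamma>) y) x)
      = (\<Sum>\<beta>\<in>J. coord_op lam z \<alpha> \<beta> (\<lambda>y. \<Sum>\<gamma>\<in>J. inv_op lam z \<beta> \<gamma> (\<zeta> \<gamma>) y) x)"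
      by (intro sum.cong refl) (simp only: mA[OF z loops_sum[OF iS] \<alpha>])
    then show "(\<Sum>\<beta>\<in>J. matrix_op cc A z \<alpha> \<beta> (\<lambda>y. \<Sum>\<gamma>\<in>J. matrix_op cc S z \<beta> \<gamma> (\<zeta> \<gamma>) y) x) = \<zeta> \<alpha> x"
      using coord_op_inv_op[OF z _ \<alpha>, of \<zeta> lam x] \<zeta> by simp
    have iA: "coord_op lam z \<beta> \<gamma> (\<zeta> \<gamma>) \<in> loops UNIV" if "\<gamma> \<in> J" for \<beta> \<gamma>
      using coord_op_loops[OF QQ_loops[OF z]] \<zeta> that by auto
    have "(\<lambda>y. \<Sum>\<gamma>\<in>J. matrix_op cc A z \<beta> \<gamma> (\<zeta> \<gamma>) y) = (\<lambda>y. \<Sum>\<gamma>\<in>J. coord_op lam z \<beta> \<gamma> (\<zeta> \<gamma>) y)" if "\<beta> \<in> J" for \<beta>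
      using \<zeta> that by (intro ext sum.cong refl) (simp add: mA[OF z])
    then have "(\<Sum>\<beta>\<in>J. matrix_op cc S z \<alpha> \<beta> (\<lambda>y. \<Sum>\<gamma>\<in>J. matrix_op cc A z \<beta> \<gamma> (\<zeta> \<gamma>) y) x)
      = (\<Sum>\<beta>\<in>J. inv_op lam z \<alpha> \<beta> (\<lambda>y. \<Sum>\<gamma>\<in>J. coord_op lam z \<beta> \<gamma> (\<zeta> \<gamma>) y) x)"
      by (intro sum.cong refl) (simp only: mS[OF z loops_sum[OF iA]])
    then show "(\<Sum>\<beta>\<in>J. matrix_op cc S z \<alpha> \<beta> (\<lambda>y. \<Sum>\<gamma>\<in>J. matrix_op cc A z \<beta> \<gamma> (\<zeta> \<gamma>) y) x) = \<zeta> \<alpha> x"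
      using inv_op_coord_op[OF z _ \<alpha>, of \<zeta> lam x] \<zeta> by simp
  qed
  with p show ?thesis by (auto simp: is_S_def)
qed

subsection \<open>Variational derivatives on $Q$\<close>

lemma has_var_deriv_unique:
  assumes "has_var_deriv \<xi> m \<phi> z \<zeta>" "has_var_deriv \<xi> m \<phi> z \<zeta>'" "i \<in> {1..m}"
  shows "\<zeta> i = \<zeta>' i"
proof
  fix x
  have l: "\<zeta> i \<in> loops UNIV" "\<zeta>' i \<in> loops UNIV" using assms by (auto simp: has_var_deriv_def)
  show "\<zeta> i x = \<zeta>' i x"
  proof (rule fundamental_lemma_eq[OF l])
    fix \<eta> :: "real \<Rightarrow> complex" assume \<eta>: "\<eta> \<in> loops UNIV"
    define s where "s k = (if k = i then \<eta> else (\<lambda>x. 0))" for k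
    have s: "\<forall>k\<in>{1..m}. s k \<in> loops UNIV" using \<eta> by (simp add: s_def const_in_loops)
    have e: "(\<Sum>k=1..m. \<omega> k x * s k x) = \<eta> x * \<omega> i x" for \<omega> :: "nat \<Rightarrow> real \<Rightarrow> complex" and x
    proof -
      have "(\<Sum>k=1..m. \<omega> k x * s k x) = (\<Sum>k=1..m. if k = i then \<eta> x * \<omega> i x else 0)"
        by (intro sum.cong) (auto simp: s_def)
      then show ?thesis using assms(3) by simp
    qed
    show "circle_int (\<lambda>x. \<eta> x * \<zeta> i x) = circle_int (\<lambda>x. \<eta> x * \<zeta>' i x)"
      using vector_derivative_unique_at assms(1,2) s unfolding has_var_deriv_def e[symmetric] by blast
  qed
qed

lemma var_deriv_eq: "has_var_deriv \<xi> m \<phi> z \<zeta> \<Longrightarrow> i \<in> {1..m} \<Longrightarrow> var_deriv \<xi> m \<phi> z i = \<zeta> i"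
  unfolding var_deriv_def by (rule has_var_deriv_unique[OF someI[of "has_var_deriv \<xi> m \<phi> z" \<zeta>]])

lemma QQ_affine:
  assumes z: "z \<in> QQ" and s: "\<forall>i\<in>{1..m}. s i \<in> loops UNIV"
  shows "(\<lambda>x. z x + (\<Sum>i=1..m. (of_real t * s i x) *s \<xi> i)) \<in> QQ"
proof -
  have "(z x - e) + (\<Sum>i=1..m. (of_real t * s i x) *s \<xi> i) \<in> gf" for x
    using z xi_gf by (intro vec.subspace_add vec.subspace_sum vec.subspace_scale gf_subspace) (auto simp: QQ_iff)
  then show ?thesis
    unfolding QQ_iff using z s
    by (auto simp: QQ_iff algebra_simps intro!: loops_add loops_sum loops_scale loops_mult const_in_loops)
qed

text \<open>On Q the projection \<rho> is the identity, so an extension coincides there with \<phi>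
  and its gradient, paired with the first m basis vectors, differentiates \<phi>.\<close>

lemma extension_var_deriv:
  assumes F: "extension br gr e f l \<phi> F" and z: "z \<in> QQ"
  shows "has_var_deriv \<xi> m \<phi> z (\<lambda>i x. killing br (grad br F z x) (\<xi> i))"
  unfolding has_var_deriv_def
proof (intro conjI ballI allI impI)
  have gl: "grad br F z \<in> loops UNIV" by (rule grad_in_loops[OF extension_functional[OF F] QQ_loops[OF z]])
  then show "(\<lambda>x. killing br (grad br F z x) (\<xi> i)) \<in> loops UNIV" for i by (intro loops_killing const_in_loops)
  fix s :: "nat \<Rightarrow> real \<Rightarrow> complex" assume s: "\<forall>i\<in>{1..m}. s i \<in> loops UNIV"
  define d where "d x = (\<Sum>i=1..m. s i x *s \<xi> i)" for x
  have dl: "d \<in> loops UNIV" unfolding d_def[abs_def] using s by (intro loops_sum loops_scale) auto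
  have "\<phi> (\<lambda>x. z x + (\<Sum>i=1..m. (of_real t * s i x) *s \<xi> i)) = F (\<lambda>x. z x + t *\<^sub>R d x)" for t :: real
  proof -
    have "(\<lambda>x. z x + (\<Sum>i=1..m. (of_real t * s i x) *s \<xi> i)) = (\<lambda>x. z x + t *\<^sub>R d x)"
      by (simp add: d_def scaleR_eq_scale vec.scale_sum_right)
    then show ?thesis using QQ_affine[OF z s, of t] F QQ_SS rho_QQ by (auto simp: extension_def)
  qed
  moreover have "loop_form br (grad br F z) d = circle_int (\<lambda>x. \<Sum>i=1..m. killing br (grad br F z x) (\<xi> i) * s i x)"
    by (simp add: loop_form_def d_def killing_simps mult.commute)
  ultimately show "((\<lambda>t::real. \<phi> (\<lambda>x. z x + (\<Sum>i=1..m. (of_real t * s i x) *s \<xi> i))) has_vector_derivative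
      circle_int (\<lambda>x. \<Sum>i=1..m. killing br (grad br F z x) (\<xi> i) * s i x)) (at 0)"
    using functional_derivative[OF extension_functional[OF F] QQ_loops[OF z] dl] by simp
qed

lemma inverse_op_single:
  assumes S: "is_S A S" and z: "z \<in> QQ" and \<zeta>: "\<zeta> \<in> loops UNIV" and \<alpha>: "\<alpha> \<in> J" and \<gamma>: "\<gamma> \<in> J"
  shows "(\<Sum>\<beta>\<in>J. matrix_op cc A z \<alpha> \<beta> (matrix_op cc S z \<beta> \<gamma> \<zeta>) x) = (if \<alpha> = \<gamma> then \<zeta> x else 0)"
    "(\<Sum>\<beta>\<in>J. matrix_op cc S z \<alpha> \<beta> (matrix_op cc A z \<beta> \<gamma> \<zeta>) x) = (if \<alpha> = \<gamma> then \<zeta> x else 0)"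
proof -
  define w where "w k = (if k = \<gamma> then \<zeta> else (\<lambda>x. 0))" for k
  have w: "\<forall>k\<in>J. w k \<in> loops UNIV" using \<zeta> by (simp add: w_def const_in_loops)
  have c: "(\<lambda>y. \<Sum>k\<in>J. matrix_op cc B z \<beta> k (w k) y) = matrix_op cc B z \<beta> \<gamma> \<zeta>" for B \<beta>
  proof
    fix y
    have "(\<Sum>k\<in>J. matrix_op cc B z \<beta> k (w k) y) = (\<Sum>k\<in>J. if k = \<gamma> then matrix_op cc B z \<beta> \<gamma> \<zeta> y else 0)"
      by (intro sum.cong) (auto simp: w_def matrix_op_def op_apply_arg_0)
    then show "(\<Sum>k\<in>J. matrix_op cc B z \<beta> k (w k) y) = matrix_op cc B z \<beta> \<gamma> \<zeta> y" using \<gamma> by simp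
  qed
  have e: "w \<alpha> x = (if \<alpha> = \<gamma> then \<zeta> x else 0)" by (simp add: w_def)
  have "(\<Sum>\<beta>\<in>J. matrix_op cc A z \<alpha> \<beta> (\<lambda>y. \<Sum>k\<in>J. matrix_op cc S z \<beta> k (w k) y) x) = w \<alpha> x \<and>
    (\<Sum>\<beta>\<in>J. matrix_op cc S z \<alpha> \<beta> (\<lambda>y. \<Sum>k\<in>J. matrix_op cc A z \<beta> k (w k) y) x) = w \<alpha> x"
    using S z w \<alpha> unfolding is_S_def inverse_op_on_def by blast
  then show "(\<Sum>\<beta>\<in>J. matrix_op cc A z \<alpha> \<beta> (matrix_op cc S z \<beta> \<gamma> \<zeta>) x) = (if \<alpha> = \<gamma> then \<zeta> x else 0)"
    "(\<Sum>\<beta>\<in>J. matrix_op cc S z \<alpha> \<beta> (matrix_op cc A z \<beta> \<gamma> \<zeta>) x) = (if \<alpha> = \<gamma> then \<zeta> x else 0)"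
    unfolding c e by blast+
qed

text \<open>Modulo loops in m the gradients are replaced by W and W' whose Hamiltonian fields take
  values in the centralizer of f. The components of W' at the dual vectors with index above m are
  eliminated by S; the others are the variational derivatives of \<psi>.\<close>

lemma dirac_formula:
  assumes A: "is_F lam A" and S: "is_S A S" and F: "extension br gr e f l \<phi> F" and G: "extension br gr e f l \<psi> G"
    and z: "z \<in> QQ"
  shows "reduced_bracket br gr e f l a lam \<phi> \<psi> z = operator_bracket \<xi> m (dirac_op cc J A S) \<phi> \<psi> z"
proof -
  have zl: "z \<in> loops UNIV" by (rule QQ_loops[OF z])
  note gl = grad_in_loops[OF extension_functional[OF F] zl] grad_in_loops[OF extension_functional[OF G] zl]
  obtain v where v: "v \<in> loops \<mm>" "\<And>x. pen lam z (\<lambda>x. grad br F z x - v x) x \<in> gf" using dirac_gradient[OF F z] by blast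
  obtain v' where v': "v' \<in> loops \<mm>" "\<And>x. pen lam z (\<lambda>x. grad br G z x - v' x) x \<in> gf" using dirac_gradient[OF G z] by blast
  have vl: "v \<in> loops UNIV" "v' \<in> loops UNIV" using v v' by (auto intro: loops_UNIV)
  define W where "W x = grad br F z x - v x" for x
  define W' where "W' x = grad br G z x - v' x" for x
  have W: "W \<in> loops UNIV" "W' \<in> loops UNIV" unfolding W_def[abs_def] W'_def[abs_def] by (intro loops_diff gl vl)+
  have Wg: "pen lam z W x \<in> gf" "pen lam z W' x \<in> gf" for x
    using v(2) v'(2) by (simp_all add: W_def[abs_def] W'_def[abs_def])
  have vn: "v x \<in> \<nn>" "v' x \<in> \<nn>" for x using v(1) v'(1) mm_le_nn by (auto simp: loops_def)
  \<comment> \<open>The basis vectors with index up to m lie in b and the corrections v, v' lie in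
    n, so these pairings do not see the corrections.\<close>
  have k: "killing br (W x) (\<xi> i) = killing br (grad br F z x) (\<xi> i)" 
    "killing br (W' x) (\<xi> i) = killing br (grad br G z x) (\<xi> i)" if "i \<in> {1..m}" for i x
    using killing_bb_nn[of "\<xi> i" "v x"] killing_bb_nn[of "\<xi> i" "v' x"] xi_gf[OF that] gf_bb vn
    by (auto simp: W_def W'_def killing_simps killing_sym[of _ "\<xi> i"])
  note pl = pen_in_loops[OF zl gl(1), of lam] pen_in_loops[OF zl gl(2), of lam] pen_in_loops[OF zl W(1), of lam] pen_in_loops[OF zl W(2), of lam]
  have "reduced_bracket br gr e f l a lam \<phi> \<psi> z = loop_form br (grad br F z) (pen lam z (grad br G z))"
    using reduced_bracket_eq[OF F G QQ_SS[OF z]] pencil_eq[OF extension_functional[OF F] extension_functional[OF G] zl] by simp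
  also have "\<dots> = loop_form br W (pen lam z (grad br G z))"
  proof -
    have "loop_form br v (pen lam z (grad br G z)) = 0"
      using killing_bb_nn[OF extension_pen_bb[OF G QQ_SS[OF z]] vn(1)] by (intro loop_form_0) (simp add: killing_sym)
    then show ?thesis unfolding W_def[abs_def] by (simp add: loop_form_diff gl vl pl)
  qed
  also have "\<dots> = loop_form br W (pen lam z W')"
  proof -
    have "loop_form br W (pen lam z v') = 0"
      unfolding pen_skew[OF zl W(1) vl(2)] using killing_bb_nn[OF _ vn(2)] Wg(1) gf_bb
      by (auto intro!: loop_form_0)
    moreover have "pen lam z W' = (\<lambda>x. pen lam z (grad br G z) x - pen lam z v' x)"
      unfolding W'_def[abs_def] by (rule ext) (rule pen_diff[OF gl(2) vl(2)])
    ultimately show ?thesis by (simp add: loop_form_diff W pl pen_in_loops zl vl)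
  qed
  finally have red: "reduced_bracket br gr e f l a lam \<phi> \<psi> z = loop_form br W (pen lam z W')" .
  define \<omega> where "\<omega> j x = killing br (W' x) (\<xi> j)" for j x
  have \<omega>: "\<omega> j \<in> loops UNIV" for j unfolding \<omega>_def[abs_def] by (intro loops_killing W const_in_loops)
  have W'e: "W' = (\<lambda>x. \<Sum>j=1..n. \<omega> j x *s \<xi>' j)" using expand_dual by (auto simp: \<omega>_def)
  have split: "(\<Sum>j=1..n. g j) = (\<Sum>j=1..m. g j) + (\<Sum>j\<in>J. g j)" for g :: "nat \<Rightarrow> complex"
  proof -
    have "{1..n} = {1..m} \<union> J" using m_le_n by auto
    then show ?thesis by (simp add: sum.union_disjoint)
  qed
  have mA: "matrix_op cc A z i j \<zeta> = coord_op lam z i j \<zeta>" if "i \<in> {1..n}" "j \<in> {1..n}" "\<zeta> \<in> loops UNIV" for i j \<zeta>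
    using is_F_coord_op[OF A that(1,2) zl that(3)] .
  have mAl: "matrix_op cc A z i j \<zeta> \<in> loops UNIV" if "i \<in> {1..n}" "j \<in> {1..n}" "\<zeta> \<in> loops UNIV" for i j \<zeta>
    using mA[OF that] coord_op_loops[OF zl that(3)] by simp
  have mSl: "matrix_op cc S z i j \<zeta> \<in> loops UNIV" if "i \<in> J" "j \<in> J" "\<zeta> \<in> loops UNIV" for i j \<zeta>
    using S that zl by (auto simp: is_S_def intro!: matrix_op_loops)
  have pW: "killing br (\<xi>' i) (pen lam z W' x) = (\<Sum>j=1..m. matrix_op cc A z i j (\<omega> j) x) + (\<Sum>j\<in>J. matrix_op cc A z i j (\<omega> j) x)"
    if "i \<in> {1..n}" for i x
    unfolding W'e pen_expand[OF zl \<omega>] split[symmetric] using that by (intro sum.cong refl) (simp add: mA \<omega>)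
  define w where "w \<alpha> x = (\<Sum>j=1..m. matrix_op cc A z \<alpha> j (\<omega> j) x)" for \<alpha> x
  have wl: "w \<alpha> \<in> loops UNIV" if "\<alpha> \<in> J" for \<alpha> 
    unfolding w_def[abs_def] using m_le_n that by (intro loops_sum mAl \<omega>) auto
  \<comment> \<open>Tangency of the field to Q: its coordinates with index above m vanish. These are
    the equations solved by S next.\<close>
  have AJ: "(\<Sum>\<gamma>\<in>J. matrix_op cc A z \<alpha> \<gamma> (\<omega> \<gamma>) x) = - w \<alpha> x" if "\<alpha> \<in> J" for \<alpha> x
  proof -
    have "killing br (\<xi>' \<alpha>) (pen lam z W' x) = 0" using Wg(2)[of x] that by (auto simp: gf_iff killing_sym)
    then show ?thesis using pW[OF J_sub[OF that], of x] by (simp add: w_def eq_neg_iff_add_eq_0 add.commute)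
  qed
  have \<omega>J: "\<omega> \<beta> = (\<lambda>x. - (\<Sum>\<alpha>\<in>J. \<Sum>j=1..m. matrix_op cc S z \<beta> \<alpha> (matrix_op cc A z \<alpha> j (\<omega> j)) x))" if \<beta>: "\<beta> \<in> J" for \<beta>
  proof
    fix x
    have "\<omega> \<beta> x = (\<Sum>\<alpha>\<in>J. matrix_op cc S z \<beta> \<alpha> (\<lambda>y. \<Sum>\<gamma>\<in>J. matrix_op cc A z \<alpha> \<gamma> (\<omega> \<gamma>) y) x)"
      using S z \<omega> \<beta> unfolding is_S_def inverse_op_on_def by simp
    also have "\<dots> = (\<Sum>\<alpha>\<in>J. matrix_op cc S z \<beta> \<alpha> (\<lambda>y. - w \<alpha> y) x)"
    proof (intro sum.cong refl)
      fix \<alpha> assume "\<alpha> \<in> J"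
      then have "(\<lambda>y. \<Sum>\<gamma>\<in>J. matrix_op cc A z \<alpha> \<gamma> (\<omega> \<gamma>) y) = (\<lambda>y. - w \<alpha> y)" by (intro ext AJ)
      then show "matrix_op cc S z \<beta> \<alpha> (\<lambda>y. \<Sum>\<gamma>\<in>J. matrix_op cc A z \<alpha> \<gamma> (\<omega> \<gamma>) y) x
        = matrix_op cc S z \<beta> \<alpha> (\<lambda>y. - w \<alpha> y) x" by (simp only:)
    qed
    also have "\<dots> = (\<Sum>\<alpha>\<in>J. - matrix_op cc S z \<beta> \<alpha> (w \<alpha>) x)"
      by (intro sum.cong refl) (simp add: matrix_op_def op_apply_arg_neg[OF wl])
    also have "\<dots> = (\<Sum>\<alpha>\<in>J. - (\<Sum>j=1..m. matrix_op cc S z \<beta> \<alpha> (matrix_op cc A z \<alpha> j (\<omega> j)) x))"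
    proof (intro sum.cong refl)
      fix \<alpha> assume "\<alpha> \<in> J"
      then have "matrix_op cc S z \<beta> \<alpha> (\<lambda>x. \<Sum>j=1..m. matrix_op cc A z \<alpha> j (\<omega> j) x) x 
        = (\<Sum>j=1..m. matrix_op cc S z \<beta> \<alpha> (matrix_op cc A z \<alpha> j (\<omega> j)) x)"
        unfolding matrix_op_def[of cc S] using m_le_n by (intro op_apply_arg_sum mAl \<omega>) auto
      then show "- matrix_op cc S z \<beta> \<alpha> (w \<alpha>) x = - (\<Sum>j=1..m. matrix_op cc S z \<beta> \<alpha> (matrix_op cc A z \<alpha> j (\<omega> j)) x)"
        by (simp add: w_def[abs_def])
    qed
    finally show "\<omega> \<beta> x = - (\<Sum>\<alpha>\<in>J. \<Sum>j=1..m. matrix_op cc S z \<beta> \<alpha> (matrix_op cc A z \<alpha> j (\<omega> j)) x)"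
      by (simp add: sum_negf)
  qed
  have main: "killing br (\<xi>' i) (pen lam z W' x) = (\<Sum>j=1..m. dirac_op cc J A S z i j (\<omega> j) x)" if i: "i \<in> {1..m}" for i x
  proof -
    have i': "i \<in> {1..n}" using i m_le_n by auto
    have t: "matrix_op cc S z \<beta> \<alpha> (matrix_op cc A z \<alpha> j (\<omega> j)) \<in> loops UNIV" if "\<beta> \<in> J" "\<alpha> \<in> J" "j \<in> {1..m}" for \<beta> \<alpha> j
      using that m_le_n by (intro mSl mAl \<omega>) auto
    have "matrix_op cc A z i \<beta> (\<omega> \<beta>) x 
      = - (\<Sum>\<alpha>\<in>J. \<Sum>j=1..m. matrix_op cc A z i \<beta> (matrix_op cc S z \<beta> \<alpha> (matrix_op cc A z \<alpha> j (\<omega> j))) x)" if \<beta>: "\<beta> \<in> J" for \<beta>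
    proof -
      have "matrix_op cc A z i \<beta> (\<omega> \<beta>) x 
        = - matrix_op cc A z i \<beta> (\<lambda>x. \<Sum>\<alpha>\<in>J. \<Sum>j=1..m. matrix_op cc S z \<beta> \<alpha> (matrix_op cc A z \<alpha> j (\<omega> j)) x) x"
        unfolding matrix_op_def[of cc A z i] by (subst \<omega>J[OF \<beta>], rule op_apply_arg_neg) (intro loops_sum t \<beta>)
      also have "matrix_op cc A z i \<beta> (\<lambda>x. \<Sum>\<alpha>\<in>J. \<Sum>j=1..m. matrix_op cc S z \<beta> \<alpha> (matrix_op cc A z \<alpha> j (\<omega> j)) x) x
        = (\<Sum>\<alpha>\<in>J. matrix_op cc A z i \<beta> (\<lambda>x. \<Sum>j=1..m. matrix_op cc S z \<beta> \<alpha> (matrix_op cc A z \<alpha> j (\<omega> j)) x) x)"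
        unfolding matrix_op_def[of cc A z i] by (rule op_apply_arg_sum) (intro loops_sum t \<beta>)
      also have "\<dots> = (\<Sum>\<alpha>\<in>J. \<Sum>j=1..m. matrix_op cc A z i \<beta> (matrix_op cc S z \<beta> \<alpha> (matrix_op cc A z \<alpha> j (\<omega> j))) x)"
        unfolding matrix_op_def[of cc A z i] by (intro sum.cong refl op_apply_arg_sum t \<beta>)
      finally show ?thesis .
    qed
    then have "(\<Sum>\<beta>\<in>J. matrix_op cc A z i \<beta> (\<omega> \<beta>) x)
      = - (\<Sum>\<beta>\<in>J. \<Sum>\<alpha>\<in>J. \<Sum>j=1..m. matrix_op cc A z i \<beta> (matrix_op cc S z \<beta> \<alpha> (matrix_op cc A z \<alpha> j (\<omega> j))) x)"
      by (simp add: sum_negf)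
    also have "(\<Sum>\<beta>\<in>J. \<Sum>\<alpha>\<in>J. \<Sum>j=1..m. matrix_op cc A z i \<beta> (matrix_op cc S z \<beta> \<alpha> (matrix_op cc A z \<alpha> j (\<omega> j))) x)
      = (\<Sum>j=1..m. \<Sum>\<beta>\<in>J. \<Sum>\<alpha>\<in>J. matrix_op cc A z i \<beta> (matrix_op cc S z \<beta> \<alpha> (matrix_op cc A z \<alpha> j (\<omega> j))) x)"
      by (simp only: sum.swap[of _ "{1..m}"])
    finally show ?thesis unfolding pW[OF i'] dirac_op_def by (simp add: sum_subtractf)
  qed
  \<comment> \<open>Tangency again: in the expansion in dual bases the terms with index above m drop
    out.\<close>
  have "loop_form br W (pen lam z W') = circle_int (\<lambda>x. \<Sum>i=1..m. killing br (W x) (\<xi> i) * killing br (\<xi>' i) (pen lam z W' x))"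
  proof -
    have "killing br (W x) (pen lam z W' x) = (\<Sum>i=1..m. killing br (W x) (\<xi> i) * killing br (\<xi>' i) (pen lam z W' x))" for x
    proof -
      have "killing br (W x) (pen lam z W' x) = (\<Sum>i=1..n. killing br (W x) (\<xi> i) * killing br (\<xi>' i) (pen lam z W' x))"
        by (subst expand_dual[of "W x"]) (simp add: killing_simps)
      also have "\<dots> = (\<Sum>i=1..m. killing br (W x) (\<xi> i) * killing br (\<xi>' i) (pen lam z W' x))"
        using Wg(2)[of x] m_le_n
        by (intro sum.mono_neutral_right) (auto simp: gf_iff killing_sym[of "\<xi>' _"] not_le)
      finally show ?thesis .
    qed
    then show ?thesis by (simp add: loop_form_def)
  qed
  also have "\<dots> = circle_int (\<lambda>x. \<Sum>i=1..m. var_deriv \<xi> m \<phi> z i x * (\<Sum>j=1..m. dirac_op cc J A S z i j (var_deriv \<xi> m \<psi> z j) x))"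
  proof -
    have "\<omega> j = var_deriv \<xi> m \<psi> z j" if "j \<in> {1..m}" for j
      using var_deriv_eq[OF extension_var_deriv[OF G z] that] k(2)[OF that] by (simp add: \<omega>_def[abs_def])
    moreover have "killing br (W x) (\<xi> i) = var_deriv \<xi> m \<phi> z i x" if "i \<in> {1..m}" for i x
      using var_deriv_eq[OF extension_var_deriv[OF F z] that] k(1)[OF that] by simp
    ultimately have "(\<Sum>i=1..m. killing br (W x) (\<xi> i) * killing br (\<xi>' i) (pen lam z W' x))
      = (\<Sum>i=1..m. var_deriv \<xi> m \<phi> z i x * (\<Sum>j=1..m. dirac_op cc J A S z i j (var_deriv \<xi> m \<psi> z j) x))" for x
      by (intro sum.cong refl) (simp only: main cong: sum.cong)
    then show ?thesis by simp
  qed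
  also have "\<dots> = operator_bracket \<xi> m (dirac_op cc J A S) \<phi> \<psi> z"
    by (simp add: operator_bracket_def sum_distrib_left)
  finally show ?thesis using red by simp
qed

lemma smeared_local: "i \<in> {1..m} \<Longrightarrow> \<eta> \<in> loops UNIV \<Longrightarrow> local_functional cc {1..m} QQ (smeared cc i \<eta>)"
  unfolding local_functional_def
  by (intro exI[of _ "\<lambda>x u. \<eta> x * u i 0"] conjI density.mult density.coefficient density.jet_var)
    (auto simp: smeared_def jet_of_def)

lemma smeared_var_deriv:
  assumes i: "i \<in> {1..m}" and \<eta>: "\<eta> \<in> loops UNIV" and z: "z \<in> QQ"
  shows "has_var_deriv \<xi> m (smeared cc i \<eta>) z (\<lambda>k. if k = i then \<eta> else (\<lambda>x. 0))"
  unfolding has_var_deriv_def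
proof (intro conjI ballI allI impI)
  show "(if k = i then \<eta> else (\<lambda>x. 0)) \<in> loops UNIV" for k using \<eta> by (simp add: const_in_loops)
  fix s :: "nat \<Rightarrow> real \<Rightarrow> complex" assume s: "\<forall>i\<in>{1..m}. s i \<in> loops UNIV"
  have l: "(\<lambda>x. \<eta> x * cc (z x) i) \<in> loops UNIV" "(\<lambda>x. \<eta> x * s i x) \<in> loops UNIV"
    using \<eta> z s i by (auto intro!: loops_mult coord_loops QQ_loops)
  have "cc (z x + (\<Sum>k=1..m. (of_real t * s k x) *s \<xi> k)) i = cc (z x) i + of_real t * s i x" for t :: real and x
  proof -
    have "(\<Sum>k=1..m. of_real t * s k x * killing br (\<xi> k) (\<xi>' i)) = (\<Sum>k=1..m. if k = i then of_real t * s i x else 0)"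
      using dual_basis i m_le_n by (intro sum.cong) auto
    then show ?thesis using i by (simp add: cc killing_simps)
  qed
  then have "smeared cc i \<eta> (\<lambda>x. z x + (\<Sum>k=1..m. (of_real t * s k x) *s \<xi> k))
    = circle_int (\<lambda>x. \<eta> x * cc (z x) i + t *\<^sub>R (\<eta> x * s i x))" for t :: real
    by (simp add: smeared_def distrib_left scaleR_conv_of_real mult_ac)
  moreover have "(\<lambda>x. \<Sum>k=1..m. (if k = i then \<eta> else (\<lambda>x. 0)) x * s k x) = (\<lambda>x. \<eta> x * s i x)"
  proof
    fix x
    have "(\<Sum>k=1..m. (if k = i then \<eta> else (\<lambda>x. 0)) x * s k x) = (\<Sum>k=1..m. if k = i then \<eta> x * s i x else 0)"
      by (intro sum.cong) auto
    then show "(\<Sum>k=1..m. (if k = i then \<eta> else (\<lambda>x. 0)) x * s k x) = \<eta> x * s i x" using i by simp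
  qed
  ultimately show "((\<lambda>t::real. smeared cc i \<eta> (\<lambda>x. z x + (\<Sum>k=1..m. (of_real t * s k x) *s \<xi> k))) has_vector_derivative
      circle_int (\<lambda>x. \<Sum>k=1..m. (if k = i then \<eta> else (\<lambda>x. 0)) x * s k x)) (at 0)"
    using poly_family_circle_int[OF poly_family_affine[OF l]] by simp
qed

text \<open>Smeared coordinates are local functionals and so possess extensions; their variational
  derivatives are supported at a single index, which leaves one entry of the matrix
  operator.\<close>

lemma dirac_coordinate_brackets:
  assumes A: "is_F lam A" and S: "is_S A S"
  shows "coordinate_brackets cc {1..m} QQ (reduced_bracket br gr e f l a lam) (dirac_op cc J A S)"
  unfolding coordinate_brackets_def
proof (intro ballI)
  fix i j z and \<eta> \<zeta> :: "real \<Rightarrow> complex"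
  assume h: "i \<in> {1..m}" "j \<in> {1..m}" "\<eta> \<in> loops UNIV" "\<zeta> \<in> loops UNIV" "z \<in> QQ"
  obtain F where F: "extension br gr e f l (smeared cc i \<eta>) F"
    using extension_exists[OF smeared_local[OF h(1,3)]] by blast
  obtain G where G: "extension br gr e f l (smeared cc j \<zeta>) G"
    using extension_exists[OF smeared_local[OF h(2,4)]] by blast
  have d0: "dirac_op cc J A S z i j (\<lambda>x. 0) x = 0" for i j x
  proof -
    have "matrix_op cc B z i j (\<lambda>x. 0) = (\<lambda>x. 0)" for B i j
      by (auto simp: matrix_op_def op_apply_arg_0)
    then show ?thesis by (simp add: dirac_op_def)
  qed
  have vd: "var_deriv \<xi> m (smeared cc i \<eta>) z k = (if k = i then \<eta> else (\<lambda>x. 0))"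
    "var_deriv \<xi> m (smeared cc j \<zeta>) z k = (if k = j then \<zeta> else (\<lambda>x. 0))" if "k \<in> {1..m}" for k
    using var_deriv_eq[OF smeared_var_deriv that] h by auto
  have "(\<Sum>i'=1..m. \<Sum>j'=1..m. var_deriv \<xi> m (smeared cc i \<eta>) z i' x * dirac_op cc J A S z i' j' (var_deriv \<xi> m (smeared cc j \<zeta>) z j') x)
     = (\<Sum>i'=1..m. \<Sum>j'=1..m. if j' = j then if i' = i then \<eta> x * dirac_op cc J A S z i j \<zeta> x else 0 else 0)" for x
    using d0 by (intro sum.cong refl) (auto simp: vd)
  also have "\<dots> x = \<eta> x * dirac_op cc J A S z i j \<zeta> x" for x using h by simp
  finally show "reduced_bracket br gr e f l a lam (smeared cc i \<eta>) (smeared cc j \<zeta>) z = circle_int (\<lambda>x. \<eta> x * dirac_op cc J A S z i j \<zeta> x)"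
    unfolding dirac_formula[OF A S F G h(5)] operator_bracket_def by simp
qed


subsection \<open>Leading terms of the reduced bracket\<close>

definition restr :: "diff_op \<Rightarrow> diff_op" where
  "restr L = map (set_zero J) L"

text \<open>The Dirac operator as an explicit list of coefficients, which \<open>dirac_op\<close>, a
  mere action on loops, does not provide. The coefficients of A are restricted to Q so that all
  factors live in the same m variables.\<close>

definition red_op :: "(nat \<Rightarrow> nat \<Rightarrow> diff_op) \<Rightarrow> (nat \<Rightarrow> nat \<Rightarrow> diff_op) \<Rightarrow> nat \<Rightarrow> nat \<Rightarrow> diff_op" where
  "red_op A S i j = op_add (restr (A i j))
     (op_sum (J \<times> J) (\<lambda>(\<beta>, \<alpha>). op_mult (\<lambda>u. -1) (op_comp (restr (A i \<beta>)) (op_comp (S \<beta> \<alpha>) (restr (A \<alpha> j))))))"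

lemma poly_op_restr: 
  assumes "is_F lam A" "i \<in> {1..n}" "j \<in> {1..n}" shows "poly_op {1..m} (restr (A i j))"
proof -
  have "diff_poly {1..m} (set_zero J p)" if "p \<in> set (A i j)" for p
    by (rule diff_poly_set_zero[of "{1..n}"]) (use assms that in \<open>auto simp: is_F_def matrix_diff_op_def\<close>)
  then show ?thesis by (auto simp: poly_op_def restr_def simp del: One_nat_def)
qed

lemma poly_op_S: "is_S A S \<Longrightarrow> \<beta> \<in> J \<Longrightarrow> \<alpha> \<in> J \<Longrightarrow> poly_op {1..m} (S \<beta> \<alpha>)"
  unfolding is_S_def matrix_diff_op_def poly_op_def by blast

lemma op_apply_restr:
  assumes "z \<in> QQ" shows "op_apply (restr L) (jet_of cc z) \<zeta> = op_apply L (jet_of cc z) \<zeta>"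
proof -
  have "(\<lambda>k r. if k \<in> J then 0 else jet_of cc z x k r) = jet_of cc z x" for x
    using jet_J[OF assms] by (auto simp: fun_eq_iff)
  then show ?thesis by (auto simp: op_apply_def restr_def set_zero_def cong: if_cong)
qed

lemma op_coeff_restr: "op_coeff (restr L) r = set_zero J (op_coeff L r)"
  by (auto simp: op_coeff_def restr_def set_zero_def)

lemma poly_op_red_op:
  assumes A: "is_F lam A" and S: "is_S A S" and ij: "i \<in> {1..m}" "j \<in> {1..m}"
  shows "poly_op {1..m} (red_op A S i j)"
proof -
  have n: "i \<in> {1..n}" "j \<in> {1..n}" using ij m_le_n by auto
  show ?thesis
    unfolding red_op_def
    by (intro poly_op_add poly_op_sum poly_op_restr[OF A] n)
      (clarify, intro poly_op_mult diff_poly.const poly_op_comp poly_op_restr[OF A] poly_op_S[OF S] n J_sub)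
qed

lemma red_op_apply:
  assumes A: "is_F lam A" and S: "is_S A S" and ij: "i \<in> {1..m}" "j \<in> {1..m}"
    and z: "z \<in> QQ" and \<zeta>: "\<zeta> \<in> loops UNIV"
  shows "matrix_op cc (red_op A S) z i j \<zeta> x = dirac_op cc J A S z i j \<zeta> x"
proof -
  have n: "i \<in> {1..n}" "j \<in> {1..n}" using ij m_le_n by auto
  note g = coord_loops[OF QQ_loops[OF z]]
  have c: "op_apply (op_comp (restr (A i \<beta>)) (op_comp (S \<beta> \<alpha>) (restr (A \<alpha> j)))) (jet_of cc z) \<zeta>
     = matrix_op cc A z i \<beta> (matrix_op cc S z \<beta> \<alpha> (matrix_op cc A z \<alpha> j \<zeta>))" if "\<beta> \<in> J" "\<alpha> \<in> J" for \<beta> \<alpha>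
  proof -
    note p = poly_op_restr[OF A n(1) J_sub[OF that(1)]] poly_op_S[OF S that] poly_op_restr[OF A J_sub[OF that(2)] n(2)]
    have "op_apply (op_comp (restr (A i \<beta>)) (op_comp (S \<beta> \<alpha>) (restr (A \<alpha> j)))) (jet_of cc z) \<zeta>
      = op_apply (restr (A i \<beta>)) (jet_of cc z) (op_apply (S \<beta> \<alpha>) (jet_of cc z) (op_apply (restr (A \<alpha> j)) (jet_of cc z) \<zeta>))"
      unfolding jet_of_jets by (simp only: op_apply_comp[OF g \<zeta> p(1) poly_op_comp[OF p(2,3)]] op_apply_comp[OF g \<zeta> p(2,3)])
    then show ?thesis by (simp only: op_apply_restr[OF z] matrix_op_def)
  qed
  have "matrix_op cc (red_op A S) z i j \<zeta> x = op_apply (restr (A i j)) (jet_of cc z) \<zeta> x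
    + (\<Sum>(\<beta>, \<alpha>)\<in>J \<times> J. - matrix_op cc A z i \<beta> (matrix_op cc S z \<beta> \<alpha> (matrix_op cc A z \<alpha> j \<zeta>)) x)"
    unfolding matrix_op_def[of cc "red_op A S"] red_op_def op_apply_add
    by (subst op_apply_sum) (auto simp: op_apply_mult c intro!: sum.cong)
  then show ?thesis
    by (simp only: op_apply_restr[OF z] sum.cartesian_product[symmetric] sum_negf dirac_op_def matrix_op_def[of cc A z i j]
      diff_conv_add_uminus)
qed

definition is_red :: "complex \<Rightarrow> (nat \<Rightarrow> nat \<Rightarrow> diff_op) \<Rightarrow> bool" where
  "is_red lam R \<longleftrightarrow> matrix_diff_op {1..m} {1..m} R \<and>
     coordinate_brackets cc {1..m} QQ (reduced_bracket br gr e f l a lam) (matrix_op cc R)"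

lemma red_op_is_red:
  assumes A: "is_F lam A" and S: "is_S A S" shows "is_red lam (red_op A S)"
  unfolding is_red_def
proof
  show "matrix_diff_op {1..m} {1..m} (red_op A S)"
    using poly_op_red_op[OF A S] unfolding matrix_diff_op_def poly_op_def by blast
  show "coordinate_brackets cc {1..m} QQ (reduced_bracket br gr e f l a lam) (matrix_op cc (red_op A S))"
    using dirac_coordinate_brackets[OF A S] red_op_apply[OF A S]
    unfolding coordinate_brackets_def by (simp del: One_nat_def)
qed

text \<open>The integrated bracket determines the action on loops, and the action determines the
  coefficients. The leading terms of any R can thus be computed from \<open>red_op\<close>.\<close>

lemma is_red_unique:
  assumes R: "is_red lam R" and R': "is_red lam R'" and ij: "i \<in> {1..m}" "j \<in> {1..m}"
  shows "op_coeff (R i j) r = op_coeff (R' i j) r"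
proof (rule op_unique_QQ)
  show "poly_op {1..m} (R i j)" "poly_op {1..m} (R' i j)"
    using R R' ij unfolding is_red_def matrix_diff_op_def poly_op_def by blast+
  fix z x and \<zeta> :: "real \<Rightarrow> complex" assume h: "z \<in> QQ" "\<zeta> \<in> loops UNIV"
  have "matrix_op cc R z i j \<zeta> x = matrix_op cc R' z i j \<zeta> x"
  proof (rule fundamental_lemma_eq)
    show "matrix_op cc R z i j \<zeta> \<in> loops UNIV" "matrix_op cc R' z i j \<zeta> \<in> loops UNIV"
      using R R' ij h QQ_loops unfolding is_red_def by (auto intro: matrix_op_loops simp del: One_nat_def)
    fix \<eta> :: "real \<Rightarrow> complex" assume "\<eta> \<in> loops UNIV"
    then have "reduced_bracket br gr e f l a lam (smeared cc i \<eta>) (smeared cc j \<zeta>) z = circle_int (\<lambda>x. \<eta> x * matrix_op cc B z i j \<zeta> x)"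
      if "is_red lam B" for B using that ij h unfolding is_red_def coordinate_brackets_def by blast
    from this[OF R] this[OF R']
    show "circle_int (\<lambda>x. \<eta> x * matrix_op cc R z i j \<zeta> x) = circle_int (\<lambda>x. \<eta> x * matrix_op cc R' z i j \<zeta> x)"
      by simp
  qed
  then show "op_apply (R i j) (jet_of cc z) \<zeta> x = op_apply (R' i j) (jet_of cc z) \<zeta> x"
    by (simp add: matrix_op_def)
qed

text \<open>The operator identities A S = 1 and S A = 1 hold on Q only as actions; uniqueness of
  coefficients turns them into identities of lists, whose parts of low degree are then
  compared.\<close>

lemma s_inverse:
  assumes A: "is_F lam A" and S: "is_S A S" and ag: "\<alpha> \<in> J" "\<gamma> \<in> J"
  shows "(\<Sum>\<beta>\<in>J. s00 (restr (A \<alpha> \<beta>)) u * s00 (S \<beta> \<gamma>) u) = (if \<alpha> = \<gamma> then 1 else 0)"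
    "(\<Sum>\<beta>\<in>J. s00 (S \<alpha> \<beta>) u * s00 (restr (A \<beta> \<gamma>)) u) = (if \<alpha> = \<gamma> then 1 else 0)"
    "(\<Sum>\<beta>\<in>J. s00 (restr (A \<alpha> \<beta>)) u * s10 (S \<beta> \<gamma>) u + s10 (restr (A \<alpha> \<beta>)) u * s00 (S \<beta> \<gamma>) u) = 0"
    "(\<Sum>\<beta>\<in>J. s00 (restr (A \<alpha> \<beta>)) u * s01 (S \<beta> \<gamma>) u + s01 (restr (A \<alpha> \<beta>)) u * s00 (S \<beta> \<gamma>) u
      + s10 (restr (A \<alpha> \<beta>)) u * total_derivative (s00 (S \<beta> \<gamma>)) u) = 0"
proof -
  \<comment> \<open>The entry of the identity matrix operator, as an operator of order zero.\<close>
  define E :: diff_op where "E = [\<lambda>u. if \<alpha> = \<gamma> then 1 else 0]"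
  have E: "poly_op {1..m} E" by (auto simp: E_def poly_op_def intro: diff_poly.const simp del: One_nat_def)
  have sE: "s00 E u = (if \<alpha> = \<gamma> then 1 else 0)" "s10 E u = 0" "s01 E u = 0"
    by (auto simp: s00_def s10_def s01_def E_def op_coeff_def part0 part1_const)
  have aE: "op_apply E j \<zeta> x = (if \<alpha> = \<gamma> then \<zeta> x else 0)" for j \<zeta> x by (simp add: E_def op_apply_def)
  have pA: "poly_op {1..m} (restr (A \<alpha> \<beta>))" if "\<alpha> \<in> J" "\<beta> \<in> J" for \<alpha> \<beta>
    by (rule poly_op_restr[OF A J_sub[OF that(1)] J_sub[OF that(2)]])
  have pS: "poly_op {1..m} (S \<alpha> \<beta>)" if "\<alpha> \<in> J" "\<beta> \<in> J" for \<alpha> \<beta> by (rule poly_op_S[OF S that])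
  define L1 where "L1 = op_sum J (\<lambda>\<beta>. op_comp (restr (A \<alpha> \<beta>)) (S \<beta> \<gamma>))"
  define L2 where "L2 = op_sum J (\<lambda>\<beta>. op_comp (S \<alpha> \<beta>) (restr (A \<beta> \<gamma>)))"
  have p1: "poly_op {1..m} (op_comp (restr (A \<alpha> \<beta>)) (S \<beta> \<gamma>))" if "\<beta> \<in> J" for \<beta>
    by (rule poly_op_comp[OF pA[OF ag(1) that] pS[OF that ag(2)]])
  have p2: "poly_op {1..m} (op_comp (S \<alpha> \<beta>) (restr (A \<beta> \<gamma>)))" if "\<beta> \<in> J" for \<beta>
    by (rule poly_op_comp[OF pS[OF ag(1) that] pA[OF that ag(2)]])
  have L: "op_coeff L1 r = op_coeff E r" "op_coeff L2 r = op_coeff E r" for r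
  proof -
    show "op_coeff L1 r = op_coeff E r"
    proof (rule op_unique_QQ[OF _ E])
      show "poly_op {1..m} L1" unfolding L1_def by (rule poly_op_sum[OF p1])
      fix z x and \<zeta> :: "real \<Rightarrow> complex" assume h: "z \<in> QQ" "\<zeta> \<in> loops UNIV"
      note g = coord_loops[OF QQ_loops[OF h(1)]]
      have "op_apply L1 (jet_of cc z) \<zeta> x = (\<Sum>\<beta>\<in>J. matrix_op cc A z \<alpha> \<beta> (matrix_op cc S z \<beta> \<gamma> \<zeta>) x)"
      proof -
        have "op_apply (op_comp (restr (A \<alpha> \<beta>)) (S \<beta> \<gamma>)) (jet_of cc z) \<zeta> = matrix_op cc A z \<alpha> \<beta> (matrix_op cc S z \<beta> \<gamma> \<zeta>)"
          if "\<beta> \<in> J" for \<beta>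
          unfolding matrix_op_def op_apply_restr[OF h(1), of "A \<alpha> \<beta>", symmetric] unfolding jet_of_jets
          by (rule op_apply_comp[OF g h(2) pA[OF ag(1) that] pS[OF that ag(2)]])
        then show ?thesis
          unfolding L1_def op_apply_sum[OF finite_atLeastAtMost] by (intro sum.cong refl) (simp only:)
      qed
      then show "op_apply L1 (jet_of cc z) \<zeta> x = op_apply E (jet_of cc z) \<zeta> x"
        using inverse_op_single(1)[OF S h ag, of x] by (simp only: aE)
    qed
    show "op_coeff L2 r = op_coeff E r"
    proof (rule op_unique_QQ[OF _ E])
      show "poly_op {1..m} L2" unfolding L2_def by (rule poly_op_sum[OF p2])
      fix z x and \<zeta> :: "real \<Rightarrow> complex" assume h: "z \<in> QQ" "\<zeta> \<in> loops UNIV"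
      note g = coord_loops[OF QQ_loops[OF h(1)]]
      have "op_apply L2 (jet_of cc z) \<zeta> x = (\<Sum>\<beta>\<in>J. matrix_op cc S z \<alpha> \<beta> (matrix_op cc A z \<beta> \<gamma> \<zeta>) x)"
      proof -
        have "op_apply (op_comp (S \<alpha> \<beta>) (restr (A \<beta> \<gamma>))) (jet_of cc z) \<zeta> = matrix_op cc S z \<alpha> \<beta> (matrix_op cc A z \<beta> \<gamma> \<zeta>)"
          if "\<beta> \<in> J" for \<beta>
          unfolding matrix_op_def op_apply_restr[OF h(1), of "A \<beta> \<gamma>", symmetric] unfolding jet_of_jets
          by (rule op_apply_comp[OF g h(2) pS[OF ag(1) that] pA[OF that ag(2)]])
        then show ?thesis
          unfolding L2_def op_apply_sum[OF finite_atLeastAtMost] by (intro sum.cong refl) (simp only:)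
      qed
      then show "op_apply L2 (jet_of cc z) \<zeta> x = op_apply E (jet_of cc z) \<zeta> x"
        using inverse_op_single(2)[OF S h ag, of x] by (simp only: aE)
    qed
  qed
  then have s: "s00 L1 = s00 E" "s10 L1 = s10 E" "s01 L1 = s01 E" "s00 L2 = s00 E"
    by (simp_all add: s00_def s10_def s01_def)
  note c1 = s_comp[OF pA[OF ag(1)] pS[OF _ ag(2)]] and c2 = s_comp[OF pS[OF ag(1)] pA[OF _ ag(2)]]
  have "s00 L1 u = (\<Sum>\<beta>\<in>J. s00 (restr (A \<alpha> \<beta>)) u * s00 (S \<beta> \<gamma>) u)"
    unfolding L1_def by (subst s_sum[OF finite_atLeastAtMost p1]) (assumption, intro sum.cong refl, simp only: c1)
  then show "(\<Sum>\<beta>\<in>J. s00 (restr (A \<alpha> \<beta>)) u * s00 (S \<beta> \<gamma>) u) = (if \<alpha> = \<gamma> then 1 else 0)" by (simp only: s sE)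
  have "s00 L2 u = (\<Sum>\<beta>\<in>J. s00 (S \<alpha> \<beta>) u * s00 (restr (A \<beta> \<gamma>)) u)"
    unfolding L2_def by (subst s_sum[OF finite_atLeastAtMost p2]) (assumption, intro sum.cong refl, simp only: c2)
  then show "(\<Sum>\<beta>\<in>J. s00 (S \<alpha> \<beta>) u * s00 (restr (A \<beta> \<gamma>)) u) = (if \<alpha> = \<gamma> then 1 else 0)" by (simp only: s sE)
  have "s10 L1 u = (\<Sum>\<beta>\<in>J. s00 (restr (A \<alpha> \<beta>)) u * s10 (S \<beta> \<gamma>) u + s10 (restr (A \<alpha> \<beta>)) u * s00 (S \<beta> \<gamma>) u)"
    unfolding L1_def by (subst s_sum[OF finite_atLeastAtMost p1]) (assumption, intro sum.cong refl, simp only: c1)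
  then show "(\<Sum>\<beta>\<in>J. s00 (restr (A \<alpha> \<beta>)) u * s10 (S \<beta> \<gamma>) u + s10 (restr (A \<alpha> \<beta>)) u * s00 (S \<beta> \<gamma>) u) = 0"
    by (simp only: s sE)
  have "s01 L1 u = (\<Sum>\<beta>\<in>J. s00 (restr (A \<alpha> \<beta>)) u * s01 (S \<beta> \<gamma>) u + s01 (restr (A \<alpha> \<beta>)) u * s00 (S \<beta> \<gamma>) u
      + s10 (restr (A \<alpha> \<beta>)) u * total_derivative (s00 (S \<beta> \<gamma>)) u)"
    unfolding L1_def by (subst s_sum[OF finite_atLeastAtMost p1]) (assumption, intro sum.cong refl, simp only: c1)
  then show "(\<Sum>\<beta>\<in>J. s00 (restr (A \<alpha> \<beta>)) u * s01 (S \<beta> \<gamma>) u + s01 (restr (A \<alpha> \<beta>)) u * s00 (S \<beta> \<gamma>) u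
      + s10 (restr (A \<alpha> \<beta>)) u * total_derivative (s00 (S \<beta> \<gamma>)) u) = 0"
    by (simp only: s sE)
qed

lemma s_red_op:
  assumes A: "is_F lam A" and S: "is_S A S" and ij: "i \<in> {1..m}" "j \<in> {1..m}"
  defines "F \<equiv> \<lambda>i j. s00 (restr (A i j))" and "F0 \<equiv> \<lambda>i j. s10 (restr (A i j))" and "G \<equiv> \<lambda>i j. s01 (restr (A i j))"
    and "H \<equiv> \<lambda>i j. s00 (S i j)"
  shows "s00 (red_op A S i j) u = F i j u - (\<Sum>\<beta>\<in>J. \<Sum>\<alpha>\<in>J. F i \<beta> u * H \<beta> \<alpha> u * F \<alpha> j u)"
    and "s10 (red_op A S i j) u = F0 i j u
       - (\<Sum>\<beta>\<in>J. \<Sum>\<alpha>\<in>J. F0 i \<beta> u * H \<beta> \<alpha> u * F \<alpha> j u)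
       + (\<Sum>\<beta>\<in>J. \<Sum>\<alpha>\<in>J. \<Sum>\<phi>\<in>J. \<Sum>\<gamma>\<in>J. F i \<beta> u * H \<beta> \<alpha> u * F0 \<alpha> \<phi> u * H \<phi> \<gamma> u * F \<gamma> j u)
       - (\<Sum>\<beta>\<in>J. \<Sum>\<alpha>\<in>J. F i \<beta> u * H \<beta> \<alpha> u * F0 \<alpha> j u)"
    and "s01 (red_op A S i j) u = (G i j u
       - (\<Sum>\<beta>\<in>J. \<Sum>\<alpha>\<in>J. G i \<beta> u * H \<beta> \<alpha> u * F \<alpha> j u)
       + (\<Sum>\<beta>\<in>J. \<Sum>\<alpha>\<in>J. \<Sum>\<phi>\<in>J. \<Sum>\<gamma>\<in>J. F i \<beta> u * H \<beta> \<alpha> u * G \<alpha> \<phi> u * H \<phi> \<gamma> u * F \<gamma> j u)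
       - (\<Sum>\<beta>\<in>J. \<Sum>\<alpha>\<in>J. F i \<beta> u * H \<beta> \<alpha> u * G \<alpha> j u))
       - (\<Sum>\<beta>\<in>J. (F0 i \<beta> u - (\<Sum>\<mu>\<in>J. \<Sum>\<alpha>\<in>J. F i \<mu> u * H \<mu> \<alpha> u * F0 \<alpha> \<beta> u))
            * (\<Sum>\<phi>\<in>J. H \<beta> \<phi> u * total_derivative (F \<phi> j) u + total_derivative (H \<beta> \<phi>) u * F \<phi> j u))"
proof -
  have n: "i \<in> {1..n}" "j \<in> {1..n}" using ij m_le_n by auto
  note pA = poly_op_restr[OF A] and pS = poly_op_S[OF S]
  define C where "C \<beta> \<alpha> = op_comp (restr (A i \<beta>)) (op_comp (S \<beta> \<alpha>) (restr (A \<alpha> j)))" for \<beta> \<alpha>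
  have pSA: "poly_op {1..m} (op_comp (S \<beta> \<alpha>) (restr (A \<alpha> j)))" if "\<beta> \<in> J" "\<alpha> \<in> J" for \<beta> \<alpha>
    by (intro poly_op_comp pS pA n J_sub that)
  have pC: "poly_op {1..m} (C \<beta> \<alpha>)" if "\<beta> \<in> J" "\<alpha> \<in> J" for \<beta> \<alpha>
    unfolding C_def by (intro poly_op_comp pSA pA n J_sub that)
  define M where "M x = (case x of (\<beta>, \<alpha>) \<Rightarrow> op_mult (\<lambda>u. -1) (C \<beta> \<alpha>))" for x
  have pM: "poly_op {1..m} (M x)" if "x \<in> J \<times> J" for x
  proof -
    from that obtain \<beta> \<alpha> where x: "x = (\<beta>, \<alpha>)" "\<beta> \<in> J" "\<alpha> \<in> J" by (rule SigmaE)
    show ?thesis unfolding x M_def prod.case by (intro poly_op_mult diff_poly.const pC x)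
  qed
  have fin: "finite (J \<times> J)" by simp
  have m1: "s00 (op_mult (\<lambda>u. -1) B) u = - s00 B u" "s10 (op_mult (\<lambda>u. -1) B) u = - s10 B u"
    "s01 (op_mult (\<lambda>u. -1) B) u = - s01 B u" if "poly_op {1..m} B" for B
    using s_mult[OF diff_poly.const that] by (simp_all add: part0 part1_const)
  have sM: "s00 (M x) u = - (case x of (\<beta>, \<alpha>) \<Rightarrow> s00 (C \<beta> \<alpha>) u)"
    "s10 (M x) u = - (case x of (\<beta>, \<alpha>) \<Rightarrow> s10 (C \<beta> \<alpha>) u)"
    "s01 (M x) u = - (case x of (\<beta>, \<alpha>) \<Rightarrow> s01 (C \<beta> \<alpha>) u)" if "x \<in> J \<times> J" for x
  proof -
    from that obtain \<beta> \<alpha> where x: "x = (\<beta>, \<alpha>)" "\<beta> \<in> J" "\<alpha> \<in> J" by (rule SigmaE)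
    show "s00 (M x) u = - (case x of (\<beta>, \<alpha>) \<Rightarrow> s00 (C \<beta> \<alpha>) u)"
      "s10 (M x) u = - (case x of (\<beta>, \<alpha>) \<Rightarrow> s10 (C \<beta> \<alpha>) u)"
      "s01 (M x) u = - (case x of (\<beta>, \<alpha>) \<Rightarrow> s01 (C \<beta> \<alpha>) u)"
      unfolding x M_def prod.case by (rule m1[OF pC[OF x(2,3)]])+
  qed
  have e: "red_op A S i j = op_add (restr (A i j)) (op_sum (J \<times> J) M)"
    by (simp add: red_op_def C_def M_def[abs_def])
  have pMs: "poly_op {1..m} (op_sum (J \<times> J) M)" by (rule poly_op_sum[OF pM])
  note s1 = s_add[OF pA[OF n] pMs, of u] and s2 = s_sum[of "J \<times> J" "{1..m}" M u, OF fin pM]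
  have t: "s00 (op_sum (J \<times> J) M) u = (\<Sum>x\<in>J \<times> J. - (case x of (\<beta>, \<alpha>) \<Rightarrow> s00 (C \<beta> \<alpha>) u))"
    "s10 (op_sum (J \<times> J) M) u = (\<Sum>x\<in>J \<times> J. - (case x of (\<beta>, \<alpha>) \<Rightarrow> s10 (C \<beta> \<alpha>) u))"
    "s01 (op_sum (J \<times> J) M) u = (\<Sum>x\<in>J \<times> J. - (case x of (\<beta>, \<alpha>) \<Rightarrow> s01 (C \<beta> \<alpha>) u))"
    using s2 by (simp_all only: sM cong: sum.cong)
  have r: "s00 (red_op A S i j) u = F i j u - (\<Sum>\<beta>\<in>J. \<Sum>\<alpha>\<in>J. s00 (C \<beta> \<alpha>) u)"
    "s10 (red_op A S i j) u = F0 i j u - (\<Sum>\<beta>\<in>J. \<Sum>\<alpha>\<in>J. s10 (C \<beta> \<alpha>) u)"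
    "s01 (red_op A S i j) u = G i j u - (\<Sum>\<beta>\<in>J. \<Sum>\<alpha>\<in>J. s01 (C \<beta> \<alpha>) u)"
    unfolding e F_def F0_def G_def sum.cartesian_product using s1 t
    by (simp_all only: sum_negf diff_conv_add_uminus)
  have c: "s00 (C \<beta> \<alpha>) u = F i \<beta> u * (H \<beta> \<alpha> u * F \<alpha> j u)"
    "s10 (C \<beta> \<alpha>) u = F i \<beta> u * (H \<beta> \<alpha> u * F0 \<alpha> j u + s10 (S \<beta> \<alpha>) u * F \<alpha> j u) + F0 i \<beta> u * (H \<beta> \<alpha> u * F \<alpha> j u)"
    "s01 (C \<beta> \<alpha>) u = F i \<beta> u * (H \<beta> \<alpha> u * G \<alpha> j u + s01 (S \<beta> \<alpha>) u * F \<alpha> j u + s10 (S \<beta> \<alpha>) u * total_derivative (F \<alpha> j) u)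
       + G i \<beta> u * (H \<beta> \<alpha> u * F \<alpha> j u)
       + F0 i \<beta> u * (H \<beta> \<alpha> u * total_derivative (F \<alpha> j) u + total_derivative (H \<beta> \<alpha>) u * F \<alpha> j u)"
    if b: "\<beta> \<in> J" "\<alpha> \<in> J" for \<beta> \<alpha>
  proof -
    note p = pA[OF n(1) J_sub[OF b(1)]] pS[OF b] pA[OF J_sub[OF b(2)] n(2)]
    have "s00 (op_comp (S \<beta> \<alpha>) (restr (A \<alpha> j))) = (\<lambda>u. s00 (S \<beta> \<alpha>) u * s00 (restr (A \<alpha> j)) u)"
      by (rule ext) (rule s_comp[OF p(2,3)])
    then have t: "total_derivative (s00 (op_comp (S \<beta> \<alpha>) (restr (A \<alpha> j)))) u
       = s00 (S \<beta> \<alpha>) u * total_derivative (s00 (restr (A \<alpha> j))) u + total_derivative (s00 (S \<beta> \<alpha>)) u * s00 (restr (A \<alpha> j)) u"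
      using total_derivative_mult[OF diff_poly_s00[OF p(2)] diff_poly_s00[OF p(3)]] by simp
    show "s00 (C \<beta> \<alpha>) u = F i \<beta> u * (H \<beta> \<alpha> u * F \<alpha> j u)"
      "s10 (C \<beta> \<alpha>) u = F i \<beta> u * (H \<beta> \<alpha> u * F0 \<alpha> j u + s10 (S \<beta> \<alpha>) u * F \<alpha> j u) + F0 i \<beta> u * (H \<beta> \<alpha> u * F \<alpha> j u)"
      "s01 (C \<beta> \<alpha>) u = F i \<beta> u * (H \<beta> \<alpha> u * G \<alpha> j u + s01 (S \<beta> \<alpha>) u * F \<alpha> j u + s10 (S \<beta> \<alpha>) u * total_derivative (F \<alpha> j) u)
       + G i \<beta> u * (H \<beta> \<alpha> u * F \<alpha> j u)
       + F0 i \<beta> u * (H \<beta> \<alpha> u * total_derivative (F \<alpha> j) u + total_derivative (H \<beta> \<alpha>) u * F \<alpha> j u)"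
      unfolding C_def F_def F0_def G_def H_def s_comp[OF p(1) pSA[OF b]] s_comp[OF p(2,3)] t by simp_all
  qed
  note low = dirac_low_degree[of J "\<lambda>\<beta> \<alpha>. H \<beta> \<alpha> u" "\<lambda>\<beta> \<alpha>. F \<beta> \<alpha> u" "\<lambda>\<beta> \<alpha>. s10 (S \<beta> \<alpha>) u" "\<lambda>\<beta> \<alpha>. F0 \<beta> \<alpha> u"
    "\<lambda>\<beta> \<alpha>. s01 (S \<beta> \<alpha>) u" "\<lambda>\<beta> \<alpha>. G \<beta> \<alpha> u" "\<lambda>\<beta> \<alpha>. total_derivative (H \<beta> \<alpha>) u" i j, OF finite_atLeastAtMost]
  have inv:
    "(\<Sum>\<beta>\<in>J. H \<alpha> \<beta> u * F \<beta> \<gamma> u) = (if \<alpha> = \<gamma> then 1 else 0)"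
    "(\<Sum>\<beta>\<in>J. F \<alpha> \<beta> u * s10 (S \<beta> \<gamma>) u + F0 \<alpha> \<beta> u * H \<beta> \<gamma> u) = 0"
    "(\<Sum>\<beta>\<in>J. F \<alpha> \<beta> u * s01 (S \<beta> \<gamma>) u + G \<alpha> \<beta> u * H \<beta> \<gamma> u
      + F0 \<alpha> \<beta> u * total_derivative (H \<beta> \<gamma>) u) = 0"
    if "\<alpha> \<in> J" "\<gamma> \<in> J" for \<alpha> \<gamma>
    unfolding F_def F0_def G_def H_def by (rule s_inverse[OF A S that])+
  show "s00 (red_op A S i j) u = F i j u - (\<Sum>\<beta>\<in>J. \<Sum>\<alpha>\<in>J. F i \<beta> u * H \<beta> \<alpha> u * F \<alpha> j u)"
    unfolding r by (simp only: mult.assoc c cong: sum.cong)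
  have "(\<Sum>\<beta>\<in>J. \<Sum>\<alpha>\<in>J. s10 (C \<beta> \<alpha>) u) = (\<Sum>\<beta>\<in>J. \<Sum>\<alpha>\<in>J. F i \<beta> u * (H \<beta> \<alpha> u * F0 \<alpha> j u + s10 (S \<beta> \<alpha>) u * F \<alpha> j u) + F0 i \<beta> u * (H \<beta> \<alpha> u * F \<alpha> j u))"
    by (intro sum.cong refl c)
  then show "s10 (red_op A S i j) u = F0 i j u
       - (\<Sum>\<beta>\<in>J. \<Sum>\<alpha>\<in>J. F0 i \<beta> u * H \<beta> \<alpha> u * F \<alpha> j u)
       + (\<Sum>\<beta>\<in>J. \<Sum>\<alpha>\<in>J. \<Sum>\<phi>\<in>J. \<Sum>\<gamma>\<in>J. F i \<beta> u * H \<beta> \<alpha> u * F0 \<alpha> \<phi> u * H \<phi> \<gamma> u * F \<gamma> j u)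
       - (\<Sum>\<beta>\<in>J. \<Sum>\<alpha>\<in>J. F i \<beta> u * H \<beta> \<alpha> u * F0 \<alpha> j u)"
    unfolding r using low(1)[OF inv] by simp
  have "(\<Sum>\<beta>\<in>J. \<Sum>\<alpha>\<in>J. s01 (C \<beta> \<alpha>) u) = (\<Sum>\<beta>\<in>J. \<Sum>\<alpha>\<in>J. F i \<beta> u * (H \<beta> \<alpha> u * G \<alpha> j u + s01 (S \<beta> \<alpha>) u * F \<alpha> j u + s10 (S \<beta> \<alpha>) u * total_derivative (F \<alpha> j) u)
       + G i \<beta> u * (H \<beta> \<alpha> u * F \<alpha> j u)
       + F0 i \<beta> u * (H \<beta> \<alpha> u * total_derivative (F \<alpha> j) u + total_derivative (H \<beta> \<alpha>) u * F \<alpha> j u))"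
    by (intro sum.cong refl c)
  then show "s01 (red_op A S i j) u = (G i j u
       - (\<Sum>\<beta>\<in>J. \<Sum>\<alpha>\<in>J. G i \<beta> u * H \<beta> \<alpha> u * F \<alpha> j u)
       + (\<Sum>\<beta>\<in>J. \<Sum>\<alpha>\<in>J. \<Sum>\<phi>\<in>J. \<Sum>\<gamma>\<in>J. F i \<beta> u * H \<beta> \<alpha> u * G \<alpha> \<phi> u * H \<phi> \<gamma> u * F \<gamma> j u)
       - (\<Sum>\<beta>\<in>J. \<Sum>\<alpha>\<in>J. F i \<beta> u * H \<beta> \<alpha> u * G \<alpha> j u))
       - (\<Sum>\<beta>\<in>J. (F0 i \<beta> u - (\<Sum>\<mu>\<in>J. \<Sum>\<alpha>\<in>J. F i \<mu> u * H \<mu> \<alpha> u * F0 \<alpha> \<beta> u))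
            * (\<Sum>\<phi>\<in>J. H \<beta> \<phi> u * total_derivative (F \<phi> j) u + total_derivative (H \<beta> \<phi>) u * F \<phi> j u))"
    unfolding r using low(2)[OF inv, of "\<lambda>\<alpha>. total_derivative (F \<alpha> j) u"] by simp
qed


section \<open>Leading terms along the slice\<close>

lemma part0_point: "(\<And>k. u k 0 = u' k 0) \<Longrightarrow> part0 p u = part0 p u'"
  unfolding part0
  by (intro arg_cong[of _ _ p] ext) (case_tac r, simp_all)

lemma s_jet:
  "s00 L (jet_of cc z x) = s00 L (point_jet (cc (z x)))" "s10 L (jet_of cc z x) = s10 L (point_jet (cc (z x)))"
  unfolding s00_def s10_def by (intro part0_point; simp add: jet_of_def point_jet_def)+

lemma slice_J: "v \<in> slice br e f \<Longrightarrow> k \<in> J \<Longrightarrow> cc v k = 0"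
  unfolding slice_def by (simp add: gf_iff cc)

lemma part0_set_zero: "(\<And>k. k \<in> J \<Longrightarrow> u k 0 = 0) \<Longrightarrow> part0 (set_zero J p) u = part0 p u"
  unfolding part0 set_zero_def
  by (intro arg_cong[of _ _ p] ext) (case_tac r, simp_all del: One_nat_def)

lemma part1_set_zero: "(\<And>k r. k \<in> J \<Longrightarrow> u k r = 0) \<Longrightarrow> part1 (set_zero J p) u = part1 p u"
proof -
  assume z: "\<And>k r. k \<in> J \<Longrightarrow> u k r = 0"
  have "(\<lambda>k r. if k \<in> J then 0 else t ^ r * u k r) = (\<lambda>k r. t ^ r * u k r)" for t
    using z by (auto simp: fun_eq_iff)
  then show ?thesis unfolding part1 set_zero_def by (simp cong: if_cong)
qed

lemma lead_F_eq:
  assumes "v \<in> slice br e f"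
  shows "lead_F L (cc v) = s00 (restr L) (point_jet (cc v))" "lead_F0 L (cc v) = s10 (restr L) (point_jet (cc v))"
  unfolding lead_F_def lead_F0_def s00_def s10_def op_coeff_restr
  using part0_set_zero[of "point_jet (cc v)"] slice_J[OF assms] by (simp_all add: point_jet_def)

lemma lead_F_op: "lead_F L w = s00 L (point_jet w)" "lead_F0 L w = s10 L (point_jet w)"
  by (simp_all add: lead_F_def lead_F0_def s00_def s10_def)

lemma lead_Gamma_sum:
  assumes "poly_op {1..N} L"
  shows "(\<Sum>k=1..N. lead_Gamma L k (cc (z x)) * dx (\<lambda>y. cc (z y) k) x) = s01 L (jet_of cc z x)"
proof -
  have "s01 L (jet_of cc z x) = (\<Sum>k\<in>{1..N}. part1 (op_coeff L 0)
     (\<lambda>j r. if r = 0 then jet_of cc z x j 0 else if r = 1 \<and> j = k then 1 else 0) * jet_of cc z x k 1)"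
    unfolding s01_def by (rule part1_linear[OF poly_op_coeff[OF assms]]) simp
  moreover have j: "jet_of cc z x k 0 = cc (z x) k" "jet_of cc z x k 1 = dx (\<lambda>y. cc (z y) k) x" for k
    by (simp_all add: jet_of_def)
  ultimately show ?thesis unfolding lead_Gamma_def j by simp
qed

lemma slice_point: "z \<in> QQ \<Longrightarrow> z x \<in> slice br e f"
  by (simp add: QQ_iff slice_def)

lemma inverse_exists:
  assumes A: "is_F lam A" and S: "is_S A S"
  shows "\<forall>v\<in>slice br e f. inverse_matrix_on J (\<lambda>\<alpha> \<beta>. lead_F (A \<alpha> \<beta>) (cc v)) (\<lambda>\<beta> \<alpha>. s00 (S \<beta> \<alpha>) (point_jet (cc v)))"
  unfolding inverse_matrix_on_def using s_inverse(1,2)[OF A S] by (simp add: lead_F_eq del: One_nat_def)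

text \<open>A left and a right inverse of the same matrix agree. A matrix H given merely point by
  point is thereby the leading part of S and depends on the point as a differential
  polynomial.\<close>

lemma inverse_unique:
  assumes A: "is_F lam A" and S: "is_S A S" and v: "v \<in> slice br e f"
    and H: "inverse_matrix_on J (\<lambda>\<alpha> \<beta>. lead_F (A \<alpha> \<beta>) (cc v)) H" and ab: "\<alpha> \<in> J" "\<beta> \<in> J"
  shows "H \<alpha> \<beta> = s00 (S \<alpha> \<beta>) (point_jet (cc v))"
proof -
  let ?F = "\<lambda>\<alpha> \<beta>. lead_F (A \<alpha> \<beta>) (cc v)" and ?S = "\<lambda>\<beta> \<alpha>. s00 (S \<beta> \<alpha>) (point_jet (cc v))"
  have HF: "(\<Sum>\<gamma>\<in>J. H \<alpha> \<gamma> * ?F \<gamma> \<beta>) = (if \<alpha> = \<beta> then 1 else 0)" if "\<alpha> \<in> J" "\<beta> \<in> J" for \<alpha> \<beta>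
    using H that unfolding inverse_matrix_on_def by blast
  have FS: "(\<Sum>\<gamma>\<in>J. ?F \<alpha> \<gamma> * ?S \<gamma> \<beta>) = (if \<alpha> = \<beta> then 1 else 0)" if "\<alpha> \<in> J" "\<beta> \<in> J" for \<alpha> \<beta>
    using inverse_exists[OF A S] v that unfolding inverse_matrix_on_def by blast
  have "?S \<alpha> \<beta> = - (\<Sum>\<gamma>\<in>J. H \<alpha> \<gamma> * - (if \<gamma> = \<beta> then 1 else 0))"
    by (rule solve_linear[OF finite_atLeastAtMost HF _ ab(1)]) (simp_all only: FS[OF _ ab(2)] add.right_inverse)
  also have "\<dots> = (\<Sum>\<gamma>\<in>J. if \<gamma> = \<beta> then H \<alpha> \<beta> else 0)"
    unfolding sum_negf[symmetric] by (intro sum.cong) auto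
  also have "\<dots> = H \<alpha> \<beta>" using ab(2) by simp
  finally show ?thesis ..
qed

text \<open>R is replaced by \<open>red_op\<close> through uniqueness, and H by the leading part of
  S; only then is the x-derivative of H F a total derivative, as the formula for \<open>s01\<close>
  requires.\<close>

lemma leading_terms:
  assumes A: "is_F lam A" and R: "is_red lam R"
    and H: "\<forall>v\<in>slice br e f. inverse_matrix_on J (\<lambda>\<alpha> \<beta>. lead_F (A \<alpha> \<beta>) (cc v)) (H v)"
  shows "(let F = (\<lambda>i j v. lead_F (A i j) (cc v));
                  F0 = (\<lambda>i j v. lead_F0 (A i j) (cc v));
                  \<Gamma> = (\<lambda>k i j v. lead_Gamma (A i j) k (cc v));
                  Ft = (\<lambda>i j v. lead_F (R i j) (cc v));
                  Ft0 = (\<lambda>i j v. lead_F0 (R i j) (cc v));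
                  \<Gamma>t = (\<lambda>k i j v. lead_Gamma (R i j) k (cc v))
              in \<forall>i\<in>{1..m}. \<forall>j\<in>{1..m}.
                (\<forall>v\<in>slice br e f.
                   Ft i j v = F i j v - (\<Sum>\<beta>\<in>J. \<Sum>\<alpha>\<in>J. F i \<beta> v * H v \<beta> \<alpha> * F \<alpha> j v) \<and>
                   Ft0 i j v =
                     F0 i j v
                     - (\<Sum>\<beta>\<in>J. \<Sum>\<alpha>\<in>J. F0 i \<beta> v * H v \<beta> \<alpha> * F \<alpha> j v)
                     + (\<Sum>\<beta>\<in>J. \<Sum>\<alpha>\<in>J. \<Sum>\<phi>\<in>J. \<Sum>\<gamma>\<in>J.
                          F i \<beta> v * H v \<beta> \<alpha> * F0 \<alpha> \<phi> v * H v \<phi> \<gamma> * F \<gamma> j v)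
                     - (\<Sum>\<beta>\<in>J. \<Sum>\<alpha>\<in>J. F i \<beta> v * H v \<beta> \<alpha> * F0 \<alpha> j v)) \<and>
                (\<forall>z\<in>QQ. \<forall>x.
                   (\<Sum>k=1..m. \<Gamma>t k i j (z x) * dx (\<lambda>y. cc (z y) k) x) =
                     (\<Sum>k=1..n.
                        (\<Gamma> k i j (z x)
                         - (\<Sum>\<beta>\<in>J. \<Sum>\<alpha>\<in>J. \<Gamma> k i \<beta> (z x) * H (z x) \<beta> \<alpha> * F \<alpha> j (z x))
                         + (\<Sum>\<mu>\<in>J. \<Sum>\<alpha>\<in>J. \<Sum>\<beta>\<in>J. \<Sum>\<phi>\<in>J.
                              F i \<mu> (z x) * H (z x) \<mu> \<alpha> * \<Gamma> k \<alpha> \<beta> (z x) * H (z x) \<beta> \<phi> * F \<phi> j (z x))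
                         - (\<Sum>\<beta>\<in>J. \<Sum>\<alpha>\<in>J. F i \<beta> (z x) * H (z x) \<beta> \<alpha> * \<Gamma> k \<alpha> j (z x)))
                        * dx (\<lambda>y. cc (z y) k) x)
                     - (\<Sum>\<beta>\<in>J.
                          (F0 i \<beta> (z x)
                           - (\<Sum>\<mu>\<in>J. \<Sum>\<alpha>\<in>J. F i \<mu> (z x) * H (z x) \<mu> \<alpha> * F0 \<alpha> \<beta> (z x)))
                          * dx (\<lambda>y. \<Sum>\<phi>\<in>J. H (z y) \<beta> \<phi> * F \<phi> j (z y)) x)))"
proof -
  obtain S where S: "is_S A S" using is_S_exists[OF A] by blast
  note Rr = is_red_unique[OF R red_op_is_red[OF A S]]
  have Rs: "s00 (R i j) u = s00 (red_op A S i j) u" "s10 (R i j) u = s10 (red_op A S i j) u"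
    "s01 (R i j) u = s01 (red_op A S i j) u" if "i \<in> {1..m}" "j \<in> {1..m}" for i j u
    unfolding s00_def s10_def s01_def Rr[OF that] by simp_all
  have Hs: "H v \<alpha> \<beta> = s00 (S \<alpha> \<beta>) (point_jet (cc v))" if "v \<in> slice br e f" "\<alpha> \<in> J" "\<beta> \<in> J" for v \<alpha> \<beta>
    using inverse_unique[OF A S that(1) _ that(2,3)] H that(1) by blast
  have rR: "poly_op {1..m} (R i j)" if "i \<in> {1..m}" "j \<in> {1..m}" for i j
    using R that unfolding is_red_def matrix_diff_op_def poly_op_def by blast
  have rA: "poly_op {1..n} (A i j)" if "i \<in> {1..n}" "j \<in> {1..n}" for i j
    using A that unfolding is_F_def matrix_diff_op_def poly_op_def by blast
  have GR: "(\<Sum>k=1..m. lead_Gamma (R i j) k (cc (z x)) * dx (\<lambda>y. cc (z y) k) x) = s01 (R i j) (jet_of cc z x)"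
    if "i \<in> {1..m}" "j \<in> {1..m}" for i j z x by (rule lead_Gamma_sum[OF rR[OF that]])
  \<comment> \<open>Coordinates with index above m vanish along Q together with their derivatives,
    so the sum up to n sees only the restricted operator.\<close>
  have GA: "(\<Sum>k=1..n. lead_Gamma (A i j) k (cc (z x)) * dx (\<lambda>y. cc (z y) k) x) = s01 (restr (A i j)) (jet_of cc z x)"
    if "z \<in> QQ" "i \<in> {1..n}" "j \<in> {1..n}" for i j z x
    unfolding lead_Gamma_sum[OF rA[OF that(2,3)]] unfolding s01_def op_coeff_restr
    by (rule part1_set_zero[symmetric]) (rule jet_J[OF that(1)])
  show ?thesis unfolding Let_def
  proof (intro ballI conjI allI)
    fix i j v assume ij: "i \<in> {1..m}" "j \<in> {1..m}" and v: "v \<in> slice br e f"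
    show "lead_F (R i j) (cc v) = lead_F (A i j) (cc v) -
      (\<Sum>\<beta>\<in>J. \<Sum>\<alpha>\<in>J. lead_F (A i \<beta>) (cc v) * H v \<beta> \<alpha> * lead_F (A \<alpha> j) (cc v))"
      unfolding lead_F_op(1)[of "R i j"] Rs[OF ij] s_red_op(1)[OF A S ij]
      unfolding lead_F_eq[OF v]
      by (simp only: Hs[OF v] cong: sum.cong)
    show "lead_F0 (R i j) (cc v) = lead_F0 (A i j) (cc v)
       - (\<Sum>\<beta>\<in>J. \<Sum>\<alpha>\<in>J. lead_F0 (A i \<beta>) (cc v) * H v \<beta> \<alpha> * lead_F (A \<alpha> j) (cc v))
       + (\<Sum>\<beta>\<in>J. \<Sum>\<alpha>\<in>J. \<Sum>\<phi>\<in>J. \<Sum>\<gamma>\<in>J. lead_F (A i \<beta>) (cc v) * H v \<beta> \<alpha> * lead_F0 (A \<alpha> \<phi>) (cc v) * H v \<phi> \<gamma> * lead_F (A \<gamma> j) (cc v))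
       - (\<Sum>\<beta>\<in>J. \<Sum>\<alpha>\<in>J. lead_F (A i \<beta>) (cc v) * H v \<beta> \<alpha> * lead_F0 (A \<alpha> j) (cc v))"
      unfolding lead_F_op(2)[of "R i j"] Rs[OF ij] s_red_op(2)[OF A S ij]
      unfolding lead_F_eq[OF v]
      by (simp only: Hs[OF v] cong: sum.cong)
  next
    fix i j z x assume ij: "i \<in> {1..m}" "j \<in> {1..m}" and z: "z \<in> QQ"
    have n: "i \<in> {1..n}" "j \<in> {1..n}" using ij m_le_n by auto
    let ?u = "jet_of cc z x"
    \<comment> \<open>Contraction with the x-derivatives of the coordinates. Being linear in the
      index k, it turns every term with a \<Gamma> into the same term with the degree-one part
      \<open>s01\<close>.\<close>
    define \<Lambda> where "\<Lambda> X = (\<Sum>k=1..n. X k * dx (\<lambda>y. cc (z y) k) x)" for X :: "nat \<Rightarrow> complex"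
    have \<Lambda>: "\<Lambda> (\<lambda>k. X k + Y k) = \<Lambda> X + \<Lambda> Y" "\<Lambda> (\<lambda>k. X k - Y k) = \<Lambda> X - \<Lambda> Y"
      "\<Lambda> (\<lambda>k. b * X k) = b * \<Lambda> X" "\<Lambda> (\<lambda>k. X k * b) = \<Lambda> X * b" for X Y b
      by (simp_all add: \<Lambda>_def distrib_right left_diff_distrib sum.distrib sum_subtractf sum_distrib_left sum_distrib_right mult_ac)
    have \<Lambda>s: "\<Lambda> (\<lambda>k. \<Sum>\<beta>\<in>J. Y \<beta> k) = (\<Sum>\<beta>\<in>J. \<Lambda> (Y \<beta>))" for Y
      unfolding \<Lambda>_def sum_distrib_right by (rule sum.swap)
    have \<Lambda>A: "\<Lambda> (\<lambda>k. lead_Gamma (A i j) k (cc (z x))) = s01 (restr (A i j)) ?u" if "i \<in> {1..n}" "j \<in> {1..n}" for i j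
      unfolding \<Lambda>_def by (rule GA[OF z that])
    note sp = slice_point[OF z]
    have F: "lead_F (A i j) (cc (z y)) = s00 (restr (A i j)) (jet_of cc z y)"
      "lead_F0 (A i j) (cc (z y)) = s10 (restr (A i j)) (jet_of cc z y)" for i j y
      unfolding s_jet by (rule lead_F_eq[OF slice_point[OF z]])+
    have Hz: "H (z y) \<alpha> \<beta> = s00 (S \<alpha> \<beta>) (jet_of cc z y)" if "\<alpha> \<in> J" "\<beta> \<in> J" for \<alpha> \<beta> y
      unfolding s_jet by (rule Hs[OF slice_point[OF z] that])
    have dxHF: "dx (\<lambda>y. \<Sum>\<phi>\<in>J. H (z y) \<beta> \<phi> * lead_F (A \<phi> j) (cc (z y))) x
      = (\<Sum>\<phi>\<in>J. s00 (S \<beta> \<phi>) ?u * total_derivative (s00 (restr (A \<phi> j))) ?u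
          + total_derivative (s00 (S \<beta> \<phi>)) ?u * s00 (restr (A \<phi> j)) ?u)" if \<beta>: "\<beta> \<in> J" for \<beta>
    proof -
      have p1: "diff_poly {1..m} (s00 (S \<beta> \<phi>))" "diff_poly {1..m} (s00 (restr (A \<phi> j)))" if "\<phi> \<in> J" for \<phi>
        by (rule diff_poly_s00[OF poly_op_S[OF S \<beta> that]], rule diff_poly_s00[OF poly_op_restr[OF A J_sub[OF that] n(2)]])
      have p2: "diff_poly {1..m} (\<lambda>u. s00 (S \<beta> \<phi>) u * s00 (restr (A \<phi> j)) u)" if "\<phi> \<in> J" for \<phi>
        by (intro diff_poly.mult p1 that)
      define p where "p u = (\<Sum>\<phi>\<in>J. s00 (S \<beta> \<phi>) u * s00 (restr (A \<phi> j)) u)" for u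
      have p: "diff_poly {1..m} p" unfolding p_def[abs_def] by (rule diff_poly_sum[OF p2])
      have "(\<lambda>y. \<Sum>\<phi>\<in>J. H (z y) \<beta> \<phi> * lead_F (A \<phi> j) (cc (z y))) = (\<lambda>y. p (jets (\<lambda>k y. cc (z y) k) y))"
        unfolding p_def jet_of_jets[symmetric] by (intro ext sum.cong refl) (simp only: F Hz[OF \<beta>])
      then have "dx (\<lambda>y. \<Sum>\<phi>\<in>J. H (z y) \<beta> \<phi> * lead_F (A \<phi> j) (cc (z y))) x = total_derivative p ?u"
        using dx_diff_poly[OF p coord_loops[OF QQ_loops[OF z]]] by (simp add: jet_of_jets)
      also have "\<dots> = (\<Sum>\<phi>\<in>J. total_derivative (\<lambda>u. s00 (S \<beta> \<phi>) u * s00 (restr (A \<phi> j)) u) ?u)"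
        unfolding p_def[abs_def] by (rule total_derivative_sum[OF p2])
      also have "\<dots> = (\<Sum>\<phi>\<in>J. s00 (S \<beta> \<phi>) ?u * total_derivative (s00 (restr (A \<phi> j))) ?u
          + total_derivative (s00 (S \<beta> \<phi>)) ?u * s00 (restr (A \<phi> j)) ?u)"
        by (intro sum.cong refl total_derivative_mult[OF p1])
      finally show ?thesis .
    qed
    show "(\<Sum>k=1..m. lead_Gamma (R i j) k (cc (z x)) * dx (\<lambda>y. cc (z y) k) x) =
                     (\<Sum>k=1..n.
                        (lead_Gamma (A i j) k (cc (z x))
                         - (\<Sum>\<beta>\<in>J. \<Sum>\<alpha>\<in>J. lead_Gamma (A i \<beta>) k (cc (z x)) * H (z x) \<beta> \<alpha> * lead_F (A \<alpha> j) (cc (z x)))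
                         + (\<Sum>\<mu>\<in>J. \<Sum>\<alpha>\<in>J. \<Sum>\<beta>\<in>J. \<Sum>\<phi>\<in>J.
                              lead_F (A i \<mu>) (cc (z x)) * H (z x) \<mu> \<alpha> * lead_Gamma (A \<alpha> \<beta>) k (cc (z x)) * H (z x) \<beta> \<phi> * lead_F (A \<phi> j) (cc (z x)))
                         - (\<Sum>\<beta>\<in>J. \<Sum>\<alpha>\<in>J. lead_F (A i \<beta>) (cc (z x)) * H (z x) \<beta> \<alpha> * lead_Gamma (A \<alpha> j) k (cc (z x))))
                        * dx (\<lambda>y. cc (z y) k) x)
                     - (\<Sum>\<beta>\<in>J.
                          (lead_F0 (A i \<beta>) (cc (z x))
                           - (\<Sum>\<mu>\<in>J. \<Sum>\<alpha>\<in>J. lead_F (A i \<mu>) (cc (z x)) * H (z x) \<mu> \<alpha> * lead_F0 (A \<alpha> \<beta>) (cc (z x))))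
                          * dx (\<lambda>y. \<Sum>\<phi>\<in>J. H (z y) \<beta> \<phi> * lead_F (A \<phi> j) (cc (z y))) x)"
      unfolding GR[OF ij] Rs[OF ij] s_red_op(3)[OF A S ij] \<Lambda>_def[symmetric] \<Lambda> \<Lambda>s
      by (simp only: dxHF cong: sum.cong) (simp only: \<Lambda>A n J_sub F Hz cong: sum.cong)
  qed
qed

end

text \<open>The existence clauses for extensions, A, S, R and H keep the quantified formulas from
  holding vacuously. The reduced bracket is compared both as a bracket of functionals and in
  coordinates.\<close>

theorem theorem3p9:
  fixes br :: "complex^'d \<Rightarrow> complex^'d \<Rightarrow> complex^'d"
    and gr :: "int \<Rightarrow> (complex^'d) set"
    and e h f a :: "complex^'d"
    and l :: "(complex^'d) set"
    and \<xi> \<xi>' :: "nat \<Rightarrow> complex^'d"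
    and n m :: nat
    and lam :: complex
  assumes simple: "simple_lie_algebra br"
    and nilpotent: "ad_nilpotent br f"
    and good: "good_grading br gr f"
    and triple: "sl2_triple br e h f"
    and compatible: "h \<in> gr 0" "e \<in> gr 2"
    and isotropic: "isotropic_subspace br gr e l"
    and centralizes: "\<forall>y\<in>n_alg br gr e l. br a y = 0"
    and basis: "is_basis \<xi> n UNIV"
    and homogeneous: "\<forall>i\<in>{1..n}. \<exists>k. \<xi> i \<in> gr k"
    and slice_basis: "m \<le> n" "is_basis \<xi> m (centralizer br f)"
    and dual_basis: "\<forall>i\<in>{1..n}. \<forall>j\<in>{1..n}. killing br (\<xi> i) (\<xi>' j) = (if i = j then 1 else 0)"
  shows
    "let c = coords br e \<xi>';
         Q = Q_space br e f;
         J = {m + 1..n};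
         ext = extension br gr e f l;
         PB = pencil br a lam;
         red = reduced_bracket br gr e f l a lam;
         is_F = (\<lambda>A. matrix_diff_op {1..n} {1..n} A \<and>
                      coordinate_brackets c {1..n} (loops UNIV) PB (matrix_op c A));
         is_S = (\<lambda>A S. matrix_diff_op J {1..m} S \<and> inverse_op_on c J Q A S);
         is_red = (\<lambda>R. matrix_diff_op {1..m} {1..m} R \<and>
                      coordinate_brackets c {1..m} Q red (matrix_op c R))
     in
       (\<forall>\<phi>. local_functional c {1..m} Q \<phi> \<longrightarrow> (\<exists>F. ext \<phi> F)) \<and>
       (\<forall>\<phi> \<psi> F G. ext \<phi> F \<longrightarrow> ext \<psi> G \<longrightarrow> (\<forall>z\<in>Q. red \<phi> \<psi> z = PB F G z)) \<and>
       (\<exists>A. is_F A) \<and>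
       (\<forall>A. is_F A \<longrightarrow>
          (\<exists>S. is_S A S) \<and>
          (\<forall>S. is_S A S \<longrightarrow>
             (\<forall>\<phi> \<psi>. (\<exists>F. ext \<phi> F) \<longrightarrow> (\<exists>G. ext \<psi> G) \<longrightarrow>
                (\<forall>z\<in>Q. red \<phi> \<psi> z = operator_bracket \<xi> m (dirac_op c J A S) \<phi> \<psi> z)) \<and>
             coordinate_brackets c {1..m} Q red (dirac_op c J A S)) \<and>
          (\<exists>R. is_red R) \<and>
          (\<exists>H. \<forall>v\<in>slice br e f. inverse_matrix_on J (\<lambda>\<alpha> \<beta>. lead_F (A \<alpha> \<beta>) (c v)) (H v)) \<and>
          (\<forall>R H. is_red R \<longrightarrow>
             (\<forall>v\<in>slice br e f. inverse_matrix_on J (\<lambda>\<alpha> \<beta>. lead_F (A \<alpha> \<beta>) (c v)) (H v)) \<longrightarrow>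
             (let F = (\<lambda>i j v. lead_F (A i j) (c v));
                  F0 = (\<lambda>i j v. lead_F0 (A i j) (c v));
                  \<Gamma> = (\<lambda>k i j v. lead_Gamma (A i j) k (c v));
                  Ft = (\<lambda>i j v. lead_F (R i j) (c v));
                  Ft0 = (\<lambda>i j v. lead_F0 (R i j) (c v));
                  \<Gamma>t = (\<lambda>k i j v. lead_Gamma (R i j) k (c v))
              in \<forall>i\<in>{1..m}. \<forall>j\<in>{1..m}.
                (\<forall>v\<in>slice br e f.
                   Ft i j v = F i j v - (\<Sum>\<beta>\<in>J. \<Sum>\<alpha>\<in>J. F i \<beta> v * H v \<beta> \<alpha> * F \<alpha> j v) \<and>
                   Ft0 i j v =
                     F0 i j v
                     - (\<Sum>\<beta>\<in>J. \<Sum>\<alpha>\<in>J. F0 i \<beta> v * H v \<beta> \<alpha> * F \<alpha> j v)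
                     + (\<Sum>\<beta>\<in>J. \<Sum>\<alpha>\<in>J. \<Sum>\<phi>\<in>J. \<Sum>\<gamma>\<in>J.
                          F i \<beta> v * H v \<beta> \<alpha> * F0 \<alpha> \<phi> v * H v \<phi> \<gamma> * F \<gamma> j v)
                     - (\<Sum>\<beta>\<in>J. \<Sum>\<alpha>\<in>J. F i \<beta> v * H v \<beta> \<alpha> * F0 \<alpha> j v)) \<and>
                (\<forall>z\<in>Q. \<forall>x.
                   (\<Sum>k=1..m. \<Gamma>t k i j (z x) * dx (\<lambda>y. c (z y) k) x) =
                     (\<Sum>k=1..n.
                        (\<Gamma> k i j (z x)
                         - (\<Sum>\<beta>\<in>J. \<Sum>\<alpha>\<in>J. \<Gamma> k i \<beta> (z x) * H (z x) \<beta> \<alpha> * F \<alpha> j (z x))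
                         + (\<Sum>\<mu>\<in>J. \<Sum>\<alpha>\<in>J. \<Sum>\<beta>\<in>J. \<Sum>\<phi>\<in>J.
                              F i \<mu> (z x) * H (z x) \<mu> \<alpha> * \<Gamma> k \<alpha> \<beta> (z x) * H (z x) \<beta> \<phi> * F \<phi> j (z x))
                         - (\<Sum>\<beta>\<in>J. \<Sum>\<alpha>\<in>J. F i \<beta> (z x) * H (z x) \<beta> \<alpha> * \<Gamma> k \<alpha> j (z x)))
                        * dx (\<lambda>y. c (z y) k) x)
                     - (\<Sum>\<beta>\<in>J.
                          (F0 i \<beta> (z x)
                           - (\<Sum>\<mu>\<in>J. \<Sum>\<alpha>\<in>J. F i \<mu> (z x) * H (z x) \<mu> \<alpha> * F0 \<alpha> \<beta> (z x)))
                          * dx (\<lambda>y. \<Sum>\<phi>\<in>J. H (z y) \<beta> \<phi> * F \<phi> j (z y)) x)))))"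
proof -
  interpret slice_data br gr e h f a l \<xi> \<xi>' n m
    using simple good triple compatible(2) isotropic centralizes basis homogeneous slice_basis dual_basis
    by unfold_locales (simp_all add: simple_lie_algebra_def)
  have formula: "(\<forall>\<phi> \<psi>. (\<exists>F. extension br gr e f l \<phi> F) \<longrightarrow> (\<exists>G. extension br gr e f l \<psi> G) \<longrightarrow>
      (\<forall>z\<in>QQ. reduced_bracket br gr e f l a lam \<phi> \<psi> z = operator_bracket \<xi> m (dirac_op cc J A S) \<phi> \<psi> z)) \<and>
     coordinate_brackets cc {1..m} QQ (reduced_bracket br gr e f l a lam) (dirac_op cc J A S)"
    if "is_F lam A" "is_S A S" for A S
    using dirac_formula[OF that] dirac_coordinate_brackets[OF that] by blast
  have inverse: "\<exists>H. \<forall>v\<in>slice br e f. inverse_matrix_on J (\<lambda>\<alpha> \<beta>. lead_F (A \<alpha> \<beta>) (cc v)) (H v)"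
    and reduced: "\<exists>R. is_red lam R" if A: "is_F lam A" for A
  proof -
    obtain S where S: "is_S A S" using is_S_exists[OF A] by blast
    show "\<exists>H. \<forall>v\<in>slice br e f. inverse_matrix_on J (\<lambda>\<alpha> \<beta>. lead_F (A \<alpha> \<beta>) (cc v)) (H v)"
      by (rule exI, rule inverse_exists[OF A S])
    show "\<exists>R. is_red lam R" using red_op_is_red[OF A S] by blast
  qed
  have red: "\<forall>\<phi> \<psi> F G. extension br gr e f l \<phi> F \<longrightarrow> extension br gr e f l \<psi> G \<longrightarrow>
      (\<forall>z\<in>QQ. reduced_bracket br gr e f l a lam \<phi> \<psi> z = pencil br a lam F G z)"
    using reduced_bracket_eq QQ_SS by blast
  have ext: "\<forall>\<phi>. local_functional cc {1..m} QQ \<phi> \<longrightarrow> (\<exists>F. extension br gr e f l \<phi> F)"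
    using extension_exists by blast
  show ?thesis
    unfolding Let_def cc_def[symmetric] is_F_def[symmetric] is_S_def[symmetric] is_red_def[symmetric]
    by (rule conjI[OF ext], rule conjI[OF red], rule conjI[OF is_F_exists], intro allI impI,
        rule conjI, erule is_S_exists, rule conjI, intro allI impI, rule formula, assumption+,
        rule conjI, erule reduced, rule conjI, erule inverse, intro allI impI,
        rule leading_terms[unfolded Let_def], assumption+)
qed

end
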